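(* Let a root datum of finite type be given, with modified quantized enveloping algebra $\dot{\mathbf{U}}$ over $\mathbb{Q}(v)$ and its completion $\widehat{\mathbf{U}}=\varprojlim_\pi\mathbf{S}(\pi)$. Given any coherent basis $B$ of $\dot{\mathbf{U}}$, the completion $\widehat{\mathbf{U}}$ may be identified with the algebra of all formal infinite linear combinations of elements of $B$ (with coefficients in $\mathbb{Q}(v)$).
   Context: **Root datum.** A Cartan datum is a finite set $I$ with a symmetric $\mathbb{Z}$-valued bilinear form $(\ ,\ )$ on $\mathbb{Z}[I]$ such that $(i,i)\in\{2,4,6,\dots\}$ for $i\in I$ and $2(i,j)/(i,i)\in\{0,-1,-2,\dots\}$ for $i\neq j$. It is of finite type if the matrix $((i,j))_{i,j\in I}$ is positive definite. A root datum for it consists of finitely generated free abelian groups $X,Y$, a perfect pairing $\langle\ ,\ \rangle:Y\times X\to\mathbb{Z}$, and embeddings $I\to Y$ ($i\mapsto h_i$), $I\to X$ ($i\mapsto\alpha_i$) with $\langle h_i,\alpha_j\rangle=2(i,j)/(i,i)$. Throughout it is of finite type. Put $d_i=(i,i)/2$; $\mathbb{N}=\{0,1,2,\dots\}$; $X^+=\{\lambda\in X:\langle h_i,\lambda\rangle\in\mathbb{N}\ \forall i\in I\}$; $\lambda\le\lambda'$ iff $\lambda'-\lambda\in\sum_i\mathbb{N}\alpha_i$. $W$ is the (finite) Weyl group acting on $X$, generated by $\lambda\mapsto\lambda-\langle h_i,\lambda\rangle\alpha_i$. **Quantum numbers.** $v$ is an indeterminate, $v_i=v^{d_i}$; for $P\in\mathbb{Q}(v)$,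 $P_i$ is $P$ with $v$ replaced by $v_i$. $[n]=(v^n-v^{-n})/(v-v^{-1})$ for $n\in\mathbb{Z}$, $[n]^!=[1][2]\cdots[n]$ for $n\in\mathbb{N}$. Divided powers: $E_{\pm i}^{(m)}=E_{\pm i}^m/[m]_i^!$. **The algebra $\mathbf{U}$** is the unital associative $\mathbb{Q}(v)$-algebra with generators $E_i,E_{-i}$ ($i\in I$), $K_h$ ($h\in Y$) and relations: $K_hK_{h'}=K_{h+h'}$, $K_0=1$; $K_hE_{\pm i}=v^{\pm\langle h,\alpha_i\rangle}E_{\pm i}K_h$; $E_iE_{-j}-E_{-j}E_i=\delta_{ij}\frac{K_{d_ih_i}-K_{-d_ih_i}}{v_i-v_i^{-1}}$; $\sum_{s+s'=1-\langle h_i,\alpha_j\rangle}(-1)^{s'}E_{\pm i}^{(s)}E_{\pm j}E_{\pm i}^{(s')}=0$ for $i\ne j$. It is graded, $\mathbf{U}=\bigoplus_{\nu\in\sum\mathbb{Z}\alpha_i}\mathbf{U}(\nu)$, with $K_h\in\mathbf{U}(0)$, $E_{\pm i}\in\mathbf{U}(\pm\alpha_i)$. **The modified form $\dot{\mathbf{U}}$.** For $\lambda,\lambda'\in X$ let ${}_\lambda\mathbf{U}_{\lambda'}=\mathbf{U}/\big(\sum_{h\in Y}(K_h-v^{\langle h,\lambda\rangle})\mathbf{U}+\sum_{h\in Y}\mathbf{U}(K_h-v^{\langle h,\lambda'\rangle})\big)$ (quotient vector space) with canonical projection $\pi_{\lambda,\lambda'}$, and $\dot{\mathbf{U}}=\bigoplus_{\lambda,\lambda'\in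 X}{}_\lambda\mathbf{U}_{\lambda'}$. Multiplication: for $t\in\mathbf{U}(\lambda_1-\lambda_1')$, $s\in\mathbf{U}(\lambda_2-\lambda_2')$, $\pi_{\lambda_1,\lambda_1'}(t)\pi_{\lambda_2,\lambda_2'}(s)=\pi_{\lambda_1,\lambda_2'}(ts)$ if $\lambda_1'=\lambda_2$ and $0$ otherwise. Put $1_\lambda=\pi_{\lambda,\lambda}(1)$ and $E_{\pm i}1_\lambda=\pi_{\lambda\pm\alpha_i,\lambda}(E_{\pm i})$. **The algebras $\mathbf{S}(\pi)$.** A nonempty subset $\pi\subset X^+$ is saturated if $\lambda\in X^+$, $\mu\in\pi$, $\lambda\le\mu$ imply $\lambda\in\pi$. For finite saturated $\pi$, $\mathbf{S}(\pi)$ is the unital associative $\mathbb{Q}(v)$-algebra with generators $E_i,E_{-i}$ ($i\in I$), $1_\lambda$ ($\lambda\in W\pi$) and, with the convention $1_\lambda=0$ for $\lambda\in X\setminus W\pi$, relations (for all $i,j\in I$, $\lambda,\lambda'\in X$): $1_\lambda1_{\lambda'}=\delta_{\lambda,\lambda'}1_\lambda$, $\sum_{\lambda\in X}1_\lambda=1$; $E_{\pm i}1_\lambda=1_{\lambda\pm\alpha_i}E_{\pm i}$; $E_iE_{-j}-E_{-j}E_i=\delta_{ij}\sum_{\lambda\in X}[\langle h_i,\lambda\rangle]_i1_\lambda$; $\sum_{s+s'=1-\langle h_i,\alpha_j\rangle}(-1)^{s'}E_{\pm i}^{(s)}E_{\pm j}E_{\pm i}^{(s')}=0$ for $i\neq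 j$. It is finite dimensional. In $\mathbf{S}(\pi)$ put $K_h=\sum_{\lambda\in W\pi}v^{\langle h,\lambda\rangle}1_\lambda$ ($h\in Y$). **Inverse limit.** For $\pi\subset\pi'$, $f_{\pi,\pi'}:\mathbf{S}(\pi')\to\mathbf{S}(\pi)$ is the surjective algebra map $E_{\pm i}\mapsto E_{\pm i}$, $1_\lambda\mapsto1_\lambda$. $\widehat{\mathbf{U}}=\varprojlim\mathbf{S}(\pi)=\{(a_\pi)_\pi\in\prod_\pi\mathbf{S}(\pi): a_\pi=f_{\pi,\pi'}(a_{\pi'})\text{ for }\pi\subset\pi'\}$, over all finite saturated $\pi\subset X^+$, with componentwise operations. **The maps $\dot{p}_\pi$.** $p_\pi:\mathbf{U}\to\mathbf{S}(\pi)$ is the algebra map $E_{\pm i}\mapsto E_{\pm i}$, $K_h\mapsto K_h$. $\dot{p}_\pi:\dot{\mathbf{U}}\to\mathbf{S}(\pi)$ is the surjective algebra map $\pi_{\lambda,\lambda'}(u)\mapsto1_\lambda p_\pi(u)1_{\lambda'}$; it sends $E_{\pm i}1_\lambda\mapsto E_{\pm i}1_\lambda$. The intersection of the kernels of all $\dot{p}_\pi$ is $(0)$, and $\widehat{\mathbf{U}}$ is the completion of $\dot{\mathbf{U}}$ for the topology in which these kernels form a neighborhood base of $0$. **Coherent basis.** A basis $B$ of $\dot{\mathbf{U}}$ (over $\mathbb{Q}(v)$) is coherent if the set of nonzero elements of $\dot{p}_\pi(B)$ is a basis of $\mathbf{S}(\pi)$, for each finite saturated $\pi\subset X^+$. Write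 $B[\pi]$ for the set of nonzero elements of $\dot{p}_\pi(B)$. **The identification.** A formal sum $\sum_{b\in B}a_b\,b$ ($a_b\in\mathbb{Q}(v)$) corresponds to the element $(a_\pi)_\pi$ of $\widehat{\mathbf{U}}$ with $a_\pi=\sum_{b\in B[\pi]}a_b\,b\in\mathbf{S}(\pi)$, where $b\in B$ and its nonzero image in $\mathbf{S}(\pi)$ are denoted by the same symbol.
   Formalization: A coherent basis is also required to have distinct nonzero images in each S(π), as using one symbol for b and its image presupposes; otherwise infinitely many elements of B could share a nonzero image and the sum over B[π] would be ill-defined. *)

theory Defs
  imports
    "HOL-Computational_Algebra.Fraction_Field"
    "HOL-Computational_Algebra.Polynomial"
    "HOL-Library.Poly_Mapping"
    "HOL-Algebra.Module"
    "HOL-Algebra.QuotRing"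
begin

section \<open>The ground field and quantum numbers\<close>

type_synonym qv = "rat poly fract"

definition v :: qv where
  "v = Fraction_Field.Fract [:0, 1:] 1"

text \<open>\<open>qint q n\<close> is \<open>[n]\<close> with \<open>v\<close> replaced by \<open>q\<close>; \<open>[n]\<^sub>i\<close> is the case \<open>q = v\<^sub>i\<close>.\<close>

definition qint :: "qv \<Rightarrow> int \<Rightarrow> qv" where
  "qint q n = (q powi n - q powi (- n)) / (q - inverse q)"

definition qfact :: "qv \<Rightarrow> nat \<Rightarrow> qv" where
  "qfact q n = (\<Prod>k = 1..n. qint q (int k))"

definition Qv_ring :: "qv ring" where
  "Qv_ring = \<lparr>carrier = UNIV, mult = (*), one = 1, zero = 0, add = (+)\<rparr>"


section \<open>Algebras over the ground field\<close>

text \<open>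
  Algebras are \<^typ>\<open>('a, 'b) module\<close> records. The locale \<^locale>\<open>algebra\<close> of the library
  only covers commutative algebras.
\<close>

definition assoc_algebra :: "(qv, 'b) module \<Rightarrow> bool" where
  "assoc_algebra A \<longleftrightarrow> Module.module Qv_ring A \<and> Ring.ring A \<and>
     (\<forall>c. \<forall>x\<in>carrier A. \<forall>y\<in>carrier A.
        (c \<odot>\<^bsub>A\<^esub> x) \<otimes>\<^bsub>A\<^esub> y = c \<odot>\<^bsub>A\<^esub> (x \<otimes>\<^bsub>A\<^esub> y) \<and>
        x \<otimes>\<^bsub>A\<^esub> (c \<odot>\<^bsub>A\<^esub> y) = c \<odot>\<^bsub>A\<^esub> (x \<otimes>\<^bsub>A\<^esub> y))"

definition algebra_iso :: "(qv, 'b) module \<Rightarrow> (qv, 'c) module \<Rightarrow> ('b \<Rightarrow> 'c) set" where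
  "algebra_iso A A' =
     {f \<in> ring_iso A A'. \<forall>c. \<forall>x\<in>carrier A. f (c \<odot>\<^bsub>A\<^esub> x) = c \<odot>\<^bsub>A'\<^esub> f x}"

definition lincomb :: "(qv, 'b) module \<Rightarrow> ('b \<Rightarrow> qv) \<Rightarrow> 'b set \<Rightarrow> 'b" where
  "lincomb M c T = (\<Oplus>\<^bsub>M\<^esub>b\<in>T. c b \<odot>\<^bsub>M\<^esub> b)"

definition lin_span :: "(qv, 'b) module \<Rightarrow> 'b set \<Rightarrow> 'b set" where
  "lin_span M S = {lincomb M c T | c T. finite T \<and> T \<subseteq> S}"

definition lin_indep :: "(qv, 'b) module \<Rightarrow> 'b set \<Rightarrow> bool" where
  "lin_indep M S \<longleftrightarrow>
     (\<forall>c T. finite T \<and> T \<subseteq> S \<and> lincomb M c T = \<zero>\<^bsub>M\<^esub> \<longrightarrow> (\<forall>b\<in>T. c b = 0))"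

definition is_basis :: "(qv, 'b) module \<Rightarrow> 'b set \<Rightarrow> bool" where
  "is_basis M B \<longleftrightarrow> B \<subseteq> carrier M \<and> lin_indep M B \<and> lin_span M B = carrier M"

definition coords :: "(qv, 'b) module \<Rightarrow> 'b set \<Rightarrow> 'b \<Rightarrow> 'b \<Rightarrow> qv" where
  "coords M B x = (THE c. {b. c b \<noteq> 0} \<subseteq> B \<and> finite {b. c b \<noteq> 0} \<and>
                          lincomb M c {b. c b \<noteq> 0} = x)"

text \<open>
  The quotient of a module by a subspace \<open>N\<close>; its \<open>mult\<close> and \<open>one\<close> are meaningful
  only if \<open>N\<close> is a two-sided ideal. In \<open>smult\<close> the summand \<open>N\<close> matters for the scalar \<open>0\<close>.
\<close>

definition quot_alg :: "(qv, 'b) module \<Rightarrow> 'b set \<Rightarrow> (qv, 'b set) module" where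
  "quot_alg A N = ring.extend (A Quot N)
     (module.fields (\<lambda>c X. N <+>\<^bsub>A\<^esub> (\<lambda>x. c \<odot>\<^bsub>A\<^esub> x) ` X))"


section \<open>Free and presented algebras\<close>

text \<open>
  The free monoid, written additively so that \<open>'g fmon \<Rightarrow>\<^sub>0 qv\<close> carries
  the (noncommutative) convolution product of the library.
\<close>

datatype 'g fmon = FMon (letters: "'g list")

instantiation fmon :: (type) monoid_add
begin

definition zero_fmon :: "'a fmon" where
  "zero_fmon = FMon []"

definition plus_fmon :: "'a fmon \<Rightarrow> 'a fmon \<Rightarrow> 'a fmon" where
  "plus_fmon x y = FMon (letters x @ letters y)"

instance
  by standard (simp_all add: zero_fmon_def plus_fmon_def)

end

type_synonym 'g fpoly = "'g fmon \<Rightarrow>\<^sub>0 qv"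

definition fgen :: "'g \<Rightarrow> 'g fpoly" where
  "fgen g = Poly_Mapping.single (FMon [g]) 1"

definition fscale :: "qv \<Rightarrow> 'g fpoly \<Rightarrow> 'g fpoly" where
  "fscale c p = Poly_Mapping.single 0 c * p"

definition free_alg :: "'g set \<Rightarrow> (qv, 'g fpoly) module" where
  "free_alg G = \<lparr>carrier = {p. \<forall>w\<in>Poly_Mapping.keys p. set (letters w) \<subseteq> G},
     mult = (*), one = 1, zero = 0, add = (+), smult = fscale\<rparr>"

definition presented_alg :: "'g set \<Rightarrow> 'g fpoly set \<Rightarrow> (qv, 'g fpoly set) module" where
  "presented_alg G R = quot_alg (free_alg G) (Idl\<^bsub>free_alg G\<^esub> R)"

definition presented_class :: "'g set \<Rightarrow> 'g fpoly set \<Rightarrow> 'g fpoly \<Rightarrow> 'g fpoly set" where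
  "presented_class G R p = (Idl\<^bsub>free_alg G\<^esub> R) +>\<^bsub>free_alg G\<^esub> p"

definition free_lift :: "(qv, 'b) module \<Rightarrow> ('g \<Rightarrow> 'b) \<Rightarrow> 'g fpoly \<Rightarrow> 'b" where
  "free_lift A \<phi> p = (\<Oplus>\<^bsub>A\<^esub>w\<in>Poly_Mapping.keys p. Poly_Mapping.lookup p w \<odot>\<^bsub>A\<^esub>
       foldr (\<lambda>g x. \<phi> g \<otimes>\<^bsub>A\<^esub> x) (letters w) \<one>\<^bsub>A\<^esub>)"

text \<open>
  The algebra map from a presented algebra to \<open>A\<close> with values \<open>\<phi>\<close> on the generators, when it
  exists: then \<^term>\<open>free_lift A \<phi>\<close> is constant on cosets.
\<close>

definition presented_lift :: "(qv, 'b) module \<Rightarrow> ('g \<Rightarrow> 'b) \<Rightarrow> 'g fpoly set \<Rightarrow> 'b" where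
  "presented_lift A \<phi> X = the_elem (free_lift A \<phi> ` X)"


section \<open>Root data\<close>

definition zsmul :: "int \<Rightarrow> 'a::ab_group_add \<Rightarrow> 'a" where
  "zsmul n x = (\<Sum>_<nat n. x) - (\<Sum>_<nat (- n). x)"

definition fg_free :: "'a::ab_group_add itself \<Rightarrow> bool" where
  "fg_free _ \<longleftrightarrow> (\<exists>S::'a set. finite S \<and> \<not> Modules.module.dependent zsmul S \<and>
                              Modules.module.span zsmul S = UNIV)"

text \<open>
  \<open>form i j\<close> is \<open>(i, j)\<close>, i.e. the bilinear form on \<open>\<int>[I]\<close> is given by its Gram matrix;
  \<open>pairing h \<zeta>\<close> is \<open>\<langle>h, \<zeta>\<rangle>\<close>. The groups \<open>X\<close> and \<open>Y\<close> are the types \<open>'x\<close> and \<open>'y\<close>.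
\<close>

record ('i, 'x, 'y) root_datum =
  idx :: "'i set"
  form :: "'i \<Rightarrow> 'i \<Rightarrow> int"
  pairing :: "'y \<Rightarrow> 'x \<Rightarrow> int"
  coroot :: "'i \<Rightarrow> 'y"
  sroot :: "'i \<Rightarrow> 'x"

definition cartan_datum :: "'i set \<Rightarrow> ('i \<Rightarrow> 'i \<Rightarrow> int) \<Rightarrow> bool" where
  "cartan_datum I f \<longleftrightarrow> finite I \<and>
     (\<forall>i\<in>I. \<forall>j\<in>I. f i j = f j i) \<and>
     (\<forall>i\<in>I. even (f i i) \<and> f i i > 0) \<and>
     (\<forall>i\<in>I. \<forall>j\<in>I. i \<noteq> j \<longrightarrow> f i i dvd 2 * f i j \<and> 2 * f i j \<le> 0)"

definition pos_def_on :: "'i set \<Rightarrow> ('i \<Rightarrow> 'i \<Rightarrow> int) \<Rightarrow> bool" where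
  "pos_def_on I f \<longleftrightarrow> (\<forall>c::'i \<Rightarrow> real. (\<exists>i\<in>I. c i \<noteq> 0) \<longrightarrow>
     (\<Sum>i\<in>I. \<Sum>j\<in>I. c i * c j * of_int (f i j)) > 0)"

definition perfect_pairing :: "('y::ab_group_add \<Rightarrow> 'x::ab_group_add \<Rightarrow> int) \<Rightarrow> bool" where
  "perfect_pairing p \<longleftrightarrow>
     (\<forall>h. additive (p h)) \<and> (\<forall>x. additive (\<lambda>h. p h x)) \<and>
     (\<forall>\<phi>. additive \<phi> \<longrightarrow> (\<exists>!h. p h = \<phi>)) \<and>
     (\<forall>\<psi>. additive \<psi> \<longrightarrow> (\<exists>!x. (\<lambda>h. p h x) = \<psi>))"

definition is_root_datum :: "('i, 'x::ab_group_add, 'y::ab_group_add) root_datum \<Rightarrow> bool" where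
  "is_root_datum D \<longleftrightarrow> cartan_datum (idx D) (form D) \<and>
     fg_free TYPE('x) \<and> fg_free TYPE('y) \<and> perfect_pairing (pairing D) \<and>
     inj_on (coroot D) (idx D) \<and> inj_on (sroot D) (idx D) \<and>
     (\<forall>i\<in>idx D. \<forall>j\<in>idx D.
        pairing D (coroot D i) (sroot D j) = 2 * form D i j div form D i i)"

definition finite_type :: "('i, 'x, 'y) root_datum \<Rightarrow> bool" where
  "finite_type D \<longleftrightarrow> pos_def_on (idx D) (form D)"

definition dnum :: "('i, 'x, 'y) root_datum \<Rightarrow> 'i \<Rightarrow> int" where
  "dnum D i = form D i i div 2"

definition vi :: "('i, 'x, 'y) root_datum \<Rightarrow> 'i \<Rightarrow> qv" where
  "vi D i = v powi dnum D i"

definition dominant :: "('i, 'x, 'y) root_datum \<Rightarrow> 'x set" where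
  "dominant D = {\<zeta>. \<forall>i\<in>idx D. pairing D (coroot D i) \<zeta> \<ge> 0}"

definition dom_le :: "('i, 'x::ab_group_add, 'y) root_datum \<Rightarrow> 'x \<Rightarrow> 'x \<Rightarrow> bool" where
  "dom_le D \<zeta> \<mu> \<longleftrightarrow> (\<exists>n::'i \<Rightarrow> nat. \<mu> - \<zeta> = (\<Sum>i\<in>idx D. zsmul (int (n i)) (sroot D i)))"

definition simple_refl :: "('i, 'x::ab_group_add, 'y) root_datum \<Rightarrow> 'i \<Rightarrow> 'x \<Rightarrow> 'x" where
  "simple_refl D i \<zeta> = \<zeta> - zsmul (pairing D (coroot D i) \<zeta>) (sroot D i)"

text \<open>Simple reflections are involutions, so the monoid they generate is the Weyl group.\<close>

inductive_set weyl :: "('i, 'x::ab_group_add, 'y) root_datum \<Rightarrow> ('x \<Rightarrow> 'x) set"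
  for D :: "('i, 'x, 'y) root_datum" where
  weyl_id: "id \<in> weyl D"
| weyl_refl: "w \<in> weyl D \<Longrightarrow> i \<in> idx D \<Longrightarrow> simple_refl D i \<circ> w \<in> weyl D"

definition weyl_orbit :: "('i, 'x::ab_group_add, 'y) root_datum \<Rightarrow> 'x set \<Rightarrow> 'x set" where
  "weyl_orbit D \<pi> = (\<Union>w\<in>weyl D. w ` \<pi>)"

definition saturated :: "('i, 'x::ab_group_add, 'y) root_datum \<Rightarrow> 'x set \<Rightarrow> bool" where
  "saturated D \<pi> \<longleftrightarrow> \<pi> \<noteq> {} \<and> \<pi> \<subseteq> dominant D \<and>
     (\<forall>\<zeta>\<in>dominant D. \<forall>\<mu>\<in>\<pi>. dom_le D \<zeta> \<mu> \<longrightarrow> \<zeta> \<in> \<pi>)"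

definition fin_sat :: "('i, 'x::ab_group_add, 'y) root_datum \<Rightarrow> 'x set set" where
  "fin_sat D = {\<pi>. finite \<pi> \<and> saturated D \<pi>}"


section \<open>The quantized enveloping algebra\<close>

datatype sign = Pos | Neg

primrec sgn_int :: "sign \<Rightarrow> int" where
  "sgn_int Pos = 1"
| "sgn_int Neg = - 1"

text \<open>
  \<open>E Pos i\<close> and \<open>E Neg i\<close> are \<open>E\<^sub>i\<close> and \<open>E\<close> with index \<open>-i\<close>; \<open>T z\<close> is the toral generator
  \<open>K\<^sub>h\<close> (\<open>z = h\<close>) for \<open>\<^bold>U\<close> and the idempotent \<open>1\<^sub>\<zeta>\<close> (\<open>z = \<zeta>\<close>) for \<open>\<^bold>S(\<pi>)\<close>.
\<close>

datatype ('i, 'z) gen = E sign 'i | T 'z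

definition divpow :: "('i, 'x, 'y) root_datum \<Rightarrow> sign \<Rightarrow> 'i \<Rightarrow> nat \<Rightarrow> ('i, 'z) gen fpoly" where
  "divpow D s i m = fscale (inverse (qfact (vi D i) m)) (fgen (E s i) ^ m)"

definition serre :: "('i, 'x, 'y) root_datum \<Rightarrow> sign \<Rightarrow> 'i \<Rightarrow> 'i \<Rightarrow> ('i, 'z) gen fpoly" where
  "serre D s i j = (let n = nat (1 - pairing D (coroot D i) (sroot D j)) in
     \<Sum>k\<le>n. (- 1) ^ (n - k) * divpow D s i k * fgen (E s j) * divpow D s i (n - k))"

definition serre_rels :: "('i, 'x, 'y) root_datum \<Rightarrow> ('i, 'z) gen fpoly set" where
  "serre_rels D = {serre D s i j | s i j. i \<in> idx D \<and> j \<in> idx D \<and> i \<noteq> j}"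

text \<open>A relation \<open>l = r\<close> is recorded as \<open>l - r\<close>.\<close>

definition U_gens :: "('i, 'x, 'y) root_datum \<Rightarrow> ('i, 'y) gen set" where
  "U_gens D = {E s i | s i. i \<in> idx D} \<union> range T"

definition U_rels :: "('i, 'x, 'y::ab_group_add) root_datum \<Rightarrow> ('i, 'y) gen fpoly set" where
  "U_rels D =
     {fgen (T h) * fgen (T h') - fgen (T (h + h')) | h h'. True} \<union>
     {fgen (T 0) - 1} \<union>
     {fgen (T h) * fgen (E s i)
        - fscale (v powi (sgn_int s * pairing D h (sroot D i))) (fgen (E s i) * fgen (T h))
      | h s i. i \<in> idx D} \<union>
     {fgen (E Pos i) * fgen (E Neg j) - fgen (E Neg j) * fgen (E Pos i)
        - (if i = j
           then fscale (inverse (vi D i - inverse (vi D i)))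
                  (fgen (T (zsmul (dnum D i) (coroot D i)))
                     - fgen (T (zsmul (- dnum D i) (coroot D i))))
           else 0)
      | i j. i \<in> idx D \<and> j \<in> idx D} \<union>
     serre_rels D"

definition U_alg ::
  "('i, 'x, 'y::ab_group_add) root_datum \<Rightarrow> (qv, ('i, 'y) gen fpoly set) module" where
  "U_alg D = presented_alg (U_gens D) (U_rels D)"

definition U_class ::
  "('i, 'x, 'y::ab_group_add) root_datum \<Rightarrow> ('i, 'y) gen fpoly \<Rightarrow> ('i, 'y) gen fpoly set" where
  "U_class D = presented_class (U_gens D) (U_rels D)"

primrec gen_wt :: "('i, 'x::ab_group_add, 'y) root_datum \<Rightarrow> ('i, 'y) gen \<Rightarrow> 'x" where
  "gen_wt D (E s i) = zsmul (sgn_int s) (sroot D i)"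
| "gen_wt D (T h) = 0"

definition U_wt ::
  "('i, 'x::ab_group_add, 'y::ab_group_add) root_datum \<Rightarrow> 'x \<Rightarrow> ('i, 'y) gen fpoly set set" where
  "U_wt D \<nu> = U_class D ` {p \<in> carrier (free_alg (U_gens D)).
     \<forall>w\<in>Poly_Mapping.keys p. sum_list (map (gen_wt D) (letters w)) = \<nu>}"


section \<open>The modified form\<close>

definition K_minus ::
  "('i, 'x::ab_group_add, 'y::ab_group_add) root_datum \<Rightarrow> 'y \<Rightarrow> 'x \<Rightarrow> ('i, 'y) gen fpoly set" where
  "K_minus D h \<zeta> = U_class D (fgen (T h)) \<ominus>\<^bsub>U_alg D\<^esub>
     (v powi pairing D h \<zeta> \<odot>\<^bsub>U_alg D\<^esub> \<one>\<^bsub>U_alg D\<^esub>)"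

definition wt_sub ::
  "('i, 'x::ab_group_add, 'y::ab_group_add) root_datum \<Rightarrow> 'x \<Rightarrow> 'x \<Rightarrow>
     ('i, 'y) gen fpoly set set" where
  "wt_sub D \<zeta> \<mu> = lin_span (U_alg D)
     ({K_minus D h \<zeta> \<otimes>\<^bsub>U_alg D\<^esub> u | h u. u \<in> carrier (U_alg D)} \<union>
      {u \<otimes>\<^bsub>U_alg D\<^esub> K_minus D h \<mu> | h u. u \<in> carrier (U_alg D)})"

text \<open>\<open>wt_quot D \<zeta> \<mu>\<close> is used only as a vector space.\<close>

definition wt_quot ::
  "('i, 'x::ab_group_add, 'y::ab_group_add) root_datum \<Rightarrow> 'x \<Rightarrow> 'x \<Rightarrow>
     (qv, ('i, 'y) gen fpoly set set) module" where
  "wt_quot D \<zeta> \<mu> = quot_alg (U_alg D) (wt_sub D \<zeta> \<mu>)"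

definition wt_proj ::
  "('i, 'x::ab_group_add, 'y::ab_group_add) root_datum \<Rightarrow> 'x \<Rightarrow> 'x \<Rightarrow>
     ('i, 'y) gen fpoly set \<Rightarrow> ('i, 'y) gen fpoly set set" where
  "wt_proj D \<zeta> \<mu> u = wt_sub D \<zeta> \<mu> +>\<^bsub>U_alg D\<^esub> u"

definition wt_mult ::
  "('i, 'x::ab_group_add, 'y::ab_group_add) root_datum \<Rightarrow> 'x \<Rightarrow> 'x \<Rightarrow> 'x \<Rightarrow>
     ('i, 'y) gen fpoly set set \<Rightarrow> ('i, 'y) gen fpoly set set \<Rightarrow> ('i, 'y) gen fpoly set set" where
  "wt_mult D \<zeta> \<mu> \<nu> a b = (THE c. \<exists>t\<in>U_wt D (\<zeta> - \<mu>). \<exists>s\<in>U_wt D (\<mu> - \<nu>).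
     a = wt_proj D \<zeta> \<mu> t \<and> b = wt_proj D \<mu> \<nu> s \<and> c = wt_proj D \<zeta> \<nu> (t \<otimes>\<^bsub>U_alg D\<^esub> s))"

type_synonym ('i, 'x, 'y) udot = "'x \<Rightarrow> 'x \<Rightarrow> ('i, 'y) gen fpoly set set"

text \<open>
  The direct sum of the \<open>wt_quot D \<zeta> \<mu>\<close>. It has no unit when \<open>X\<close> is infinite, so the
  \<open>one\<close> field is left unspecified.
\<close>

definition Udot ::
  "('i, 'x::ab_group_add, 'y::ab_group_add) root_datum \<Rightarrow> (qv, ('i, 'x, 'y) udot) module" where
  "Udot D = \<lparr>
     carrier = {x. (\<forall>\<zeta> \<mu>. x \<zeta> \<mu> \<in> carrier (wt_quot D \<zeta> \<mu>)) \<and>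
                   finite {(\<zeta>, \<mu>). x \<zeta> \<mu> \<noteq> \<zero>\<^bsub>wt_quot D \<zeta> \<mu>\<^esub>}},
     mult = (\<lambda>x y \<zeta> \<nu>. \<Oplus>\<^bsub>wt_quot D \<zeta> \<nu>\<^esub>
               \<mu> \<in> {\<mu>. x \<zeta> \<mu> \<noteq> \<zero>\<^bsub>wt_quot D \<zeta> \<mu>\<^esub> \<and> y \<mu> \<nu> \<noteq> \<zero>\<^bsub>wt_quot D \<mu> \<nu>\<^esub>}.
               wt_mult D \<zeta> \<mu> \<nu> (x \<zeta> \<mu>) (y \<mu> \<nu>)),
     one = undefined,
     zero = (\<lambda>\<zeta> \<mu>. \<zero>\<^bsub>wt_quot D \<zeta> \<mu>\<^esub>),
     add = (\<lambda>x y \<zeta> \<mu>. x \<zeta> \<mu> \<oplus>\<^bsub>wt_quot D \<zeta> \<mu>\<^esub> y \<zeta> \<mu>),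
     smult = (\<lambda>c x \<zeta> \<mu>. c \<odot>\<^bsub>wt_quot D \<zeta> \<mu>\<^esub> x \<zeta> \<mu>)\<rparr>"

definition Udot_idem ::
  "('i, 'x::ab_group_add, 'y::ab_group_add) root_datum \<Rightarrow> 'x \<Rightarrow> ('i, 'x, 'y) udot" where
  "Udot_idem D \<kappa> = (\<lambda>\<zeta> \<mu>. if \<zeta> = \<kappa> \<and> \<mu> = \<kappa> then wt_proj D \<kappa> \<kappa> \<one>\<^bsub>U_alg D\<^esub>
                         else \<zero>\<^bsub>wt_quot D \<zeta> \<mu>\<^esub>)"


section \<open>The algebras \<open>\<^bold>S(\<pi>)\<close> and their inverse limit\<close>

definition S_gens :: "('i, 'x::ab_group_add, 'y) root_datum \<Rightarrow> 'x set \<Rightarrow> ('i, 'x) gen set" where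
  "S_gens D \<pi> = {E s i | s i. i \<in> idx D} \<union> T ` weyl_orbit D \<pi>"

text \<open>The convention \<open>1\<^sub>\<zeta> = 0\<close> for \<open>\<zeta>\<close> outside \<open>W\<pi>\<close>.\<close>

definition idem :: "('i, 'x::ab_group_add, 'y) root_datum \<Rightarrow> 'x set \<Rightarrow> 'x \<Rightarrow> ('i, 'x) gen fpoly" where
  "idem D \<pi> \<zeta> = (if \<zeta> \<in> weyl_orbit D \<pi> then fgen (T \<zeta>) else 0)"

definition S_rels ::
  "('i, 'x::ab_group_add, 'y) root_datum \<Rightarrow> 'x set \<Rightarrow> ('i, 'x) gen fpoly set" where
  "S_rels D \<pi> =
     {idem D \<pi> \<zeta> * idem D \<pi> \<zeta>' - (if \<zeta> = \<zeta>' then idem D \<pi> \<zeta> else 0) | \<zeta> \<zeta>'. True} \<union>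
     {(\<Sum>\<zeta>\<in>weyl_orbit D \<pi>. idem D \<pi> \<zeta>) - 1} \<union>
     {fgen (E s i) * idem D \<pi> \<zeta>
        - idem D \<pi> (\<zeta> + zsmul (sgn_int s) (sroot D i)) * fgen (E s i)
      | s i \<zeta>. i \<in> idx D} \<union>
     {fgen (E Pos i) * fgen (E Neg j) - fgen (E Neg j) * fgen (E Pos i)
        - (if i = j
           then (\<Sum>\<zeta>\<in>weyl_orbit D \<pi>.
                   fscale (qint (vi D i) (pairing D (coroot D i) \<zeta>)) (idem D \<pi> \<zeta>))
           else 0)
      | i j. i \<in> idx D \<and> j \<in> idx D} \<union>
     serre_rels D"

definition S_alg ::
  "('i, 'x::ab_group_add, 'y) root_datum \<Rightarrow> 'x set \<Rightarrow> (qv, ('i, 'x) gen fpoly set) module" where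
  "S_alg D \<pi> = presented_alg (S_gens D \<pi>) (S_rels D \<pi>)"

definition S_class ::
  "('i, 'x::ab_group_add, 'y) root_datum \<Rightarrow> 'x set \<Rightarrow>
     ('i, 'x) gen fpoly \<Rightarrow> ('i, 'x) gen fpoly set" where
  "S_class D \<pi> = presented_class (S_gens D \<pi>) (S_rels D \<pi>)"

primrec S_gen_class ::
  "('i, 'x::ab_group_add, 'y) root_datum \<Rightarrow> 'x set \<Rightarrow> ('i, 'x) gen \<Rightarrow> ('i, 'x) gen fpoly set" where
  "S_gen_class D \<pi> (E s i) = S_class D \<pi> (fgen (E s i))"
| "S_gen_class D \<pi> (T \<zeta>) = S_class D \<pi> (idem D \<pi> \<zeta>)"

text \<open>\<open>S_trans D \<pi> \<pi>'\<close> is the map \<open>f\<close> from \<open>\<^bold>S(\<pi>')\<close> to \<open>\<^bold>S(\<pi>)\<close>.\<close>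

definition S_trans ::
  "('i, 'x::ab_group_add, 'y) root_datum \<Rightarrow> 'x set \<Rightarrow> 'x set \<Rightarrow>
     ('i, 'x) gen fpoly set \<Rightarrow> ('i, 'x) gen fpoly set" where
  "S_trans D \<pi> \<pi>' = presented_lift (S_alg D \<pi>) (S_gen_class D \<pi>)"

type_synonym ('i, 'x) uhat = "'x set \<Rightarrow> ('i, 'x) gen fpoly set"

definition Uhat ::
  "('i, 'x::ab_group_add, 'y) root_datum \<Rightarrow> (qv, ('i, 'x) uhat) module" where
  "Uhat D = \<lparr>
     carrier = {a \<in> (\<Pi>\<^sub>E \<pi>\<in>fin_sat D. carrier (S_alg D \<pi>)).
                  \<forall>\<pi>\<in>fin_sat D. \<forall>\<pi>'\<in>fin_sat D. \<pi> \<subseteq> \<pi>' \<longrightarrow> a \<pi> = S_trans D \<pi> \<pi>' (a \<pi>')},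
     mult = (\<lambda>a b. \<lambda>\<pi>\<in>fin_sat D. a \<pi> \<otimes>\<^bsub>S_alg D \<pi>\<^esub> b \<pi>),
     one = (\<lambda>\<pi>\<in>fin_sat D. \<one>\<^bsub>S_alg D \<pi>\<^esub>),
     zero = (\<lambda>\<pi>\<in>fin_sat D. \<zero>\<^bsub>S_alg D \<pi>\<^esub>),
     add = (\<lambda>a b. \<lambda>\<pi>\<in>fin_sat D. a \<pi> \<oplus>\<^bsub>S_alg D \<pi>\<^esub> b \<pi>),
     smult = (\<lambda>c a. \<lambda>\<pi>\<in>fin_sat D. c \<odot>\<^bsub>S_alg D \<pi>\<^esub> a \<pi>)\<rparr>"


section \<open>The maps to \<open>\<^bold>S(\<pi>)\<close>\<close>

definition S_K ::
  "('i, 'x::ab_group_add, 'y) root_datum \<Rightarrow> 'x set \<Rightarrow> 'y \<Rightarrow> ('i, 'x) gen fpoly set" where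
  "S_K D \<pi> h = S_class D \<pi>
     (\<Sum>\<zeta>\<in>weyl_orbit D \<pi>. fscale (v powi pairing D h \<zeta>) (idem D \<pi> \<zeta>))"

primrec p_gen ::
  "('i, 'x::ab_group_add, 'y) root_datum \<Rightarrow> 'x set \<Rightarrow> ('i, 'y) gen \<Rightarrow> ('i, 'x) gen fpoly set" where
  "p_gen D \<pi> (E s i) = S_class D \<pi> (fgen (E s i))"
| "p_gen D \<pi> (T h) = S_K D \<pi> h"

definition p_map ::
  "('i, 'x::ab_group_add, 'y) root_datum \<Rightarrow> 'x set \<Rightarrow>
     ('i, 'y) gen fpoly set \<Rightarrow> ('i, 'x) gen fpoly set" where
  "p_map D \<pi> = presented_lift (S_alg D \<pi>) (p_gen D \<pi>)"

text \<open>On a component \<open>X\<close> = \<open>wt_proj D \<zeta> \<mu> u\<close>, a coset of elements of \<open>\<^bold>U\<close>.\<close>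

definition pdot_comp ::
  "('i, 'x::ab_group_add, 'y) root_datum \<Rightarrow> 'x set \<Rightarrow> 'x \<Rightarrow> 'x \<Rightarrow>
     ('i, 'y) gen fpoly set set \<Rightarrow> ('i, 'x) gen fpoly set" where
  "pdot_comp D \<pi> \<zeta> \<mu> X = the_elem ((\<lambda>u. S_class D \<pi> (idem D \<pi> \<zeta>) \<otimes>\<^bsub>S_alg D \<pi>\<^esub>
     p_map D \<pi> u \<otimes>\<^bsub>S_alg D \<pi>\<^esub> S_class D \<pi> (idem D \<pi> \<mu>)) ` X)"

definition pdot ::
  "('i, 'x::ab_group_add, 'y::ab_group_add) root_datum \<Rightarrow> 'x set \<Rightarrow>
     ('i, 'x, 'y) udot \<Rightarrow> ('i, 'x) gen fpoly set" where
  "pdot D \<pi> x = finsum (S_alg D \<pi>) (\<lambda>(\<zeta>, \<mu>). pdot_comp D \<pi> \<zeta> \<mu> (x \<zeta> \<mu>))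
     {(\<zeta>, \<mu>). x \<zeta> \<mu> \<noteq> \<zero>\<^bsub>wt_quot D \<zeta> \<mu>\<^esub>}"


section \<open>Coherent bases and formal linear combinations\<close>

text \<open>
  \<open>basis_supp D B \<pi>\<close> is \<open>B[\<pi>]\<close>, regarded as a set of elements of \<open>B\<close> rather than of \<open>\<^bold>S(\<pi>)\<close>.
\<close>

definition basis_supp ::
  "('i, 'x::ab_group_add, 'y::ab_group_add) root_datum \<Rightarrow> ('i, 'x, 'y) udot set \<Rightarrow>
     'x set \<Rightarrow> ('i, 'x, 'y) udot set" where
  "basis_supp D B \<pi> = {b \<in> B. pdot D \<pi> b \<noteq> \<zero>\<^bsub>S_alg D \<pi>\<^esub>}"

text \<open>
  The nonzero elements of the image of \<open>B\<close> are to form a basis as a family indexed by \<open>B[\<pi>]\<close>.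
  This is what makes it legitimate to denote \<open>b\<close> and its nonzero image by the same symbol;
  if distinct elements of \<open>B\<close> could share a nonzero image, the sums over \<open>B[\<pi>]\<close> that define
  the identification below would be ambiguous or infinite.
\<close>

definition coherent_basis ::
  "('i, 'x::ab_group_add, 'y::ab_group_add) root_datum \<Rightarrow> ('i, 'x, 'y) udot set \<Rightarrow> bool" where
  "coherent_basis D B \<longleftrightarrow> is_basis (Udot D) B \<and>
     (\<forall>\<pi>\<in>fin_sat D. inj_on (pdot D \<pi>) (basis_supp D B \<pi>) \<and>
        is_basis (S_alg D \<pi>) (pdot D \<pi> ` B - {\<zero>\<^bsub>S_alg D \<pi>\<^esub>}))"

text \<open>\<open>struct_const D B b c d\<close> is the coefficient of \<open>d\<close> in the product of \<open>b\<close> and \<open>c\<close>.\<close>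

definition struct_const ::
  "('i, 'x::ab_group_add, 'y::ab_group_add) root_datum \<Rightarrow> ('i, 'x, 'y) udot set \<Rightarrow>
     ('i, 'x, 'y) udot \<Rightarrow> ('i, 'x, 'y) udot \<Rightarrow> ('i, 'x, 'y) udot \<Rightarrow> qv" where
  "struct_const D B b c d = coords (Udot D) B (b \<otimes>\<^bsub>Udot D\<^esub> c) d"

text \<open>
  A formal sum is its coefficient function. Products are expanded bilinearly by the structure
  constants of \<open>B\<close>, and the unit is the formal sum of all idempotents \<open>1\<^sub>\<zeta>\<close>, expanded in \<open>B\<close>.
\<close>

definition formal_alg ::
  "('i, 'x::ab_group_add, 'y::ab_group_add) root_datum \<Rightarrow> ('i, 'x, 'y) udot set \<Rightarrow>
     (qv, ('i, 'x, 'y) udot \<Rightarrow> qv) module" where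
  "formal_alg D B = \<lparr>
     carrier = {a. \<forall>b. b \<notin> B \<longrightarrow> a b = 0},
     mult = (\<lambda>a a' d. if d \<in> B
               then \<Sum>(b, c) \<in> {(b, c) \<in> B \<times> B. struct_const D B b c d \<noteq> 0}.
                      a b * a' c * struct_const D B b c d
               else 0),
     one = (\<lambda>d. if d \<in> B
              then \<Sum>\<zeta> \<in> {\<zeta>. coords (Udot D) B (Udot_idem D \<zeta>) d \<noteq> 0}.
                     coords (Udot D) B (Udot_idem D \<zeta>) d
              else 0),
     zero = (\<lambda>_. 0),
     add = (\<lambda>a a' b. a b + a' b),
     smult = (\<lambda>k a b. k * a b)\<rparr>"

definition formal_ident ::
  "('i, 'x::ab_group_add, 'y::ab_group_add) root_datum \<Rightarrow> ('i, 'x, 'y) udot set \<Rightarrow>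
     (('i, 'x, 'y) udot \<Rightarrow> qv) \<Rightarrow> ('i, 'x) uhat" where
  "formal_ident D B a = (\<lambda>\<pi>\<in>fin_sat D.
     \<Oplus>\<^bsub>S_alg D \<pi>\<^esub>b\<in>basis_supp D B \<pi>. a b \<odot>\<^bsub>S_alg D \<pi>\<^esub> pdot D \<pi> b)"

end

theory Submission imports Defs begin

text \<open>
  The statement is formal once two facts are known: \<open>S(\<pi>)\<close> is finite dimensional, so that \<open>B[\<pi>]\<close>
  is finite, and the kernels of the maps to the \<open>S(\<pi>)\<close> intersect in zero, so that every
  \<open>b \<in> B\<close> lies in some \<open>B[\<pi>]\<close>. Then \<open>d \<in> B[\<pi>]\<close> occurs in \<open>b c\<close> only if \<open>b, c \<in> B[\<pi>]\<close>,
  and a compatible family of vectors of the \<open>S(\<pi>)\<close> is the same as a coefficient function on \<open>B\<close>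
  because the finite saturated sets are directed.

  \<open>S(\<pi>)\<close> is spanned by the products \<open>F\<^sub>y 1\<^sub>\<kappa> E\<^sub>x\<close> over words \<open>x\<close>, \<open>y\<close>, and long words vanish since
  they shift the finite set \<open>W\<pi>\<close> of weights off itself.

  For the kernels, an element of weights \<open>(\<zeta>, \<mu>)\<close> is a combination of products \<open>F\<^sub>y E\<^sub>x\<close>, which is
  applied to the generating vector of a tensor product of an integrable lowest weight module and an
  integrable highest weight module, of extremal weights \<open>- a\<close> and \<open>b\<close> with \<open>b - a\<close> given by \<open>\<mu>\<close>. The
  result is \<open>x \<otimes> y\<close> up to terms with shorter \<open>x\<close>, so if it vanishes for large \<open>a\<close>, \<open>b\<close> then
  the combination lies in the Serre ideals. The tensor product has finitely many
  weights, hence is a module over \<open>S(\<pi>)\<close> for large \<open>\<pi>\<close>. No semisimplicity is needed: the highest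
  weight module is the Verma module modulo the vectors \<open>F\<^sub>i\<close> to the power \<open>b\<^sub>i + 1\<close>, and its weights are
  finite in number because a positive definite quadratic function on the root lattice, invariant
  under the Weyl group, is bounded on them.
\<close>

section \<open>Quantum integers\<close>

text \<open>The combinations killed by all the tensor products have to be exactly those in the Serre
  ideals, so the modules are divided by as little as possible: a Verma module is the free space on
  words modulo the Serre vectors. These generate a submodule because a Serre element commutes with
  every \<open>E\<^sub>k\<close> as soon as the commutators of the \<open>E\<^sub>i\<close> with the
  \<open>F\<^sub>j\<close> are given. The same fact carries the Serre relations to the tensor
  product: they are evident on vectors with one extremal factor and spread from there, so that no
  coproduct of a Serre element is expanded. Quotient modules are never formed. Operators act on the
  free space on words or pairs of words, a stable subspace N is carried along, and relations hold
  modulo N. The leading term x \<otimes> y is thus a basis vector. Every such N is graded by the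
  letters of the words, so that one may cut by length; the vectors \<open>F\<^sub>i\<close> to the
  power \<open>b\<^sub>i + 1\<close> are longer than all words of a given combination once b is
  large, and the cut reduces the integrable quotient to the Verma module.\<close>

lemma v_power: "v ^ n = Fraction_Field.Fract (monom 1 n) 1"
proof (induction n)
  case 0
  then show ?case by (simp add: One_fract_def monom_0 one_pCons)
next
  case (Suc n)
  then show ?case
    by (simp add: v_def mult_fract monom_Suc)
qed

lemma v_nonzero: "v \<noteq> 0"
proof
  assume "v = 0"
  then have "Fraction_Field.Fract [:0, 1:] 1 = Fraction_Field.Fract (0 :: rat poly) 1"
    by (simp add: v_def Zero_fract_def)
  then show False by (simp add: eq_fract)
qed

lemma v_power_eq_1: "v ^ n = 1 \<Longrightarrow> n = 0"
proof -
  assume "v ^ n = 1"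
  then have "monom (1::rat) n = 1" by (simp add: v_power One_fract_def eq_fract)
  then have "degree (monom (1::rat) n) = 0" by simp
  then show "n = 0" by (simp add: degree_monom_eq)
qed

text \<open>What the quantum integers need from their parameter: [n] is then invertible for every n
  \<noteq> 0. The property passes from v to its powers v_i.\<close>

definition non_root_of_unity :: "qv \<Rightarrow> bool" where
  "non_root_of_unity q \<longleftrightarrow> q \<noteq> 0 \<and> (\<forall>n::int. q powi n = 1 \<longrightarrow> n = 0)"

lemma non_root_of_unity_v: "non_root_of_unity v"
  unfolding non_root_of_unity_def
proof (intro conjI allI impI)
  show "v \<noteq> 0" by (rule v_nonzero)
  fix n :: int assume n: "v powi n = 1"
  show "n = 0"
  proof (cases "n \<ge> 0")
    case True
    then have "v ^ nat n = 1" using n by (simp add: power_int_def)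
    then show ?thesis using v_power_eq_1 True by fastforce
  next
    case False
    then have "v ^ nat (- n) = 1" using n by (simp add: power_int_def power_inverse)
    then show ?thesis using v_power_eq_1 False by fastforce
  qed
qed

lemma non_root_of_unity_powi:
  assumes "non_root_of_unity q" "d \<noteq> 0"
  shows "non_root_of_unity (q powi d)"
  using assms unfolding non_root_of_unity_def by (auto simp: power_int_mult[symmetric])

lemma v_powi_inject: "v powi m = v powi n \<longleftrightarrow> m = n"
proof
  assume "v powi m = v powi n"
  then have "v powi (m - n) = 1" using v_nonzero by (simp add: power_int_diff)
  then show "m = n" using non_root_of_unity_v unfolding non_root_of_unity_def by fastforce
qed simp

text \<open>Up to the factor [n]! this is the signed quantum binomial coefficient. With n = 1 - a_ij
  it is what the divided powers contribute to the Serre relation.\<close>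

definition serre_coeff :: "qv \<Rightarrow> nat \<Rightarrow> nat \<Rightarrow> qv" where
  "serre_coeff q n s = (- 1) ^ (n - s) * inverse (qfact q s) * inverse (qfact q (n - s))"

locale quantum_parameter =
  fixes q :: qv
  assumes nru: "non_root_of_unity q"
begin

lemma q_nz[simp]: "q \<noteq> 0" using nru by (simp add: non_root_of_unity_def)

lemma den_nz: "q - inverse q \<noteq> 0"
proof
  assume "q - inverse q = 0"
  then have "q powi 2 = 1" by (simp add: power2_eq_square field_simps)
  then show False using nru unfolding non_root_of_unity_def by fastforce
qed

lemma qint_nz: "n \<noteq> 0 \<Longrightarrow> qint q n \<noteq> 0"
proof
  assume n: "n \<noteq> 0" "qint q n = 0"
  then have "q powi n = q powi (- n)" using den_nz by (simp add: qint_def)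
  then have "q powi (2 * n) = 1"
    by (metis mult_2 power_int_add q_nz right_inverse power_int_eq_0_iff power_int_minus)
  then show False using nru n unfolding non_root_of_unity_def by fastforce
qed

lemma qint_0[simp]: "qint q 0 = 0" by (simp add: qint_def)
lemma qint_minus: "qint q (- n) = - qint q n" by (simp add: qint_def minus_divide_left)

text \<open>With the coproduct E \<mapsto> E \<otimes> 1 + K \<otimes> E, F \<mapsto> F \<otimes>
  K^-1 + 1 \<otimes> F, the commutator of E and F on weights a and b is the left side, and it has to
  be the quantum integer of the total weight.\<close>

lemma qint_tensor: "qint q a * q powi (- b) + q powi a * qint q b = qint q (a + b)"
  unfolding qint_def
  by (simp add: divide_simps den_nz power_int_diff power_int_minus power_int_add) (simp add: field_simps)

text \<open>This identity and \<open>qint_split'\<close> are exchanged by q \<mapsto> q^-1, which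
  fixes [n].\<close>

lemma qint_split: "qint q n = q powi s * qint q (n - s) + q powi (s - n) * qint q s"
  using qint_tensor[of "n - s" "s"] unfolding qint_def
  by (simp add: divide_simps den_nz power_int_diff power_int_minus) (simp add: field_simps)

lemma qint_split': "qint q n = q powi (- s) * qint q (n - s) + q powi (n - s) * qint q s"
  unfolding qint_def
  by (simp add: divide_simps den_nz power_int_diff power_int_minus) (simp add: field_simps)

text \<open>The induction step in the commutator of E with F^k on a vector of weight m: one further
  F contributes [m - 2k].\<close>

lemma qint_step: "qint q k * qint q (m - k + 1) + qint q (m - 2 * k) = qint q (k + 1) * qint q (m - k)"
proof -
  define x where "x = q powi k"
  define y where "y = q powi m"
  have xy: "x \<noteq> 0" "y \<noteq> 0" by (simp_all add: x_def y_def)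
  have 2: "q powi (2 * k) = x * x" unfolding x_def by (metis mult_2 power_int_add q_nz)
  define d where "d = q - inverse q"
  have d: "d \<noteq> 0" using den_nz by (simp add: d_def)
  have e1: "qint q k = (x - inverse x) / d" by (simp add: qint_def x_def d_def power_int_minus)
  have e2: "qint q (m - k + 1) = (y * q / x - x / (y * q)) / d"
    by (simp add: qint_def x_def y_def d_def power_int_minus power_int_add power_int_diff)
  have e3: "qint q (m - 2 * k) = (y / (x * x) - (x * x) / y) / d"
    using 2 by (simp add: qint_def y_def d_def power_int_minus power_int_add power_int_diff)
  have e4: "qint q (k + 1) = (x * q - inverse (x * q)) / d"
    by (simp only: qint_def x_def d_def power_int_minus power_int_add[OF disjI1[OF q_nz]] power_int_1_right)
  have e5: "qint q (m - k) = (y / x - x / y) / d"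
    by (simp add: qint_def x_def y_def d_def power_int_minus power_int_add power_int_diff)
  have e: "(y / (x * x) - (x * x) / y) / d = (y / (x * x) - (x * x) / y) * (q - inverse q) / (d * d)"
    using d by (simp add: d_def[symmetric])
  show ?thesis
    unfolding e1 e2 e3 e4 e5 e
    using d xy by (simp add: divide_simps) (simp add: field_simps)
qed

lemma qfact_0[simp]: "qfact q 0 = 1" by (simp add: qfact_def)
lemma qfact_Suc: "qfact q (Suc n) = qfact q n * qint q (int n + 1)"
  by (simp add: qfact_def add.commute)
lemma qfact_nz: "qfact q n \<noteq> 0"
  by (induction n) (use qint_nz in \<open>auto simp: qfact_Suc\<close>)

text \<open>By the q-binomial theorem the sum is a multiple of a product with a vanishing factor.
  Here it is summed directly: its partial sums have a closed form. The function r stands for t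
  \<mapsto> q^t or t \<mapsto> q^-t, so that one proof serves both signs.\<close>

lemma alternating_sum_zero:
  fixes r :: "int \<Rightarrow> qv"
  assumes split: "\<And>s. qint q (int n) = r s * qint q (int n - s) + r (s - int n) * qint q s"
    and r: "\<And>s t. r (s + t) = r s * r t" and n: "n \<ge> 1"
  shows "(\<Sum>s\<le>n. serre_coeff q n s * r (int s * (int n - 1))) = 0"
proof -
  \<comment> \<open>T m is [n] times the partial sum up to m < n. The remaining term s = n, scaled
    likewise, is - T (n - 1).\<close>
  define T where "T m = (- 1) ^ (n - m) * r (int m * int n) * inverse (qfact q m) * inverse (qfact q (n - 1 - m))" for m
  have r0: "r 0 * r 0 = r 0" using r[of 0 0] by simp
  have rn: "r (int n * t) * r (- t) = r ((int n - 1) * t)" for t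
    by (simp add: r[symmetric] algebra_simps)
  have main: "qint q (int n) * (\<Sum>s\<le>m. serre_coeff q n s * r (int s * (int n - 1))) = T m" if "m < n" for m
    using that
  proof (induction m)
    case 0
    obtain k where k: "n = Suc k" using n by (cases n) auto
    \<comment> \<open>Multiplicativity alone would permit r 0 = 0; the splitting identity at s = 0
      excludes it.\<close>
    have "qint q (int n) = r 0 * qint q (int n)" using split[of 0] by simp
    then have r01: "r 0 = 1" using qint_nz[of "int n"] n by simp
    show ?case using qint_nz[of "int n"] qfact_nz[of k]
      by (simp add: k serre_coeff_def T_def qfact_Suc r01 divide_simps add.commute)
  next
    case (Suc m)
    define s where "s = Suc m"
    obtain k where k: "n = s + Suc k" using Suc.prems unfolding s_def
      by (metis add_Suc_right add_Suc_shift less_iff_Suc_add)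
    have "qint q (int n) * (\<Sum>s\<le>Suc m. serre_coeff q n s * r (int s * (int n - 1))) =
      T m + qint q (int n) * (serre_coeff q n s * r (int s * (int n - 1)))"
      using Suc by (simp add: distrib_left s_def)
    also have "qint q (int n) * (serre_coeff q n s * r (int s * (int n - 1))) =
      (- 1) ^ (n - s) * inverse (qfact q s) * inverse (qfact q (n - s)) *
       ((r (int s) * r (int s * (int n - 1))) * qint q (int n - int s)
       + (r (int s - int n) * r (int s * (int n - 1))) * qint q (int s))"
      by (subst split[of "int s"]) (simp add: serre_coeff_def algebra_simps)
    also have "r (int s) * r (int s * (int n - 1)) = r (int s * int n)"
      by (simp add: r[symmetric] algebra_simps)
    also have "r (int s - int n) * r (int s * (int n - 1)) = r (int m * int n)"
      by (simp add: r[symmetric] s_def algebra_simps)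
    also have "(- 1) ^ (n - s) * inverse (qfact q s) * inverse (qfact q (n - s)) *
       (r (int s * int n) * qint q (int n - int s) + r (int m * int n) * qint q (int s))
       = T s - T m"
    proof -
      have a: "qfact q (n - s) = qfact q k * qint q (int n - int s)"
        by (simp add: k qfact_Suc add.commute)
      have b: "qfact q s = qfact q m * qint q (int s)"
        by (simp add: s_def qfact_Suc add.commute)
      have c: "qint q (int n - int s) \<noteq> 0" "qint q (int s) \<noteq> 0"
        by (rule qint_nz, simp add: k, rule qint_nz, simp add: s_def)
      have t1: "T s = (- 1) ^ (n - s) * r (int s * int n) * inverse (qfact q s) * inverse (qfact q k)"
        by (simp add: T_def k)
      have nm: "n - m = Suc (n - s)" "n - Suc m = n - s" using k s_def by auto
      have t2: "T m = - ((- 1) ^ (n - s)) * r (int m * int n) * inverse (qfact q m) * inverse (qfact q (n - s))"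
        by (simp add: T_def nm)
      show ?thesis unfolding t1 t2 unfolding a b using c qfact_nz[of k] qfact_nz[of m]
        by (simp add: field_simps)
    qed
    finally show ?case by (simp add: s_def)
  qed
  have "(\<Sum>s\<le>n. serre_coeff q n s * r (int s * (int n - 1))) =
     (\<Sum>s\<le>n - 1. serre_coeff q n s * r (int s * (int n - 1))) + serre_coeff q n n * r (int n * (int n - 1))"
    using n by (cases n) auto
  also have "qint q (int n) * \<dots> = 0"
  proof -
    have e: "int n * (int n - 1) = int (n - 1) * int n" using n by (simp add: of_nat_diff)
    obtain k where k: "n = Suc k" using n by (cases n) auto
    have 1: "qint q (int n) * (\<Sum>s\<le>n - 1. serre_coeff q n s * r (int s * (int n - 1))) = T (n - 1)"
      using main[of "n - 1"] n by simp
    have 2: "qint q (int n) * (serre_coeff q n n * r (int n * (int n - 1))) = - T (n - 1)"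
      unfolding e using qint_nz[of "int n"] by (simp add: k T_def serre_coeff_def qfact_Suc divide_simps add.commute)
    show ?thesis using 1 2 by (simp add: distrib_left)
  qed
  finally show ?thesis using qint_nz[of "int n"] n by simp
qed

lemma serre_coeff_sum:
  assumes "n \<ge> 1"
  shows "(\<Sum>s\<le>n. serre_coeff q n s * q powi (int s * (int n - 1))) = 0"
    "(\<Sum>s\<le>n. serre_coeff q n s * q powi (- (int s * (int n - 1)))) = 0"
proof -
  show "(\<Sum>s\<le>n. serre_coeff q n s * q powi (int s * (int n - 1))) = 0"
    by (rule alternating_sum_zero[OF qint_split _ assms]) (simp add: power_int_add)
  have s: "qint q (int n) = q powi (- s) * qint q (int n - s) + q powi (- (s - int n)) * qint q s" for s
    using qint_split'[of "int n" s] by simp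
  show "(\<Sum>s\<le>n. serre_coeff q n s * q powi (- (int s * (int n - 1)))) = 0"
    by (rule alternating_sum_zero[OF s _ assms]) (simp add: power_int_add[symmetric])
qed

end

section \<open>Cartan data of finite type\<close>

text \<open>Induction on the index set by completing the square in the variable k. The form becomes
  a positive multiple of a square plus a positive definite form in the other variables, so a bound
  on the total bounds first the other variables and then n k.\<close>

lemma finite_quadratic_sublevel:
  fixes g :: "'i \<Rightarrow> 'i \<Rightarrow> real" and l :: "'i \<Rightarrow> real"
  assumes "finite I" "\<And>i j. i \<in> I \<Longrightarrow> j \<in> I \<Longrightarrow> g i j = g j i"
    "\<And>c. \<exists>i\<in>I. c i \<noteq> 0 \<Longrightarrow> (\<Sum>i\<in>I. \<Sum>j\<in>I. c i * c j * g i j) > 0"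
  shows "finite {n :: 'i \<Rightarrow> int. (\<forall>i. i \<notin> I \<longrightarrow> n i = 0) \<and>
    (\<Sum>i\<in>I. \<Sum>j\<in>I. of_int (n i) * of_int (n j) * g i j) - (\<Sum>i\<in>I. l i * of_int (n i)) \<le> C}"
  using assms
proof (induction I arbitrary: g l C rule: finite_induct)
  case empty
  have "{n :: 'i \<Rightarrow> int. (\<forall>i. i \<notin> {} \<longrightarrow> n i = 0) \<and>
    (\<Sum>i\<in>{}. \<Sum>j\<in>{}. of_int (n i) * of_int (n j) * g i j) - (\<Sum>i\<in>{}. l i * of_int (n i)) \<le> C}
    \<subseteq> {\<lambda>_. 0}" by auto
  then show ?case by (rule finite_subset) simp
next
  case (insert k J)
  note fin = insert.hyps(1) and k = insert.hyps(2)
  have sym: "g i j = g j i" if "i \<in> insert k J" "j \<in> insert k J" for i j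
    using insert.prems(1) that by blast
  define G where "G = g k k"
  have G: "G > 0"
  proof -
    define c where "c i = (if i = k then 1 else 0 :: real)" for i
    have "(\<Sum>i\<in>insert k J. \<Sum>j\<in>insert k J. c i * c j * g i j) =
        (\<Sum>i\<in>insert k J. if i = k then (\<Sum>j\<in>insert k J. if j = k then g k k else 0) else 0)"
      by (intro sum.cong refl) (auto simp: c_def intro!: sum.neutral sum.cong)
    also have "\<dots> = g k k" using fin by simp
    finally show ?thesis using insert.prems(2)[of c] by (auto simp: G_def c_def)
  qed
  \<comment> \<open>The Schur complement of g k k; l' is the linear part after the same
    substitution.\<close>
  define g' where "g' i j = g i j - g k i * g k j / G" for i j
  define l' where "l' j = l j - l k * g k j / G" for j
  define s where "s c = (\<Sum>j\<in>J. c j * g k j)" for c :: "'i \<Rightarrow> real"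
  have expand: "(\<Sum>i\<in>insert k J. \<Sum>j\<in>insert k J. c i * c j * g i j) =
      G * (c k)\<^sup>2 + 2 * c k * s c + (\<Sum>i\<in>J. \<Sum>j\<in>J. c i * c j * g i j)" for c
  proof -
    have "(\<Sum>i\<in>J. c i * c k * g i k) = c k * s c"
      unfolding s_def sum_distrib_left
      by (rule sum.cong) (use sym in \<open>auto simp: algebra_simps\<close>)
    moreover have "(\<Sum>j\<in>J. c k * c j * g k j) = c k * s c"
      unfolding s_def sum_distrib_left by (rule sum.cong) (auto simp: algebra_simps)
    ultimately show ?thesis using fin k
      by (simp add: sum.distrib G_def power2_eq_square algebra_simps)
  qed
  have s2: "(\<Sum>i\<in>J. \<Sum>j\<in>J. c i * c j * g' i j) =
      (\<Sum>i\<in>J. \<Sum>j\<in>J. c i * c j * g i j) - (s c)\<^sup>2 / G" for c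
    unfolding g'_def s_def power2_eq_square sum_product sum_divide_distrib sum_subtractf[symmetric]
    by (intro sum.cong refl) (simp add: algebra_simps)
  have sq: "(\<Sum>i\<in>insert k J. \<Sum>j\<in>insert k J. c i * c j * g i j) =
      G * (c k + s c / G)\<^sup>2 + (\<Sum>i\<in>J. \<Sum>j\<in>J. c i * c j * g' i j)" for c
    unfolding expand s2 using G by (simp add: power2_eq_square field_simps)
  have pos': "(\<Sum>i\<in>J. \<Sum>j\<in>J. c i * c j * g' i j) > 0" if c: "\<exists>i\<in>J. c i \<noteq> 0" for c
  proof -
    \<comment> \<open>This value of the k-th variable makes the square in \<open>sq\<close> vanish,
      so that positivity of g becomes positivity of g'.\<close>
    define c' where "c' = c(k := - s c / G)"
    have on: "c' j = c j" if "j \<in> J" for j using k that by (auto simp: c'_def)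
    have "s c' = s c" unfolding s_def by (rule sum.cong) (auto simp: on)
    moreover have "c' k = - s c / G" by (simp add: c'_def)
    moreover have "(\<Sum>i\<in>J. \<Sum>j\<in>J. c' i * c' j * g' i j) = (\<Sum>i\<in>J. \<Sum>j\<in>J. c i * c j * g' i j)"
      by (intro sum.cong refl) (auto simp: on)
    moreover have "\<exists>i\<in>insert k J. c' i \<noteq> 0" using c on by force
    ultimately show ?thesis using insert.prems(2)[of c'] sq[of c'] by simp
  qed
  \<comment> \<open>Absorbing the linear term in n k into the square costs the constant (l k)^2 / (4
    G).\<close>
  define C' where "C' = C + (l k)\<^sup>2 / (4 * G)"
  define P where "P n = (\<Sum>i\<in>J. \<Sum>j\<in>J. of_int (n i) * of_int (n j) * g' i j) - (\<Sum>i\<in>J. l' i * of_int (n i))" for n :: "'i \<Rightarrow> int"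
  have fin': "finite {n :: 'i \<Rightarrow> int. (\<forall>i. i \<notin> J \<longrightarrow> n i = 0) \<and> P n \<le> C'}" (is "finite ?F")
    unfolding P_def
    by (rule insert.IH[OF _ pos'])
      (use sym in \<open>auto simp: g'_def algebra_simps\<close>)
  define t where "t n = s (\<lambda>i. of_int (n i)) / G - l k / (2 * G)" for n :: "'i \<Rightarrow> int"
  have val: "(\<Sum>i\<in>insert k J. \<Sum>j\<in>insert k J. of_int (n i) * of_int (n j) * g i j)
      - (\<Sum>i\<in>insert k J. l i * of_int (n i)) = G * (of_int (n k) + t n)\<^sup>2 + P n - (l k)\<^sup>2 / (4 * G)"
    for n :: "'i \<Rightarrow> int"
  proof -
    have "(\<Sum>i\<in>J. l' i * of_int (n i)) = (\<Sum>i\<in>J. l i * of_int (n i)) - l k * s (\<lambda>i. of_int (n i)) / G"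
      unfolding l'_def s_def sum_distrib_left sum_divide_distrib sum_subtractf[symmetric]
      by (intro sum.cong refl) (simp add: algebra_simps)
    moreover have "G * (x + S / G)\<^sup>2 + p - (a * x + L) =
        G * (x + (S / G - a / (2 * G)))\<^sup>2 + (p - (L - a * S / G)) - a\<^sup>2 / (4 * G)" for x S p a L :: real
      using G by (simp add: power2_eq_square field_simps)
    ultimately show ?thesis using fin k unfolding sq P_def t_def by simp
  qed
  \<comment> \<open>A solution is determined by its restriction to J and by the integer n k, which
    the square confines to an interval. The estimate |x| \<le> 1 + x^2 takes the place of a square
    root.\<close>
  have "{n :: 'i \<Rightarrow> int. (\<forall>i. i \<notin> insert k J \<longrightarrow> n i = 0) \<and>
    (\<Sum>i\<in>insert k J. \<Sum>j\<in>insert k J. of_int (n i) * of_int (n j) * g i j) - (\<Sum>i\<in>insert k J. l i * of_int (n i)) \<le> C}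
    \<subseteq> (\<Union>n'\<in>?F. (\<lambda>z. n'(k := z)) ` {z. \<bar>of_int z + t n'\<bar> \<le> 1 + (C' - P n') / G})" (is "?L \<subseteq> _")
  proof
    fix n assume n: "n \<in> ?L"
    define n' where "n' = n(k := 0)"
    have on: "n' j = n j" if "j \<in> J" for j using k that by (auto simp: n'_def)
    have Pn: "P n' = P n" unfolding P_def using on by simp
    have tn: "t n' = t n" unfolding t_def s_def using on by simp
    have le: "G * (of_int (n k) + t n)\<^sup>2 \<le> C' - P n" using n unfolding mem_Collect_eq val C'_def by linarith
    have "0 \<le> G * (of_int (n k) + t n)\<^sup>2" using G by simp
    then have "n' \<in> ?F" using n le Pn by (auto simp: n'_def)
    moreover have "\<bar>of_int (n k) + t n'\<bar> \<le> 1 + (C' - P n') / G"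
    proof -
      have "(of_int (n k) + t n)\<^sup>2 \<le> (C' - P n) / G" using le G by (simp add: field_simps)
      moreover have "\<bar>x\<bar> \<le> 1 + x\<^sup>2" for x :: real
      proof -
        have "0 \<le> (\<bar>x\<bar> - 1/2)\<^sup>2" by simp
        then show ?thesis by (simp add: power2_eq_square field_simps)
      qed
      ultimately show ?thesis unfolding Pn tn by (smt (verit))
    qed
    moreover have "n = n'(k := n k)" by (simp add: n'_def)
    ultimately show "n \<in> (\<Union>n'\<in>?F. (\<lambda>z. n'(k := z)) ` {z. \<bar>of_int z + t n'\<bar> \<le> 1 + (C' - P n') / G})"
      by blast
  qed
  note subset = this
  have fz: "finite {z :: int. \<bar>of_int z + t n'\<bar> \<le> r}" for n' r
  proof (rule finite_subset)
    show "{z :: int. \<bar>of_int z + t n'\<bar> \<le> r} \<subseteq> {\<lceil>- r - t n'\<rceil>..\<lfloor>r - t n'\<rfloor>}"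
      by (auto simp: ceiling_le_iff le_floor_iff)
  qed simp
  show ?case by (rule finite_subset[OF subset finite_UN_I[OF fin' finite_imageI[OF fz]]])
qed

locale finite_cartan =
  fixes I :: "'i set" and fm :: "'i \<Rightarrow> 'i \<Rightarrow> int"
  assumes cartan: "cartan_datum I fm" and pos_def: "pos_def_on I fm"
begin

definition ca :: "'i \<Rightarrow> 'i \<Rightarrow> int" where "ca i j = 2 * fm i j div fm i i"
definition qi :: "'i \<Rightarrow> qv" where "qi i = v powi (fm i i div 2)"

lemma finite_I[simp]: "finite I" using cartan by (simp add: cartan_datum_def)
lemma fm_sym: "i \<in> I \<Longrightarrow> j \<in> I \<Longrightarrow> fm i j = fm j i" using cartan by (simp add: cartan_datum_def)
lemma fm_pos: "i \<in> I \<Longrightarrow> fm i i > 0" using cartan by (simp add: cartan_datum_def)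
lemma fm_even: "i \<in> I \<Longrightarrow> even (fm i i)" using cartan by (simp add: cartan_datum_def)

lemma fm_ca: "i \<in> I \<Longrightarrow> j \<in> I \<Longrightarrow> fm i i * ca i j = 2 * fm i j"
  using cartan unfolding cartan_datum_def ca_def
  by (cases "i = j") (auto simp: dvd_mult_div_cancel)

lemma ca_diag[simp]: "i \<in> I \<Longrightarrow> ca i i = 2"
  using fm_pos[of i] by (simp add: ca_def)

lemma ca_nonpos: assumes "i \<in> I" "j \<in> I" "i \<noteq> j" shows "ca i j \<le> 0"
proof (rule ccontr)
  assume "\<not> ca i j \<le> 0"
  then have "fm i i * ca i j > 0" using fm_pos[of i] assms by simp
  then show False using fm_ca[of i j] assms cartan unfolding cartan_datum_def by force
qed

text \<open>Both sides are v^(i, j), and the form is symmetric.\<close>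

lemma qi_ca: assumes "i \<in> I" "j \<in> I" shows "qi i powi ca i j = qi j powi ca j i"
proof -
  have "fm i i div 2 * ca i j = fm i j" if "i \<in> I" "j \<in> I" for i j
    using fm_ca[OF that] fm_even[OF that(1)] by auto
  then show ?thesis using fm_sym[OF assms] assms unfolding qi_def
    by (simp add: power_int_mult[symmetric])
qed

lemma qparam: assumes "i \<in> I" shows "quantum_parameter (qi i)"
  unfolding qi_def using fm_pos[OF assms] fm_even[OF assms]
  by (intro quantum_parameter.intro non_root_of_unity_powi non_root_of_unity_v) auto

text \<open>Let \<lambda> be a weight with coordinates b_i at the coroots and \<nu> = \<Sum> n_i
  \<alpha>_i. Then this is |\<lambda> - \<nu>|^2 - |\<lambda>|^2 for the invariant form, written so
  that no form on X is required; \<open>wgt b n\<close> gives the coordinates of \<lambda> -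
  \<nu>.\<close>

definition Qf :: "('i \<Rightarrow> int) \<Rightarrow> ('i \<Rightarrow> int) \<Rightarrow> int" where
  "Qf b n = (\<Sum>i\<in>I. \<Sum>j\<in>I. n i * n j * fm i j) - (\<Sum>i\<in>I. n i * fm i i * b i)"

definition wgt :: "('i \<Rightarrow> int) \<Rightarrow> ('i \<Rightarrow> int) \<Rightarrow> 'i \<Rightarrow> int" where
  "wgt b n i = b i - (\<Sum>j\<in>I. n j * ca i j)"

text \<open>Adding \<open>wgt b n i\<close> to n_i is the simple reflection s_i applied to \<lambda>
  - \<nu>, and reflections preserve the norm.\<close>

lemma Qf_reflect:
  assumes i: "i \<in> I"
  shows "Qf b (n(i := n i + wgt b n i)) = Qf b n"
proof -
  define m where "m = wgt b n i"
  define e where "e j = (if j = i then m else 0)" for j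
  have n': "n(i := n i + m) = (\<lambda>j. n j + e j)" by (auto simp: e_def)
  have s1: "(\<Sum>j\<in>I. \<Sum>k\<in>I. n j * e k * fm j k) = m * (\<Sum>j\<in>I. n j * fm i j)"
  proof -
    have "(\<Sum>k\<in>I. n j * e k * fm j k) = m * (n j * fm i j)" if "j \<in> I" for j
    proof -
      have "(\<Sum>k\<in>I. n j * e k * fm j k) = (\<Sum>k\<in>I. if k = i then m * (n j * fm i j) else 0)"
        using fm_sym[OF that] by (intro sum.cong refl) (auto simp: e_def)
      then show ?thesis using i by simp
    qed
    then show ?thesis by (simp add: sum_distrib_left)
  qed
  have s2: "(\<Sum>j\<in>I. \<Sum>k\<in>I. e j * n k * fm j k) = m * (\<Sum>j\<in>I. n j * fm i j)"
  proof -
    have "(\<Sum>j\<in>I. \<Sum>k\<in>I. e j * n k * fm j k) = (\<Sum>j\<in>I. if j = i then \<Sum>k\<in>I. m * (n k * fm i k) else 0)"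
      by (intro sum.cong refl) (auto simp: e_def mult.assoc)
    then show ?thesis using i by (simp add: sum_distrib_left)
  qed
  have s3: "(\<Sum>j\<in>I. \<Sum>k\<in>I. e j * e k * fm j k) = m * m * fm i i"
  proof -
    have "(\<Sum>j\<in>I. \<Sum>k\<in>I. e j * e k * fm j k) =
        (\<Sum>j\<in>I. if j = i then \<Sum>k\<in>I. if k = i then m * m * fm i i else 0 else 0)"
    proof (intro sum.cong refl)
      fix j assume "j \<in> I"
      have "(\<Sum>k\<in>I. e j * e k * fm j k) = (\<Sum>k\<in>I. if j = i then if k = i then m * m * fm i i else 0 else 0)"
        by (intro sum.cong refl) (auto simp: e_def)
      then show "(\<Sum>k\<in>I. e j * e k * fm j k) = (if j = i then \<Sum>k\<in>I. if k = i then m * m * fm i i else 0 else 0)"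
        by simp
    qed
    also have "\<dots> = m * m * fm i i" using i by simp
    finally show ?thesis .
  qed
  have s4: "(\<Sum>j\<in>I. e j * fm j j * b j) = m * fm i i * b i"
  proof -
    have "(\<Sum>j\<in>I. e j * fm j j * b j) = (\<Sum>j\<in>I. if j = i then m * fm i i * b i else 0)"
      by (intro sum.cong refl) (auto simp: e_def)
    then show ?thesis using i by simp
  qed
  have s5: "2 * (\<Sum>j\<in>I. n j * fm i j) = fm i i * (\<Sum>j\<in>I. n j * ca i j)"
    unfolding sum_distrib_left by (intro sum.cong refl) (use fm_ca[OF i] in \<open>simp add: algebra_simps\<close>)
  have t: "(\<Sum>j\<in>I. \<Sum>k\<in>I. (n j + e j) * (n k + e k) * fm j k) =
      (\<Sum>j\<in>I. \<Sum>k\<in>I. n j * n k * fm j k) + (\<Sum>j\<in>I. \<Sum>k\<in>I. n j * e k * fm j k)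
      + (\<Sum>j\<in>I. \<Sum>k\<in>I. e j * n k * fm j k) + (\<Sum>j\<in>I. \<Sum>k\<in>I. e j * e k * fm j k)"
    by (simp only: sum.distrib[symmetric]) (intro sum.cong refl, simp only: distrib_left distrib_right add_ac)
  have t': "(\<Sum>j\<in>I. (n j + e j) * fm j j * b j) = (\<Sum>j\<in>I. n j * fm j j * b j) + (\<Sum>j\<in>I. e j * fm j j * b j)"
    by (simp only: sum.distrib[symmetric] distrib_right)
  have "Qf b (\<lambda>j. n j + e j) = Qf b n + m * (2 * (\<Sum>j\<in>I. n j * fm i j)) + m * m * fm i i - m * fm i i * b i"
    unfolding Qf_def t t' s1 s2 s3 s4 by simp
  also have "\<dots> = Qf b n + m * fm i i * (m - wgt b n i)" unfolding s5 wgt_def by (simp add: algebra_simps)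
  finally show ?thesis unfolding n'[symmetric] m_def by simp
qed

text \<open>The negative of \<open>Qf b n\<close> is (\<nu>, \<lambda>) + (\<nu>, \<lambda> -
  \<nu>), and both terms are nonnegative when \<lambda> and \<lambda> - \<nu> are dominant and \<nu>
  is a nonnegative combination of simple roots.\<close>

lemma Qf_dominant:
  assumes "\<And>i. i \<in> I \<Longrightarrow> n i \<ge> 0" "\<And>i. i \<in> I \<Longrightarrow> b i \<ge> 0" "\<And>i. i \<in> I \<Longrightarrow> wgt b n i \<ge> 0"
  shows "Qf b n \<le> 0"
proof -
  have "2 * (\<Sum>i\<in>I. \<Sum>j\<in>I. n i * n j * fm i j) = (\<Sum>i\<in>I. n i * fm i i * (\<Sum>j\<in>I. n j * ca i j))"
    unfolding sum_distrib_left
    by (intro sum.cong refl) (use fm_ca in \<open>simp add: algebra_simps\<close>)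
  also have "\<dots> \<le> (\<Sum>i\<in>I. n i * fm i i * b i)"
    by (intro sum_mono mult_left_mono) (use assms fm_pos in \<open>auto simp: wgt_def less_imp_le\<close>)
  finally have 1: "2 * (\<Sum>i\<in>I. \<Sum>j\<in>I. n i * n j * fm i j) \<le> (\<Sum>i\<in>I. n i * fm i i * b i)" .
  have "(\<Sum>i\<in>I. n i * fm i i * b i) \<ge> 0"
    by (intro sum_nonneg mult_nonneg_nonneg) (use assms fm_pos in \<open>auto simp: less_imp_le\<close>)
  then show ?thesis using 1 unfolding Qf_def by linarith
qed

lemma finite_Qf: "finite {n. (\<forall>i. i \<notin> I \<longrightarrow> n i = 0) \<and> Qf b n \<le> C}"
proof -
  have eq: "Qf b n \<le> C \<longleftrightarrow> (\<Sum>i\<in>I. \<Sum>j\<in>I. real_of_int (n i) * of_int (n j) * of_int (fm i j))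
    - (\<Sum>i\<in>I. of_int (fm i i * b i) * of_int (n i)) \<le> of_int C" for n
  proof -
    have "real_of_int (Qf b n) = (\<Sum>i\<in>I. \<Sum>j\<in>I. real_of_int (n i) * of_int (n j) * of_int (fm i j))
      - (\<Sum>i\<in>I. of_int (n i) * of_int (fm i i) * of_int (b i))"
      unfolding Qf_def by simp
    also have "(\<Sum>i\<in>I. real_of_int (n i) * of_int (fm i i) * of_int (b i)) =
      (\<Sum>i\<in>I. of_int (fm i i * b i) * of_int (n i))"
      by (intro sum.cong refl) (simp add: mult_ac)
    finally show ?thesis by (metis of_int_le_iff)
  qed
  show ?thesis unfolding eq
    by (rule finite_quadratic_sublevel)
      (use pos_def fm_sym in \<open>auto simp: pos_def_on_def\<close>)
qed

text \<open>A vector killed by the Cartan matrix has norm zero for a positive definite form.\<close>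

lemma ca_inj:
  assumes "\<And>i. i \<in> I \<Longrightarrow> (\<Sum>j\<in>I. n j * ca i j) = 0" "i \<in> I"
  shows "n i = (0::int)"
proof (rule ccontr)
  assume "n i \<noteq> 0"
  then have "(\<Sum>i\<in>I. \<Sum>j\<in>I. real_of_int (n i) * real_of_int (n j) * of_int (fm i j)) > 0"
    using pos_def[unfolded pos_def_on_def, rule_format, of "\<lambda>i. of_int (n i)"] assms(2) by auto
  then have "0 < real_of_int (\<Sum>i\<in>I. \<Sum>j\<in>I. n i * n j * fm i j)" by (simp only: of_int_sum of_int_mult)
  then have pos: "0 < (\<Sum>i\<in>I. \<Sum>j\<in>I. n i * n j * fm i j)" by (simp only: of_int_0_less_iff)
  have "2 * (\<Sum>i\<in>I. \<Sum>j\<in>I. n i * n j * fm i j) = (\<Sum>i\<in>I. n i * fm i i * (\<Sum>j\<in>I. n j * ca i j))"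
    unfolding sum_distrib_left
    by (intro sum.cong refl) (use fm_ca in \<open>simp add: algebra_simps\<close>)
  also have "\<dots> = 0" by (intro sum.neutral ballI) (simp only: assms(1) mult_zero_right)
  finally show False using pos by simp
qed

end

section \<open>Linear algebra on finitely supported functions\<close>

definition sc :: "qv \<Rightarrow> ('w \<Rightarrow>\<^sub>0 qv) \<Rightarrow> ('w \<Rightarrow>\<^sub>0 qv)" where
  "sc c p = Poly_Mapping.map ((*) c) p"

lemma lookup_sc[simp]: "Poly_Mapping.lookup (sc c p) w = c * Poly_Mapping.lookup p w"
  by (simp add: sc_def Poly_Mapping.map.rep_eq when_def)

interpretation pm: vector_space "sc :: qv \<Rightarrow> ('w \<Rightarrow>\<^sub>0 qv) \<Rightarrow> ('w \<Rightarrow>\<^sub>0 qv)"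
  by unfold_locales (auto intro!: poly_mapping_eqI simp: lookup_add algebra_simps)

abbreviation bs :: "'w \<Rightarrow> ('w \<Rightarrow>\<^sub>0 qv)" where "bs w \<equiv> Poly_Mapping.single w 1"

lemma sc_single[simp]: "sc c (Poly_Mapping.single w d) = Poly_Mapping.single w (c * d)"
  by (rule poly_mapping_eqI) (simp add: lookup_single when_def)

lemma keys_sc: "Poly_Mapping.keys (sc c p) \<subseteq> Poly_Mapping.keys p"
  by (auto simp: in_keys_iff)

lemma pm_expand: "p = (\<Sum>w\<in>Poly_Mapping.keys p. sc (Poly_Mapping.lookup p w) (bs w))"
  by (rule poly_mapping_eqI) (simp add: lookup_sum lookup_single when_def in_keys_iff)

definition lin :: "(('w \<Rightarrow>\<^sub>0 qv) \<Rightarrow> ('u \<Rightarrow>\<^sub>0 qv)) \<Rightarrow> bool" where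
  "lin f \<longleftrightarrow> (\<forall>x y. f (x + y) = f x + f y) \<and> (\<forall>c x. f (sc c x) = sc c (f x))"

definition lx :: "('w \<Rightarrow> ('u \<Rightarrow>\<^sub>0 qv)) \<Rightarrow> ('w \<Rightarrow>\<^sub>0 qv) \<Rightarrow> ('u \<Rightarrow>\<^sub>0 qv)" where
  "lx \<phi> p = (\<Sum>w\<in>Poly_Mapping.keys p. sc (Poly_Mapping.lookup p w) (\<phi> w))"

lemma lin_add: "lin f \<Longrightarrow> f (x + y) = f x + f y" and lin_sc: "lin f \<Longrightarrow> f (sc c x) = sc c (f x)"
  by (simp_all add: lin_def)

lemma lin_0: "lin f \<Longrightarrow> f 0 = 0" using lin_sc[of f 0 0] by simp
lemma lin_diff: "lin f \<Longrightarrow> f (x - y) = f x - f y"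
  using lin_add[of f "x - y" y] by (simp add: algebra_simps)
lemma lin_minus: "lin f \<Longrightarrow> f (- x) = - f x" using lin_diff[of f 0 x] lin_0 by fastforce
lemma lin_sum: "lin f \<Longrightarrow> f (\<Sum>a\<in>A. g a) = (\<Sum>a\<in>A. f (g a))"
  by (induction A rule: infinite_finite_induct) (auto simp: lin_0 lin_add)
lemma lin_pow: "lin (f :: ('w \<Rightarrow>\<^sub>0 qv) \<Rightarrow> ('w \<Rightarrow>\<^sub>0 qv)) \<Longrightarrow> lin (f ^^ n)" by (induction n) (auto simp: lin_def)
lemma lin_comp: "lin f \<Longrightarrow> lin g \<Longrightarrow> lin (\<lambda>x. f (g x))" by (auto simp: lin_def)
lemma lin_plus: "lin f \<Longrightarrow> lin g \<Longrightarrow> lin (\<lambda>x. f x + g x)"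
  by (auto simp: lin_def pm.scale_right_distrib)
lemma lin_minus2: "lin f \<Longrightarrow> lin g \<Longrightarrow> lin (\<lambda>x. f x - g x)"
  by (auto simp: lin_def pm.scale_right_diff_distrib)
lemma lin_scale: "lin f \<Longrightarrow> lin (\<lambda>x. sc c (f x))"
  by (auto simp: lin_def pm.scale_right_distrib mult.commute)
lemma lin_zero: "lin (\<lambda>x. 0)" by (auto simp: lin_def)
lemma lin_id: "lin (\<lambda>x. x)" by (auto simp: lin_def)
lemma lin_sums: "(\<And>a. a \<in> A \<Longrightarrow> lin (g a)) \<Longrightarrow> lin (\<lambda>x. \<Sum>a\<in>A. g a x)"
  by (induction A rule: infinite_finite_induct) (auto simp: lin_zero intro!: lin_plus)

lemma lx_superset:
  assumes "finite S" "Poly_Mapping.keys p \<subseteq> S"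
  shows "lx \<phi> p = (\<Sum>w\<in>S. sc (Poly_Mapping.lookup p w) (\<phi> w))"
  unfolding lx_def using assms
  by (intro sum.mono_neutral_left) (auto simp: in_keys_iff)

lemma lin_lx[simp]: "lin (lx \<phi>)"
  unfolding lin_def
proof (intro conjI allI)
  fix x y :: "'a \<Rightarrow>\<^sub>0 qv"
  let ?S = "Poly_Mapping.keys x \<union> Poly_Mapping.keys y"
  have k: "Poly_Mapping.keys (x + y) \<subseteq> ?S" by (rule keys_add)
  show "lx \<phi> (x + y) = lx \<phi> x + lx \<phi> y"
    by (simp add: lx_superset[OF _ k] lx_superset[of ?S x] lx_superset[of ?S y] lookup_add
        pm.scale_left_distrib sum.distrib)
next
  fix c and x :: "'a \<Rightarrow>\<^sub>0 qv"
  show "lx \<phi> (sc c x) = sc c (lx \<phi> x)"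
    by (simp add: lx_superset[OF _ keys_sc, of x] lx_superset[of "Poly_Mapping.keys x" x] pm.scale_sum_right)
qed

lemma lx_single[simp]: "lx \<phi> (Poly_Mapping.single w c) = sc c (\<phi> w)"
  by (simp add: lx_def)

lemmas lx_add = lin_add[OF lin_lx] and lx_sc = lin_sc[OF lin_lx] and lx_0 = lin_0[OF lin_lx]
  and lx_sum = lin_sum[OF lin_lx]

text \<open>Agreement is asked only on the basis vectors that occur in p. This is how identities
  that hold on a single weight space are proved.\<close>

lemma lin_eqI:
  assumes "lin f" "lin g" "\<And>w. w \<in> Poly_Mapping.keys p \<Longrightarrow> f (bs w) = g (bs w)"
  shows "f p = g p"
proof -
  have "f p = f (\<Sum>w\<in>Poly_Mapping.keys p. sc (Poly_Mapping.lookup p w) (bs w))" using pm_expand by metis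
  also have "\<dots> = g (\<Sum>w\<in>Poly_Mapping.keys p. sc (Poly_Mapping.lookup p w) (bs w))"
    unfolding lin_sum[OF assms(1)] lin_sum[OF assms(2)] lin_sc[OF assms(1)] lin_sc[OF assms(2)]
    using assms(3) by simp
  also have "\<dots> = g p" using pm_expand by metis
  finally show ?thesis .
qed

lemma lin_lx_apply: "lin f \<Longrightarrow> f (lx \<phi> p) = lx (\<lambda>w. f (\<phi> w)) p"
  by (rule lin_eqI[OF lin_comp[OF _ lin_lx] lin_lx]) (simp_all add: lin_sc)

lemma subspace_lin:
  assumes "lin f" "pm.subspace S" "\<And>w. w \<in> Poly_Mapping.keys p \<Longrightarrow> f (bs w) \<in> S"
  shows "f p \<in> S"
proof -
  have "f p = f (\<Sum>w\<in>Poly_Mapping.keys p. sc (Poly_Mapping.lookup p w) (bs w))" using pm_expand by metis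
  also have "\<dots> \<in> S" unfolding lin_sum[OF assms(1)] lin_sc[OF assms(1)]
    using assms(2,3) by (intro pm.subspace_sum pm.subspace_scale)
  finally show ?thesis .
qed

lemma keys_lx: "w' \<in> Poly_Mapping.keys (lx \<phi> p) \<Longrightarrow> \<exists>w\<in>Poly_Mapping.keys p. w' \<in> Poly_Mapping.keys (\<phi> w)"
proof (rule ccontr)
  assume a: "w' \<in> Poly_Mapping.keys (lx \<phi> p)" "\<not> (\<exists>w\<in>Poly_Mapping.keys p. w' \<in> Poly_Mapping.keys (\<phi> w))"
  then have "Poly_Mapping.lookup (lx \<phi> p) w' = 0"
    unfolding lx_def by (auto simp: lookup_sum in_keys_iff intro!: sum.neutral)
  then show False using a by (simp add: in_keys_iff)
qed

section \<open>Weight representations\<close>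

text \<open>\<open>E\<^sub>i\<close> and \<open>F\<^sub>i\<close> acting on the space with basis \<open>'w\<close>, the basis vector \<open>w\<close> having weight \<open>wt w\<close>.\<close>

locale wrep = finite_cartan I fm for I :: "'i set" and fm +
  fixes wt :: "'w \<Rightarrow> 'i \<Rightarrow> int" and e f :: "'i \<Rightarrow> 'w \<Rightarrow> ('w \<Rightarrow>\<^sub>0 qv)"
  assumes e_wt: "\<And>i k w w'. i \<in> I \<Longrightarrow> k \<in> I \<Longrightarrow> w' \<in> Poly_Mapping.keys (e i w) \<Longrightarrow> wt w' k = wt w k + ca k i"
    and f_wt: "\<And>i k w w'. i \<in> I \<Longrightarrow> k \<in> I \<Longrightarrow> w' \<in> Poly_Mapping.keys (f i w) \<Longrightarrow> wt w' k = wt w k - ca k i"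
    and comm: "\<And>i j w. i \<in> I \<Longrightarrow> j \<in> I \<Longrightarrow>
      lx (e i) (f j w) = lx (f j) (e i w) + (if i = j then sc (qint (qi i) (wt w i)) (bs w) else 0)"
begin

abbreviation "EE i \<equiv> lx (e i)"
abbreviation "FF i \<equiv> lx (f i)"

definition hom :: "('i \<Rightarrow> int) \<Rightarrow> ('w \<Rightarrow>\<^sub>0 qv) \<Rightarrow> bool" where
  "hom m x \<longleftrightarrow> (\<forall>w\<in>Poly_Mapping.keys x. \<forall>k\<in>I. wt w k = m k)"

lemmas Fpow_add = lin_add[OF lin_pow[OF lin_lx]] and Fpow_sc = lin_sc[OF lin_pow[OF lin_lx]]

lemma hom_F: "hom m x \<Longrightarrow> i \<in> I \<Longrightarrow> hom (\<lambda>k. m k - ca k i) (FF i x)"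
  unfolding hom_def using f_wt keys_lx[of _ "f i" x] by fastforce

lemma hom_bs: "hom (wt w) (bs w)" by (simp add: hom_def)

lemma hom_F_pow: "hom m x \<Longrightarrow> i \<in> I \<Longrightarrow> hom (\<lambda>k. m k - int n * ca k i) ((FF i ^^ n) x)"
proof (induction n)
  case (Suc n)
  then show ?case using hom_F[of "\<lambda>k. m k - int n * ca k i" "(FF i ^^ n) x" i]
    by (simp add: algebra_simps)
qed simp

lemma comm_hom:
  assumes "i \<in> I" "j \<in> I" "hom m x"
  shows "EE i (FF j x) = FF j (EE i x) + (if i = j then sc (qint (qi i) (m i)) x else 0)"
proof (rule lin_eqI[where f = "\<lambda>x. EE i (FF j x)"
      and g = "\<lambda>x. FF j (EE i x) + (if i = j then sc (qint (qi i) (m i)) x else 0)"])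
  show "lin (\<lambda>x. EE i (FF j x))" by (rule lin_comp[OF lin_lx lin_lx])
  show "lin (\<lambda>x. FF j (EE i x) + (if i = j then sc (qint (qi i) (m i)) x else 0))"
    by (cases "i = j") (simp_all add: lin_plus lin_comp[OF lin_lx lin_lx] lin_scale lin_id)
qed (use assms in \<open>simp add: comm hom_def\<close>)

lemma comm_ne:
  assumes "i \<in> I" "j \<in> I" "i \<noteq> j"
  shows "EE i (FF j x) = FF j (EE i x)"
  by (rule lin_eqI[where f = "\<lambda>x. EE i (FF j x)" and g = "\<lambda>x. FF j (EE i x)"])
    (use assms in \<open>simp_all add: comm lin_comp[OF lin_lx lin_lx]\<close>)

lemma comm_ne_pow:
  assumes "i \<in> I" "j \<in> I" "i \<noteq> j"
  shows "EE i ((FF j ^^ n) x) = (FF j ^^ n) (EE i x)"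
  by (induction n) (auto simp: comm_ne[OF assms])

text \<open>The rank one computation: the commutators met along F_i^n add up by
  \<open>qint_step\<close>. At n = 0 the coefficient contains [0] = 0, so the truncated
  \<open>n - 1\<close> is harmless.\<close>

lemma E_F_pow:
  assumes i: "i \<in> I" and h: "hom m x"
  shows "EE i ((FF i ^^ n) x) =
    (FF i ^^ n) (EE i x) + sc (qint (qi i) (int n) * qint (qi i) (m i - int n + 1)) ((FF i ^^ (n - 1)) x)"
proof (induction n)
  case 0
  interpret quantum_parameter "qi i" by (rule qparam[OF i])
  show ?case by simp
next
  case (Suc n)
  interpret quantum_parameter "qi i" by (rule qparam[OF i])
  have "EE i ((FF i ^^ Suc n) x) = FF i (EE i ((FF i ^^ n) x)) + sc (qint (qi i) (m i - 2 * int n)) ((FF i ^^ n) x)"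
    using comm_hom[OF i i hom_F_pow[OF h i, of n]] i by (simp add: algebra_simps)
  also have "FF i (EE i ((FF i ^^ n) x)) = (FF i ^^ Suc n) (EE i x)
      + sc (qint (qi i) (int n) * qint (qi i) (m i - int n + 1)) ((FF i ^^ n) x)"
    unfolding Suc.IH lx_add lx_sc by (cases n) auto
  also have "\<dots> + sc (qint (qi i) (m i - 2 * int n)) ((FF i ^^ n) x) = (FF i ^^ Suc n) (EE i x) +
      sc (qint (qi i) (int n) * qint (qi i) (m i - int n + 1) + qint (qi i) (m i - 2 * int n)) ((FF i ^^ n) x)"
    by (simp add: pm.scale_left_distrib)
  finally show ?case unfolding qint_step by (simp add: algebra_simps)
qed

definition serreF :: "'i \<Rightarrow> 'i \<Rightarrow> ('w \<Rightarrow>\<^sub>0 qv) \<Rightarrow> ('w \<Rightarrow>\<^sub>0 qv)" where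
  "serreF i j x = (\<Sum>s\<le>nat (1 - ca i j). sc (serre_coeff (qi i) (nat (1 - ca i j)) s)
     ((FF i ^^ s) (FF j ((FF i ^^ (nat (1 - ca i j) - s)) x))))"

lemma lin_serreF: "lin (serreF i j)"
  unfolding serreF_def by (intro lin_sums lin_scale lin_comp[OF lin_pow[OF lin_lx]] lin_comp[OF lin_lx] lin_pow lin_lx)

text \<open>Passing E_k through the Serre element leaves an error, which can be nonzero only for k =
  j and k = i. For k = j it is a multiple of F_i^n x whose scalar vanishes by
  \<open>serre_coeff_sum\<close>. For k = i the errors from the two blocks of F_i around F_j
  telescope.\<close>

lemma serre_commute_hom:
  assumes i: "i \<in> I" and j: "j \<in> I" and ij: "i \<noteq> j" and k: "k \<in> I" and h: "hom m x"
  shows "EE k (serreF i j x) = serreF i j (EE k x)"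
proof -
  interpret quantum_parameter "qi i" by (rule qparam[OF i])
  define n where "n = nat (1 - ca i j)"
  have n: "int n = 1 - ca i j" "n \<ge> 1" using ca_nonpos[OF i j ij] by (auto simp: n_def)
  define c where "c = serre_coeff (qi i) n"
  have S: "serreF i j x = (\<Sum>s\<le>n. sc (c s) ((FF i ^^ s) (FF j ((FF i ^^ (n - s)) x))))" for x
    by (simp add: serreF_def n_def c_def)
  have ES: "EE k (serreF i j x) = (\<Sum>s\<le>n. sc (c s) (EE k ((FF i ^^ s) (FF j ((FF i ^^ (n - s)) x)))))"
    by (simp add: S lx_sum lx_sc)
  consider "k \<noteq> i" "k \<noteq> j" | "k = j" | "k = i" by blast
  then show ?thesis
  proof cases
    case 1
    then show ?thesis unfolding ES unfolding S by (simp add: comm_ne_pow i j k comm_ne)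
  next
    case 2
    have t: "EE j ((FF i ^^ s) (FF j ((FF i ^^ (n - s)) x))) = (FF i ^^ s) (FF j ((FF i ^^ (n - s)) (EE j x)))
      + sc (qint (qi j) (m j - int (n - s) * ca j i)) ((FF i ^^ n) x)" if "s \<le> n" for s
    proof -
      have "EE j ((FF i ^^ s) (FF j ((FF i ^^ (n - s)) x))) = (FF i ^^ s) (EE j (FF j ((FF i ^^ (n - s)) x)))"
        using comm_ne_pow[OF j i ij[symmetric]] by simp
      also have "EE j (FF j ((FF i ^^ (n - s)) x)) = FF j (EE j ((FF i ^^ (n - s)) x)) +
         sc (qint (qi j) (m j - int (n - s) * ca j i)) ((FF i ^^ (n - s)) x)"
        using comm_hom[OF j j hom_F_pow[OF h i, of "n - s"]] by simp
      also have "EE j ((FF i ^^ (n - s)) x) = (FF i ^^ (n - s)) (EE j x)" using comm_ne_pow[OF j i ij[symmetric]] by simp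
      also have "(FF i ^^ s) (FF j ((FF i ^^ (n - s)) (EE j x)) +
         sc (qint (qi j) (m j - int (n - s) * ca j i)) ((FF i ^^ (n - s)) x)) =
        (FF i ^^ s) (FF j ((FF i ^^ (n - s)) (EE j x))) + sc (qint (qi j) (m j - int (n - s) * ca j i)) ((FF i ^^ s) ((FF i ^^ (n - s)) x))"
        unfolding Fpow_add Fpow_sc ..
      also have "(FF i ^^ s) ((FF i ^^ (n - s)) x) = (FF i ^^ n) x"
        using that by (simp flip: funpow_add comp_apply[of "FF i ^^ s" "FF i ^^ (n - s)"])
      finally show ?thesis .
    qed
    \<comment> \<open>Each quantum integer is a difference of two exponentials in s. By
      \<open>qi_ca\<close> these are powers of q_i with exponents plus and minus s (n - 1), and both
      alternating sums vanish.\<close>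
    have "(\<Sum>s\<le>n. c s * qint (qi j) (m j - int (n - s) * ca j i)) = 0"
    proof -
      interpret j: quantum_parameter "qi j" by (rule qparam[OF j])
      define A where "A = qi j powi (m j - int n * ca j i)"
      define D where "D = qi j - inverse (qi j)"
      have p: "qi j powi (int s * ca j i) = qi i powi (- (int s * (int n - 1)))" for s
      proof -
        have "qi j powi (ca j i * int s) = (qi j powi ca j i) powi int s" by (rule power_int_mult)
        also have "\<dots> = (qi i powi ca i j) powi int s" by (simp only: qi_ca[OF i j])
        also have "\<dots> = qi i powi (ca i j * int s)" by (rule power_int_mult[symmetric])
        also have "ca i j * int s = - (int s * (int n - 1))" unfolding n(1) by (simp add: algebra_simps)
        finally show ?thesis by (simp only: mult.commute)
      qed
      have p': "qi j powi (- (int s * ca j i)) = qi i powi (int s * (int n - 1))" for s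
        using p[of s] by (metis power_int_minus inverse_inverse_eq)
      have "c s * qint (qi j) (m j - int (n - s) * ca j i) =
        (A / D) * (c s * qi i powi (- (int s * (int n - 1)))) - (inverse A / D) * (c s * qi i powi (int s * (int n - 1)))"
        if "s \<le> n" for s
      proof -
        have a: "m j - int (n - s) * ca j i = (m j - int n * ca j i) + int s * ca j i"
          using that by (simp add: of_nat_diff algebra_simps)
        have b: "- ((m j - int n * ca j i) + int s * ca j i) = - (m j - int n * ca j i) + - (int s * ca j i)" by simp
        have "qint (qi j) (m j - int (n - s) * ca j i) = (A * qi i powi (- (int s * (int n - 1))) - inverse A * qi i powi (int s * (int n - 1))) / D"
          unfolding a qint_def b power_int_add[OF disjI1[OF j.q_nz]] p p' A_def D_def power_int_minus
          by (simp only: inverse_inverse_eq)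
        moreover have "x * ((A * y - B * z) / D) = (A / D) * (x * y) - (B / D) * (x * z)" for x y z B :: qv
          by (simp add: diff_divide_distrib right_diff_distrib mult.left_commute)
        ultimately show ?thesis by (simp only:)
      qed
      then have "(\<Sum>s\<le>n. c s * qint (qi j) (m j - int (n - s) * ca j i)) =
        (\<Sum>s\<le>n. (A / D) * (c s * qi i powi (- (int s * (int n - 1)))) - (inverse A / D) * (c s * qi i powi (int s * (int n - 1))))"
        by (intro sum.cong refl) (simp only: atMost_iff)
      also have "\<dots> = 0" unfolding sum_subtractf sum_distrib_left[symmetric] c_def serre_coeff_sum[OF n(2)] by simp
      finally show ?thesis .
    qed
    then have z: "(\<Sum>s\<le>n. sc (c s) (sc (qint (qi j) (m j - int (n - s) * ca j i)) ((FF i ^^ n) x))) = 0"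
      by (simp add: pm.scale_sum_left[symmetric])
    have "EE j (serreF i j x) = (\<Sum>s\<le>n. sc (c s) ((FF i ^^ s) (FF j ((FF i ^^ (n - s)) (EE j x)))
      + sc (qint (qi j) (m j - int (n - s) * ca j i)) ((FF i ^^ n) x)))"
      unfolding ES[unfolded 2] by (intro sum.cong refl) (simp add: t)
    also have "\<dots> = serreF i j (EE j x)"
      unfolding S pm.scale_right_distrib sum.distrib z by simp
    finally show ?thesis unfolding 2 .
  next
    case 3
    obtain r where r: "n = Suc r" using n by (cases n) auto
    define G where "G s = (FF i ^^ s) (FF j ((FF i ^^ (r - s)) x))" for s
    define c' where "c' s = (- 1) ^ (r - s) * inverse (qfact (qi i) s) * inverse (qfact (qi i) (r - s)) * qint (qi i) (m i - int (r - s))" for s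
    \<comment> \<open>X s comes from E_i meeting the block to the left of F_j, Y s from the block to
      its right; X (s + 1) and Y s are opposite multiples of G s. The guards at s = 0 and s = n
      record that an empty block contributes nothing.\<close>
    define X where "X s = (if s = 0 then 0 else sc (c' (s - 1)) (G (s - 1)))" for s
    define Y where "Y s = (if s = n then 0 else - sc (c' s) (G s))" for s
    have t: "sc (c s) (EE i ((FF i ^^ s) (FF j ((FF i ^^ (n - s)) x)))) = sc (c s) ((FF i ^^ s) (FF j ((FF i ^^ (n - s)) (EE i x)))) + X s + Y s"
      if "s \<le> n" for s
    proof -
      define u where "u = n - s"
      have su: "int s = int n - int u" using that by (simp add: u_def)
      have hy: "hom (\<lambda>k. m k - int u * ca k i - ca k j) (FF j ((FF i ^^ u) x))"
        by (rule hom_F[OF hom_F_pow[OF h i] j])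
      have 1: "EE i ((FF i ^^ s) (FF j ((FF i ^^ u) x))) = (FF i ^^ s) (EE i (FF j ((FF i ^^ u) x))) +
         sc (qint (qi i) (int s) * qint (qi i) (m i - int u)) ((FF i ^^ (s - 1)) (FF j ((FF i ^^ u) x)))"
      proof -
        \<comment> \<open>Here n = 1 - a_ij is decisive: the left block for u and the right block
          for u + 1 both see [m_i - u].\<close>
        have "m i - int u * ca i i - ca i j - int s + 1 = m i - int u" using i n su by simp
        then show ?thesis using E_F_pow[OF i hy, of s] by (simp only:)
      qed
      have 2: "EE i (FF j ((FF i ^^ u) x)) = FF j ((FF i ^^ u) (EE i x)) +
         sc (qint (qi i) (int u) * qint (qi i) (m i - int u + 1)) (FF j ((FF i ^^ (u - 1)) x))"
        using comm_ne[OF i j ij] E_F_pow[OF i h, of u] by (simp add: lx_add lx_sc)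
      have 3: "(FF i ^^ s) (EE i (FF j ((FF i ^^ u) x))) = (FF i ^^ s) (FF j ((FF i ^^ u) (EE i x))) +
         sc (qint (qi i) (int u) * qint (qi i) (m i - int u + 1)) ((FF i ^^ s) (FF j ((FF i ^^ (u - 1)) x)))"
        unfolding 2 Fpow_add Fpow_sc ..
      have X: "sc (c s * (qint (qi i) (int s) * qint (qi i) (m i - int u))) ((FF i ^^ (s - 1)) (FF j ((FF i ^^ u) x))) = X s"
      proof (cases s)
        case (Suc s')
        have "r - s' = u" using that r Suc by (auto simp: u_def)
        moreover have "c s * qint (qi i) (int s) = (- 1) ^ u * inverse (qfact (qi i) s') * inverse (qfact (qi i) u)"
        proof -
          have "qfact (qi i) s = qfact (qi i) s' * qint (qi i) (int s)" by (simp add: Suc qfact_Suc add.commute)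
          then show ?thesis using qint_nz[of "int s"] Suc unfolding c_def serre_coeff_def u_def[symmetric] by simp
        qed
        moreover have "s - 1 = s'" "s \<noteq> 0" using Suc by auto
        ultimately show ?thesis unfolding X_def G_def c'_def by (simp only: if_False mult.assoc[symmetric])
      qed (simp add: X_def)
      have Y: "sc (c s * (qint (qi i) (int u) * qint (qi i) (m i - int u + 1))) ((FF i ^^ s) (FF j ((FF i ^^ (u - 1)) x))) = Y s"
      proof (cases u)
        case 0 then show ?thesis using that u_def by (simp add: Y_def)
      next
        case (Suc u')
        have "r - s = u'" "s \<noteq> n" using that r Suc by (auto simp: u_def)
        moreover have "c s * qint (qi i) (int u) = - ((- 1) ^ u' * inverse (qfact (qi i) s) * inverse (qfact (qi i) u'))"
        proof -
          have "qfact (qi i) u = qfact (qi i) u' * qint (qi i) (int u)" by (simp add: Suc qfact_Suc add.commute)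
          then show ?thesis using qint_nz[of "int u"] Suc unfolding c_def serre_coeff_def u_def[symmetric] by simp
        qed
        moreover have "m i - int u + 1 = m i - int u'" "u - 1 = u'" using Suc by simp_all
        ultimately show ?thesis unfolding Y_def G_def c'_def
          by (simp only: if_False mult.assoc[symmetric] mult_minus_left pm.scale_minus_left)
      qed
      show ?thesis
        unfolding u_def[symmetric] 1 3 pm.scale_right_distrib pm.scale_scale X Y by simp
    qed
    have "(\<Sum>s\<le>n. X s) + (\<Sum>s\<le>n. Y s) = 0"
      unfolding r sum.atMost_Suc_shift[of X] sum.atMost_Suc[of Y]
      by (simp add: X_def Y_def r sum_negf[symmetric] sum.distrib[symmetric])
    then have z: "(\<Sum>s\<le>n. X s + Y s) = 0" by (simp add: sum.distrib)
    have "EE i (serreF i j x) = (\<Sum>s\<le>n. sc (c s) ((FF i ^^ s) (FF j ((FF i ^^ (n - s)) (EE i x)))) + (X s + Y s))"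
      unfolding ES[unfolded 3] by (intro sum.cong refl) (simp only: t atMost_iff add.assoc)
    also have "\<dots> = serreF i j (EE i x)" unfolding S sum.distrib[of _ "\<lambda>s. X s + Y s"] z by simp
    finally show ?thesis unfolding 3 .
  qed
qed

lemma serre_commute:
  assumes "i \<in> I" "j \<in> I" "i \<noteq> j" "k \<in> I"
  shows "EE k (serreF i j x) = serreF i j (EE k x)"
proof (rule lin_eqI[where f = "\<lambda>x. EE k (serreF i j x)" and g = "\<lambda>x. serreF i j (EE k x)"])
  show "lin (\<lambda>x. EE k (serreF i j x))" by (rule lin_comp[OF lin_lx lin_serreF])
  show "lin (\<lambda>x. serreF i j (EE k x))" by (rule lin_comp[OF lin_serreF lin_lx])
qed (rule serre_commute_hom[OF assms hom_bs])

text \<open>The exchange of all E_i with F_i together with negation of the weights. It yields the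
  statements on E from those on F.\<close>

lemma wrep_mirror: "wrep I fm (\<lambda>w k. - wt w k) f e"
proof
  fix i k w w' assume "i \<in> I" "k \<in> I" "w' \<in> Poly_Mapping.keys (f i w)"
  then show "- wt w' k = - wt w k + ca k i" using f_wt by simp
next
  fix i k w w' assume "i \<in> I" "k \<in> I" "w' \<in> Poly_Mapping.keys (e i w)"
  then show "- wt w' k = - wt w k - ca k i" using e_wt by simp
next
  fix i j w assume "i \<in> I" "j \<in> I"
  then show "lx (f i) (e j w) = lx (e j) (f i w) + (if i = j then sc (qint (qi i) (- wt w i)) (bs w) else 0)"
    using comm[of j i w] quantum_parameter.qint_minus[OF qparam[of i]]
    by (cases "i = j") (simp_all add: single_uminus)
qed

end

section \<open>Verma modules and their integrable quotients\<close>

context finite_cartan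
begin

text \<open>
  The Verma module of highest weight \<open>b\<close>, before division by the Serre relations, has the words in
  the \<open>F\<^sub>i\<close> as its basis; \<open>rem b i\<close> is the action of \<open>E\<^sub>i\<close>. Since the letters range over a type,
  words with letters outside \<open>I\<close> have to be killed along the way: these are \<open>G0\<close> below.
\<close>

definition wtw :: "('i \<Rightarrow> int) \<Rightarrow> 'i list \<Rightarrow> 'i \<Rightarrow> int" where
  "wtw b w k = b k - (\<Sum>j\<in>#mset w. ca k j)"

definition fw :: "'i \<Rightarrow> 'i list \<Rightarrow> ('i list \<Rightarrow>\<^sub>0 qv)" where "fw i w = bs (i # w)"

primrec rem :: "('i \<Rightarrow> int) \<Rightarrow> 'i \<Rightarrow> 'i list \<Rightarrow> ('i list \<Rightarrow>\<^sub>0 qv)" where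
  "rem b i [] = 0"
| "rem b i (j # w) = lx (fw j) (rem b i w) + (if i = j then sc (qint (qi i) (wtw b w i)) (bs w) else 0)"

lemma rem_mset: "u \<in> Poly_Mapping.keys (rem b i w) \<Longrightarrow> add_mset i (mset u) = mset w"
proof (induction w arbitrary: u)
  case (Cons j w)
  have "u \<in> Poly_Mapping.keys (lx (fw j) (rem b i w)) \<or> (i = j \<and> u = w)"
    using Cons.prems keys_add[of "lx (fw j) (rem b i w)"] keys_sc
    by (fastforce split: if_splits)
  then show ?case
  proof
    assume "u \<in> Poly_Mapping.keys (lx (fw j) (rem b i w))"
    then obtain u' where "u' \<in> Poly_Mapping.keys (rem b i w)" "u = j # u'"
      using keys_lx[of u "fw j"] by (auto simp: fw_def)
    then show ?thesis using Cons.IH[of u'] by simp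
  qed simp
qed simp

text \<open>The recursion for \<open>rem\<close> is the commutator relation itself, with E_i killing
  the empty word; only the weights need an argument.\<close>

lemma wrepV: "wrep I fm (wtw b) (rem b) fw"
proof
  fix i k w w' assume "w' \<in> Poly_Mapping.keys (rem b i w)"
  from rem_mset[OF this, symmetric] show "wtw b w' k = wtw b w k + ca k i" by (simp add: wtw_def)
next
  fix i k w w' assume "w' \<in> Poly_Mapping.keys (fw i w)"
  then show "wtw b w' k = wtw b w k - ca k i" by (simp add: wtw_def fw_def)
next
  fix i j w
  show "lx (rem b i) (fw j w) = lx (fw j) (rem b i w) + (if i = j then sc (qint (qi i) (wtw b w i)) (bs w) else 0)"
    by (simp add: fw_def[of j w])
qed

abbreviation "FW i \<equiv> lx (fw i)"

lemma FW_pow: "(FW i ^^ n) (bs w) = bs (replicate n i @ w)"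
  by (induction n) (simp_all add: fw_def)

definition serreW :: "'i \<Rightarrow> 'i \<Rightarrow> ('i list \<Rightarrow>\<^sub>0 qv) \<Rightarrow> ('i list \<Rightarrow>\<^sub>0 qv)" where
  "serreW i j x = (\<Sum>s\<le>nat (1 - ca i j). sc (serre_coeff (qi i) (nat (1 - ca i j)) s)
     ((FW i ^^ s) (FW j ((FW i ^^ (nat (1 - ca i j) - s)) x))))"

lemma serreW_eq: "wrep.serreF fm fw i j = serreW i j"
  using wrep.serreF_def[OF wrepV] by (intro ext) (simp add: serreW_def)

lemma lin_serreW: "lin (serreW i j)"
  using wrep.lin_serreF[OF wrepV] by (simp add: serreW_eq)

lemma serreW_bs: "serreW i j (bs w) = (\<Sum>s\<le>nat (1 - ca i j). sc (serre_coeff (qi i) (nat (1 - ca i j)) s)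
     (bs (replicate s i @ j # replicate (nat (1 - ca i j) - s) i @ w)))"
  unfolding serreW_def FW_pow by (simp add: fw_def FW_pow del: sc_single)

text \<open>
  The submodule generated by the Serre relations and the words in \<open>G\<close>: for \<open>G = G0\<close> the quotient
  is the Verma module, for \<open>G = Gb c\<close> it is the integrable module of highest weight \<open>c\<close>.
\<close>

inductive_set NN :: "'i list set \<Rightarrow> ('i list \<Rightarrow>\<^sub>0 qv) set" for G where
  NN_0: "0 \<in> NN G"
| NN_add: "x \<in> NN G \<Longrightarrow> y \<in> NN G \<Longrightarrow> x + y \<in> NN G"
| NN_sc: "x \<in> NN G \<Longrightarrow> sc c x \<in> NN G"
| NN_f: "x \<in> NN G \<Longrightarrow> i \<in> I \<Longrightarrow> FW i x \<in> NN G"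
| NN_G: "w \<in> G \<Longrightarrow> bs w \<in> NN G"
| NN_S: "i \<in> I \<Longrightarrow> j \<in> I \<Longrightarrow> i \<noteq> j \<Longrightarrow> serreW i j (bs w) \<in> NN G"

lemma NN_subspace: "pm.subspace (NN G)"
  by (auto simp: pm.subspace_def intro: NN.intros)

lemma NN_mono: "G \<subseteq> G' \<Longrightarrow> NN G \<subseteq> NN G'"
proof
  fix x assume "x \<in> NN G" "G \<subseteq> G'"
  then show "x \<in> NN G'" by (induction) (auto intro: NN.intros)
qed

lemma NN_serre: assumes "i \<in> I" "j \<in> I" "i \<noteq> j" shows "serreW i j x \<in> NN G"
  by (rule subspace_lin[OF lin_serreW NN_subspace]) (rule NN_S[OF assms])

lemma NN_keys: "(\<And>w. w \<in> Poly_Mapping.keys x \<Longrightarrow> bs w \<in> NN G) \<Longrightarrow> x \<in> NN G"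
  using subspace_lin[OF lin_id NN_subspace] by blast

lemma NN_FW_pow: "x \<in> NN G \<Longrightarrow> i \<in> I \<Longrightarrow> (FW i ^^ n) x \<in> NN G"
  by (induction n) (auto intro: NN_f)

text \<open>One operator for everything that depends only on the letters of a word: the toral
  elements, projections to weights, and truncation by length.\<close>

definition diag :: "('i multiset \<Rightarrow> qv) \<Rightarrow> ('i list \<Rightarrow>\<^sub>0 qv) \<Rightarrow> ('i list \<Rightarrow>\<^sub>0 qv)" where
  "diag g = lx (\<lambda>w. sc (g (mset w)) (bs w))"

lemma lin_diag: "lin (diag g)" by (simp add: diag_def)
lemma diag_bs: "diag g (bs w) = sc (g (mset w)) (bs w)" by (simp add: diag_def)

lemma diag_hom: "(\<And>u. u \<in> Poly_Mapping.keys x \<Longrightarrow> mset u = M) \<Longrightarrow> diag g x = sc (g M) x"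
  by (rule lin_eqI[OF lin_diag lin_scale[OF lin_id]]) (simp add: diag_bs)

lemma diag_FW: "diag g (FW i x) = FW i (diag (\<lambda>M. g (add_mset i M)) x)"
  by (rule lin_eqI[where f = "\<lambda>x. diag g (FW i x)" and g = "\<lambda>x. FW i (diag (\<lambda>M. g (add_mset i M)) x)"])
    (rule lin_comp[OF lin_diag lin_lx] lin_comp[OF lin_lx lin_diag] | simp add: fw_def diag_bs lx_sc del: sc_single)+

text \<open>All words of a Serre vector have the same letters.\<close>

lemma diag_serre: "diag g (serreW i j (bs w)) =
    sc (g (replicate_mset (nat (1 - ca i j)) i + add_mset j (mset w))) (serreW i j (bs w))"
proof (rule diag_hom)
  fix u assume "u \<in> Poly_Mapping.keys (serreW i j (bs w))"
  then have "u \<in> (\<Union>s\<in>{..nat (1 - ca i j)}. Poly_Mapping.keys (sc (serre_coeff (qi i) (nat (1 - ca i j)) s)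
      (bs (replicate s i @ j # replicate (nat (1 - ca i j) - s) i @ w))))"
    unfolding serreW_bs by (rule subsetD[OF keys_sum])
  then obtain s where s: "s \<le> nat (1 - ca i j)"
    and u: "u \<in> Poly_Mapping.keys (sc (serre_coeff (qi i) (nat (1 - ca i j)) s) (bs (replicate s i @ j # replicate (nat (1 - ca i j) - s) i @ w)))"
    by auto
  from subsetD[OF keys_sc u] have "u = replicate s i @ j # replicate (nat (1 - ca i j) - s) i @ w" by simp
  with s show "mset u = replicate_mset (nat (1 - ca i j)) i + add_mset j (mset w)"
    by (auto simp add: multiset_eq_iff)
qed

text \<open>The generators are homogeneous, so the submodule is graded. The function g varies in the
  induction because prefixing a letter shifts it.\<close>

lemma NN_diag: "x \<in> NN G \<Longrightarrow> diag g x \<in> NN G"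
proof (induction arbitrary: g rule: NN.induct)
  case NN_0 then show ?case by (simp add: lin_0[OF lin_diag] NN.NN_0)
next
  case (NN_add x y) then show ?case by (simp add: lin_add[OF lin_diag] NN.NN_add)
next
  case (NN_sc x c) then show ?case by (simp add: lin_sc[OF lin_diag] NN.NN_sc)
next
  case (NN_f x i) then show ?case by (simp add: diag_FW NN.NN_f)
next
  case (NN_G w) then show ?case unfolding diag_bs by (intro NN.NN_sc NN.NN_G)
next
  case (NN_S i j w) then show ?case unfolding diag_serre by (intro NN.NN_sc NN.NN_S)
qed

text \<open>Stability under E_k has to be tested on G only: the commutator with F_i is diagonal,
  hence handled by \<open>NN_diag\<close>, and a Serre element commutes with E_k.\<close>

lemma NN_rem:
  assumes G: "\<And>w i. w \<in> G \<Longrightarrow> i \<in> I \<Longrightarrow> rem b i w \<in> NN G"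
  shows "x \<in> NN G \<Longrightarrow> k \<in> I \<Longrightarrow> lx (rem b k) x \<in> NN G"
proof (induction rule: NN.induct)
  case NN_0 then show ?case by (simp add: lx_0 NN.NN_0)
next
  case (NN_add x y) then show ?case by (simp add: lx_add NN.NN_add)
next
  case (NN_sc x c) then show ?case by (simp add: lx_sc NN.NN_sc)
next
  case (NN_f x i)
  have "lx (rem b k) (FW i x) = FW i (lx (rem b k) x) +
    (if k = i then diag (\<lambda>M. qint (qi k) (b k - (\<Sum>j\<in>#M. ca k j))) x else 0)"
  proof (rule lin_eqI[where f = "\<lambda>x. lx (rem b k) (FW i x)" and g = "\<lambda>x. FW i (lx (rem b k) x) +
    (if k = i then diag (\<lambda>M. qint (qi k) (b k - (\<Sum>j\<in>#M. ca k j))) x else 0)"])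
    show "lin (\<lambda>x. lx (rem b k) (FW i x))" by (rule lin_comp[OF lin_lx lin_lx])
    show "lin (\<lambda>x. FW i (lx (rem b k) x) +
        (if k = i then diag (\<lambda>M. qint (qi k) (b k - (\<Sum>j\<in>#M. ca k j))) x else 0))"
      by (cases "k = i") (simp_all add: lin_plus lin_comp[OF lin_lx lin_lx] lin_diag)
    fix w
    show "lx (rem b k) (FW i (bs w)) = FW i (lx (rem b k) (bs w)) +
        (if k = i then diag (\<lambda>M. qint (qi k) (b k - (\<Sum>j\<in>#M. ca k j))) (bs w) else 0)"
      by (simp add: fw_def[of i w] diag_bs wtw_def)
  qed
  then show ?case using NN_f by (simp add: NN.NN_f NN_add NN_diag NN.NN_0)
next
  case (NN_G w) then show ?case using G by simp
next
  case (NN_S i j w)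
  interpret V: wrep I fm "wtw b" "rem b" fw by (rule wrepV)
  have "lx (rem b k) (serreW i j (bs w)) = serreW i j (lx (rem b k) (bs w))"
    using V.serre_commute[OF NN_S(1-3) NN_S(4)] by (simp add: serreW_eq)
  then show ?case using NN_S by (simp add: NN_serre)
qed

section \<open>Integrable quotients: singular vectors, local nilpotence, reflections, finite
  dimension\<close>

definition G0 :: "'i list set" where "G0 = {w. \<not> set w \<subseteq> I}"
definition Gb :: "('i \<Rightarrow> nat) \<Rightarrow> 'i list set" where
  "Gb c = G0 \<union> {replicate (Suc (c i)) i | i. i \<in> I}"

lemma rem_G0: assumes "w \<in> G0" "i \<in> I" shows "rem b i w \<in> NN G0"
proof (rule NN_keys)
  fix u assume "u \<in> Poly_Mapping.keys (rem b i w)"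
  then have "mset w = add_mset i (mset u)" using rem_mset by metis
  then have "set w = insert i (set u)" by (metis set_mset_add_mset_insert set_mset_mset)
  then show "bs u \<in> NN G0" using assms by (intro NN_G) (auto simp: G0_def)
qed

lemma NN_G0_rem: "x \<in> NN G0 \<Longrightarrow> k \<in> I \<Longrightarrow> lx (rem b k) x \<in> NN G0"
  using NN_rem[of G0 b] rem_G0 by blast

text \<open>The word consisting of c_i + 1 letters i is a singular vector: E_i produces the factor
  [b_i - c_i] = 0, and every other E_k commutes with F_i and reaches the highest weight
  vector.\<close>

lemma NN_Gb_rem:
  assumes b: "\<And>i. i \<in> I \<Longrightarrow> b i = int (c i)"
  shows "x \<in> NN (Gb c) \<Longrightarrow> k \<in> I \<Longrightarrow> lx (rem b k) x \<in> NN (Gb c)"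
proof (rule NN_rem)
  interpret V: wrep I fm "wtw b" "rem b" fw by (rule wrepV)
  fix w k assume w: "w \<in> Gb c" and k: "k \<in> I"
  show "rem b k w \<in> NN (Gb c)"
  proof (cases "w \<in> G0")
    case True
    then show ?thesis using rem_G0[OF _ k] NN_mono[of G0 "Gb c"] by (auto simp: Gb_def)
  next
    case False
    then obtain i where i: "i \<in> I" "w = replicate (Suc (c i)) i" using w by (auto simp: Gb_def)
    interpret quantum_parameter "qi i" by (rule qparam[OF i(1)])
    have "rem b k w = lx (rem b k) ((FW i ^^ Suc (c i)) (bs []))"
      by (simp only: i(2) FW_pow append_Nil2 lx_single pm.scale_one)
    also have "\<dots> = 0"
    proof (cases "k = i")
      case True
      have "b i - int (Suc (c i)) + 1 = 0" using b i by simp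
      then show ?thesis
        using V.E_F_pow[OF i(1) V.hom_bs[of "[]"], of "Suc (c i)"] True
        by (simp add: wtw_def lx_0 lin_0[OF lin_pow[OF lin_lx]] del: funpow.simps)
    next
      case False
      then show ?thesis using V.comm_ne_pow[OF k i(1) False] by (simp add: lin_0[OF lin_pow[OF lin_lx]] del: funpow.simps)
    qed
    finally show ?thesis by (simp add: NN_0)
  qed
qed

lemma NN_truncate:
  assumes c: "\<And>i. i \<in> I \<Longrightarrow> c i \<ge> d"
  shows "x \<in> NN (Gb c) \<Longrightarrow> (\<And>M. size M > d \<Longrightarrow> g M = 0) \<Longrightarrow> diag g x \<in> NN G0"
proof (induction arbitrary: g rule: NN.induct)
  case NN_0 then show ?case by (simp add: lin_0[OF lin_diag] NN.NN_0)
next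
  case (NN_add x y) then show ?case by (simp add: lin_add[OF lin_diag] NN.NN_add)
next
  case (NN_sc x c) then show ?case by (simp add: lin_sc[OF lin_diag] NN.NN_sc)
next
  case (NN_f x i) then show ?case by (simp add: diag_FW NN.NN_f)
next
  case (NN_G w)
  show ?case
  proof (cases "w \<in> G0")
    case True then show ?thesis unfolding diag_bs by (intro NN.NN_sc NN.NN_G)
  next
    case False
    then have "size (mset w) > d" using NN_G c by (fastforce simp: Gb_def)
    then show ?thesis using NN_G(2) by (simp add: diag_bs NN.NN_0)
  qed
next
  case (NN_S i j w) then show ?case unfolding diag_serre by (intro NN.NN_sc NN.NN_S)
qed

text \<open>Local nilpotence of F_i, by induction on the word. A letter j \<noteq> i is crossed by
  means of the Serre relation, which trades F_i^n F_j for terms with fewer F_i in front of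
  F_j.\<close>

lemma NN_nilpotent:
  assumes i: "i \<in> I"
  shows "\<exists>m. bs (replicate m i @ w) \<in> NN (Gb c)"
proof (induction w)
  case Nil
  show ?case by (rule exI[of _ "Suc (c i)"]) (use i in \<open>auto simp: Gb_def intro!: NN_G\<close>)
next
  case (Cons j w)
  then obtain m where m: "bs (replicate m i @ w) \<in> NN (Gb c)" by blast
  have m': "bs (replicate u i @ w) \<in> NN (Gb c)" if "u \<ge> m" for u
  proof -
    have "replicate u i @ w = replicate (u - m) i @ replicate m i @ w"
      using that by (metis append_assoc le_add_diff_inverse2 replicate_add)
    then show ?thesis using NN_FW_pow[OF m i, of "u - m"] by (simp add: FW_pow)
  qed
  show ?case
  proof (cases "j \<in> I")
    case False
    then show ?thesis by (intro exI[of _ 0] NN_G) (auto simp: Gb_def G0_def)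
  next
    case j: True
    show ?thesis
    proof (cases "i = j")
      case True
      then show ?thesis using m'[of "Suc m"] by (metis append_Cons le_SucI le_refl replicate_Suc replicate_app_Cons_same)
    next
      case ij: False
      define n where "n = nat (1 - ca i j)"
      interpret quantum_parameter "qi i" by (rule qparam[OF i])
      \<comment> \<open>Either m letters i already stand behind j, where the induction hypothesis on
        w applies, or at least n stand in front. In the latter case the Serre relation is solved for
        its term s = n; the other terms have smaller k.\<close>
      have "k + u \<ge> m + n \<Longrightarrow> bs (replicate k i @ j # replicate u i @ w) \<in> NN (Gb c)" for k u
      proof (induction k arbitrary: u rule: less_induct)
        case (less k)
        show ?case
        proof (cases "u \<ge> m")
          case True
          then show ?thesis using NN_FW_pow[OF NN_f[OF m'[OF True] j] i, of k] by (simp add: fw_def FW_pow)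
        next
          case False
          then have k: "k \<ge> n" using less.prems by simp
          let ?t = "\<lambda>s. bs (replicate (k - n + s) i @ j # replicate (n - s + u) i @ w)"
          have "(FW i ^^ (k - n)) (serreW i j (bs (replicate u i @ w))) \<in> NN (Gb c)"
            by (intro NN_FW_pow NN_S i j ij)
          also have "(FW i ^^ (k - n)) (serreW i j (bs (replicate u i @ w))) =
              (\<Sum>s\<le>n. sc (serre_coeff (qi i) n s) (?t s))"
            unfolding serreW_bs n_def[symmetric] lin_sum[OF lin_pow[OF lin_lx]] lin_sc[OF lin_pow[OF lin_lx]] FW_pow
            by (intro sum.cong refl) (simp only: replicate_add append_assoc append_Cons)
          also have "\<dots> = (\<Sum>s<n. sc (serre_coeff (qi i) n s) (?t s)) + sc (serre_coeff (qi i) n n) (?t n)"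
            by (simp only: lessThan_Suc_atMost[symmetric] sum.lessThan_Suc)
          finally have 1: "(\<Sum>s<n. sc (serre_coeff (qi i) n s) (?t s)) + sc (serre_coeff (qi i) n n) (?t n) \<in> NN (Gb c)" .
          have 2: "(\<Sum>s<n. sc (serre_coeff (qi i) n s) (?t s)) \<in> NN (Gb c)"
          proof (intro pm.subspace_sum[OF NN_subspace] NN_sc)
            fix s assume s: "s \<in> {..<n}"
            show "?t s \<in> NN (Gb c)" by (rule less.IH) (use s k less.prems in auto)
          qed
          have "sc (serre_coeff (qi i) n n) (?t n) \<in> NN (Gb c)"
            using pm.subspace_diff[OF NN_subspace 1 2] by (simp only: add_diff_cancel_left')
          then have "sc (inverse (serre_coeff (qi i) n n)) (sc (serre_coeff (qi i) n n) (?t n)) \<in> NN (Gb c)"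
            by (rule NN_sc)
          moreover have "serre_coeff (qi i) n n \<noteq> 0" using qfact_nz by (simp add: serre_coeff_def)
          ultimately have "?t n \<in> NN (Gb c)" by simp
          then show ?thesis using k by simp
        qed
      qed
      from this[of "m + n" 0] show ?thesis by auto
    qed
  qed
qed

text \<open>Rank one representation theory. Applying F_i as long as the result is nonzero leads to a
  lowest weight vector F_i^c0 w; from there E_i climbs without vanishing along the whole string,
  past the weight of w to the reflected weight. Some word occurring there is nonzero modulo the
  submodule.\<close>

lemma NN_reflect:
  assumes w: "bs w \<notin> NN (Gb c)" and i: "i \<in> I" and b: "\<And>i. i \<in> I \<Longrightarrow> b i = int (c i)"
    and neg: "wtw b w i < 0"
  shows "\<exists>w'. bs w' \<notin> NN (Gb c) \<and> mset w' + replicate_mset (nat (- wtw b w i)) i = mset w"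
proof -
  interpret V: wrep I fm "wtw b" "rem b" fw by (rule wrepV)
  \<comment> \<open>With E and F exchanged, x is a highest weight vector modulo the submodule, so
    \<open>E_F_pow\<close> describes the climb.\<close>
  interpret M: wrep I fm "\<lambda>w k. - wtw b w k" fw "rem b" by (rule V.wrep_mirror)
  interpret quantum_parameter "qi i" by (rule qparam[OF i])
  let ?N = "NN (Gb c)"
  define m where "m = wtw b w i"
  define k0 where "k0 = (LEAST k. bs (replicate k i @ w) \<in> ?N)"
  have k0: "bs (replicate k0 i @ w) \<in> ?N" unfolding k0_def by (rule LeastI_ex[OF NN_nilpotent[OF i]])
  then have "k0 \<noteq> 0" using w by (metis append_Nil replicate_0)
  then obtain c0 where c0: "k0 = Suc c0" by (cases k0) auto
  define x where "x = (bs (replicate c0 i @ w) :: 'i list \<Rightarrow>\<^sub>0 qv)"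
  have x: "x \<notin> ?N" unfolding x_def using not_less_Least[of c0 "\<lambda>k. bs (replicate k i @ w) \<in> ?N"] c0
    by (simp add: k0_def[symmetric])
  have Fx: "FW i x \<in> ?N" using k0 by (simp add: x_def c0 fw_def)
  have hx: "M.hom (\<lambda>k. - wtw b (replicate c0 i @ w) k) x" unfolding x_def by (rule M.hom_bs)
  have m': "wtw b (replicate c0 i @ w) i = m - 2 * int c0"
    using i by (simp add: wtw_def m_def)
  have stable: "(lx (rem b i) ^^ n) y \<in> ?N" if "y \<in> ?N" for n y
    using that by (induction n) (auto intro: NN_Gb_rem[OF b _ i])
  have E: "(lx (rem b i) ^^ n) x \<notin> ?N" if "n \<le> nat (2 * int c0 - m)" for n
    using that
  proof (induction n)
    case 0 then show ?case using x by simp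
  next
    case (Suc n)
    show ?case
    proof
      assume "(lx (rem b i) ^^ Suc n) x \<in> ?N"
      then have 1: "FW i ((lx (rem b i) ^^ Suc n) x) \<in> ?N" using i by (rule NN_f)
      \<comment> \<open>Nonzero as long as n + 1 is at most 2 c0 - m, the length of the
        string.\<close>
      define z where "z = qint (qi i) (int (Suc n)) * qint (qi i) (- (m - 2 * int c0) - int (Suc n) + 1)"
      have "FW i ((lx (rem b i) ^^ Suc n) x) = (lx (rem b i) ^^ Suc n) (FW i x) + sc z ((lx (rem b i) ^^ n) x)"
        using M.E_F_pow[OF i hx, of "Suc n"] unfolding m' z_def by (simp only: diff_Suc_1)
      then have "sc z ((lx (rem b i) ^^ n) x) = FW i ((lx (rem b i) ^^ Suc n) x) - (lx (rem b i) ^^ Suc n) (FW i x)"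
        by (simp only: add_diff_cancel_left')
      then have 2: "sc z ((lx (rem b i) ^^ n) x) \<in> ?N"
        using pm.subspace_diff[OF NN_subspace 1 stable[OF Fx, of "Suc n"]] by (simp only:)
      have "z \<noteq> 0" unfolding z_def using Suc.prems neg by (intro no_zero_divisors qint_nz) (auto simp: m_def)
      then have "(lx (rem b i) ^^ n) x \<in> ?N" using NN_sc[OF 2, of "inverse z"] by simp
      then show False using Suc by simp
    qed
  qed
  \<comment> \<open>It takes c0 steps to return to the weight of w and - m more to reach the
    reflected weight.\<close>
  define n where "n = c0 + nat (- m)"
  have "n \<le> nat (2 * int c0 - m)" using neg by (simp add: n_def m_def)
  from E[OF this] obtain w' where w': "w' \<in> Poly_Mapping.keys ((lx (rem b i) ^^ n) x)" "bs w' \<notin> ?N"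
    using NN_keys by blast
  have keys: "u \<in> Poly_Mapping.keys ((lx (rem b i) ^^ k) x) \<Longrightarrow> mset u + replicate_mset k i = mset w + replicate_mset c0 i" for k u
  proof (induction k arbitrary: u)
    case 0 then show ?case by (simp add: x_def)
  next
    case (Suc k)
    then obtain u' where "u' \<in> Poly_Mapping.keys ((lx (rem b i) ^^ k) x)" "u \<in> Poly_Mapping.keys (rem b i u')"
      using keys_lx by fastforce
    then show ?case using Suc.IH[of u'] rem_mset[of u b i u'] by (metis add_mset_add_single union_mset_add_mset_left union_mset_add_mset_right replicate_mset_Suc)
  qed
  have "mset w' + replicate_mset (nat (- m)) i + replicate_mset c0 i = mset w + replicate_mset c0 i"
  proof (rule multiset_eqI)
    fix a
    show "count (mset w' + replicate_mset (nat (- m)) i + replicate_mset c0 i) a = count (mset w + replicate_mset c0 i) a"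
      using arg_cong[OF keys[OF w'(1)], of "\<lambda>M. count M a"] by (simp add: n_def split: if_splits)
  qed
  then show ?thesis using w'(2) unfolding m_def by (auto simp del: replicate_mset_eq_empty_iff)
qed

lemma wtw_wgt:
  assumes "set w \<subseteq> I"
  shows "wtw b w i = wgt b (\<lambda>j. int (count (mset w) j)) i"
proof -
  have "(\<Sum>j\<in>#mset w. ca i j) = (\<Sum>j\<in>I. int (count (mset w) j) * ca i j)"
    using assms
  proof (induction w)
    case (Cons a w)
    have "(\<Sum>j\<in>I. int (count (mset (a # w)) j) * ca i j) =
        (\<Sum>j\<in>I. int (count (mset w) j) * ca i j) + (\<Sum>j\<in>I. if j = a then ca i a else 0)"
      unfolding sum.distrib[symmetric] by (intro sum.cong refl) (simp add: algebra_simps)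
    then show ?case using Cons by simp
  qed simp
  then show ?thesis by (simp add: wtw_def wgt_def)
qed

text \<open>A word of dominant weight satisfies the bound by \<open>Qf_dominant\<close>. Any other
  is replaced, by reflection, with a shorter word that is still nonzero and has the same value of
  \<open>Qf\<close>.\<close>

lemma NN_Qf:
  assumes "bs w \<notin> NN (Gb c)"
  shows "set w \<subseteq> I" "Qf (\<lambda>i. int (c i)) (\<lambda>j. int (count (mset w) j)) \<le> 0"
proof -
  have sub: "set u \<subseteq> I" if "bs u \<notin> NN (Gb c)" for u
    using that NN_G[of u "Gb c"] by (auto simp: Gb_def G0_def)
  show "set w \<subseteq> I" by (rule sub[OF assms])
  show "Qf (\<lambda>i. int (c i)) (\<lambda>j. int (count (mset w) j)) \<le> 0"
    using assms
  proof (induction "length w" arbitrary: w rule: less_induct)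
    case less
    define b where "b = (\<lambda>i. int (c i))"
    let ?n = "\<lambda>w j. int (count (mset w) j)"
    show ?case
    proof (cases "\<forall>i\<in>I. wtw b w i \<ge> 0")
      case True
      then show ?thesis by (intro Qf_dominant) (auto simp: b_def wtw_wgt[OF sub[OF less.prems]])
    next
      case False
      then obtain i where i: "i \<in> I" "wtw b w i < 0" by force
      obtain w' where w': "bs w' \<notin> NN (Gb c)" "mset w' + replicate_mset (nat (- wtw b w i)) i = mset w"
        using NN_reflect[OF less.prems i(1) _ i(2)] by (auto simp: b_def)
      have "length w = length w' + nat (- wtw b w i)"
        using w'(2) by (metis size_mset size_replicate_mset size_union)
      then have len: "length w' < length w" using i by simp
      have cnt: "count (mset w) j = count (mset w') j + (if j = i then nat (- wtw b w i) else 0)" for j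
        unfolding w'(2)[symmetric] by simp
      have wi: "wgt b (?n w) i = wtw b w i" using wtw_wgt[OF sub[OF less.prems]] by simp
      have "?n w' = (?n w)(i := ?n w i + wgt b (?n w) i)"
        unfolding wi using i by (auto simp: cnt fun_eq_iff)
      then have "Qf b (?n w') = Qf b (?n w)" using Qf_reflect[OF i(1)] by simp
      then show ?thesis using less.hyps[OF len w'(1)] by (simp add: b_def)
    qed
  qed
qed

theorem NN_cofinite: "\<exists>d. \<forall>w. length w > d \<longrightarrow> bs w \<in> NN (Gb c)"
proof -
  let ?S = "{n. (\<forall>i. i \<notin> I \<longrightarrow> n i = 0) \<and> Qf (\<lambda>i. int (c i)) n \<le> 0}"
  have fin: "finite ((\<lambda>n. nat (\<Sum>i\<in>I. n i)) ` ?S)" using finite_Qf by blast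
  obtain d where d: "\<And>n. n \<in> ?S \<Longrightarrow> nat (\<Sum>i\<in>I. n i) \<le> d"
    using finite_nat_set_iff_bounded_le[of "(\<lambda>n. nat (\<Sum>i\<in>I. n i)) ` ?S"] fin by auto
  have "length w \<le> d" if "bs w \<notin> NN (Gb c)" for w
  proof -
    let ?n = "\<lambda>j. int (count (mset w) j)"
    have "?n \<in> ?S" using NN_Qf[OF that] by (auto simp: count_mset_0_iff)
    then have "nat (\<Sum>i\<in>I. ?n i) \<le> d" by (rule d)
    moreover have "(\<Sum>i\<in>I. count (mset w) i) = length w"
    proof -
      have "length w = (\<Sum>i\<in>set w. count (mset w) i)"
        by (metis size_mset size_multiset_overloaded_eq set_mset_mset)
      also have "\<dots> = (\<Sum>i\<in>I. count (mset w) i)"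
        using NN_Qf(1)[OF that] by (intro sum.mono_neutral_left) (auto simp: count_mset_0_iff)
      finally show ?thesis by simp
    qed
    ultimately show ?thesis by (simp flip: of_nat_sum)
  qed
  then show ?thesis by (meson not_le)
qed

end

section \<open>Tensor products of a lowest and a highest weight module\<close>

declare sc_single[simp del]

definition tens :: "('u \<Rightarrow>\<^sub>0 qv) \<Rightarrow> ('w \<Rightarrow>\<^sub>0 qv) \<Rightarrow> ('u \<times> 'w \<Rightarrow>\<^sub>0 qv)" where
  "tens p r = lx (\<lambda>x. lx (\<lambda>y. bs (x, y)) r) p"

lemma lin_tens1: "lin (\<lambda>p. tens p r)" by (simp add: tens_def)
lemma lin_tens2: "lin (tens p)"
  unfolding tens_def lx_def[of _ p] by (intro lin_sums lin_scale lin_lx)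
lemma tens_bs[simp]: "tens (bs x) (bs y) = bs (x, y)" by (simp add: tens_def)

lemmas tens_add1 = lin_add[OF lin_tens1] and tens_sc1 = lin_sc[OF lin_tens1] and tens_01 = lin_0[OF lin_tens1]
  and tens_add2 = lin_add[OF lin_tens2] and tens_sc2 = lin_sc[OF lin_tens2] and tens_02 = lin_0[OF lin_tens2]

lemma keys_tens: "z \<in> Poly_Mapping.keys (tens p r) \<Longrightarrow> fst z \<in> Poly_Mapping.keys p \<and> snd z \<in> Poly_Mapping.keys r"
  unfolding tens_def by (auto dest!: keys_lx)

lemma keys_plusE: "w \<in> Poly_Mapping.keys (x + y) \<Longrightarrow> w \<in> Poly_Mapping.keys x \<or> w \<in> Poly_Mapping.keys y"
  using keys_add[of x y] by auto

lemma keys_scE: "w \<in> Poly_Mapping.keys (sc c x) \<Longrightarrow> w \<in> Poly_Mapping.keys x"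
  using keys_sc[of c x] by auto

lemma tens_eqI:
  assumes "\<And>r. lin (\<lambda>p. f p r)" "\<And>p. lin (f p)" "\<And>r. lin (\<lambda>p. g p r)" "\<And>p. lin (g p)"
    and "\<And>x y. f (bs x) (bs y) = g (bs x) (bs y)"
  shows "f p r = g p r"
proof -
  have "f (bs x) r = g (bs x) r" for x by (rule lin_eqI[OF assms(2,4,5)])
  then show ?thesis by (rule lin_eqI[OF assms(1,3)])
qed

context finite_cartan
begin

text \<open>
  In the basis vector \<open>(x, y)\<close> the word \<open>x\<close> stands for a vector of the lowest weight module (the Verma
  module of highest weight \<open>a\<close> with the roles of \<open>E\<^sub>i\<close> and \<open>F\<^sub>i\<close> exchanged) and \<open>y\<close> for a vector of
  the highest weight module.
\<close>

definition eV :: "('i \<Rightarrow> int) \<Rightarrow> ('i \<Rightarrow> int) \<Rightarrow> 'i \<Rightarrow> 'i list \<times> 'i list \<Rightarrow> ('i list \<times> 'i list \<Rightarrow>\<^sub>0 qv)" where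
  "eV a b i = (\<lambda>(x, y). bs (i # x, y) + sc (qi i powi (- wtw a x i)) (tens (bs x) (rem b i y)))"

text \<open>For \<open>i \<notin> I\<close> the value is immaterial; dropping the first summand keeps the subspaces below stable.\<close>

definition fV :: "('i \<Rightarrow> int) \<Rightarrow> ('i \<Rightarrow> int) \<Rightarrow> 'i \<Rightarrow> 'i list \<times> 'i list \<Rightarrow> ('i list \<times> 'i list \<Rightarrow>\<^sub>0 qv)" where
  "fV a b i = (\<lambda>(x, y). bs (x, i # y) +
     (if i \<in> I then sc (qi i powi (- wtw b y i)) (tens (rem a i x) (bs y)) else 0))"

text \<open>The first factor is a lowest weight module, so the Verma weight of x enters with a minus
  sign.\<close>

definition wtV :: "('i \<Rightarrow> int) \<Rightarrow> ('i \<Rightarrow> int) \<Rightarrow> 'i list \<times> 'i list \<Rightarrow> 'i \<Rightarrow> int" where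
  "wtV a b = (\<lambda>(x, y) k. wtw b y k - wtw a x k)"

text \<open>On the first factor, where x has weight - \<open>wtw a x\<close>, this is the action of
  K_i; on the second, with b for a, it is that of K_i^-1. Thus \<open>EV_tens\<close> and
  \<open>FV_tens\<close> are the coproduct E \<mapsto> E \<otimes> 1 + K \<otimes> E, F \<mapsto> F
  \<otimes> K^-1 + 1 \<otimes> F.\<close>

definition kd :: "('i \<Rightarrow> int) \<Rightarrow> 'i \<Rightarrow> ('i list \<Rightarrow>\<^sub>0 qv) \<Rightarrow> ('i list \<Rightarrow>\<^sub>0 qv)" where
  "kd a i = diag (\<lambda>M. qi i powi (- (a i - (\<Sum>j\<in>#M. ca i j))))"

lemma kd_bs: "kd a i (bs x) = sc (qi i powi (- wtw a x i)) (bs x)"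
  by (simp add: kd_def diag_bs wtw_def del: sc_single)

lemma lin_kd: "lin (kd a i)" by (simp add: kd_def lin_diag)

lemma kd_rem: assumes "i \<in> I" "j \<in> I"
  shows "kd a i (rem a j x) = sc (qi i powi (- (wtw a x i + ca i j))) (rem a j x)"
proof (rule lin_eqI[OF lin_kd lin_scale[OF lin_id]])
  interpret V: wrep I fm "wtw a" "rem a" fw by (rule wrepV)
  fix w assume "w \<in> Poly_Mapping.keys (rem a j x)"
  then show "kd a i (bs w) = sc (qi i powi (- (wtw a x i + ca i j))) (bs w)"
    unfolding kd_bs using V.e_wt[OF assms(2,1)] by simp
qed

lemma EV_tens: "lx (eV a b i) (tens p r) = tens (FW i p) r + tens (kd a i p) (lx (rem b i) r)"
  by (rule tens_eqI[where f = "\<lambda>p r. lx (eV a b i) (tens p r)"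
        and g = "\<lambda>p r. tens (FW i p) r + tens (kd a i p) (lx (rem b i) r)"])
    (rule lin_comp[OF lin_lx lin_tens1] lin_comp[OF lin_lx lin_tens2]
        lin_plus[OF lin_comp[OF lin_tens1 lin_lx] lin_comp[OF lin_tens1 lin_kd]]
        lin_plus[OF lin_tens2 lin_comp[OF lin_tens2 lin_lx]]
     | simp add: eV_def kd_bs fw_def tens_sc1 del: sc_single)+

lemma FV_tens: assumes "i \<in> I"
  shows "lx (fV a b i) (tens p r) = tens (lx (rem a i) p) (kd b i r) + tens p (FW i r)"
  by (rule tens_eqI[where f = "\<lambda>p r. lx (fV a b i) (tens p r)"
        and g = "\<lambda>p r. tens (lx (rem a i) p) (kd b i r) + tens p (FW i r)"])
    (rule lin_comp[OF lin_lx lin_tens1] lin_comp[OF lin_lx lin_tens2]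
        lin_plus[OF lin_comp[OF lin_tens1 lin_lx] lin_tens1]
        lin_plus[OF lin_comp[OF lin_tens2 lin_kd] lin_comp[OF lin_tens2 lin_lx]]
     | simp add: fV_def kd_bs fw_def tens_sc2 assms add.commute del: sc_single)+

lemma keys_eV:
  assumes "w' \<in> Poly_Mapping.keys (eV a b i (x, y))"
  shows "w' = (i # x, y) \<or> (\<exists>u\<in>Poly_Mapping.keys (rem b i y). w' = (x, u))"
proof -
  have "w' \<in> Poly_Mapping.keys (bs (i # x, y)) \<or> w' \<in> Poly_Mapping.keys (tens (bs x) (rem b i y))"
    using keys_plusE[OF assms[unfolded eV_def prod.case]] by (auto dest: keys_scE)
  then show ?thesis using keys_tens[of w' "bs x" "rem b i y"] by (cases w') auto
qed

lemma keys_fV: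
  assumes "w' \<in> Poly_Mapping.keys (fV a b i (x, y))"
  shows "w' = (x, i # y) \<or> (\<exists>u\<in>Poly_Mapping.keys (rem a i x). w' = (u, y))"
proof -
  have "w' \<in> Poly_Mapping.keys (bs (x, i # y)) \<or> w' \<in> Poly_Mapping.keys (tens (rem a i x) (bs y))"
  proof (cases "i \<in> I")
    case True
    then have "fV a b i (x, y) = bs (x, i # y) + sc (qi i powi (- wtw b y i)) (tens (rem a i x) (bs y))"
      by (simp add: fV_def)
    then have "w' \<in> Poly_Mapping.keys (bs (x, i # y) + sc (qi i powi (- wtw b y i)) (tens (rem a i x) (bs y)))"
      using assms by simp
    then have "w' \<in> Poly_Mapping.keys (bs (x, i # y)) \<or>
        w' \<in> Poly_Mapping.keys (sc (qi i powi (- wtw b y i)) (tens (rem a i x) (bs y)))"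
      by (rule keys_plusE)
    then show ?thesis by (auto dest: keys_scE)
  next
    case False
    then show ?thesis using assms by (simp add: fV_def)
  qed
  then show ?thesis using keys_tens[of w' "rem a i x" "bs y"] by (cases w') auto
qed

lemma wrepT: "wrep I fm (wtV a b) (eV a b) (fV a b)"
proof
  interpret V: wrep I fm "wtw b" "rem b" fw by (rule wrepV)
  fix i k w w' assume ik: "i \<in> I" "k \<in> I" and w': "w' \<in> Poly_Mapping.keys (eV a b i w)"
  obtain x y where xy: "w = (x, y)" by (cases w)
  then consider "w' = (i # x, y)" | u where "w' = (x, u)" "u \<in> Poly_Mapping.keys (rem b i y)"
    using keys_eV w' unfolding xy by blast
  then show "wtV a b w' k = wtV a b w k + ca k i"
  proof cases
    case 1
    then show ?thesis by (simp add: xy wtV_def wtw_def)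
  next
    case 2
    then show ?thesis using V.e_wt[OF ik 2(2)] by (simp add: xy wtV_def)
  qed
next
  interpret V: wrep I fm "wtw a" "rem a" fw by (rule wrepV)
  fix i k w w' assume ik: "i \<in> I" "k \<in> I" and w': "w' \<in> Poly_Mapping.keys (fV a b i w)"
  obtain x y where xy: "w = (x, y)" by (cases w)
  then consider "w' = (x, i # y)" | u where "w' = (u, y)" "u \<in> Poly_Mapping.keys (rem a i x)"
    using keys_fV w' unfolding xy by blast
  then show "wtV a b w' k = wtV a b w k - ca k i"
  proof cases
    case 1
    then show ?thesis by (simp add: xy wtV_def wtw_def)
  next
    case 2
    then show ?thesis using V.e_wt[OF ik 2(2)] by (simp add: xy wtV_def)
  qed
next
  fix i j and w :: "'i list \<times> 'i list" assume i: "i \<in> I" and j: "j \<in> I"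
  interpret quantum_parameter "qi i" by (rule qparam[OF i])
  obtain x y where xy: "w = (x, y)" by (cases w)
  define \<beta> where "\<beta> = qi j powi (- wtw b y j)"
  define \<kappa> where "\<kappa> = qi i powi (- wtw a x i)"
  define \<delta> where "\<delta> = (if i = j then 1 else 0 :: qv)"
  \<comment> \<open>The terms in which a letter is removed from both words acquire an extra inverse
    of q_i^a_ij in one order and of q_j^a_ji in the other; these coincide.\<close>
  have cross: "\<beta> * qi i powi (- (wtw a x i + ca i j)) = \<kappa> * qi j powi (- (wtw b y j + ca j i))"
  proof -
    interpret j: quantum_parameter "qi j" by (rule qparam[OF j])
    have 1: "qi i powi (- (wtw a x i + ca i j)) = \<kappa> * inverse (qi i powi ca i j)"
      unfolding \<kappa>_def power_int_minus power_int_add[OF disjI1[OF q_nz]] by simp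
    have 2: "qi j powi (- (wtw b y j + ca j i)) = \<beta> * inverse (qi j powi ca j i)"
      unfolding \<beta>_def power_int_minus power_int_add[OF disjI1[OF j.q_nz]] by simp
    show ?thesis unfolding 1 2 qi_ca[OF i j] by (simp only: mult_ac)
  qed
  have L: "lx (eV a b i) (fV a b j w) = sc \<beta> (tens (FW i (rem a j x)) (bs y))
      + sc (\<beta> * qi i powi (- (wtw a x i + ca i j))) (tens (rem a j x) (rem b i y))
      + bs (i # x, j # y) + sc \<kappa> (tens (bs x) (FW j (rem b i y))) + sc (\<kappa> * \<delta> * qint (qi i) (wtw b y i)) (bs w)"
  proof -
    have "fV a b j w = sc \<beta> (tens (rem a j x) (bs y)) + tens (bs x) (bs (j # y))"
      using j by (simp add: fV_def xy \<beta>_def add.commute)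
    then have "lx (eV a b i) (fV a b j w) = sc \<beta> (tens (FW i (rem a j x)) (bs y) + tens (kd a i (rem a j x)) (rem b i y))
        + (bs (i # x, j # y) + sc \<kappa> (tens (bs x) (rem b i (j # y))))"
      by (simp only: lx_add lx_sc EV_tens kd_bs) (simp add: fw_def \<kappa>_def tens_sc1 del: sc_single rem.simps)
    also have "rem b i (j # y) = FW j (rem b i y) + sc (\<delta> * qint (qi i) (wtw b y i)) (bs y)"
      by (simp add: \<delta>_def)
    finally show ?thesis unfolding kd_rem[OF i j] xy
      by (simp add: tens_sc1 tens_sc2 tens_add2 pm.scale_right_distrib mult.assoc add.assoc)
  qed
  have R: "lx (fV a b j) (eV a b i w) = sc \<beta> (tens (FW i (rem a j x)) (bs y))
      + sc (\<kappa> * qi j powi (- (wtw b y j + ca j i))) (tens (rem a j x) (rem b i y))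
      + bs (i # x, j # y) + sc \<kappa> (tens (bs x) (FW j (rem b i y))) + sc (\<beta> * \<delta> * qint (qi i) (wtw a x i)) (bs w)"
  proof -
    have "eV a b i w = tens (bs (i # x)) (bs y) + sc \<kappa> (tens (bs x) (rem b i y))"
      by (simp add: eV_def xy \<kappa>_def)
    then have "lx (fV a b j) (eV a b i w) = sc \<beta> (tens (rem a j (i # x)) (bs y)) + bs (i # x, j # y)
        + sc \<kappa> (tens (rem a j x) (kd b j (rem b i y)) + tens (bs x) (FW j (rem b i y)))"
      by (simp only: lx_add lx_sc FV_tens[OF j] kd_bs) (simp add: fw_def \<beta>_def tens_sc2 del: sc_single rem.simps)
    also have "rem a j (i # x) = FW i (rem a j x) + sc (\<delta> * qint (qi i) (wtw a x i)) (bs x)"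
      by (simp add: \<delta>_def)
    finally show ?thesis unfolding kd_rem[OF j i] xy
      by (simp add: tens_sc1 tens_sc2 tens_add1 pm.scale_right_distrib mult.assoc add_ac)
  qed
  \<comment> \<open>What is left for i = j is the commutator in each factor, and
    \<open>qint_tensor\<close> adds the two.\<close>
  have D: "\<kappa> * \<delta> * qint (qi i) (wtw b y i) - \<beta> * \<delta> * qint (qi i) (wtw a x i) = \<delta> * qint (qi i) (wtV a b w i)"
  proof (cases "i = j")
    case True
    have "qint (qi i) (wtV a b w i) = qint (qi i) (- wtw a x i) * qi i powi (- wtw b y i) + qi i powi (- wtw a x i) * qint (qi i) (wtw b y i)"
      unfolding qint_tensor by (simp add: wtV_def xy)
    then show ?thesis using True by (simp add: \<delta>_def \<kappa>_def \<beta>_def qint_minus[unfolded True])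
  qed (simp add: \<delta>_def)
  have S: "X + Y + Z + W + sc s w = X + Y' + Z + W + sc t w + sc u w" if "Y = Y'" "s - t = u"
    for X Y Y' Z W w :: "'i list \<times> 'i list \<Rightarrow>\<^sub>0 qv" and s t u
    using that by (simp add: pm.scale_left_diff_distrib algebra_simps flip: that(2))
  show "lx (eV a b i) (fV a b j w) = lx (fV a b j) (eV a b i w) + (if i = j then sc (qint (qi i) (wtV a b w i)) (bs w) else 0)"
  proof -
    have "lx (eV a b i) (fV a b j w) = lx (fV a b j) (eV a b i w) + sc (\<delta> * qint (qi i) (wtV a b w i)) (bs w)"
      unfolding L R by (rule S[OF arg_cong[OF cross, of "\<lambda>c. sc c _"] D])
    then show ?thesis by (simp add: \<delta>_def del: sc_single split: if_splits)
  qed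
qed

text \<open>The kernel of the tensor product of the two quotient maps.\<close>

definition NV :: "'i list set \<Rightarrow> 'i list set \<Rightarrow> ('i list \<times> 'i list \<Rightarrow>\<^sub>0 qv) set" where
  "NV G G' = pm.span {tens p r | p r. p \<in> NN G \<or> r \<in> NN G'}"

lemma NV_subspace: "pm.subspace (NV G G')" by (simp add: NV_def pm.subspace_span)
lemma NV_tens: "p \<in> NN G \<or> r \<in> NN G' \<Longrightarrow> tens p r \<in> NV G G'"
  unfolding NV_def by (intro pm.span_base) blast
lemma NV_bs: "bs x \<in> NN G \<or> bs y \<in> NN G' \<Longrightarrow> bs (x, y) \<in> NV G G'"
  using NV_tens[of "bs x" G "bs y" G'] by simp
lemma NV_keys: "(\<And>w. w \<in> Poly_Mapping.keys x \<Longrightarrow> bs w \<in> NV G G') \<Longrightarrow> x \<in> NV G G'"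
  using subspace_lin[OF lin_id NV_subspace] by blast

lemmas NV_add = pm.subspace_add[OF NV_subspace] and NV_sc = pm.subspace_scale[OF NV_subspace]
  and NV_diff = pm.subspace_diff[OF NV_subspace] and NV_sum = pm.subspace_sum[OF NV_subspace]
  and NV_0 = pm.subspace_0[OF NV_subspace]

lemma NV_lin:
  assumes f: "lin f" and S: "pm.subspace S" and "\<And>p r. p \<in> NN G \<or> r \<in> NN G' \<Longrightarrow> f (tens p r) \<in> S"
    and "x \<in> NV G G'"
  shows "f x \<in> S"
proof -
  have "pm.subspace {x. f x \<in> S}"
    unfolding pm.subspace_def mem_Collect_eq lin_0[OF f] lin_add[OF f] lin_sc[OF f]
    using S unfolding pm.subspace_def by blast
  then have "NV G G' \<subseteq> {x. f x \<in> S}" unfolding NV_def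
    by (intro pm.span_minimal) (use assms(3) in auto)
  then show ?thesis using assms(4) by blast
qed

end

locale tensor_rep = finite_cartan I fm for I :: "'i set" and fm +
  fixes a b :: "'i \<Rightarrow> int" and G G' :: "'i list set"
  assumes rem1: "\<And>x k. x \<in> NN G \<Longrightarrow> k \<in> I \<Longrightarrow> lx (rem a k) x \<in> NN G"
    and rem2: "\<And>x k. x \<in> NN G' \<Longrightarrow> k \<in> I \<Longrightarrow> lx (rem b k) x \<in> NN G'"
    and G0: "G0 \<subseteq> G" "G0 \<subseteq> G'"
begin

sublocale T: wrep I fm "wtV a b" "eV a b" "fV a b" by (rule wrepT)

abbreviation "EV i \<equiv> lx (eV a b i)"
abbreviation "FV i \<equiv> lx (fV a b i)"
abbreviation "N \<equiv> NV G G'"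

lemma N_EV: "x \<in> N \<Longrightarrow> i \<in> I \<Longrightarrow> EV i x \<in> N"
  by (rule NV_lin[OF lin_lx NV_subspace])
    (auto simp: EV_tens kd_def intro!: NV_add NV_tens intro: NN_f NN_diag rem2)

lemma N_FV: "x \<in> N \<Longrightarrow> i \<in> I \<Longrightarrow> FV i x \<in> N"
  by (rule NV_lin[OF lin_lx NV_subspace])
    (auto simp: FV_tens kd_def intro!: NV_add NV_tens intro: NN_f NN_diag rem1)

lemma N_junk: "\<not> set x \<subseteq> I \<or> \<not> set y \<subseteq> I \<Longrightarrow> bs (x, y) \<in> N"
  using G0 by (intro NV_bs) (auto simp: G0_def intro: NN_G)

lemma FV_outside: "i \<notin> I \<Longrightarrow> FV i x \<in> N"
  by (rule subspace_lin[OF lin_lx NV_subspace]) (auto simp: fV_def intro!: N_junk)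

abbreviation "SF \<equiv> T.serreF"
definition "SE = wrep.serreF fm (eV a b)"

lemma lin_SE: "lin (SE i j)"
  unfolding SE_def by (rule wrep.lin_serreF[OF T.wrep_mirror])

lemma SE_commute: "i \<in> I \<Longrightarrow> j \<in> I \<Longrightarrow> i \<noteq> j \<Longrightarrow> k \<in> I \<Longrightarrow> FV k (SE i j x) = SE i j (FV k x)"
  unfolding SE_def by (rule wrep.serre_commute[OF T.wrep_mirror])

lemma SE_def': "SE i j x = (\<Sum>s\<le>nat (1 - ca i j). sc (serre_coeff (qi i) (nat (1 - ca i j)) s)
     ((EV i ^^ s) (EV j ((EV i ^^ (nat (1 - ca i j) - s)) x))))"
  unfolding SE_def by (rule wrep.serreF_def[OF T.wrep_mirror])

lemma FV_nil: "i \<in> I \<Longrightarrow> FV i (tens (bs []) r) = tens (bs []) (FW i r)"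
  by (simp add: FV_tens tens_01)

lemma FV_nil_pow: "i \<in> I \<Longrightarrow> (FV i ^^ n) (tens (bs []) r) = tens (bs []) ((FW i ^^ n) r)"
  by (induction n) (auto simp: FV_nil)

lemma EV_nil: "EV i (tens p (bs [])) = tens (FW i p) (bs [])"
  by (simp add: EV_tens tens_02)

lemma EV_nil_pow: "(EV i ^^ n) (tens p (bs [])) = tens ((FW i ^^ n) p) (bs [])"
  by (induction n) (auto simp: EV_nil)

text \<open>On ([], y) the F_i act through the second factor alone, where Serre vectors lie in the
  submodule. Since E_k takes (x, y) to (k # x, y) up to terms with the same x, and commutes with the
  Serre element, induction on x reaches all pairs.\<close>

lemma SF_in_N:
  assumes i: "i \<in> I" and j: "j \<in> I" and ij: "i \<noteq> j"
  shows "SF i j z \<in> N"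
proof -
  have stable: "SF i j z \<in> N" if "z \<in> N" for z
  proof -
    have pw: "(FV i ^^ n) z \<in> N" if "z \<in> N" for n z using that by (induction n) (auto intro: N_FV i)
    then show ?thesis unfolding T.serreF_def using that i j by (intro NV_sum NV_sc pw N_FV)
  qed
  have "SF i j (bs (x, y)) \<in> N" for x y
  proof (induction x arbitrary: y)
    case Nil
    have "SF i j (tens (bs []) (bs y)) = tens (bs []) (serreW i j (bs y))"
      unfolding T.serreF_def serreW_def FV_nil_pow[OF i] FV_nil[OF j] lin_sum[OF lin_tens2] tens_sc2 ..
    then show ?case using NV_tens[of "bs []" G "serreW i j (bs y)" G'] NN_serre[OF i j ij] by simp
  next
    case (Cons k x)
    show ?case
    proof (cases "k \<in> I")
      case False
      then show ?thesis by (intro stable N_junk) auto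
    next
      case k: True
      have "bs (k # x, y) = EV k (bs (x, y)) - sc (qi k powi (- wtw a x k)) (tens (bs x) (rem b k y))"
        by (simp add: eV_def)
      then have "SF i j (bs (k # x, y)) = EV k (SF i j (bs (x, y))) - sc (qi k powi (- wtw a x k)) (SF i j (tens (bs x) (rem b k y)))"
        by (simp only: lin_diff[OF T.lin_serreF] lin_sc[OF T.lin_serreF] T.serre_commute[OF i j ij k])
      moreover have "SF i j (tens (bs x) (rem b k y)) \<in> N"
        by (rule subspace_lin[where f = "\<lambda>r. SF i j (tens (bs x) r)", OF lin_comp[OF T.lin_serreF lin_tens2] NV_subspace]) (simp add: Cons.IH)
      ultimately show ?thesis using Cons.IH N_EV[OF _ k] by (auto intro!: NV_diff NV_sc)
    qed
  qed
  then have "SF i j (bs w) \<in> N" for w by (cases w) simp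
  then show ?thesis by (rule subspace_lin[OF T.lin_serreF NV_subspace])
qed

text \<open>The mirror image of \<open>SF_in_N\<close>: on (x, []) the E_i act through the first
  factor alone, and the F_k build up y.\<close>

lemma SE_in_N:
  assumes i: "i \<in> I" and j: "j \<in> I" and ij: "i \<noteq> j"
  shows "SE i j z \<in> N"
proof -
  have stable: "SE i j z \<in> N" if "z \<in> N" for z
  proof -
    have pw: "(EV i ^^ n) z \<in> N" if "z \<in> N" for n z using that by (induction n) (auto intro: N_EV i)
    then show ?thesis unfolding SE_def' using that i j by (intro NV_sum NV_sc pw N_EV)
  qed
  have "SE i j (bs (x, y)) \<in> N" for x y
  proof (induction y arbitrary: x)
    case Nil
    have "SE i j (tens (bs x) (bs [])) = tens (serreW i j (bs x)) (bs [])"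
      unfolding SE_def' serreW_def EV_nil_pow EV_nil lin_sum[OF lin_tens1] tens_sc1 ..
    then show ?case using NV_tens[of "serreW i j (bs x)" G "bs []" G'] NN_serre[OF i j ij] by simp
  next
    case (Cons k y)
    show ?case
    proof (cases "k \<in> I")
      case False
      then show ?thesis by (intro stable N_junk) auto
    next
      case k: True
      have "bs (x, k # y) = FV k (bs (x, y)) - sc (qi k powi (- wtw b y k)) (tens (rem a k x) (bs y))"
        using k by (simp add: fV_def)
      then have "SE i j (bs (x, k # y)) = FV k (SE i j (bs (x, y))) - sc (qi k powi (- wtw b y k)) (SE i j (tens (rem a k x) (bs y)))"
        by (simp only: lin_diff[OF lin_SE] lin_sc[OF lin_SE] SE_commute[OF i j ij k])
      moreover have "SE i j (tens (rem a k x) (bs y)) \<in> N"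
        by (rule subspace_lin[where f = "\<lambda>p. SE i j (tens p (bs y))", OF lin_comp[OF lin_SE lin_tens1] NV_subspace]) (simp add: Cons.IH)
      ultimately show ?thesis using Cons.IH N_FV[OF _ k] by (auto intro!: NV_diff NV_sc)
    qed
  qed
  then have "SE i j (bs w) \<in> N" for w by (cases w) simp
  then show ?thesis by (rule subspace_lin[OF lin_SE NV_subspace])
qed

end

section \<open>Triangularity: recovering a combination from its value on the generating
  vector\<close>

context finite_cartan
begin

text \<open>\<open>tau\<close> sends \<open>(x, y)\<close> to \<open>F\<^sub>y E\<^sub>x\<close> applied to the generating vector \<open>([], [])\<close>.\<close>

definition tau :: "('i \<Rightarrow> int) \<Rightarrow> ('i \<Rightarrow> int) \<Rightarrow> ('i list \<times> 'i list \<Rightarrow>\<^sub>0 qv) \<Rightarrow> ('i list \<times> 'i list \<Rightarrow>\<^sub>0 qv)" where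
  "tau a b = lx (\<lambda>(x, y). foldr (\<lambda>i. lx (fV a b i)) y (bs (x, [])))"

text \<open>Each F_i either lengthens y or shortens x, and x stays intact only if the first
  alternative is taken for every letter.\<close>

lemma tau_unitriangular:
  "\<exists>u. foldr (\<lambda>i. lx (fV a b i)) y (bs (x, [])) = bs (x, y) + u \<and>
    (\<forall>(x', y') \<in> Poly_Mapping.keys u. length x' < length x \<and> length y' \<le> length y)"
proof (induction y)
  case (Cons i y)
  then obtain u where u: "foldr (\<lambda>i. lx (fV a b i)) y (bs (x, [])) = bs (x, y) + u"
    "\<forall>(x', y') \<in> Poly_Mapping.keys u. length x' < length x \<and> length y' \<le> length y" by blast
  define w where "w = (if i \<in> I then sc (qi i powi (- wtw b y i)) (tens (rem a i x) (bs y)) else 0)"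
  have "foldr (\<lambda>i. lx (fV a b i)) (i # y) (bs (x, [])) = bs (x, i # y) + (w + lx (fV a b i) u)"
  proof -
    have "fV a b i (x, y) = bs (x, i # y) + w" by (simp add: fV_def w_def)
    then show ?thesis by (simp add: u(1) lx_add add.assoc)
  qed
  moreover have len: "length v < length z" if "v \<in> Poly_Mapping.keys (rem a i z)" for v z
    using arg_cong[OF rem_mset[OF that], of size] by simp
  have "length x' < length x \<and> length y' \<le> Suc (length y)" if "(x', y') \<in> Poly_Mapping.keys (w + lx (fV a b i) u)" for x' y'
  proof -
    have "(x', y') \<in> Poly_Mapping.keys w \<or> (x', y') \<in> Poly_Mapping.keys (lx (fV a b i) u)"
      using that by (rule keys_plusE)
    then show ?thesis
    proof (elim disjE)
      assume "(x', y') \<in> Poly_Mapping.keys w"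
      then have "(x', y') \<in> Poly_Mapping.keys (tens (rem a i x) (bs y))"
        unfolding w_def by (auto dest: keys_scE split: if_splits)
      then show ?thesis using keys_tens[of "(x', y')"] len[of x' x] by fastforce
    next
      assume "(x', y') \<in> Poly_Mapping.keys (lx (fV a b i) u)"
      then obtain x2 y2 where 2: "(x2, y2) \<in> Poly_Mapping.keys u" "(x', y') \<in> Poly_Mapping.keys (fV a b i (x2, y2))"
        using keys_lx by (metis prod.exhaust)
      have "length x2 < length x" "length y2 \<le> length y" using u(2) 2(1) by auto
      then show ?thesis using keys_fV[OF 2(2)] len[of x' x2] by auto
    qed
  qed
  ultimately show ?case by auto
qed simp

lemma tensor_rep_G0: "tensor_rep I fm a b G0 G0"
  by unfold_locales (auto intro: NN_G0_rem)

lemma tensor_rep_Gb: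
  assumes "\<And>i. i \<in> I \<Longrightarrow> a i = int (c i)" "\<And>i. i \<in> I \<Longrightarrow> b i = int (c' i)"
  shows "tensor_rep I fm a b (Gb c) (Gb c')"
proof unfold_locales
  show "lx (rem a k) x \<in> NN (Gb c)" if "x \<in> NN (Gb c)" "k \<in> I" for x k
    by (rule NN_Gb_rem[OF assms(1) that])
  show "lx (rem b k) x \<in> NN (Gb c')" if "x \<in> NN (Gb c')" "k \<in> I" for x k
    by (rule NN_Gb_rem[OF assms(2) that])
qed (auto simp: Gb_def)

text \<open>Combinations of words in the F_i that vanish in the Verma module act as zero on every
  vector of the tensor product, because the Serre relations hold there.\<close>

lemma actF_in_N:
  assumes "r \<in> NN G0"
  shows "lx (\<lambda>y. foldr (\<lambda>i. lx (fV a b i)) y z) r \<in> NV G0 G0"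
proof -
  interpret tensor_rep I fm a b G0 G0 by (rule tensor_rep_G0)
  let ?act = "\<lambda>r. lx (\<lambda>y. foldr FV y z) r"
  show ?thesis using assms
  proof (induction rule: NN.induct)
    case NN_0 then show ?case by (simp add: lx_0 NV_0)
  next
    case (NN_add x y) then show ?case by (simp add: lx_add NV_add)
  next
    case (NN_sc x c) then show ?case by (simp add: lx_sc NV_sc)
  next
    case (NN_f x i)
    have "?act (FW i x) = FV i (?act x)"
      unfolding lin_lx_apply[OF lin_lx] by (simp add: fw_def)
    then show ?case using NN_f N_FV by simp
  next
    case (NN_G w)
    then have "\<not> set w \<subseteq> I" by (simp add: G0_def)
    then have "foldr FV w z \<in> N"
    proof (induction w)
      case (Cons j w)
      then show ?case by (cases "j \<in> I") (auto intro: FV_outside N_FV)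
    qed simp
    then show ?case by simp
  next
    case (NN_S i j w)
    have pow: "foldr FV (replicate n i) y = (FV i ^^ n) y" for n y by (induction n) auto
    have "?act (serreW i j (bs w)) = SF i j (foldr FV w z)"
      unfolding serreW_bs T.serreF_def lx_sum lx_sc by (simp add: pow del: sc_single)
    then show ?case using SF_in_N NN_S by simp
  qed
qed

text \<open>An E-part in the Verma submodule is zero modulo N before any F_i is applied, and the F_i
  preserve N. An F-part is covered by \<open>actF_in_N\<close>.\<close>

lemma tau_NV0: assumes "t \<in> NV G0 G0" shows "tau a b t \<in> NV G0 G0"
proof (rule NV_lin[OF _ NV_subspace _ assms])
  interpret tensor_rep I fm a b G0 G0 by (rule tensor_rep_G0)
  show l: "lin (tau a b)" by (simp add: tau_def)
  fix p r :: "'i list \<Rightarrow>\<^sub>0 qv" assume "p \<in> NN G0 \<or> r \<in> NN G0"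
  then show "tau a b (tens p r) \<in> NV G0 G0"
  proof
    assume p: "p \<in> NN G0"
    have lf: "lin (foldr FV y)" for y by (induction y) (auto simp: id_def lin_id comp_def intro: lin_comp)
    have 1: "tau a b (tens p (bs y)) = foldr FV y (tens p (bs []))" for y
      by (rule lin_eqI[where f = "\<lambda>p. tau a b (tens p (bs y))" and g = "\<lambda>p. foldr FV y (tens p (bs []))",
          OF lin_comp[OF l lin_tens1] lin_comp[OF lf lin_tens1]]) (simp add: tau_def)
    have "foldr FV y (tens p (bs [])) \<in> N" for y
    proof (induction y)
      case Nil show ?case using NV_tens p by simp
    next
      case (Cons j y) then show ?case by (cases "j \<in> I") (auto intro: FV_outside N_FV)
    qed
    note f = this
    show ?thesis
      by (rule subspace_lin[where f = "\<lambda>r. tau a b (tens p r)", OF lin_comp[OF l lin_tens2] NV_subspace]) (simp only: 1 f)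
  next
    assume r: "r \<in> NN G0"
    have 1: "tau a b (tens (bs x) r) = lx (\<lambda>y. foldr FV y (bs (x, []))) r" for x
      by (rule lin_eqI[where f = "\<lambda>r. tau a b (tens (bs x) r)", OF lin_comp[OF l lin_tens2] lin_lx]) (simp add: tau_def)
    show ?thesis
      by (rule subspace_lin[where f = "\<lambda>p. tau a b (tens p r)", OF lin_comp[OF l lin_tens1] NV_subspace])
        (simp only: 1 actF_in_N[OF r])
  qed
qed

definition prV :: "('i multiset \<Rightarrow> qv) \<Rightarrow> ('i multiset \<Rightarrow> qv) \<Rightarrow> ('i list \<times> 'i list \<Rightarrow>\<^sub>0 qv) \<Rightarrow> ('i list \<times> 'i list \<Rightarrow>\<^sub>0 qv)" where
  "prV g h = lx (\<lambda>(x, y). sc (g (mset x) * h (mset y)) (bs (x, y)))"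

lemma prV_tens: "prV g h (tens p r) = tens (diag g p) (diag h r)"
  by (rule tens_eqI[where f = "\<lambda>p r. prV g h (tens p r)" and g = "\<lambda>p r. tens (diag g p) (diag h r)"])
    (rule lin_comp[OF _ lin_tens1] lin_comp[OF _ lin_tens2] lin_comp[OF lin_tens1 lin_diag] lin_comp[OF lin_tens2 lin_diag]
     | simp add: prV_def diag_bs tens_sc1 tens_sc2 del: sc_single | simp)+

lemma prV_id:
  assumes "\<And>x y. (x, y) \<in> Poly_Mapping.keys z \<Longrightarrow> g (mset x) * h (mset y) = 1"
  shows "prV g h z = z"
  unfolding prV_def
proof (rule lin_eqI[OF lin_lx lin_id])
  fix w assume "w \<in> Poly_Mapping.keys z"
  then show "lx (\<lambda>(x, y). sc (g (mset x) * h (mset y)) (bs (x, y))) (bs w) = bs w"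
    using assms[of "fst w" "snd w"] by (cases w) simp
qed

lemma prV_0:
  assumes "\<And>x y. (x, y) \<in> Poly_Mapping.keys z \<Longrightarrow> g (mset x) * h (mset y) = 0"
  shows "prV g h z = 0"
  unfolding prV_def
proof (rule lin_eqI[OF lin_lx lin_zero])
  fix w assume "w \<in> Poly_Mapping.keys z"
  then show "lx (\<lambda>(x, y). sc (g (mset x) * h (mset y)) (bs (x, y))) (bs w) = 0"
    using assms[of "fst w" "snd w"] by (cases w) simp
qed

text \<open>The parts of t are peeled off from the longest x downwards. In the top length
  \<open>tau\<close> is the identity by triangularity, and the target is graded, so the top part of
  t lies in it and can be subtracted by \<open>tau_NV0\<close>.\<close>

lemma tau_reflects_NV0:
  assumes "tau a b t \<in> NV G0 G0"
  shows "t \<in> NV G0 G0"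
proof -
  have "(\<And>x y. (x, y) \<in> Poly_Mapping.keys t \<Longrightarrow> length x < d) \<Longrightarrow> tau a b t \<in> NV G0 G0 \<Longrightarrow> t \<in> NV G0 G0" for d t
  proof (induction d arbitrary: t)
    case 0
    then have "Poly_Mapping.keys t = {}" by fastforce
    then have "t = 0" by simp
    then show ?case by (simp add: NV_0)
  next
    case (Suc d)
    define pr where "pr = prV (\<lambda>M. if size M = d then 1 else 0) (\<lambda>M. 1)"
    have lp: "lin pr" by (simp add: pr_def prV_def)
    have lt: "lin (tau a b)" by (simp add: tau_def)
    have 1: "pr (tau a b t) = pr t"
    proof (rule lin_eqI[OF lin_comp[OF lp lt] lp])
      fix w assume w: "w \<in> Poly_Mapping.keys t"
      obtain x y where xy: "w = (x, y)" by (cases w)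
      obtain u where u: "foldr (\<lambda>i. lx (fV a b i)) y (bs (x, [])) = bs (x, y) + u"
        "\<forall>(x', y') \<in> Poly_Mapping.keys u. length x' < length x \<and> length y' \<le> length y"
        using tau_unitriangular by blast
      have "pr u = 0" unfolding pr_def
        by (rule prV_0) (use u(2) Suc.prems(1)[of x y] w xy in fastforce)
      then show "pr (tau a b (bs w)) = pr (bs w)" by (simp add: tau_def xy u(1) lin_add[OF lp])
    qed
    have "pr (tau a b t) \<in> NV G0 G0"
      by (rule NV_lin[OF lp NV_subspace _ Suc.prems(2)]) (auto simp: pr_def prV_tens intro!: NV_tens NN_diag)
    then have pt: "pr t \<in> NV G0 G0" by (simp add: 1)
    have "t - pr t \<in> NV G0 G0"
    proof (rule Suc.IH)
      have "tau a b (t - pr t) = tau a b t - tau a b (pr t)" by (rule lin_diff[OF lt])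
      then show "tau a b (t - pr t) \<in> NV G0 G0" using Suc.prems(2) tau_NV0[OF pt] by (auto intro: NV_diff)
      define pr' where "pr' = prV (\<lambda>M::'i multiset. if size M = d then 0 else 1) (\<lambda>M. 1)"
      have "t - pr t = pr' t" unfolding pr_def pr'_def prV_def
        by (rule lin_eqI[OF lin_minus2[OF lin_id lin_lx] lin_lx]) (simp split: prod.splits)
      fix x y assume "(x, y) \<in> Poly_Mapping.keys (t - pr t)"
      then have "(x, y) \<in> Poly_Mapping.keys (pr' t)" using \<open>t - pr t = pr' t\<close> by simp
      then obtain w where w: "w \<in> Poly_Mapping.keys t"
        "(x, y) \<in> Poly_Mapping.keys (case w of (x, y) \<Rightarrow> sc ((if size (mset x) = d then 0 else 1) * 1) (bs (x, y)))"
        unfolding pr'_def prV_def using keys_lx by fast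
      then have "length x \<noteq> d" "(x, y) \<in> Poly_Mapping.keys t"
        by (auto split: prod.splits if_splits)
      then show "length x < d" using Suc.prems(1) by fastforce
    qed
    from NV_add[OF this pt] show ?case by simp
  qed
  moreover have "\<exists>d. \<forall>x y. (x, y) \<in> Poly_Mapping.keys t \<longrightarrow> length x < d"
  proof -
    have "finite ((\<lambda>w. length (fst w)) ` Poly_Mapping.keys t)" by simp
    then obtain d where "\<forall>n\<in>(\<lambda>w. length (fst w)) ` Poly_Mapping.keys t. n < d"
      using finite_nat_set_iff_bounded by blast
    then show ?thesis by force
  qed
  ultimately show ?thesis using assms by blast
qed

text \<open>No word of t, hence none of its image, is longer than d. A cut at d therefore fixes the
  image, while it turns the integrable relations into Verma relations.\<close>

theorem tau_separates:
  assumes len: "\<And>x y. (x, y) \<in> Poly_Mapping.keys t \<Longrightarrow> length x \<le> d \<and> length y \<le> d"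
    and c: "\<And>i. i \<in> I \<Longrightarrow> c i \<ge> d" "\<And>i. i \<in> I \<Longrightarrow> c' i \<ge> d"
    and t: "tau a b t \<in> NV (Gb c) (Gb c')"
  shows "t \<in> NV G0 G0"
proof (rule tau_reflects_NV0)
  define g where "g = (\<lambda>M::'i multiset. if size M > d then 0 else 1 :: qv)"
  have "prV g g (tau a b t) \<in> NV G0 G0"
  proof (rule NV_lin[OF _ NV_subspace _ t])
    show "lin (prV g g)" by (simp add: prV_def)
    fix p r :: "'i list \<Rightarrow>\<^sub>0 qv" assume "p \<in> NN (Gb c) \<or> r \<in> NN (Gb c')"
    moreover have "g M = 0" if "size M > d" for M using that by (simp add: g_def)
    ultimately have "diag g p \<in> NN G0 \<or> diag g r \<in> NN G0"
      using NN_truncate[of d c p g] NN_truncate[of d c' r g] c by blast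
    then show "prV g g (tens p r) \<in> NV G0 G0" unfolding prV_tens by (rule NV_tens)
  qed
  moreover have "prV g g (tau a b t) = tau a b t"
  proof (rule prV_id)
    fix x' y' assume "(x', y') \<in> Poly_Mapping.keys (tau a b t)"
    then obtain x y where xy: "(x, y) \<in> Poly_Mapping.keys t"
      "(x', y') \<in> Poly_Mapping.keys (foldr (\<lambda>i. lx (fV a b i)) y (bs (x, [])))"
      unfolding tau_def by (auto dest!: keys_lx)
    obtain u where u: "foldr (\<lambda>i. lx (fV a b i)) y (bs (x, [])) = bs (x, y) + u"
        "\<forall>(x', y') \<in> Poly_Mapping.keys u. length x' < length x \<and> length y' \<le> length y"
      using tau_unitriangular by blast
    have "(x', y') = (x, y) \<or> (x', y') \<in> Poly_Mapping.keys u" using xy(2) keys_plusE unfolding u(1) by fastforce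
    then have "length x' \<le> d \<and> length y' \<le> d" using u(2) len[OF xy(1)] by fastforce
    then show "g (mset x') * g (mset y') = 1" by (simp add: g_def)
  qed
  ultimately show "tau a b t \<in> NV G0 G0" by simp
qed

lemma NV_cofinite: "\<exists>d. \<forall>x y. length x > d \<or> length y > d \<longrightarrow> bs (x, y) \<in> NV (Gb c) (Gb c')"
proof -
  obtain d1 where "\<forall>w. length w > d1 \<longrightarrow> bs w \<in> NN (Gb c)" using NN_cofinite by blast
  moreover obtain d2 where "\<forall>w. length w > d2 \<longrightarrow> bs w \<in> NN (Gb c')" using NN_cofinite by blast
  ultimately show ?thesis by (intro exI[of _ "max d1 d2"]) (auto intro!: NV_bs)
qed

end

section \<open>Vector spaces, quotients and presented algebras\<close>

lemma Qv_ring_simps[simp]: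
  "carrier Qv_ring = UNIV" "mult Qv_ring = (*)" "one Qv_ring = 1" "zero Qv_ring = 0" "add Qv_ring = (+)"
  by (simp_all add: Qv_ring_def)

lemma cring_Qv_ring: "cring Qv_ring"
proof (rule cringI)
  show "abelian_group Qv_ring"
  proof (rule abelian_groupI)
    fix x :: qv
    show "\<exists>y\<in>carrier Qv_ring. y \<oplus>\<^bsub>Qv_ring\<^esub> x = \<zero>\<^bsub>Qv_ring\<^esub>" by (intro bexI[of _ "- x"]) auto
  qed (auto simp: algebra_simps)
  show "Group.comm_monoid Qv_ring" by (rule comm_monoidI) (auto simp: algebra_simps)
qed (auto simp: algebra_simps)

locale qvspace =
  fixes M :: "(qv, 'b) module" (structure)
  assumes vs: "Module.module Qv_ring M"
begin

sublocale Module.module Qv_ring M by (rule vs)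

lemma sm_closed[simp, intro]: "x \<in> carrier M \<Longrightarrow> c \<odot> x \<in> carrier M" using smult_closed[of c x] by simp
lemma sm_add_l: "x \<in> carrier M \<Longrightarrow> (c + d) \<odot> x = c \<odot> x \<oplus> d \<odot> x" using smult_l_distr[of c d x] by simp
lemma sm_add_r: "x \<in> carrier M \<Longrightarrow> y \<in> carrier M \<Longrightarrow> c \<odot> (x \<oplus> y) = c \<odot> x \<oplus> c \<odot> y"
  using smult_r_distr[of c x y] by simp
lemma sm_assoc: "x \<in> carrier M \<Longrightarrow> (c * d) \<odot> x = c \<odot> (d \<odot> x)" using smult_assoc1[of c d x] by simp
lemma sm_one[simp]: "x \<in> carrier M \<Longrightarrow> 1 \<odot> x = x" using smult_one[of x] by simp
lemma sm_zero_l[simp]: "x \<in> carrier M \<Longrightarrow> 0 \<odot> x = \<zero>" using smult_l_null[of x] by simp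
lemma sm_zero_r[simp]: "c \<odot> \<zero> = \<zero>" using smult_r_null[of c] by simp

lemma sm_minus: assumes x: "x \<in> carrier M" shows "(- 1) \<odot> x = \<ominus> x"
proof -
  have "(- 1) \<odot> x \<oplus> x = (- 1 + 1) \<odot> x" using x by (simp only: sm_add_l sm_one)
  also have "\<dots> = \<zero>" using x by simp
  finally show ?thesis using x by (simp add: minus_equality)
qed

lemma sm_finsum: "finite A \<Longrightarrow> g \<in> A \<rightarrow> carrier M \<Longrightarrow> c \<odot> finsum M g A = (\<Oplus>a\<in>A. c \<odot> g a)"
  using finsum_smult_ldistr[of A c g] by simp

definition sbsp :: "'b set \<Rightarrow> bool" where
  "sbsp N \<longleftrightarrow> N \<subseteq> carrier M \<and> \<zero> \<in> N \<and> (\<forall>x\<in>N. \<forall>y\<in>N. x \<oplus> y \<in> N) \<and> (\<forall>c. \<forall>x\<in>N. c \<odot> x \<in> N)"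

lemma sbsp_finsum: "sbsp N \<Longrightarrow> (\<And>a. a \<in> A \<Longrightarrow> g a \<in> N) \<Longrightarrow> finsum M g A \<in> N"
proof (induction A rule: infinite_finite_induct)
  case (insert a A)
  then have "finsum M g (insert a A) = g a \<oplus> finsum M g A"
    by (intro finsum_insert) (auto simp: sbsp_def)
  then show ?case using insert by (auto simp: sbsp_def)
qed (auto simp: sbsp_def)

lemma lincomb_cong: "(\<And>b. b \<in> TT \<Longrightarrow> c b = d b) \<Longrightarrow> TT \<subseteq> carrier M \<Longrightarrow> lincomb M c TT = lincomb M d TT"
  unfolding lincomb_def by (rule finsum_cong') auto

lemma lincomb_mono_neutral:
  assumes "finite U" "TT \<subseteq> U" "U \<subseteq> carrier M" "\<And>b. b \<in> U - TT \<Longrightarrow> c b = 0"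
  shows "lincomb M c TT = lincomb M c U"
  unfolding lincomb_def
  by (rule add.finprod_mono_neutral_cong_left) (use assms in auto)

lemma lincomb_closed: "TT \<subseteq> carrier M \<Longrightarrow> lincomb M c TT \<in> carrier M"
  unfolding lincomb_def by (rule finsum_closed) auto

lemma lincomb_add:
  assumes "TT \<subseteq> carrier M"
  shows "lincomb M c TT \<oplus> lincomb M d TT = lincomb M (\<lambda>b. c b + d b) TT"
proof -
  have "(\<Oplus>b\<in>TT. (c b + d b) \<odot> b) = (\<Oplus>b\<in>TT. c b \<odot> b \<oplus> d b \<odot> b)"
    using assms by (intro finsum_cong') (auto simp: sm_add_l)
  then show ?thesis unfolding lincomb_def using assms by (subst finsum_addf[symmetric]) auto
qed

lemma lincomb_smult:
  assumes "TT \<subseteq> carrier M" "finite TT"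
  shows "k \<odot> lincomb M c TT = lincomb M (\<lambda>b. k * c b) TT"
proof -
  have "k \<odot> lincomb M c TT = (\<Oplus>b\<in>TT. k \<odot> (c b \<odot> b))"
    unfolding lincomb_def using assms by (intro sm_finsum) auto
  also have "\<dots> = lincomb M (\<lambda>b. k * c b) TT"
    unfolding lincomb_def using assms by (intro finsum_cong') (auto simp: sm_assoc)
  finally show ?thesis .
qed

lemma lincomb_diff_eq:
  assumes TT: "TT \<subseteq> carrier M" "finite TT" and eq: "lincomb M c TT = lincomb M d TT"
  shows "lincomb M (\<lambda>b. c b - d b) TT = \<zero>"
proof -
  have "lincomb M (\<lambda>b. c b - d b) TT = lincomb M c TT \<oplus> (- 1) \<odot> lincomb M d TT"
    using TT by (simp add: lincomb_smult lincomb_add)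
  then show ?thesis using eq TT by (simp add: sm_minus lincomb_closed r_neg)
qed

lemma span_base: assumes "b \<in> S" "S \<subseteq> carrier M" shows "b \<in> lin_span M S"
proof -
  have "lincomb M (\<lambda>_. 1) {b} = b" unfolding lincomb_def
    using assms by (subst finsum_insert) auto
  then show ?thesis unfolding lin_span_def using assms by (intro CollectI exI[of _ "\<lambda>_. 1"] exI[of _ "{b}"]) auto
qed

lemma span_sbsp: assumes S: "S \<subseteq> carrier M" shows "sbsp (lin_span M S)"
  unfolding sbsp_def
proof (intro conjI ballI allI subsetI)
  fix x assume "x \<in> lin_span M S"
  then show "x \<in> carrier M" unfolding lin_span_def using S by (auto intro!: lincomb_closed)
next
  show "\<zero> \<in> lin_span M S" unfolding lin_span_def by (auto intro!: exI[of _ "{}"] simp: lincomb_def)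
next
  fix x y assume "x \<in> lin_span M S" "y \<in> lin_span M S"
  then obtain c TT d U where x: "x = lincomb M c TT" "finite TT" "TT \<subseteq> S" and y: "y = lincomb M d U" "finite U" "U \<subseteq> S"
    unfolding lin_span_def by auto
  \<comment> \<open>A coefficient function may be nonzero outside its index set, so both are cut off
    before passing to the union.\<close>
  define c' where "c' b = (if b \<in> TT then c b else 0)" for b
  define d' where "d' b = (if b \<in> U then d b else 0)" for b
  have "x = lincomb M c' TT" unfolding x(1) using x S by (intro lincomb_cong) (auto simp: c'_def)
  also have "\<dots> = lincomb M c' (TT \<union> U)" using x y S by (intro lincomb_mono_neutral) (auto simp: c'_def)
  finally have x': "x = lincomb M c' (TT \<union> U)" .
  have "y = lincomb M d' U" unfolding y(1) using y S by (intro lincomb_cong) (auto simp: d'_def)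
  also have "\<dots> = lincomb M d' (TT \<union> U)" using x y S by (intro lincomb_mono_neutral) (auto simp: d'_def)
  finally have y': "y = lincomb M d' (TT \<union> U)" .
  have "x \<oplus> y = lincomb M (\<lambda>b. c' b + d' b) (TT \<union> U)" unfolding x' y' using x y S by (intro lincomb_add) auto
  then show "x \<oplus> y \<in> lin_span M S" unfolding lin_span_def using x y by blast
next
  fix k x assume "x \<in> lin_span M S"
  then obtain c TT where x: "x = lincomb M c TT" "finite TT" "TT \<subseteq> S" unfolding lin_span_def by auto
  then have "k \<odot> x = lincomb M (\<lambda>b. k * c b) TT" using S by (simp add: lincomb_smult order_trans)
  then show "k \<odot> x \<in> lin_span M S" unfolding lin_span_def using x by blast
qed

lemma span_minimal: assumes "sbsp V" "S \<subseteq> V" shows "lin_span M S \<subseteq> V"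
proof
  fix x assume "x \<in> lin_span M S"
  then obtain c TT where x: "x = lincomb M c TT" "TT \<subseteq> S" unfolding lin_span_def by auto
  then show "x \<in> V" unfolding x(1) lincomb_def
    by (intro sbsp_finsum[OF assms(1)]) (use assms x in \<open>auto simp: sbsp_def\<close>)
qed

lemma sbsp_abelian_subgroup: assumes "sbsp N" shows "abelian_subgroup N M"
proof (rule abelian_subgroupI3[OF additive_subgroupI abelian_group_axioms])
  show "subgroup N (add_monoid M)"
  proof (rule group.subgroupI)
    show "group (add_monoid M)" by (rule a_group)
    show "N \<subseteq> carrier (add_monoid M)" "N \<noteq> {}" using assms by (auto simp: sbsp_def)
    fix x y assume xy: "x \<in> N" "y \<in> N"
    then show "x \<otimes>\<^bsub>add_monoid M\<^esub> y \<in> N" using assms by (auto simp: sbsp_def)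
    have "inv\<^bsub>add_monoid M\<^esub> x = (- 1) \<odot> x"
      using xy assms sm_minus[of x] by (auto simp: sbsp_def a_inv_def)
    then show "inv\<^bsub>add_monoid M\<^esub> x \<in> N" using xy assms by (auto simp: sbsp_def)
  qed
qed

context
  fixes N assumes N: "sbsp N"
begin

lemma quot_carrier: "carrier (quot_alg M N) = (\<lambda>x. N +> x) ` carrier M"
  by (auto simp: quot_alg_def FactRing_def ring.defs module.defs A_RCOSETS_def RCOSETS_def a_r_coset_def)

lemma quot_zero: "\<zero>\<^bsub>quot_alg M N\<^esub> = N +> \<zero>"
  using N abelian_subgroup.a_rcos_const[OF sbsp_abelian_subgroup[OF N], of \<zero>]
  by (auto simp: quot_alg_def FactRing_def ring.defs module.defs sbsp_def)

lemma quot_add: "x \<in> carrier M \<Longrightarrow> y \<in> carrier M \<Longrightarrow>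
    (N +> x) \<oplus>\<^bsub>quot_alg M N\<^esub> (N +> y) = N +> (x \<oplus> y)"
  using abelian_subgroup.a_rcos_sum[OF sbsp_abelian_subgroup[OF N]]
  by (simp add: quot_alg_def FactRing_def ring.defs module.defs)

lemma quot_eq: assumes "x \<in> carrier M" "y \<in> carrier M"
  shows "N +> x = N +> y \<longleftrightarrow> x \<ominus> y \<in> N"
proof -
  interpret N: abelian_subgroup N M by (rule sbsp_abelian_subgroup[OF N])
  have "x \<in> N +> y \<longleftrightarrow> x \<ominus> y \<in> N" using N.a_rcos_module[OF assms(2,1)] assms by (simp add: minus_eq)
  moreover have "N +> x = N +> y \<longleftrightarrow> x \<in> N +> y"
    using N.a_repr_independence'[of x y] N.a_repr_independenceD[of x y] assms by metis
  ultimately show ?thesis by simp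
qed

lemma mem_coset: "y \<in> N +> x \<longleftrightarrow> (\<exists>n\<in>N. y = n \<oplus> x)"
  by (auto simp: a_r_coset_def r_coset_def)

lemma quot_smult: assumes x: "x \<in> carrier M"
  shows "c \<odot>\<^bsub>quot_alg M N\<^esub> (N +> x) = N +> (c \<odot> x)"
proof -
  have "c \<odot>\<^bsub>quot_alg M N\<^esub> (N +> x) = set_add M N ((\<lambda>x. c \<odot> x) ` (N +> x))"
    by (simp add: quot_alg_def FactRing_def ring.defs module.defs)
  also have "\<dots> = N +> (c \<odot> x)"
  proof (rule subset_antisym; rule subsetI)
    fix y assume "y \<in> set_add M N ((\<lambda>x. c \<odot> x) ` (N +> x))"
    then obtain n m where nm: "n \<in> N" "m \<in> N" "y = n \<oplus> c \<odot> (m \<oplus> x)"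
      by (auto simp: set_add_def set_mult_def mem_coset)
    then have "y = (n \<oplus> c \<odot> m) \<oplus> c \<odot> x" using x N by (auto simp: sbsp_def sm_add_r a_assoc subset_iff)
    then show "y \<in> N +> c \<odot> x" using nm N by (auto simp: mem_coset sbsp_def)
  next
    fix y assume "y \<in> N +> c \<odot> x"
    \<comment> \<open>Writing x as \<zero> \<oplus> x exhibits it as a member of its own coset; this
      also covers the scalar 0.\<close>
    then obtain n where n: "n \<in> N" "y = n \<oplus> c \<odot> (\<zero> \<oplus> x)" using x by (auto simp: mem_coset)
    then show "y \<in> set_add M N ((\<lambda>x. c \<odot> x) ` (N +> x))"
    proof -
      have "\<zero> \<oplus> x \<in> N +> x" using N by (auto simp: mem_coset sbsp_def)
      then have "n \<oplus> c \<odot> (\<zero> \<oplus> x) \<in> set_add M N ((\<lambda>x. c \<odot> x) ` (N +> x))"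
        using n(1) unfolding set_add_def set_mult_def by force
      then show ?thesis using n(2) by simp
    qed
  qed
  finally show ?thesis .
qed

end
end

text \<open>The axioms pass along a surjection compatible with the operations; all quotient
  structures below obtain theirs in this way.\<close>

lemma module_image:
  fixes A :: "(qv, 'a) module" and B :: "(qv, 'b) module"
  assumes A: "Module.module Qv_ring A" and car: "carrier B = h ` carrier A"
    and add: "\<And>x y. x \<in> carrier A \<Longrightarrow> y \<in> carrier A \<Longrightarrow> h x \<oplus>\<^bsub>B\<^esub> h y = h (x \<oplus>\<^bsub>A\<^esub> y)"
    and zero: "\<zero>\<^bsub>B\<^esub> = h \<zero>\<^bsub>A\<^esub>"
    and sm: "\<And>c x. x \<in> carrier A \<Longrightarrow> c \<odot>\<^bsub>B\<^esub> h x = h (c \<odot>\<^bsub>A\<^esub> x)"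
  shows "Module.module Qv_ring B"
proof -
  interpret A: qvspace A by (rule qvspace.intro[OF A])
  have "abelian_group B"
  proof (rule abelian_groupI)
    fix x assume "x \<in> carrier B"
    then obtain a where a: "a \<in> carrier A" "x = h a" using car by auto
    have "h (\<ominus>\<^bsub>A\<^esub> a) \<oplus>\<^bsub>B\<^esub> x = \<zero>\<^bsub>B\<^esub>" using a by (simp add: add zero A.l_neg)
    then show "\<exists>y\<in>carrier B. y \<oplus>\<^bsub>B\<^esub> x = \<zero>\<^bsub>B\<^esub>" using a car by auto
  next
    fix x y assume "x \<in> carrier B" "y \<in> carrier B"
    then obtain a b where ab: "a \<in> carrier A" "b \<in> carrier A" "x = h a" "y = h b" using car by auto
    then show "x \<oplus>\<^bsub>B\<^esub> y = y \<oplus>\<^bsub>B\<^esub> x" by (simp add: add A.a_comm)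
  qed (auto simp: car add zero A.a_assoc)
  then show ?thesis
    by (intro moduleI cring_Qv_ring) (auto simp: car add sm A.sm_add_l A.sm_add_r A.sm_assoc)
qed

lemma assoc_algebra_image:
  fixes A :: "(qv, 'a) module" and B :: "(qv, 'b) module"
  assumes A: "assoc_algebra A" and car: "carrier B = h ` carrier A"
    and add: "\<And>x y. x \<in> carrier A \<Longrightarrow> y \<in> carrier A \<Longrightarrow> h x \<oplus>\<^bsub>B\<^esub> h y = h (x \<oplus>\<^bsub>A\<^esub> y)"
    and zero: "\<zero>\<^bsub>B\<^esub> = h \<zero>\<^bsub>A\<^esub>"
    and sm: "\<And>c x. x \<in> carrier A \<Longrightarrow> c \<odot>\<^bsub>B\<^esub> h x = h (c \<odot>\<^bsub>A\<^esub> x)"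
    and mult: "\<And>x y. x \<in> carrier A \<Longrightarrow> y \<in> carrier A \<Longrightarrow> h x \<otimes>\<^bsub>B\<^esub> h y = h (x \<otimes>\<^bsub>A\<^esub> y)"
    and one: "\<one>\<^bsub>B\<^esub> = h \<one>\<^bsub>A\<^esub>"
  shows "assoc_algebra B"
proof -
  have A': "Module.module Qv_ring A" "Ring.ring A"
    "\<And>c x y. x \<in> carrier A \<Longrightarrow> y \<in> carrier A \<Longrightarrow> (c \<odot>\<^bsub>A\<^esub> x) \<otimes>\<^bsub>A\<^esub> y = c \<odot>\<^bsub>A\<^esub> (x \<otimes>\<^bsub>A\<^esub> y)"
    "\<And>c x y. x \<in> carrier A \<Longrightarrow> y \<in> carrier A \<Longrightarrow> x \<otimes>\<^bsub>A\<^esub> (c \<odot>\<^bsub>A\<^esub> y) = c \<odot>\<^bsub>A\<^esub> (x \<otimes>\<^bsub>A\<^esub> y)"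
    using A by (auto simp: assoc_algebra_def)
  interpret A: qvspace A by (rule qvspace.intro[OF A'(1)])
  interpret Ar: Ring.ring A by (rule A'(2))
  have B: "Module.module Qv_ring B" by (rule module_image[OF A'(1) car add zero sm])
  interpret B: qvspace B by (rule qvspace.intro[OF B])
  have "Ring.ring B"
  proof (rule ringI[OF B.abelian_group_axioms])
    show "Group.monoid B" by (rule monoidI) (auto simp: car mult one Ar.m_assoc)
  qed (auto simp: car mult add Ar.l_distr Ar.r_distr)
  then show ?thesis using B A'(3,4) unfolding assoc_algebra_def by (auto simp: car mult sm)
qed

lemma (in qvspace) quot_module: "sbsp N \<Longrightarrow> Module.module Qv_ring (quot_alg M N)"
  by (rule module_image[OF vs quot_carrier]) (auto simp: quot_add quot_zero quot_smult)

subsection \<open>The free algebra\<close>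

definition FG :: "'g set \<Rightarrow> 'g fpoly set" where
  "FG G = {p. \<forall>w\<in>Poly_Mapping.keys p. set (letters w) \<subseteq> G}"

lemma fscale_sc: "fscale = sc"
  by (intro ext) (simp add: fscale_def sc_def mult_map_scale_conv_mult)

lemma fmon_zero: "letters 0 = []" and fmon_plus: "letters (x + y) = letters x @ letters y"
  by (simp_all add: zero_fmon_def plus_fmon_def)

lemma sc_mult_left: "sc c p * q = sc c (p * q :: 'g fpoly)"
  by (simp add: fscale_sc[symmetric] fscale_def mult.assoc)

lemma lin_mult_right: "lin (\<lambda>p. p * q :: 'g fpoly)"
  by (simp add: lin_def distrib_right sc_mult_left)

lemma mult_single_0: "p * Poly_Mapping.single 0 c = sc c (p :: 'g fpoly)"
  by (rule lin_eqI[OF lin_mult_right lin_scale[OF lin_id]]) (simp add: mult_single sc_single)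

lemma sc_mult_right: "p * sc c q = sc c (p * q :: 'g fpoly)"
  unfolding mult_single_0[symmetric] by (simp add: mult.assoc)

lemma lin_mult_left: "lin (\<lambda>q. p * q :: 'g fpoly)"
  by (simp add: lin_def distrib_left sc_mult_right)

lemma FG_0[simp, intro]: "0 \<in> FG G" by (simp add: FG_def)
lemma FG_1[simp, intro]: "1 \<in> FG G" by (simp add: FG_def fmon_zero)
lemma FG_add[simp, intro]: "p \<in> FG G \<Longrightarrow> q \<in> FG G \<Longrightarrow> p + q \<in> FG G"
  unfolding FG_def by (auto dest!: keys_plusE)
lemma FG_sc[simp, intro]: "p \<in> FG G \<Longrightarrow> sc c p \<in> FG G"
  unfolding FG_def by (auto dest!: keys_scE)
lemma FG_minus[simp, intro]: "p \<in> FG G \<Longrightarrow> - p \<in> FG G"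
  using FG_sc[of p G "- 1"] by simp
lemma FG_diff[simp, intro]: "p \<in> FG G \<Longrightarrow> q \<in> FG G \<Longrightarrow> p - q \<in> FG G"
  using FG_add[of p G "- q"] by simp
lemma FG_sum[intro]: "(\<And>a. a \<in> A \<Longrightarrow> f a \<in> FG G) \<Longrightarrow> sum f A \<in> FG G"
  by (induction A rule: infinite_finite_induct) auto
lemma FG_mult[simp, intro]: assumes "p \<in> FG G" "q \<in> FG G" shows "p * q \<in> FG G"
proof -
  have "set (letters w) \<subseteq> G" if w: "w \<in> Poly_Mapping.keys (p * q)" for w
  proof -
    obtain a b where "w = a + b" "a \<in> Poly_Mapping.keys p" "b \<in> Poly_Mapping.keys q"
      using keys_mult[of p q] w by blast
    then show ?thesis using assms by (auto simp: FG_def fmon_plus)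
  qed
  then show ?thesis by (auto simp: FG_def)
qed
lemma FG_pow[simp, intro]: "p \<in> FG G \<Longrightarrow> p ^ n \<in> FG G" by (induction n) auto
lemma FG_fgen[simp, intro]: "g \<in> G \<Longrightarrow> fgen g \<in> FG G" by (auto simp: FG_def fgen_def)
lemma FG_bs: "set (letters w) \<subseteq> G \<Longrightarrow> bs w \<in> FG G" by (simp add: FG_def)
lemma FG_prod_list[intro]: "(\<And>x. x \<in> set xs \<Longrightarrow> x \<in> FG G) \<Longrightarrow> prod_list xs \<in> FG G"
  by (induction xs) auto

lemma bs_prod_list: "bs w = prod_list (map fgen (letters w))"
proof (cases w)
  case (FMon xs)
  have "bs (FMon xs) = prod_list (map fgen xs)"
  proof (induction xs)
    case Nil
    then show ?case by (simp add: zero_fmon_def[symmetric])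
  next
    case (Cons x xs)
    have "FMon (x # xs) = FMon [x] + FMon xs" by (simp add: plus_fmon_def)
    then have "bs (FMon (x # xs)) = fgen x * bs (FMon xs)" by (simp only: fgen_def mult_single mult_1)
    then show ?case using Cons by simp
  qed
  then show ?thesis by (simp add: FMon)
qed

lemma free_alg_simps[simp]:
  "carrier (free_alg G) = FG G" "mult (free_alg G) = (*)" "one (free_alg G) = 1"
  "zero (free_alg G) = 0" "add (free_alg G) = (+)" "smult (free_alg G) = sc"
  by (simp_all add: free_alg_def FG_def fscale_sc)

lemma free_alg_algebra: "assoc_algebra (free_alg G)"
proof -
  have ab: "abelian_group (free_alg G)"
  proof (rule abelian_groupI)
    fix x assume "x \<in> carrier (free_alg G)"
    then show "\<exists>y\<in>carrier (free_alg G). y \<oplus>\<^bsub>free_alg G\<^esub> x = \<zero>\<^bsub>free_alg G\<^esub>"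
      by (intro bexI[of _ "- x"]) auto
  qed (auto simp: algebra_simps)
  have "Ring.ring (free_alg G)"
    by (rule ringI[OF ab monoidI]) (auto simp: algebra_simps)
  moreover have "Module.module Qv_ring (free_alg G)"
    by (rule moduleI[OF cring_Qv_ring ab]) (auto simp: pm.scale_left_distrib pm.scale_right_distrib)
  ultimately show ?thesis by (auto simp: assoc_algebra_def sc_mult_left sc_mult_right)
qed

lemma free_alg_module: "Module.module Qv_ring (free_alg G)" and free_alg_ring: "Ring.ring (free_alg G)"
  using free_alg_algebra[of G] by (auto simp: assoc_algebra_def)

lemma free_alg_minus: "x \<in> FG G \<Longrightarrow> y \<in> FG G \<Longrightarrow> x \<ominus>\<^bsub>free_alg G\<^esub> y = x - y"
proof -
  assume xy: "x \<in> FG G" "y \<in> FG G"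
  interpret Ring.ring "free_alg G" by (rule free_alg_ring)
  have "\<ominus>\<^bsub>free_alg G\<^esub> y = - y" using xy by (intro minus_equality) auto
  then show ?thesis by (simp add: minus_eq)
qed

text \<open>Substitution of polynomials for the generators. Maps between presented algebras are
  computed through it on representatives.\<close>

definition fsub :: "('g \<Rightarrow> 'h fpoly) \<Rightarrow> 'g fpoly \<Rightarrow> 'h fpoly" where
  "fsub \<psi> = lx (\<lambda>w. prod_list (map \<psi> (letters w)))"

lemma lin_fsub: "lin (fsub \<psi>)" by (simp add: fsub_def)
lemmas fsub_add = lin_add[OF lin_fsub] and fsub_sc = lin_sc[OF lin_fsub] and fsub_0 = lin_0[OF lin_fsub]
  and fsub_diff = lin_diff[OF lin_fsub] and fsub_sum = lin_sum[OF lin_fsub] and fsub_minus = lin_minus[OF lin_fsub]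
lemma fsub_1[simp]: "fsub \<psi> 1 = 1"
proof -
  have "fsub \<psi> (bs 0) = 1" unfolding fsub_def by (simp add: fmon_zero del: single_one)
  then show ?thesis by simp
qed
lemma fsub_fgen[simp]: "fsub \<psi> (fgen g) = \<psi> g" by (simp add: fsub_def fgen_def)

lemma fsub_mult: "fsub \<psi> (p * q) = fsub \<psi> p * fsub \<psi> q"
  by (rule tens_eqI[where f = "\<lambda>p q. fsub \<psi> (p * q)" and g = "\<lambda>p q. fsub \<psi> p * fsub \<psi> q"])
    (rule lin_comp[OF lin_fsub lin_mult_right] lin_comp[OF lin_fsub lin_mult_left]
      lin_comp[OF lin_mult_right lin_fsub] lin_comp[OF lin_mult_left lin_fsub]
      | simp add: mult_single fsub_def fmon_plus)+

lemma fsub_pow: "fsub \<psi> (p ^ n) = fsub \<psi> p ^ n"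
  by (induction n) (auto simp: fsub_mult)

lemma fsub_FG: assumes "p \<in> FG G" "\<And>g. g \<in> G \<Longrightarrow> \<psi> g \<in> FG H" shows "fsub \<psi> p \<in> FG H"
proof -
  have "prod_list (map \<psi> (letters w)) \<in> FG H" if "w \<in> Poly_Mapping.keys p" for w
  proof (rule FG_prod_list)
    fix x assume "x \<in> set (map \<psi> (letters w))"
    moreover have "set (letters w) \<subseteq> G" using that assms(1) by (auto simp: FG_def)
    ultimately show "x \<in> FG H" using assms(2) by auto
  qed
  then show ?thesis unfolding fsub_def lx_def by (intro FG_sum FG_sc)
qed

subsection \<open>Presented algebras\<close>

text \<open>Two-sided ideals of the free algebra freed from records; closure under negation and
  scalars follows since \<open>FG G\<close> contains the constants.\<close>

definition idealp :: "'g set \<Rightarrow> 'g fpoly set \<Rightarrow> bool" where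
  "idealp G J \<longleftrightarrow> J \<subseteq> FG G \<and> 0 \<in> J \<and> (\<forall>x\<in>J. \<forall>y\<in>J. x + y \<in> J) \<and>
     (\<forall>x\<in>J. \<forall>p\<in>FG G. p * x \<in> J \<and> x * p \<in> J)"

lemma ideal_free_alg: "ideal J (free_alg G) \<longleftrightarrow> idealp G J"
proof
  assume "ideal J (free_alg G)"
  then interpret J: ideal J "free_alg G" .
  show "idealp G J" unfolding idealp_def
  proof (intro conjI ballI)
    show "J \<subseteq> FG G" using additive_subgroup.a_subset[OF J.is_additive_subgroup] unfolding free_alg_simps .
    show "0 \<in> J" using additive_subgroup.zero_closed[OF J.is_additive_subgroup] unfolding free_alg_simps .
    show "x + y \<in> J" if "x \<in> J" "y \<in> J" for x y using additive_subgroup.a_closed[OF J.is_additive_subgroup that] unfolding free_alg_simps .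
    fix x p assume x: "x \<in> J" "p \<in> FG G"
    then have p: "p \<in> carrier (free_alg G)" by simp
    show "p * x \<in> J" using J.I_l_closed[OF x(1) p] unfolding free_alg_simps .
    show "x * p \<in> J" using J.I_r_closed[OF x(1) p] unfolding free_alg_simps .
  qed
next
  assume J: "idealp G J"
  show "ideal J (free_alg G)"
  proof (rule idealI[OF free_alg_ring])
    show "subgroup J (add_monoid (free_alg G))"
    proof (rule group.subgroupI)
      show "group (add_monoid (free_alg G))"
        by (rule abelian_group.a_group[OF ring.is_abelian_group[OF free_alg_ring]])
      show "J \<subseteq> carrier (add_monoid (free_alg G))" "J \<noteq> {}" using J by (auto simp: idealp_def)
      fix x y assume xy: "x \<in> J" "y \<in> J"
      then show "x \<otimes>\<^bsub>add_monoid (free_alg G)\<^esub> y \<in> J" using J by (auto simp: idealp_def)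
      interpret Ring.ring "free_alg G" by (rule free_alg_ring)
      have x: "x \<in> FG G" using J xy by (auto simp: idealp_def)
      have "\<ominus>\<^bsub>free_alg G\<^esub> x = - x" using x by (intro minus_equality) auto
      then have "inv\<^bsub>add_monoid (free_alg G)\<^esub> x = (- 1) * x" by (simp add: a_inv_def)
      moreover have "- 1 \<in> FG G" by (rule FG_minus) simp
      then have "(- 1) * x \<in> J" using J xy unfolding idealp_def by blast
      ultimately show "inv\<^bsub>add_monoid (free_alg G)\<^esub> x \<in> J" by simp
    qed
  qed (use J in \<open>auto simp: idealp_def\<close>)
qed

lemma idealp_sc: assumes "idealp G J" "x \<in> J" shows "sc c x \<in> J"
proof -
  have "sc c x = sc c 1 * x" by (simp add: sc_mult_left)
  moreover have "sc c 1 \<in> FG G" by simp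
  ultimately show ?thesis using assms by (metis idealp_def)
qed

lemma idealp_minus: "idealp G J \<Longrightarrow> x \<in> J \<Longrightarrow> - x \<in> J"
  using idealp_sc[of G J x "- 1"] by simp

lemma idealp_diff: "idealp G J \<Longrightarrow> x \<in> J \<Longrightarrow> y \<in> J \<Longrightarrow> x - y \<in> J"
  using idealp_minus[of G J y] unfolding idealp_def by (metis uminus_add_conv_diff add.commute)

lemma idealp_sum: "idealp G J \<Longrightarrow> (\<And>a. a \<in> A \<Longrightarrow> f a \<in> J) \<Longrightarrow> sum f A \<in> J"
  by (induction A rule: infinite_finite_induct) (auto simp: idealp_def)

lemma idealp_pullback:
  assumes J: "idealp H J" and \<psi>: "\<And>g. g \<in> G \<Longrightarrow> \<psi> g \<in> FG H"
  shows "idealp G {p \<in> FG G. fsub \<psi> p \<in> J}"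
proof -
  have "fsub \<psi> p \<in> FG H" if "p \<in> FG G" for p using that \<psi> by (rule fsub_FG)
  then show ?thesis using J unfolding idealp_def by (auto simp: fsub_0 fsub_add fsub_mult)
qed

locale presentation =
  fixes G :: "'g set" and R :: "'g fpoly set"
  assumes R_FG: "R \<subseteq> FG G"
begin

definition "PI = Idl\<^bsub>free_alg G\<^esub> R"
abbreviation "PA \<equiv> presented_alg G R"
abbreviation "cl \<equiv> presented_class G R"

interpretation fr: Ring.ring "free_alg G" by (rule free_alg_ring)
interpretation fv: qvspace "free_alg G" by (rule qvspace.intro[OF free_alg_module])

lemma PI_ideal: "ideal PI (free_alg G)"
  unfolding PI_def by (rule fr.genideal_ideal) (simp add: R_FG)

lemma PI_idealp: "idealp G PI" using PI_ideal by (simp add: ideal_free_alg)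

lemma PI_FG: "x \<in> PI \<Longrightarrow> x \<in> FG G" and PI_0: "0 \<in> PI"
  and PI_add: "x \<in> PI \<Longrightarrow> y \<in> PI \<Longrightarrow> x + y \<in> PI"
  and PI_l: "x \<in> PI \<Longrightarrow> p \<in> FG G \<Longrightarrow> p * x \<in> PI"
  and PI_r: "x \<in> PI \<Longrightarrow> p \<in> FG G \<Longrightarrow> x * p \<in> PI"
  using PI_idealp by (auto simp: idealp_def)

lemmas PI_sc = idealp_sc[OF PI_idealp] and PI_minus = idealp_minus[OF PI_idealp]
  and PI_diff = idealp_diff[OF PI_idealp] and PI_sum = idealp_sum[OF PI_idealp]

lemma PI_R: "r \<in> R \<Longrightarrow> r \<in> PI"
  using fr.genideal_self[of R] R_FG by (auto simp: PI_def)

lemma PI_minimal: "idealp G J \<Longrightarrow> R \<subseteq> J \<Longrightarrow> PI \<subseteq> J"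
  unfolding PI_def by (rule fr.genideal_minimal) (simp_all add: ideal_free_alg)

lemma PI_sbsp: "fv.sbsp PI"
  using PI_FG PI_0 PI_add PI_sc by (auto simp: fv.sbsp_def)

lemma PA_eq: "PA = quot_alg (free_alg G) PI" by (simp add: presented_alg_def PI_def)
lemma cl_eq: "cl p = PI +>\<^bsub>free_alg G\<^esub> p" by (simp add: presented_class_def PI_def)

lemma PA_carrier: "carrier PA = cl ` FG G"
  unfolding PA_eq fv.quot_carrier[OF PI_sbsp] by (auto simp: cl_eq)

lemma cl_closed[simp]: "p \<in> FG G \<Longrightarrow> cl p \<in> carrier PA" by (simp add: PA_carrier)

lemma PA_E: assumes "a \<in> carrier PA" obtains p where "p \<in> FG G" "a = cl p"
  using assms PA_carrier by auto

lemma cl_iff: "p \<in> FG G \<Longrightarrow> q \<in> FG G \<Longrightarrow> cl p = cl q \<longleftrightarrow> p - q \<in> PI"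
  unfolding cl_eq using fv.quot_eq[OF PI_sbsp, of p q] by (simp add: free_alg_minus)

lemma PA_add: "p \<in> FG G \<Longrightarrow> q \<in> FG G \<Longrightarrow> cl p \<oplus>\<^bsub>PA\<^esub> cl q = cl (p + q)"
  unfolding PA_eq cl_eq using fv.quot_add[OF PI_sbsp] by simp
lemma PA_zero: "\<zero>\<^bsub>PA\<^esub> = cl 0"
  unfolding PA_eq cl_eq using fv.quot_zero[OF PI_sbsp] by simp
lemma PA_smult: "p \<in> FG G \<Longrightarrow> c \<odot>\<^bsub>PA\<^esub> cl p = cl (sc c p)"
  unfolding PA_eq cl_eq using fv.quot_smult[OF PI_sbsp] by simp
lemma PA_mult: "p \<in> FG G \<Longrightarrow> q \<in> FG G \<Longrightarrow> cl p \<otimes>\<^bsub>PA\<^esub> cl q = cl (p * q)"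
  unfolding PA_eq cl_eq quot_alg_def using ideal.rcoset_mult_add[OF PI_ideal, of p q]
  by (simp add: FactRing_def ring.defs module.defs)
lemma PA_one: "\<one>\<^bsub>PA\<^esub> = cl 1"
  unfolding PA_eq cl_eq quot_alg_def by (simp add: FactRing_def ring.defs module.defs)

lemma cl_zero_iff: "p \<in> FG G \<Longrightarrow> cl p = \<zero>\<^bsub>PA\<^esub> \<longleftrightarrow> p \<in> PI"
  unfolding PA_zero using cl_iff[of p 0] by simp

lemma PA_algebra: "assoc_algebra PA"
  by (rule assoc_algebra_image[OF free_alg_algebra, of _ cl])
    (auto simp: PA_carrier PA_add PA_zero PA_smult PA_mult PA_one)

lemma PA_module: "Module.module Qv_ring PA" and PA_ring: "Ring.ring PA"
  using PA_algebra by (auto simp: assoc_algebra_def)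

lemma PA_finsum:
  assumes "finite S" "\<And>a. a \<in> S \<Longrightarrow> f a \<in> FG G"
  shows "finsum PA (\<lambda>a. cl (f a)) S = cl (\<Sum>a\<in>S. f a)"
proof -
  interpret P: Ring.ring PA by (rule PA_ring)
  show ?thesis using assms
  proof (induction S rule: finite_induct)
    case empty then show ?case by (simp add: PA_zero)
  next
    case (insert x S)
    then have "finsum PA (\<lambda>a. cl (f a)) (insert x S) = cl (f x) \<oplus>\<^bsub>PA\<^esub> finsum PA (\<lambda>a. cl (f a)) S"
      by (intro P.finsum_insert) auto
    then show ?case using insert by (simp add: PA_add FG_sum)
  qed
qed

lemma PA_minus: assumes "p \<in> FG G" "q \<in> FG G" shows "cl p \<ominus>\<^bsub>PA\<^esub> cl q = cl (p - q)"
proof -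
  interpret P: Ring.ring PA by (rule PA_ring)
  have "\<ominus>\<^bsub>PA\<^esub> cl q = cl (- q)" using assms by (intro P.minus_equality) (auto simp: PA_add PA_zero)
  then show ?thesis using assms by (simp add: P.minus_eq PA_add)
qed

lemma free_lift_cl:
  assumes p: "p \<in> FG H" and \<psi>: "\<And>h. h \<in> H \<Longrightarrow> \<psi> h \<in> FG G" and \<phi>: "\<And>h. h \<in> H \<Longrightarrow> \<phi> h = cl (\<psi> h)"
  shows "free_lift PA \<phi> p = cl (fsub \<psi> p)"
proof -
  interpret P: qvspace PA by (rule qvspace.intro[OF PA_module])
  have w: "foldr (\<lambda>g x. \<phi> g \<otimes>\<^bsub>PA\<^esub> x) ws \<one>\<^bsub>PA\<^esub> = cl (prod_list (map \<psi> ws)) \<and> prod_list (map \<psi> ws) \<in> FG G"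
    if "set ws \<subseteq> H" for ws
    using that by (induction ws) (auto simp: PA_one PA_mult \<phi> \<psi>)
  have k: "set (letters w) \<subseteq> H" if "w \<in> Poly_Mapping.keys p" for w using p that by (auto simp: FG_def)
  have "free_lift PA \<phi> p = finsum PA (\<lambda>w. cl (sc (Poly_Mapping.lookup p w) (prod_list (map \<psi> (letters w))))) (Poly_Mapping.keys p)"
    unfolding free_lift_def by (rule P.finsum_cong') (use w k in \<open>auto simp: PA_smult\<close>)
  also have "\<dots> = cl (fsub \<psi> p)" unfolding fsub_def lx_def
    by (rule PA_finsum) (use w k in auto)
  finally show ?thesis .
qed

end

text \<open>\<open>presented_lift\<close> evaluates on a whole coset, so its image must be shown to
  be a single point: the relations, hence the ideal they generate, are sent into the ideal of the
  target.\<close>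

lemma presented_lift_cl:
  assumes P: "presentation G R" and Q: "presentation H S" and p: "p \<in> FG H"
    and \<psi>: "\<And>h. h \<in> H \<Longrightarrow> \<psi> h \<in> FG G" and \<phi>: "\<And>h. h \<in> H \<Longrightarrow> \<phi> h = presented_class G R (\<psi> h)"
    and rel: "\<And>r. r \<in> S \<Longrightarrow> fsub \<psi> r \<in> presentation.PI G R"
  shows "presented_lift (presented_alg G R) \<phi> (presented_class H S p) = presented_class G R (fsub \<psi> p)"
proof -
  interpret P: presentation G R by (rule P)
  interpret Q: presentation H S by (rule Q)
  have "Q.PI \<subseteq> {p \<in> FG H. fsub \<psi> p \<in> P.PI}"
    by (rule Q.PI_minimal[OF idealp_pullback[OF P.PI_idealp \<psi>]]) (use rel Q.R_FG in auto)
  then have n: "fsub \<psi> n \<in> P.PI" if "n \<in> Q.PI" for n using that by blast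
  have e: "free_lift (presented_alg G R) \<phi> (n + p) = presented_class G R (fsub \<psi> p)" if "n \<in> Q.PI" for n
  proof -
    have "free_lift (presented_alg G R) \<phi> (n + p) = presented_class G R (fsub \<psi> (n + p))"
      using Q.PI_FG[OF that] p by (intro P.free_lift_cl[OF _ \<psi> \<phi>]) auto
    also have "\<dots> = presented_class G R (fsub \<psi> p)"
      using n[OF that] Q.PI_FG[OF that] p by (subst P.cl_iff) (auto simp: fsub_add intro!: fsub_FG[OF _ \<psi>])
    finally show ?thesis .
  qed
  have "free_lift (presented_alg G R) \<phi> ` presented_class H S p = {presented_class G R (fsub \<psi> p)}"
  proof -
    have "presented_class H S p = {n + p | n. n \<in> Q.PI}"
      unfolding Q.cl_eq by (auto simp: a_r_coset_def r_coset_def)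
    then show ?thesis using e Q.PI_0 by auto
  qed
  then show ?thesis by (simp add: presented_lift_def)
qed

section \<open>Weights\<close>

lemma zsmul_0[simp]: "zsmul 0 x = 0" by (simp add: zsmul_def)

lemma zsmul_add_1: "zsmul (n + 1) x = zsmul n x + x"
proof (cases "n \<ge> 0")
  case True
  then have "nat (n + 1) = Suc (nat n)" "nat (- n) = 0" "nat (- (n + 1)) = 0" by auto
  then show ?thesis by (simp add: zsmul_def)
next
  case False
  then have "nat (- n) = Suc (nat (- (n + 1)))" "nat n = 0" "nat (n + 1) = 0" by auto
  then show ?thesis by (simp add: zsmul_def)
qed

lemma zsmul_1[simp]: "zsmul 1 x = x" using zsmul_add_1[of 0 x] by simp

lemma zsmul_add: "zsmul (m + n) x = zsmul m x + zsmul n x"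
proof (induction n rule: int_induct[where k = 0])
  case (step1 i)
  then show ?case using zsmul_add_1[of "m + i" x] zsmul_add_1[of i x] by (simp add: add.assoc)
next
  case (step2 i)
  have "zsmul (m + i) x = zsmul (m + (i - 1)) x + x" using zsmul_add_1[of "m + (i - 1)" x] by (simp add: algebra_simps)
  moreover have "zsmul i x = zsmul (i - 1) x + x" using zsmul_add_1[of "i - 1" x] by simp
  ultimately show ?case using step2 by (metis add.assoc add_right_cancel)
qed simp

lemma zsmul_minus: "zsmul (- n) x = - zsmul n x"
  using zsmul_add[of "- n" n x] by (simp add: eq_neg_iff_add_eq_0)

lemma additive_zsmul: assumes "additive (f :: 'a::ab_group_add \<Rightarrow> int)" shows "f (zsmul n x) = n * f x"
proof -
  interpret additive f by (rule assms)
  show ?thesis by (simp add: zsmul_def diff sum split: nat_diff_split)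
qed

locale rdatum =
  fixes D :: "('i, 'x::ab_group_add, 'y::ab_group_add) root_datum"
  assumes rd: "is_root_datum D" and ft: "finite_type D"
begin

abbreviation "II \<equiv> idx D"
abbreviation "al \<equiv> sroot D"
abbreviation "ch \<equiv> coroot D"
abbreviation "pr \<equiv> pairing D"

sublocale finite_cartan II "form D"
  using rd ft by unfold_locales (auto simp: is_root_datum_def finite_type_def)

lemma pr_add1: "pr (h + h') x = pr h x + pr h' x"
  and pr_add2: "pr h (x + x') = pr h x + pr h x'"
  and pr_zsmul1: "pr (zsmul n h) x = n * pr h x" and pr_zsmul2: "pr h (zsmul n x) = n * pr h x"
proof -
  have a: "additive (\<lambda>h. pr h x)" "additive (pr h)" for x h
    using rd by (auto simp: is_root_datum_def perfect_pairing_def)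
  show "pr (h + h') x = pr h x + pr h' x" by (rule additive.add[OF a(1)])
  show "pr h (x + x') = pr h x + pr h x'" by (rule additive.add[OF a(2)])
  show "pr (zsmul n h) x = n * pr h x" using additive_zsmul[OF a(1)] by simp
  show "pr h (zsmul n x) = n * pr h x" using additive_zsmul[OF a(2)] by simp
qed

lemma pr_0[simp]: "pr 0 x = 0" "pr h 0 = 0" using pr_add1[of 0 0 x] pr_add2[of h 0 0] by simp_all
lemma pr_diff2: "pr h (x - x') = pr h x - pr h x'"
  using pr_add2[of h "x - x'" x'] by simp
lemma pr_sum2: "pr h (sum f A) = (\<Sum>a\<in>A. pr h (f a))"
  by (induction A rule: infinite_finite_induct) (auto simp: pr_add2)

lemma pr_ca: "i \<in> II \<Longrightarrow> j \<in> II \<Longrightarrow> pr (ch i) (al j) = ca i j"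
  using rd by (auto simp: is_root_datum_def ca_def)

lemma vi_qi: "vi D i = qi i" by (simp add: vi_def qi_def dnum_def)

lemma pr_separates: assumes "x \<noteq> x'" shows "\<exists>h. pr h x \<noteq> pr h x'"
proof (rule ccontr)
  assume "\<not> (\<exists>h. pr h x \<noteq> pr h x')"
  then have "(\<lambda>h. pr h x) = (\<lambda>h. pr h x')" by auto
  moreover have "additive (\<lambda>h. pr h x)" by (simp add: additive_def pr_add1)
  then have "\<exists>!z. (\<lambda>h. pr h z) = (\<lambda>h. pr h x)"
    using rd unfolding is_root_datum_def perfect_pairing_def by blast
  ultimately show False using assms by metis
qed

definition wsum :: "('i \<Rightarrow> int) \<Rightarrow> 'x" where "wsum n = (\<Sum>i\<in>II. zsmul (n i) (al i))"

lemma pr_wsum: "i \<in> II \<Longrightarrow> pr (ch i) (wsum n) = (\<Sum>j\<in>II. n j * ca i j)"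
  unfolding wsum_def pr_sum2 by (intro sum.cong refl) (simp add: pr_zsmul2 pr_ca)

lemma wsum_add: "wsum (\<lambda>i. n i + m i) = wsum n + wsum m"
  by (simp add: wsum_def zsmul_add sum.distrib)

lemma wsum_upd: assumes "i \<in> II" shows "wsum (n(i := n i + m)) = wsum n + zsmul m (al i)"
proof -
  have "n(i := n i + m) = (\<lambda>j. n j + (if j = i then m else 0))" by auto
  moreover have "wsum (\<lambda>j. if j = i then m else 0) = (\<Sum>j\<in>II. if j = i then zsmul m (al i) else 0)"
    unfolding wsum_def by (intro sum.cong) auto
  ultimately show ?thesis using assms by (simp add: wsum_add)
qed

text \<open>Linear independence of the simple roots: pairing with the coroots reduces it to
  injectivity of the Cartan matrix.\<close>

lemma wsum_inj: assumes "wsum n = wsum m" "i \<in> II" shows "n i = m i"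
proof -
  have "n i - m i = 0"
  proof (rule ca_inj[OF _ assms(2)])
    fix j assume j: "j \<in> II"
    then have "(\<Sum>k\<in>II. n k * ca j k) = (\<Sum>k\<in>II. m k * ca j k)" using assms(1) pr_wsum by metis
    then show "(\<Sum>k\<in>II. (n k - m k) * ca j k) = 0" by (simp add: left_diff_distrib sum_subtractf)
  qed
  then show ?thesis by simp
qed

text \<open>A reflection moves a weight by a multiple of a root and keeps its norm, which is the
  condition \<open>Qf\<close> = 0. Finiteness of orbits follows from that of the sublevel
  sets.\<close>

lemma weyl_form:
  assumes "w \<in> weyl D"
  shows "\<exists>n. (\<forall>i. i \<notin> II \<longrightarrow> n i = 0) \<and> w \<zeta> = \<zeta> - wsum n \<and> Qf (\<lambda>i. pr (ch i) \<zeta>) n = 0"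
  using assms
proof induction
  case weyl_id
  show ?case by (rule exI[of _ "\<lambda>_. 0"]) (simp add: wsum_def Qf_def)
next
  case (weyl_refl w i)
  define b where "b = (\<lambda>i. pr (ch i) \<zeta>)"
  from weyl_refl obtain n where n: "\<forall>i. i \<notin> II \<longrightarrow> n i = 0" "w \<zeta> = \<zeta> - wsum n" "Qf b n = 0" by (auto simp: b_def)
  define m where "m = wgt b n i"
  have "pr (ch i) (w \<zeta>) = m" using weyl_refl n by (simp add: pr_diff2 pr_wsum m_def wgt_def b_def)
  then have "(simple_refl D i \<circ> w) \<zeta> = \<zeta> - wsum (n(i := n i + m))"
    unfolding wsum_upd[OF weyl_refl(2)] by (simp add: simple_refl_def n(2))
  moreover have "Qf b (n(i := n i + m)) = 0" using Qf_reflect[OF weyl_refl(2)] n(3) by (simp add: m_def)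
  moreover have "\<forall>j. j \<notin> II \<longrightarrow> (n(i := n i + m)) j = 0" using n(1) weyl_refl(2) by auto
  ultimately show ?case unfolding b_def by blast
qed

lemma finite_weyl_orbit: assumes "finite \<pi>" shows "finite (weyl_orbit D \<pi>)"
proof -
  have "weyl_orbit D \<pi> \<subseteq> (\<Union>\<zeta>\<in>\<pi>. (\<lambda>n. \<zeta> - wsum n) ` {n. (\<forall>i. i \<notin> II \<longrightarrow> n i = 0) \<and> Qf (\<lambda>i. pr (ch i) \<zeta>) n \<le> 0})"
  proof
    fix \<mu> assume "\<mu> \<in> weyl_orbit D \<pi>"
    then obtain w \<zeta> where w: "w \<in> weyl D" "\<zeta> \<in> \<pi>" "\<mu> = w \<zeta>" by (auto simp: weyl_orbit_def)
    with weyl_form[OF w(1), of \<zeta>] show "\<mu> \<in> (\<Union>\<zeta>\<in>\<pi>. (\<lambda>n. \<zeta> - wsum n) ` {n. (\<forall>i. i \<notin> II \<longrightarrow> n i = 0) \<and> Qf (\<lambda>i. pr (ch i) \<zeta>) n \<le> 0})"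
      by force
  qed
  then show ?thesis by (rule finite_subset) (use assms finite_Qf in blast)
qed

lemma weyl_orbit_mono: "\<pi> \<subseteq> \<pi>' \<Longrightarrow> weyl_orbit D \<pi> \<subseteq> weyl_orbit D \<pi>'"
  by (auto simp: weyl_orbit_def)

lemma weyl_comp: "w \<in> weyl D \<Longrightarrow> w' \<in> weyl D \<Longrightarrow> w \<circ> w' \<in> weyl D"
proof (induction rule: weyl.induct)
  case (weyl_refl w i)
  then show ?case using weyl.weyl_refl[of "w \<circ> w'" D i] by (simp only: comp_assoc)
qed simp

lemma simple_refl_invol: assumes "i \<in> II" shows "simple_refl D i (simple_refl D i \<zeta>) = \<zeta>"
proof -
  have "pr (ch i) (simple_refl D i \<zeta>) = - pr (ch i) \<zeta>"
    using assms by (simp add: simple_refl_def pr_diff2 pr_zsmul2 pr_ca)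
  then show ?thesis by (simp add: simple_refl_def zsmul_minus)
qed

lemma weyl_inverse: "w \<in> weyl D \<Longrightarrow> \<exists>w'\<in>weyl D. \<forall>\<zeta>. w' (w \<zeta>) = \<zeta>"
proof (induction rule: weyl.induct)
  case weyl_id then show ?case by (intro bexI[of _ id]) (auto intro: weyl.weyl_id)
next
  case (weyl_refl w i)
  then obtain w' where w': "w' \<in> weyl D" "\<forall>\<zeta>. w' (w \<zeta>) = \<zeta>" by blast
  have "simple_refl D i \<circ> id \<in> weyl D" by (intro weyl.intros weyl_refl)
  then have "w' \<circ> (simple_refl D i \<circ> id) \<in> weyl D" by (rule weyl_comp[OF w'(1)])
  then show ?case using w' weyl_refl simple_refl_invol by (intro bexI) auto
qed

text \<open>In the finite set of all n with \<mu> - \<open>wsum n\<close> in the orbit and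
  \<open>Qf\<close> zero, a member with least coordinate sum is dominant: a reflection at a coroot
  with negative pairing would lower the sum.\<close>

lemma dominant_conjugate: "\<exists>\<kappa>\<in>dominant D. \<mu> \<in> weyl_orbit D {\<kappa>}"
proof -
  define b where "b = (\<lambda>i. pr (ch i) \<mu>)"
  define S where "S = {n. (\<forall>i. i \<notin> II \<longrightarrow> n i = 0) \<and> (\<exists>w\<in>weyl D. w \<mu> = \<mu> - wsum n) \<and> Qf b n = 0}"
  have "S \<subseteq> {n. (\<forall>i. i \<notin> II \<longrightarrow> n i = 0) \<and> Qf b n \<le> 0}" by (auto simp: S_def)
  then have fin: "finite S" using finite_Qf finite_subset by blast
  have "(\<lambda>_. 0) \<in> S" unfolding S_def by (auto simp: wsum_def Qf_def intro!: bexI[of _ id] weyl.weyl_id)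
  then have ne: "S \<noteq> {}" by blast
  obtain n where n: "n \<in> S" "\<And>m. m \<in> S \<Longrightarrow> (\<Sum>i\<in>II. n i) \<le> (\<Sum>i\<in>II. m i)"
    using fin ne arg_min_if_finite[of S "\<lambda>n. \<Sum>i\<in>II. n i"] by (metis not_le)
  obtain w where w: "w \<in> weyl D" "w \<mu> = \<mu> - wsum n" using n(1) by (auto simp: S_def)
  have "w \<mu> \<in> dominant D" unfolding dominant_def
  proof (intro CollectI ballI)
    fix i assume i: "i \<in> II"
    define m where "m = wgt b n i"
    have pm: "pr (ch i) (w \<mu>) = m" using i w by (simp add: pr_diff2 pr_wsum m_def wgt_def b_def)
    have "(simple_refl D i \<circ> w) \<mu> = \<mu> - wsum (n(i := n i + m))"
      unfolding wsum_upd[OF i] using pm by (simp add: simple_refl_def w(2))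
    moreover have "Qf b (n(i := n i + m)) = 0" using Qf_reflect[OF i] n(1) by (simp add: m_def S_def)
    moreover have "\<forall>j. j \<notin> II \<longrightarrow> (n(i := n i + m)) j = 0" using n(1) i by (auto simp: S_def)
    ultimately have "n(i := n i + m) \<in> S"
      using weyl.weyl_refl[OF w(1) i] unfolding S_def by blast
    then have "(\<Sum>j\<in>II. n j) \<le> (\<Sum>j\<in>II. (n(i := n i + m)) j)" by (rule n(2))
    also have "\<dots> = (\<Sum>j\<in>II. n j + (if j = i then m else 0))" by (intro sum.cong) auto
    also have "\<dots> = (\<Sum>j\<in>II. n j) + m" using i by (simp add: sum.distrib)
    finally show "pr (ch i) (w \<mu>) \<ge> 0" using pm by simp
  qed
  moreover obtain w' where w': "w' \<in> weyl D" "w' (w \<mu>) = \<mu>" using weyl_inverse[OF w(1)] by blast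
  have "w' (w \<mu>) \<in> weyl_orbit D {w \<mu>}" unfolding weyl_orbit_def using w'(1) by blast
  then have "\<mu> \<in> weyl_orbit D {w \<mu>}" by (simp only: w'(2))
  ultimately show ?thesis by blast
qed

lemma dom_le_wsum: "dom_le D \<zeta> \<mu> \<longleftrightarrow> (\<exists>n. (\<forall>i. n i \<ge> 0) \<and> (\<forall>i. i \<notin> II \<longrightarrow> n i = 0) \<and> \<zeta> = \<mu> - wsum n)"
proof
  assume "dom_le D \<zeta> \<mu>"
  then obtain n :: "'i \<Rightarrow> nat" where n: "\<mu> - \<zeta> = (\<Sum>i\<in>II. zsmul (int (n i)) (al i))" by (auto simp: dom_le_def)
  have "(\<Sum>i\<in>II. zsmul (int (n i)) (al i)) = wsum (\<lambda>i. if i \<in> II then int (n i) else 0)"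
    unfolding wsum_def by (intro sum.cong) auto
  then show "\<exists>n. (\<forall>i. n i \<ge> 0) \<and> (\<forall>i. i \<notin> II \<longrightarrow> n i = 0) \<and> \<zeta> = \<mu> - wsum n"
    using n by (intro exI[of _ "\<lambda>i. if i \<in> II then int (n i) else 0"]) (auto simp: algebra_simps)
next
  assume "\<exists>n. (\<forall>i. n i \<ge> 0) \<and> (\<forall>i. i \<notin> II \<longrightarrow> n i = 0) \<and> \<zeta> = \<mu> - wsum n"
  then obtain n where "\<forall>i. n i \<ge> 0" "\<zeta> = \<mu> - wsum n" by blast
  then show "dom_le D \<zeta> \<mu>" unfolding dom_le_def wsum_def by (intro exI[of _ "\<lambda>i. nat (n i)"]) auto
qed

lemma dom_le_refl: "dom_le D \<zeta> \<zeta>"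
  unfolding dom_le_wsum by (rule exI[of _ "\<lambda>_. 0"]) (simp add: wsum_def)

lemma dom_le_trans: assumes "dom_le D \<zeta> \<mu>" "dom_le D \<mu> \<nu>" shows "dom_le D \<zeta> \<nu>"
proof -
  from assms obtain n m where nm: "\<forall>i. n i \<ge> 0" "\<forall>i. i \<notin> II \<longrightarrow> n i = 0" "\<zeta> = \<mu> - wsum n"
    "\<forall>i. m i \<ge> 0" "\<forall>i. i \<notin> II \<longrightarrow> m i = 0" "\<mu> = \<nu> - wsum m" unfolding dom_le_wsum by blast
  then show ?thesis unfolding dom_le_wsum
    by (intro exI[of _ "\<lambda>i. n i + m i"]) (auto simp: wsum_add algebra_simps)
qed

lemma finite_below: assumes "\<kappa> \<in> dominant D" shows "finite {\<zeta> \<in> dominant D. dom_le D \<zeta> \<kappa>}"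
proof -
  define b where "b = (\<lambda>i. pr (ch i) \<kappa>)"
  have "{\<zeta> \<in> dominant D. dom_le D \<zeta> \<kappa>} \<subseteq> (\<lambda>n. \<kappa> - wsum n) ` {n. (\<forall>i. i \<notin> II \<longrightarrow> n i = 0) \<and> Qf b n \<le> 0}"
  proof
    fix \<zeta> assume z: "\<zeta> \<in> {\<zeta> \<in> dominant D. dom_le D \<zeta> \<kappa>}"
    then obtain n where n: "\<forall>i. n i \<ge> 0" "\<forall>i. i \<notin> II \<longrightarrow> n i = 0" "\<zeta> = \<kappa> - wsum n" unfolding dom_le_wsum by blast
    have "Qf b n \<le> 0"
    proof (rule Qf_dominant)
      fix i assume i: "i \<in> II"
      show "n i \<ge> 0" using n by blast
      show "b i \<ge> 0" using assms i by (simp add: b_def dominant_def)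
      have "wgt b n i = pr (ch i) \<zeta>" using i n(3) by (simp add: wgt_def b_def pr_diff2 pr_wsum)
      then show "wgt b n i \<ge> 0" using z i by (simp add: dominant_def)
    qed
    then show "\<zeta> \<in> (\<lambda>n. \<kappa> - wsum n) ` {n. (\<forall>i. i \<notin> II \<longrightarrow> n i = 0) \<and> Qf b n \<le> 0}" using n by blast
  qed
  then show ?thesis using finite_Qf finite_surj by blast
qed

text \<open>Every weight is conjugate to a dominant one, and only finitely many dominant weights lie
  below a dominant one.\<close>

lemma fin_sat_covers: assumes "finite P" shows "\<exists>\<pi>\<in>fin_sat D. P \<subseteq> weyl_orbit D \<pi>"
proof -
  obtain c where c: "\<And>\<mu>. c \<mu> \<in> dominant D" "\<And>\<mu>. \<mu> \<in> weyl_orbit D {c \<mu>}" using dominant_conjugate by metis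
  \<comment> \<open>The weight 0 is added to keep \<pi> nonempty when P is empty.\<close>
  define \<pi> where "\<pi> = (\<Union>\<mu>\<in>insert 0 P. {\<zeta> \<in> dominant D. dom_le D \<zeta> (c \<mu>)})"
  have "finite \<pi>" unfolding \<pi>_def using assms finite_below[OF c(1)] by blast
  moreover have mem: "c \<mu> \<in> \<pi>" if "\<mu> \<in> insert 0 P" for \<mu> using that c(1) dom_le_refl by (auto simp: \<pi>_def)
  moreover have "saturated D \<pi>" unfolding saturated_def
  proof (intro conjI ballI impI)
    show "\<pi> \<noteq> {}" using mem by blast
    show "\<pi> \<subseteq> dominant D" by (auto simp: \<pi>_def)
    fix \<zeta> \<mu> assume "\<zeta> \<in> dominant D" "\<mu> \<in> \<pi>" "dom_le D \<zeta> \<mu>"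
    then show "\<zeta> \<in> \<pi>" unfolding \<pi>_def using dom_le_trans by blast
  qed
  moreover have "\<mu> \<in> weyl_orbit D \<pi>" if "\<mu> \<in> P" for \<mu>
    using c(2)[of \<mu>] weyl_orbit_mono[of "{c \<mu>}" \<pi>] mem that by blast
  ultimately show ?thesis unfolding fin_sat_def by blast
qed

lemma fin_sat_finite: "\<pi> \<in> fin_sat D \<Longrightarrow> finite (weyl_orbit D \<pi>)"
  by (simp add: fin_sat_def finite_weyl_orbit)

lemma fin_sat_union: "\<pi> \<in> fin_sat D \<Longrightarrow> \<pi>' \<in> fin_sat D \<Longrightarrow> \<pi> \<union> \<pi>' \<in> fin_sat D"
  unfolding fin_sat_def saturated_def by blast

end

section \<open>The algebras \<open>U\<close> and \<open>S(\<pi>)\<close>\<close>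

lemma fsub_comp: "fsub \<phi> (fsub \<psi> p) = fsub (\<lambda>g. fsub \<phi> (\<psi> g)) p"
proof (rule lin_eqI[OF lin_comp[OF lin_fsub lin_fsub] lin_fsub])
  fix w
  have "fsub \<phi> (prod_list (map \<psi> ws)) = prod_list (map (\<lambda>g. fsub \<phi> (\<psi> g)) ws)" for ws
    by (induction ws) (auto simp: fsub_mult)
  then show "fsub \<phi> (fsub \<psi> (bs w)) = fsub (\<lambda>g. fsub \<phi> (\<psi> g)) (bs w)"
    by (simp add: fsub_def[of \<psi>] fsub_def[of "\<lambda>g. fsub \<phi> (\<psi> g)"])
qed

lemma fsub_divpow: "\<psi> (E s i) = fgen (E s i) \<Longrightarrow> fsub \<psi> (divpow D s i m) = divpow D s i m"
  by (simp add: divpow_def fscale_sc fsub_sc fsub_pow)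

lemma fsub_serre: assumes "\<psi> (E s i) = fgen (E s i)" "\<psi> (E s j) = fgen (E s j)"
  shows "fsub \<psi> (serre D s i j) = serre D s i j"
proof -
  have "fsub \<psi> ((- 1) ^ n) = (- 1) ^ n" for n by (simp add: fsub_pow fsub_minus)
  then show ?thesis using assms
    by (simp add: serre_def Let_def fsub_sum fsub_mult fsub_divpow)
qed

context rdatum
begin

lemma FG_divpow: "E s i \<in> G \<Longrightarrow> divpow D s i m \<in> FG G"
  by (simp add: divpow_def fscale_sc)

lemma FG_serre: "E s i \<in> G \<Longrightarrow> E s j \<in> G \<Longrightarrow> serre D s i j \<in> FG G"
  unfolding serre_def Let_def by (intro FG_sum FG_mult FG_pow FG_divpow FG_minus FG_1 FG_fgen)

lemma FG_serre_rels:
  fixes G :: "('i, 'z) gen set"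
  assumes "\<And>s i. i \<in> II \<Longrightarrow> E s i \<in> G"
  shows "serre_rels D \<subseteq> FG G"
proof
  fix r :: "('i, 'z) gen fpoly" assume "r \<in> serre_rels D"
  then obtain s i j where r: "r = serre D s i j" "i \<in> II" "j \<in> II" unfolding serre_rels_def by blast
  show "r \<in> FG G" unfolding r(1) by (rule FG_serre[OF assms[OF r(2)] assms[OF r(3)]])
qed

lemma U_gens_iff[simp]: "E s i \<in> U_gens D \<longleftrightarrow> i \<in> II" "T h \<in> U_gens D" by (auto simp: U_gens_def)
lemma S_gens_iff[simp]: "E s i \<in> S_gens D \<pi> \<longleftrightarrow> i \<in> II" by (auto simp: S_gens_def)
lemma FG_idem[simp, intro]: "idem D \<pi> \<zeta> \<in> FG (S_gens D \<pi>)"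
  by (auto simp: idem_def S_gens_def intro!: FG_fgen)

lemma U_pres: "presentation (U_gens D) (U_rels D)"
proof
  show "U_rels D \<subseteq> FG (U_gens D)" unfolding U_rels_def
    using FG_serre_rels[of "U_gens D"] by (auto simp: fscale_sc)
qed

lemma S_pres: "presentation (S_gens D \<pi>) (S_rels D \<pi>)"
proof
  show "S_rels D \<pi> \<subseteq> FG (S_gens D \<pi>)" unfolding S_rels_def
    using FG_serre_rels[of "S_gens D \<pi>"] by (auto simp: fscale_sc intro!: FG_sum FG_diff)
qed

sublocale U: presentation "U_gens D" "U_rels D"
  rewrites "presented_alg (U_gens D) (U_rels D) = U_alg D"
    and "presented_class (U_gens D) (U_rels D) = U_class D"
  by (rule U_pres) (simp_all add: U_alg_def U_class_def)

sublocale S: presentation "S_gens D \<pi>" "S_rels D \<pi>"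
  rewrites "presented_alg (S_gens D \<pi>) (S_rels D \<pi>) = S_alg D \<pi>"
    and "presented_class (S_gens D \<pi>) (S_rels D \<pi>) = S_class D \<pi>"
  for \<pi>
  by (rule S_pres) (simp_all add: S_alg_def S_class_def)

abbreviation "UG \<equiv> FG (U_gens D)"
abbreviation "SG \<pi> \<equiv> FG (S_gens D \<pi>)"
abbreviation "UI \<equiv> U.PI"
abbreviation "SI \<pi> \<equiv> S.PI \<pi>"
abbreviation "Wo \<pi> \<equiv> weyl_orbit D \<pi>"
definition "sal s i = zsmul (sgn_int s) (al i)"

lemma S_idem: "idem D \<pi> \<zeta> * idem D \<pi> \<zeta>' - (if \<zeta> = \<zeta>' then idem D \<pi> \<zeta> else 0) \<in> SI \<pi>"
  by (rule S.PI_R) (unfold S_rels_def, blast)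
lemma S_one: "(\<Sum>\<zeta>\<in>Wo \<pi>. idem D \<pi> \<zeta>) - 1 \<in> SI \<pi>"
  by (rule S.PI_R) (unfold S_rels_def, blast)
lemma S_E: "i \<in> II \<Longrightarrow> fgen (E s i) * idem D \<pi> \<zeta> - idem D \<pi> (\<zeta> + sal s i) * fgen (E s i) \<in> SI \<pi>"
  by (rule S.PI_R) (unfold S_rels_def sal_def, blast)
lemma S_comm: "i \<in> II \<Longrightarrow> j \<in> II \<Longrightarrow>
  fgen (E Pos i) * fgen (E Neg j) - fgen (E Neg j) * fgen (E Pos i)
        - (if i = j then (\<Sum>\<zeta>\<in>Wo \<pi>. sc (qint (qi i) (pr (ch i) \<zeta>)) (idem D \<pi> \<zeta>)) else 0) \<in> SI \<pi>"
  by (rule S.PI_R) (unfold S_rels_def fscale_sc[symmetric] vi_qi[symmetric], blast)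
lemma S_serre: "i \<in> II \<Longrightarrow> j \<in> II \<Longrightarrow> i \<noteq> j \<Longrightarrow> serre D s i j \<in> SI \<pi>"
  by (rule S.PI_R) (unfold S_rels_def serre_rels_def, blast)

lemma U_KK: "fgen (T h) * fgen (T h') - fgen (T (h + h')) \<in> UI"
  by (rule U.PI_R) (unfold U_rels_def, blast)
lemma U_KE: "i \<in> II \<Longrightarrow> fgen (T h) * fgen (E s i) - sc (v powi (pr h (sal s i))) (fgen (E s i) * fgen (T h)) \<in> UI"
  by (rule U.PI_R) (unfold U_rels_def fscale_sc[symmetric] sal_def pr_zsmul2, blast)
lemma U_comm: "i \<in> II \<Longrightarrow> j \<in> II \<Longrightarrow> fgen (E Pos i) * fgen (E Neg j) - fgen (E Neg j) * fgen (E Pos i)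
   - (if i = j then sc (inverse (qi i - inverse (qi i)))
       (fgen (T (zsmul (dnum D i) (ch i))) - fgen (T (zsmul (- dnum D i) (ch i)))) else 0) \<in> UI"
  by (rule U.PI_R) (unfold U_rels_def fscale_sc[symmetric] vi_qi[symmetric], blast)
lemma U_serre: "i \<in> II \<Longrightarrow> j \<in> II \<Longrightarrow> i \<noteq> j \<Longrightarrow> serre D s i j \<in> UI"
  by (rule U.PI_R) (unfold U_rels_def serre_rels_def, blast)

text \<open>The idempotents sum to 1, so an identity in S(\<pi>) may be tested after multiplication
  by each of them.\<close>

lemma SI_by_idem:
  assumes "x \<in> SG \<pi>" "\<And>\<mu>. \<mu> \<in> Wo \<pi> \<Longrightarrow> x * idem D \<pi> \<mu> \<in> SI \<pi>"
  shows "x \<in> SI \<pi>"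
proof -
  have "(\<Sum>\<mu>\<in>Wo \<pi>. x * idem D \<pi> \<mu>) \<in> SI \<pi>" using assms(2) by (rule S.PI_sum)
  moreover have "x * ((\<Sum>\<mu>\<in>Wo \<pi>. idem D \<pi> \<mu>) - 1) \<in> SI \<pi>" by (rule S.PI_l[OF S_one assms(1)])
  ultimately have "(\<Sum>\<mu>\<in>Wo \<pi>. x * idem D \<pi> \<mu>) - x * ((\<Sum>\<mu>\<in>Wo \<pi>. idem D \<pi> \<mu>) - 1) \<in> SI \<pi>" by (rule S.PI_diff)
  then show ?thesis by (simp add: right_diff_distrib sum_distrib_left)
qed

definition Kp :: "'x set \<Rightarrow> 'y \<Rightarrow> ('i, 'x) gen fpoly" where
  "Kp \<pi> h = (\<Sum>\<zeta>\<in>Wo \<pi>. sc (v powi pr h \<zeta>) (idem D \<pi> \<zeta>))"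

lemma Kp_FG[simp, intro]: "Kp \<pi> h \<in> SG \<pi>" unfolding Kp_def by (intro FG_sum FG_sc FG_idem)

lemma idem_sum_r:
  assumes "finite (Wo \<pi>)"
  shows "(\<Sum>\<zeta>\<in>Wo \<pi>. sc (c \<zeta>) (idem D \<pi> \<zeta>)) * idem D \<pi> \<mu> - sc (c \<mu>) (idem D \<pi> \<mu>) \<in> SI \<pi>"
proof -
  have "(\<Sum>\<zeta>\<in>Wo \<pi>. sc (c \<zeta>) (idem D \<pi> \<zeta> * idem D \<pi> \<mu> - (if \<zeta> = \<mu> then idem D \<pi> \<zeta> else 0))) \<in> SI \<pi>"
    by (intro S.PI_sum S.PI_sc S_idem)
  also have "(\<Sum>\<zeta>\<in>Wo \<pi>. sc (c \<zeta>) (idem D \<pi> \<zeta> * idem D \<pi> \<mu> - (if \<zeta> = \<mu> then idem D \<pi> \<zeta> else 0))) =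
     (\<Sum>\<zeta>\<in>Wo \<pi>. sc (c \<zeta>) (idem D \<pi> \<zeta>)) * idem D \<pi> \<mu> - (\<Sum>\<zeta>\<in>Wo \<pi>. if \<zeta> = \<mu> then sc (c \<mu>) (idem D \<pi> \<mu>) else 0)"
    by (simp add: pm.scale_right_diff_distrib sum_subtractf sum_distrib_right sc_mult_left
        if_distrib[of "sc _"] cong: if_cong)
  also have "(\<Sum>\<zeta>\<in>Wo \<pi>. if \<zeta> = \<mu> then sc (c \<mu>) (idem D \<pi> \<mu>) else 0) = sc (c \<mu>) (idem D \<pi> \<mu>)"
    using assms by (auto simp: idem_def)
  finally show ?thesis .
qed

lemma idem_sum_l:
  assumes "finite (Wo \<pi>)"
  shows "idem D \<pi> \<mu> * (\<Sum>\<zeta>\<in>Wo \<pi>. sc (c \<zeta>) (idem D \<pi> \<zeta>)) - sc (c \<mu>) (idem D \<pi> \<mu>) \<in> SI \<pi>"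
proof -
  have "(\<Sum>\<zeta>\<in>Wo \<pi>. sc (c \<zeta>) (idem D \<pi> \<mu> * idem D \<pi> \<zeta> - (if \<mu> = \<zeta> then idem D \<pi> \<mu> else 0))) \<in> SI \<pi>"
    by (intro S.PI_sum S.PI_sc S_idem)
  also have "(\<Sum>\<zeta>\<in>Wo \<pi>. sc (c \<zeta>) (idem D \<pi> \<mu> * idem D \<pi> \<zeta> - (if \<mu> = \<zeta> then idem D \<pi> \<mu> else 0))) =
     idem D \<pi> \<mu> * (\<Sum>\<zeta>\<in>Wo \<pi>. sc (c \<zeta>) (idem D \<pi> \<zeta>)) - (\<Sum>\<zeta>\<in>Wo \<pi>. if \<mu> = \<zeta> then sc (c \<mu>) (idem D \<pi> \<mu>) else 0)"
    by (simp add: pm.scale_right_diff_distrib sum_subtractf sum_distrib_left sc_mult_right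
        if_distrib[of "sc _"] cong: if_cong)
  also have "(\<Sum>\<zeta>\<in>Wo \<pi>. if \<mu> = \<zeta> then sc (c \<mu>) (idem D \<pi> \<mu>) else 0) = sc (c \<mu>) (idem D \<pi> \<mu>)"
    using assms by (auto simp: idem_def)
  finally show ?thesis .
qed

lemmas Kp_idem_r = idem_sum_r[where c = "\<lambda>\<zeta>. v powi pr h \<zeta>" for h, folded Kp_def]
  and Kp_idem_l = idem_sum_l[where c = "\<lambda>\<zeta>. v powi pr h \<zeta>" for h, folded Kp_def]

text \<open>\<open>pg\<close> and \<open>tg\<close> give the maps from U and from a larger S(\<pi>')
  to S(\<pi>) on generators, as polynomials and not as classes, ready for
  \<open>fsub\<close>.\<close>

primrec pg :: "'x set \<Rightarrow> ('i, 'y) gen \<Rightarrow> ('i, 'x) gen fpoly" where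
  "pg \<pi> (E s i) = fgen (E s i)"
| "pg \<pi> (T h) = Kp \<pi> h"

primrec tg :: "'x set \<Rightarrow> ('i, 'x) gen \<Rightarrow> ('i, 'x) gen fpoly" where
  "tg \<pi> (E s i) = fgen (E s i)"
| "tg \<pi> (T \<zeta>) = idem D \<pi> \<zeta>"

lemma pg_FG: "g \<in> U_gens D \<Longrightarrow> pg \<pi> g \<in> SG \<pi>" by (cases g) auto
lemma tg_FG: "g \<in> S_gens D \<pi>' \<Longrightarrow> tg \<pi> g \<in> SG \<pi>" by (cases g) auto

lemma v_add: "v powi (m + n) = v powi m * v powi n" by (simp add: power_int_add v_nonzero)

lemma pg_rel: assumes fin: "finite (Wo \<pi>)" and r: "r \<in> U_rels D" shows "fsub (pg \<pi>) r \<in> SI \<pi>"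
proof -
  note FGi = FG_mult FG_diff FG_sc Kp_FG FG_fgen
  consider h h' where "r = fgen (T h) * fgen (T h') - fgen (T (h + h'))"
    | "r = fgen (T 0) - 1"
    | h s i where "i \<in> II" "r = fgen (T h) * fgen (E s i) - fscale (v powi (sgn_int s * pr h (al i))) (fgen (E s i) * fgen (T h))"
    | i j where "i \<in> II" "j \<in> II" "r = fgen (E Pos i) * fgen (E Neg j) - fgen (E Neg j) * fgen (E Pos i)
        - (if i = j then fscale (inverse (vi D i - inverse (vi D i)))
                  (fgen (T (zsmul (dnum D i) (ch i))) - fgen (T (zsmul (- dnum D i) (ch i)))) else 0)"
    | s i j where "i \<in> II" "j \<in> II" "i \<noteq> j" "r = serre D s i j"
    using r unfolding U_rels_def serre_rels_def by blast
  then show ?thesis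
  proof cases
    case 1
    have "fsub (pg \<pi>) r = Kp \<pi> h * Kp \<pi> h' - Kp \<pi> (h + h')" by (simp add: 1 fsub_diff fsub_mult)
    also have "\<dots> \<in> SI \<pi>"
    proof (rule SI_by_idem)
      fix \<mu>
      have a: "Kp \<pi> h * (Kp \<pi> h' * idem D \<pi> \<mu> - sc (v powi pr h' \<mu>) (idem D \<pi> \<mu>)) \<in> SI \<pi>"
        by (intro S.PI_l Kp_idem_r[OF fin] Kp_FG)
      have b: "sc (v powi pr h' \<mu>) (Kp \<pi> h * idem D \<pi> \<mu> - sc (v powi pr h \<mu>) (idem D \<pi> \<mu>)) \<in> SI \<pi>"
        by (intro S.PI_sc Kp_idem_r[OF fin])
      have c: "Kp \<pi> (h + h') * idem D \<pi> \<mu> - sc (v powi pr (h + h') \<mu>) (idem D \<pi> \<mu>) \<in> SI \<pi>"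
        by (rule Kp_idem_r[OF fin])
      show "(Kp \<pi> h * Kp \<pi> h' - Kp \<pi> (h + h')) * idem D \<pi> \<mu> \<in> SI \<pi>"
        using S.PI_diff[OF S.PI_add[OF a b] c]
        by (simp add: algebra_simps sc_mult_right pr_add1 v_add pm.scale_right_diff_distrib)
    qed (intro FGi)
    finally show ?thesis .
  next
    case 2
    have "fsub (pg \<pi>) r = (\<Sum>\<zeta>\<in>Wo \<pi>. idem D \<pi> \<zeta>) - 1" by (simp add: 2 fsub_diff Kp_def)
    then show ?thesis using S_one by simp
  next
    case 3
    have "fsub (pg \<pi>) r = Kp \<pi> h * fgen (E s i) - sc (v powi pr h (sal s i)) (fgen (E s i) * Kp \<pi> h)"
      by (simp add: 3 fsub_diff fsub_mult fsub_sc fscale_sc sal_def pr_zsmul2)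
    also have "\<dots> \<in> SI \<pi>"
    proof (rule SI_by_idem)
      fix \<mu>
      let ?e = "fgen (E s i) :: ('i, 'x) gen fpoly" and ?m = "\<mu> + sal s i"
      have a: "Kp \<pi> h * (?e * idem D \<pi> \<mu> - idem D \<pi> ?m * ?e) \<in> SI \<pi>"
        by (intro S.PI_l S_E Kp_FG 3)
      have b: "(Kp \<pi> h * idem D \<pi> ?m - sc (v powi pr h ?m) (idem D \<pi> ?m)) * ?e \<in> SI \<pi>"
        using 3 by (intro S.PI_r Kp_idem_r[OF fin] FG_fgen) auto
      have c: "sc (v powi pr h ?m) (?e * idem D \<pi> \<mu> - idem D \<pi> ?m * ?e) \<in> SI \<pi>"
        by (intro S.PI_sc S_E 3)
      have d: "sc (v powi pr h (sal s i)) (?e * (Kp \<pi> h * idem D \<pi> \<mu> - sc (v powi pr h \<mu>) (idem D \<pi> \<mu>))) \<in> SI \<pi>"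
        using 3 by (intro S.PI_sc S.PI_l Kp_idem_r[OF fin] FG_fgen) auto
      show "(Kp \<pi> h * ?e - sc (v powi pr h (sal s i)) (?e * Kp \<pi> h)) * idem D \<pi> \<mu> \<in> SI \<pi>"
        using S.PI_diff[OF S.PI_diff[OF S.PI_add[OF a b] c] d]
        by (simp add: algebra_simps sc_mult_right sc_mult_left pr_add2 v_add pm.scale_right_diff_distrib)
    qed (use 3 in \<open>auto intro!: FGi\<close>)
    finally show ?thesis .
  next
    case 4
    \<comment> \<open>The toral elements on the left take the values q_i^m and q_i^-m at a weight
      with pairing m, since v^(d_i m) = q_i^m; their scaled difference is [m]_i.\<close>
    have "sc (inverse (qi i - inverse (qi i))) (Kp \<pi> (zsmul (dnum D i) (ch i)) - Kp \<pi> (zsmul (- dnum D i) (ch i)))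
        = (\<Sum>\<zeta>\<in>Wo \<pi>. sc (qint (qi i) (pr (ch i) \<zeta>)) (idem D \<pi> \<zeta>))"
      unfolding Kp_def sum_subtractf[symmetric] pm.scale_sum_right
    proof (intro sum.cong refl)
      fix \<zeta>
      have q: "v powi (dnum D i * m) = qi i powi m" for m
        by (simp add: qi_def dnum_def power_int_mult)
      have "v powi pr (zsmul (dnum D i) (ch i)) \<zeta> = qi i powi pr (ch i) \<zeta>"
        "v powi pr (zsmul (- dnum D i) (ch i)) \<zeta> = qi i powi (- pr (ch i) \<zeta>)"
        using q[of "pr (ch i) \<zeta>"] q[of "- pr (ch i) \<zeta>"] by (simp_all add: pr_zsmul1)
      then show "sc (inverse (qi i - inverse (qi i))) (sc (v powi pr (zsmul (dnum D i) (ch i)) \<zeta>) (idem D \<pi> \<zeta>)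
          - sc (v powi pr (zsmul (- dnum D i) (ch i)) \<zeta>) (idem D \<pi> \<zeta>)) = sc (qint (qi i) (pr (ch i) \<zeta>)) (idem D \<pi> \<zeta>)"
        unfolding pm.scale_left_diff_distrib[symmetric] pm.scale_scale
        by (simp add: qint_def field_simps)
    qed
    then have "fsub (pg \<pi>) r = fgen (E Pos i) * fgen (E Neg j) - fgen (E Neg j) * fgen (E Pos i)
        - (if i = j then (\<Sum>\<zeta>\<in>Wo \<pi>. sc (qint (qi i) (pr (ch i) \<zeta>)) (idem D \<pi> \<zeta>)) else 0)"
      by (cases "i = j") (simp_all add: 4(3) fsub_diff fsub_mult fsub_sc fsub_0 fscale_sc vi_qi)
    then show ?thesis using S_comm[OF 4(1,2)] by simp
  next
    case 5
    then show ?thesis using S_serre by (simp add: fsub_serre)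
  qed
qed

lemma p_map_class:
  assumes "finite (Wo \<pi>)" "p \<in> UG"
  shows "p_map D \<pi> (U_class D p) = S_class D \<pi> (fsub (pg \<pi>) p)"
  unfolding p_map_def S_alg_def S_class_def U_class_def
proof (rule presented_lift_cl[OF S_pres U_pres assms(2)])
  fix g assume "g \<in> U_gens D"
  then show "p_gen D \<pi> g = presented_class (S_gens D \<pi>) (S_rels D \<pi>) (pg \<pi> g)"
    by (cases g) (simp_all add: S_class_def[symmetric] S_K_def Kp_def fscale_sc)
qed (use pg_FG pg_rel[OF assms(1)] in auto)

lemma fsub_idem: assumes "Wo \<pi> \<subseteq> Wo \<pi>'" shows "fsub (tg \<pi>) (idem D \<pi>' \<zeta>) = idem D \<pi> \<zeta>"
  using assms by (auto simp: idem_def fsub_0)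

lemma sum_idem_sub:
  assumes "finite (Wo \<pi>')" "Wo \<pi> \<subseteq> Wo \<pi>'"
  shows "(\<Sum>\<zeta>\<in>Wo \<pi>'. sc (c \<zeta>) (idem D \<pi> \<zeta>)) = (\<Sum>\<zeta>\<in>Wo \<pi>. sc (c \<zeta>) (idem D \<pi> \<zeta>))"
  using assms by (intro sum.mono_neutral_right) (auto simp: idem_def)

lemma tg_rel:
  assumes fin: "finite (Wo \<pi>')" and sub: "Wo \<pi> \<subseteq> Wo \<pi>'" and r: "r \<in> S_rels D \<pi>'"
  shows "fsub (tg \<pi>) r \<in> SI \<pi>"
proof -
  note id = fsub_idem[OF sub]
  have one: "(\<Sum>\<zeta>\<in>Wo \<pi>'. idem D \<pi> \<zeta>) = (\<Sum>\<zeta>\<in>Wo \<pi>. idem D \<pi> \<zeta>)"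
    using sum_idem_sub[OF fin sub, of "\<lambda>_. 1"] by simp
  consider \<zeta> \<zeta>' where "r = idem D \<pi>' \<zeta> * idem D \<pi>' \<zeta>' - (if \<zeta> = \<zeta>' then idem D \<pi>' \<zeta> else 0)"
    | "r = (\<Sum>\<zeta>\<in>Wo \<pi>'. idem D \<pi>' \<zeta>) - 1"
    | s i \<zeta> where "i \<in> II" "r = fgen (E s i) * idem D \<pi>' \<zeta> - idem D \<pi>' (\<zeta> + zsmul (sgn_int s) (al i)) * fgen (E s i)"
    | i j where "i \<in> II" "j \<in> II" "r = fgen (E Pos i) * fgen (E Neg j) - fgen (E Neg j) * fgen (E Pos i)
        - (if i = j then (\<Sum>\<zeta>\<in>Wo \<pi>'. fscale (qint (vi D i) (pr (ch i) \<zeta>)) (idem D \<pi>' \<zeta>)) else 0)"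
    | s i j where "i \<in> II" "j \<in> II" "i \<noteq> j" "r = serre D s i j"
    using r unfolding S_rels_def serre_rels_def by blast
  then show ?thesis
  proof cases
    case 1
    have "fsub (tg \<pi>) r = idem D \<pi> \<zeta> * idem D \<pi> \<zeta>' - (if \<zeta> = \<zeta>' then idem D \<pi> \<zeta> else 0)"
      by (simp add: 1 fsub_diff fsub_mult id fsub_0)
    then show ?thesis using S_idem by simp
  next
    case 2
    then show ?thesis using S_one[of \<pi>] by (simp add: fsub_diff fsub_sum id one)
  next
    case 3
    then show ?thesis using S_E[OF 3(1), of s \<pi> \<zeta>] by (simp add: fsub_diff fsub_mult id sal_def)
  next
    case 4
    have "fsub (tg \<pi>) r = fgen (E Pos i) * fgen (E Neg j) - fgen (E Neg j) * fgen (E Pos i)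
        - (if i = j then (\<Sum>\<zeta>\<in>Wo \<pi>. sc (qint (qi i) (pr (ch i) \<zeta>)) (idem D \<pi> \<zeta>)) else 0)"
      by (simp add: 4(3) fsub_diff fsub_mult id fsub_sum fsub_sc fscale_sc vi_qi fsub_0 sum_idem_sub[OF fin sub])
    then show ?thesis using S_comm[OF 4(1,2)] by simp
  next
    case 5
    then show ?thesis using S_serre by (simp add: fsub_serre)
  qed
qed

lemma S_trans_class:
  assumes "finite (Wo \<pi>')" "Wo \<pi> \<subseteq> Wo \<pi>'" "p \<in> SG \<pi>'"
  shows "S_trans D \<pi> \<pi>' (S_class D \<pi>' p) = S_class D \<pi> (fsub (tg \<pi>) p)"
  unfolding S_trans_def S_alg_def S_class_def[of D \<pi>']
  unfolding S_class_def
proof (rule presented_lift_cl[OF S_pres S_pres assms(3)])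
  fix g assume "g \<in> S_gens D \<pi>'"
  then show "S_gen_class D \<pi> g = presented_class (S_gens D \<pi>) (S_rels D \<pi>) (tg \<pi> g)"
    by (cases g) (simp_all add: S_class_def[symmetric])
qed (use tg_FG tg_rel[OF assms(1,2)] in auto)

lemma fsub_tg_pg:
  assumes "finite (Wo \<pi>')" "Wo \<pi> \<subseteq> Wo \<pi>'"
  shows "fsub (tg \<pi>) (fsub (pg \<pi>') p) = fsub (pg \<pi>) p"
proof -
  have "fsub (tg \<pi>) (pg \<pi>' g) = pg \<pi> g" for g
  proof (cases g)
    case (T h)
    then show ?thesis by (simp add: Kp_def fsub_sum fsub_sc fsub_idem[OF assms(2)] sum_idem_sub[OF assms])
  qed simp
  then show ?thesis by (simp add: fsub_comp)
qed

end

section \<open>The modified form\<close>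

context rdatum
begin

lemma UI_subspace: "pm.subspace UI" and SI_subspace: "pm.subspace (SI \<pi>)"
  using U.PI_0 U.PI_add U.PI_sc S.PI_0 S.PI_add S.PI_sc by (auto simp: pm.subspace_def)

interpretation Um: qvspace "U_alg D" by (rule qvspace.intro[OF U.PA_module])
interpretation Ur: Ring.ring "U_alg D" by (rule U.PA_ring)

definition Kd :: "'y \<Rightarrow> 'x \<Rightarrow> ('i, 'y) gen fpoly" where
  "Kd h \<zeta> = fgen (T h) - sc (v powi pr h \<zeta>) 1"

lemma Kd_FG[simp, intro]: "Kd h \<zeta> \<in> UG" by (auto simp: Kd_def)

lemma K_minus_eq: "K_minus D h \<zeta> = U_class D (Kd h \<zeta>)"
  unfolding K_minus_def Kd_def U.PA_one by (simp add: U.PA_smult U.PA_minus)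

lemma wt_sub_gens: "{K_minus D h \<zeta> \<otimes>\<^bsub>U_alg D\<^esub> u | h u. u \<in> carrier (U_alg D)} \<union>
      {u \<otimes>\<^bsub>U_alg D\<^esub> K_minus D h \<mu> | h u. u \<in> carrier (U_alg D)} \<subseteq> carrier (U_alg D)"
  by (auto simp: K_minus_eq)

lemma wt_sub_sbsp: "Um.sbsp (wt_sub D \<zeta> \<mu>)"
  unfolding wt_sub_def by (rule Um.span_sbsp[OF wt_sub_gens])

text \<open>\<open>wt_sub D \<zeta> \<mu>\<close>, pulled back to the free algebra.\<close>

definition Wsub :: "'x \<Rightarrow> 'x \<Rightarrow> ('i, 'y) gen fpoly set" where
  "Wsub \<zeta> \<mu> = {p \<in> UG. U_class D p \<in> wt_sub D \<zeta> \<mu>}"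

lemma Wsub_UI: assumes "p \<in> UI" shows "p \<in> Wsub \<zeta> \<mu>"
proof -
  have "U_class D p = \<zero>\<^bsub>U_alg D\<^esub>" using assms U.PI_FG U.cl_zero_iff by blast
  then show ?thesis using wt_sub_sbsp[of \<zeta> \<mu>] assms U.PI_FG by (auto simp: Wsub_def Um.sbsp_def)
qed

lemma Wsub_add: "p \<in> Wsub \<zeta> \<mu> \<Longrightarrow> q \<in> Wsub \<zeta> \<mu> \<Longrightarrow> p + q \<in> Wsub \<zeta> \<mu>"
  using wt_sub_sbsp[of \<zeta> \<mu>] by (auto simp: Wsub_def Um.sbsp_def U.PA_add[symmetric])
lemma Wsub_sc: "p \<in> Wsub \<zeta> \<mu> \<Longrightarrow> sc c p \<in> Wsub \<zeta> \<mu>"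
  using wt_sub_sbsp[of \<zeta> \<mu>] by (auto simp: Wsub_def Um.sbsp_def U.PA_smult[symmetric])
lemma Wsub_subspace: "pm.subspace (Wsub \<zeta> \<mu>)"
  using Wsub_add Wsub_sc Wsub_UI[OF U.PI_0] by (auto simp: pm.subspace_def)
lemmas Wsub_diff = pm.subspace_diff[OF Wsub_subspace]

lemma Wsub_l: assumes "p \<in> UG" shows "Kd h \<zeta> * p \<in> Wsub \<zeta> \<mu>"
proof -
  have "U_class D (Kd h \<zeta> * p) = K_minus D h \<zeta> \<otimes>\<^bsub>U_alg D\<^esub> U_class D p"
    using assms by (simp add: K_minus_eq U.PA_mult)
  also have "\<dots> \<in> wt_sub D \<zeta> \<mu>" unfolding wt_sub_def
    by (rule Um.span_base[OF UnI1 wt_sub_gens]) (use assms U.cl_closed in blast)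
  finally show ?thesis using assms by (auto simp: Wsub_def)
qed

lemma Wsub_r: assumes "p \<in> UG" shows "p * Kd h \<mu> \<in> Wsub \<zeta> \<mu>"
proof -
  have "U_class D (p * Kd h \<mu>) = U_class D p \<otimes>\<^bsub>U_alg D\<^esub> K_minus D h \<mu>"
    using assms by (simp add: K_minus_eq U.PA_mult)
  also have "\<dots> \<in> wt_sub D \<zeta> \<mu>" unfolding wt_sub_def
    by (rule Um.span_base[OF UnI2 wt_sub_gens]) (use assms U.cl_closed in blast)
  finally show ?thesis using assms by (auto simp: Wsub_def)
qed

text \<open>\<open>wt_sub\<close> is a span in U and is compared with the image of J there. As J
  contains the ideal of relations, membership in J depends only on the class.\<close>

lemma Wsub_elim:
  assumes J: "pm.subspace J" "UI \<subseteq> J" "\<And>h p. p \<in> UG \<Longrightarrow> Kd h \<zeta> * p \<in> J" "\<And>h p. p \<in> UG \<Longrightarrow> p * Kd h \<mu> \<in> J"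
    and x: "x \<in> Wsub \<zeta> \<mu>"
  shows "x \<in> J"
proof -
  let ?V = "U_class D ` (J \<inter> UG)"
  have "Um.sbsp ?V" unfolding Um.sbsp_def
  proof (intro conjI ballI allI)
    show "?V \<subseteq> carrier (U_alg D)" by auto
    show "\<zero>\<^bsub>U_alg D\<^esub> \<in> ?V" unfolding U.PA_zero using J(1) by (auto simp: pm.subspace_def)
    show "x \<oplus>\<^bsub>U_alg D\<^esub> y \<in> ?V" if "x \<in> ?V" "y \<in> ?V" for x y
    proof -
      from that obtain p q where "p \<in> J" "p \<in> UG" "q \<in> J" "q \<in> UG" "x = U_class D p" "y = U_class D q" by blast
      then show ?thesis using J(1) by (auto simp: U.PA_add pm.subspace_def)
    qed
    show "c \<odot>\<^bsub>U_alg D\<^esub> x \<in> ?V" if "x \<in> ?V" for c x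
    proof -
      from that obtain p where "p \<in> J" "p \<in> UG" "x = U_class D p" by blast
      then show ?thesis using J(1) by (auto simp: U.PA_smult pm.subspace_def)
    qed
  qed
  moreover have "{K_minus D h \<zeta> \<otimes>\<^bsub>U_alg D\<^esub> u | h u. u \<in> carrier (U_alg D)} \<union>
      {u \<otimes>\<^bsub>U_alg D\<^esub> K_minus D h \<mu> | h u. u \<in> carrier (U_alg D)} \<subseteq> ?V"
  proof -
    have "K_minus D h \<zeta> \<otimes>\<^bsub>U_alg D\<^esub> u \<in> ?V" "u \<otimes>\<^bsub>U_alg D\<^esub> K_minus D h \<mu> \<in> ?V" if u: "u \<in> carrier (U_alg D)" for h u
    proof -
      obtain p where p: "p \<in> UG" "u = U_class D p" using U.PA_E[OF u] by blast
      show "K_minus D h \<zeta> \<otimes>\<^bsub>U_alg D\<^esub> u \<in> ?V" "u \<otimes>\<^bsub>U_alg D\<^esub> K_minus D h \<mu> \<in> ?V"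
        using J(3,4)[OF p(1), of h] p(1) by (auto simp: K_minus_eq p(2) U.PA_mult)
    qed
    then show ?thesis by blast
  qed
  ultimately have "wt_sub D \<zeta> \<mu> \<subseteq> ?V" unfolding wt_sub_def by (rule Um.span_minimal)
  then have "U_class D x \<in> ?V" using x by (auto simp: Wsub_def)
  then obtain q where q: "q \<in> J" "q \<in> UG" "U_class D x = U_class D q" by blast
  then have "x - q \<in> J" using x J(2) U.cl_iff[of x q] by (auto simp: Wsub_def)
  then have "x - q + q \<in> J" using q J(1) unfolding pm.subspace_def by blast
  then show ?thesis by simp
qed

definition gw :: "('i, 'y) gen fmon \<Rightarrow> 'x" where "gw w = sum_list (map (gen_wt D) (letters w))"
definition UH :: "'x \<Rightarrow> ('i, 'y) gen fpoly set" where "UH \<nu> = {p \<in> UG. \<forall>w\<in>Poly_Mapping.keys p. gw w = \<nu>}"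

lemma U_wt_eq: "U_wt D \<nu> = U_class D ` UH \<nu>"
  by (simp add: U_wt_def UH_def gw_def)

lemma UH_UG: "p \<in> UH \<nu> \<Longrightarrow> p \<in> UG" by (simp add: UH_def)
lemma UH_0[simp]: "0 \<in> UH \<nu>" by (simp add: UH_def)
lemma UH_1[simp]: "1 \<in> UH 0" by (simp add: UH_def gw_def fmon_zero)
lemma UH_keys: "p \<in> UH \<nu> \<Longrightarrow> w \<in> Poly_Mapping.keys p \<Longrightarrow> set (letters w) \<subseteq> U_gens D \<and> gw w = \<nu>"
  by (auto simp: UH_def FG_def)

lemma U_word_induct:
  assumes "set (letters w) \<subseteq> U_gens D"
    and "P 1 0" and E: "\<And>s i x \<nu>. i \<in> II \<Longrightarrow> x \<in> UG \<Longrightarrow> P x \<nu> \<Longrightarrow> P (fgen (E s i) * x) (sal s i + \<nu>)"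
    and T: "\<And>h x \<nu>. x \<in> UG \<Longrightarrow> P x \<nu> \<Longrightarrow> P (fgen (T h) * x) \<nu>"
  shows "P (bs w) (gw w)"
proof -
  have "P (prod_list (map fgen gs)) (sum_list (map (gen_wt D) gs)) \<and> prod_list (map fgen gs) \<in> UG"
    if "set gs \<subseteq> U_gens D" for gs
    using that
  proof (induction gs)
    case (Cons g gs)
    then show ?case using E T by (cases g) (auto simp: sal_def)
  qed (simp add: assms(2))
  then show ?thesis using assms(1) by (simp add: bs_prod_list gw_def)
qed

lemma K_word:
  assumes "set (letters w) \<subseteq> U_gens D"
  shows "fgen (T h) * bs w - sc (v powi pr h (gw w)) (bs w * fgen (T h)) \<in> UI"
proof (rule U_word_induct[where P = "\<lambda>x \<nu>. fgen (T h) * x - sc (v powi pr h \<nu>) (x * fgen (T h)) \<in> UI", OF assms])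
  show "fgen (T h) * 1 - sc (v powi pr h 0) (1 * fgen (T h)) \<in> UI" using U.PI_0 by simp
next
  fix s i x \<nu> assume i: "i \<in> II" and x: "x \<in> UG"
    and IH: "fgen (T h) * x - sc (v powi pr h \<nu>) (x * fgen (T h)) \<in> UI"
  have a: "(fgen (T h) * fgen (E s i) - sc (v powi (pr h (sal s i))) (fgen (E s i) * fgen (T h))) * x \<in> UI"
    using U_KE[OF i] x by (rule U.PI_r)
  have b: "sc (v powi (pr h (sal s i))) (fgen (E s i) * (fgen (T h) * x - sc (v powi pr h \<nu>) (x * fgen (T h)))) \<in> UI"
    using i by (intro U.PI_sc U.PI_l[OF IH]) auto
  show "fgen (T h) * (fgen (E s i) * x) - sc (v powi pr h (sal s i + \<nu>)) (fgen (E s i) * x * fgen (T h)) \<in> UI"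
    using U.PI_add[OF a b]
    by (simp add: algebra_simps sc_mult_left sc_mult_right pr_add2 v_add pm.scale_right_diff_distrib)
next
  fix h' x \<nu> assume x: "x \<in> UG" and IH: "fgen (T h) * x - sc (v powi pr h \<nu>) (x * fgen (T h)) \<in> UI"
  have "fgen (T h) * fgen (T h') - fgen (T h') * fgen (T h) \<in> UI"
    using U.PI_diff[OF U_KK[of h h'] U_KK[of h' h]] by (simp add: add.commute)
  then have a: "(fgen (T h) * fgen (T h') - fgen (T h') * fgen (T h)) * x \<in> UI" using x by (rule U.PI_r)
  have b: "fgen (T h') * (fgen (T h) * x - sc (v powi pr h \<nu>) (x * fgen (T h))) \<in> UI"
    by (intro U.PI_l[OF IH]) auto
  show "fgen (T h) * (fgen (T h') * x) - sc (v powi pr h \<nu>) (fgen (T h') * x * fgen (T h)) \<in> UI"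
    using U.PI_add[OF a b] by (simp add: algebra_simps sc_mult_left sc_mult_right)
qed

lemma K_UH:
  assumes "p \<in> UH \<nu>"
  shows "fgen (T h) * p - sc (v powi pr h \<nu>) (p * fgen (T h)) \<in> UI"
proof (rule subspace_lin[where f = "\<lambda>p. fgen (T h) * p - sc (v powi pr h \<nu>) (p * fgen (T h))", OF _ UI_subspace])
  show "lin (\<lambda>p. fgen (T h) * p - sc (v powi pr h \<nu>) (p * fgen (T h)))"
    by (rule lin_minus2[OF lin_mult_left lin_scale[OF lin_mult_right]])
  fix w assume "w \<in> Poly_Mapping.keys p"
  then show "fgen (T h) * bs w - sc (v powi pr h \<nu>) (bs w * fgen (T h)) \<in> UI"
    using K_word[of w h] UH_keys[OF assms, of w] by simp
qed

text \<open>Modulo \<open>Wsub\<close>, left multiplication by K_h acts on the word as v to the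
  power pr h \<zeta>, but also, after moving K_h to the right, as v to the power pr h (gw w +
  \<mu>). Some h in Y makes the exponents differ, and then a nonzero multiple of the word
  vanishes.\<close>

lemma word_Wsub:
  assumes w: "set (letters w) \<subseteq> U_gens D" and ne: "gw w \<noteq> \<zeta> - \<mu>"
  shows "bs w \<in> Wsub \<zeta> \<mu>"
proof -
  obtain h where h: "pr h (gw w) \<noteq> pr h (\<zeta> - \<mu>)" using pr_separates[OF ne] by blast
  have ug: "bs w \<in> UG" using w by (rule FG_bs)
  define \<nu> where "\<nu> = gw w"
  define c where "c = v powi pr h \<nu> * v powi pr h \<mu> - v powi pr h \<zeta>"
  have a: "Kd h \<zeta> * bs w \<in> Wsub \<zeta> \<mu>" "bs w * Kd h \<mu> \<in> Wsub \<zeta> \<mu>" using Wsub_l Wsub_r ug by auto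
  have b: "fgen (T h) * bs w - sc (v powi pr h \<nu>) (bs w * fgen (T h)) \<in> Wsub \<zeta> \<mu>"
    unfolding \<nu>_def by (rule Wsub_UI[OF K_word[OF w]])
  have "Kd h \<zeta> * bs w - (fgen (T h) * bs w - sc (v powi pr h \<nu>) (bs w * fgen (T h))) - sc (v powi pr h \<nu>) (bs w * Kd h \<mu>) \<in> Wsub \<zeta> \<mu>"
    by (rule Wsub_diff[OF Wsub_diff[OF a(1) b] Wsub_sc[OF a(2)]])
  also have "Kd h \<zeta> * bs w - (fgen (T h) * bs w - sc (v powi pr h \<nu>) (bs w * fgen (T h))) - sc (v powi pr h \<nu>) (bs w * Kd h \<mu>) = sc c (bs w)"
    unfolding Kd_def c_def
    by (simp add: left_diff_distrib right_diff_distrib sc_mult_left sc_mult_right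
        pm.scale_right_diff_distrib pm.scale_left_diff_distrib)
  finally have "sc (inverse c) (sc c (bs w)) \<in> Wsub \<zeta> \<mu>" by (rule Wsub_sc)
  moreover have "c \<noteq> 0"
  proof -
    have "pr h \<nu> + pr h \<mu> \<noteq> pr h \<zeta>" using h by (simp add: \<nu>_def pr_diff2)
    then show ?thesis using v_powi_inject by (simp add: c_def v_add[symmetric])
  qed
  ultimately show ?thesis by simp
qed

text \<open>The homogeneous part of weight \<open>\<nu>\<close>.\<close>

definition hp :: "'x \<Rightarrow> ('i, 'y) gen fpoly \<Rightarrow> ('i, 'y) gen fpoly" where
  "hp \<nu> = lx (\<lambda>w. if gw w = \<nu> then bs w else 0)"

lemma hp_UH: assumes "p \<in> UG" shows "hp \<nu> p \<in> UH \<nu>"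
proof -
  have "set (letters w) \<subseteq> U_gens D \<and> gw w = \<nu>" if w: "w \<in> Poly_Mapping.keys (hp \<nu> p)" for w
  proof -
    obtain w' where "w' \<in> Poly_Mapping.keys p" "w \<in> Poly_Mapping.keys (if gw w' = \<nu> then bs w' else 0)"
      using keys_lx[OF w[unfolded hp_def]] by blast
    then show ?thesis using assms by (auto simp: FG_def split: if_splits)
  qed
  then show ?thesis by (auto simp: UH_def FG_def)
qed

lemma hp_Wsub: assumes "p \<in> UG" shows "p - hp (\<zeta> - \<mu>) p \<in> Wsub \<zeta> \<mu>"
proof (rule subspace_lin[where f = "\<lambda>p. p - hp (\<zeta> - \<mu>) p", OF _ Wsub_subspace])
  show "lin (\<lambda>p. p - hp (\<zeta> - \<mu>) p)" unfolding hp_def by (rule lin_minus2[OF lin_id lin_lx])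
  fix w assume "w \<in> Poly_Mapping.keys p"
  then have "set (letters w) \<subseteq> U_gens D" using assms by (auto simp: FG_def)
  then show "bs w - hp (\<zeta> - \<mu>) (bs w) \<in> Wsub \<zeta> \<mu>"
    using word_Wsub[of w \<zeta> \<mu>] Wsub_UI[OF U.PI_0] by (simp add: hp_def)
qed

text \<open>With \<open>Wsub_mult_l\<close> this makes products of components independent of
  representatives. The factor q has to be homogeneous of weight \<mu> - \<nu>, so that K_h passes it
  and its value at \<mu> turns into the value at \<nu>.\<close>

lemma Wsub_mult_r:
  assumes x: "x \<in> Wsub \<zeta> \<mu>" and q: "q \<in> UH (\<mu> - \<nu>)"
  shows "x * q \<in> Wsub \<zeta> \<nu>"
proof -
  have "x \<in> {x. x * q \<in> Wsub \<zeta> \<nu>}"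
  proof (rule Wsub_elim[OF _ _ _ _ x])
    show "pm.subspace {x. x * q \<in> Wsub \<zeta> \<nu>}"
      using Wsub_subspace[of \<zeta> \<nu>] by (auto simp: pm.subspace_def distrib_right sc_mult_left)
    show "UI \<subseteq> {x. x * q \<in> Wsub \<zeta> \<nu>}" using U.PI_r UH_UG[OF q] Wsub_UI by blast
    fix h p assume p: "p \<in> UG"
    show "Kd h \<zeta> * p \<in> {x. x * q \<in> Wsub \<zeta> \<nu>}"
      using Wsub_l[of "p * q"] p UH_UG[OF q] by (simp add: mult.assoc)
    have a: "p * (fgen (T h) * q - sc (v powi pr h (\<mu> - \<nu>)) (q * fgen (T h))) \<in> Wsub \<zeta> \<nu>"
      by (intro Wsub_UI U.PI_l K_UH q p)
    have b: "sc (v powi pr h (\<mu> - \<nu>)) (p * q * Kd h \<nu>) \<in> Wsub \<zeta> \<nu>"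
      using p UH_UG[OF q] by (intro Wsub_sc Wsub_r) auto
    have "v powi pr h \<mu> = v powi pr h (\<mu> - \<nu>) * v powi pr h \<nu>" by (simp add: v_add[symmetric] pr_diff2)
    then show "p * Kd h \<mu> \<in> {x. x * q \<in> Wsub \<zeta> \<nu>}"
      using Wsub_add[OF a b] unfolding Kd_def
      by (simp add: left_diff_distrib right_diff_distrib sc_mult_left sc_mult_right mult.assoc pm.scale_right_diff_distrib)
  qed
  then show ?thesis by simp
qed

lemma Wsub_mult_l:
  assumes x: "x \<in> Wsub \<mu> \<nu>" and q: "q \<in> UH (\<zeta> - \<mu>)"
  shows "q * x \<in> Wsub \<zeta> \<nu>"
proof -
  have "x \<in> {x. q * x \<in> Wsub \<zeta> \<nu>}"
  proof (rule Wsub_elim[OF _ _ _ _ x])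
    show "pm.subspace {x. q * x \<in> Wsub \<zeta> \<nu>}"
      using Wsub_subspace[of \<zeta> \<nu>] by (auto simp: pm.subspace_def distrib_left sc_mult_right)
    show "UI \<subseteq> {x. q * x \<in> Wsub \<zeta> \<nu>}" using U.PI_l UH_UG[OF q] Wsub_UI by blast
    fix h p assume p: "p \<in> UG"
    show "p * Kd h \<nu> \<in> {x. q * x \<in> Wsub \<zeta> \<nu>}"
      using Wsub_r[of "q * p"] p UH_UG[OF q] by (simp add: mult.assoc)
    define c where "c = v powi pr h (\<zeta> - \<mu>)"
    have c: "c \<noteq> 0" by (simp add: c_def v_nonzero)
    have a: "(fgen (T h) * q - sc c (q * fgen (T h))) * p \<in> Wsub \<zeta> \<nu>"
      unfolding c_def by (intro Wsub_UI U.PI_r K_UH q p)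
    have b: "Kd h \<zeta> * (q * p) \<in> Wsub \<zeta> \<nu>"
      using p UH_UG[OF q] by (intro Wsub_l) auto
    have "v powi pr h \<zeta> = c * v powi pr h \<mu>" by (simp add: c_def v_add[symmetric] pr_diff2)
    then have "Kd h \<zeta> * (q * p) - (fgen (T h) * q - sc c (q * fgen (T h))) * p = sc c (q * (Kd h \<mu> * p))"
      unfolding Kd_def
      by (simp add: left_diff_distrib right_diff_distrib sc_mult_left sc_mult_right mult.assoc pm.scale_right_diff_distrib)
    then have "sc c (q * (Kd h \<mu> * p)) \<in> Wsub \<zeta> \<nu>" using Wsub_diff[OF b a] by simp
    then have "sc (inverse c) (sc c (q * (Kd h \<mu> * p))) \<in> Wsub \<zeta> \<nu>" by (rule Wsub_sc)
    then show "Kd h \<mu> * p \<in> {x. q * x \<in> Wsub \<zeta> \<nu>}" using c by simp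
  qed
  then show ?thesis by simp
qed

definition wproj :: "'x \<Rightarrow> 'x \<Rightarrow> ('i, 'y) gen fpoly \<Rightarrow> ('i, 'y) gen fpoly set set" where
  "wproj \<zeta> \<mu> p = wt_proj D \<zeta> \<mu> (U_class D p)"

lemma wq_carrier: "carrier (wt_quot D \<zeta> \<mu>) = wproj \<zeta> \<mu> ` UG"
  unfolding wt_quot_def Um.quot_carrier[OF wt_sub_sbsp] U.PA_carrier by (auto simp: wproj_def wt_proj_def)

lemma wq_closed[simp]: "p \<in> UG \<Longrightarrow> wproj \<zeta> \<mu> p \<in> carrier (wt_quot D \<zeta> \<mu>)" by (simp add: wq_carrier)

lemma wq_zero: "\<zero>\<^bsub>wt_quot D \<zeta> \<mu>\<^esub> = wproj \<zeta> \<mu> 0"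
  unfolding wt_quot_def Um.quot_zero[OF wt_sub_sbsp] by (simp add: wproj_def wt_proj_def U.PA_zero)

lemma wq_add: "p \<in> UG \<Longrightarrow> q \<in> UG \<Longrightarrow> wproj \<zeta> \<mu> p \<oplus>\<^bsub>wt_quot D \<zeta> \<mu>\<^esub> wproj \<zeta> \<mu> q = wproj \<zeta> \<mu> (p + q)"
  unfolding wt_quot_def wproj_def wt_proj_def by (simp add: Um.quot_add[OF wt_sub_sbsp] U.PA_add)

lemma wq_smult: "p \<in> UG \<Longrightarrow> c \<odot>\<^bsub>wt_quot D \<zeta> \<mu>\<^esub> wproj \<zeta> \<mu> p = wproj \<zeta> \<mu> (sc c p)"
  unfolding wt_quot_def wproj_def wt_proj_def by (simp add: Um.quot_smult[OF wt_sub_sbsp] U.PA_smult)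

lemma wq_eq: "p \<in> UG \<Longrightarrow> q \<in> UG \<Longrightarrow> wproj \<zeta> \<mu> p = wproj \<zeta> \<mu> q \<longleftrightarrow> p - q \<in> Wsub \<zeta> \<mu>"
  unfolding wproj_def wt_proj_def by (simp add: Um.quot_eq[OF wt_sub_sbsp] U.PA_minus Wsub_def)

lemma wq_module: "Module.module Qv_ring (wt_quot D \<zeta> \<mu>)"
  unfolding wt_quot_def by (rule Um.quot_module[OF wt_sub_sbsp])

lemma wq_E: assumes "X \<in> carrier (wt_quot D \<zeta> \<mu>)" obtains p where "p \<in> UH (\<zeta> - \<mu>)" "X = wproj \<zeta> \<mu> p"
proof -
  obtain p where p: "p \<in> UG" "X = wproj \<zeta> \<mu> p" using assms by (auto simp: wq_carrier)
  have "X = wproj \<zeta> \<mu> (hp (\<zeta> - \<mu>) p)"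
    unfolding p(2) by (subst wq_eq) (use p UH_UG[OF hp_UH[OF p(1)]] hp_Wsub[OF p(1)] in auto)
  then show thesis using that hp_UH[OF p(1)] by blast
qed

lemma wq_finsum:
  assumes "finite A" "\<And>a. a \<in> A \<Longrightarrow> f a \<in> UG"
  shows "finsum (wt_quot D \<zeta> \<mu>) (\<lambda>a. wproj \<zeta> \<mu> (f a)) A = wproj \<zeta> \<mu> (\<Sum>a\<in>A. f a)"
proof -
  interpret Q: qvspace "wt_quot D \<zeta> \<mu>" by (rule qvspace.intro[OF wq_module])
  show ?thesis using assms
  proof (induction A rule: finite_induct)
    case empty then show ?case by (simp add: wq_zero)
  next
    case (insert x S)
    then have "finsum (wt_quot D \<zeta> \<mu>) (\<lambda>a. wproj \<zeta> \<mu> (f a)) (insert x S) =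
      wproj \<zeta> \<mu> (f x) \<oplus>\<^bsub>wt_quot D \<zeta> \<mu>\<^esub> finsum (wt_quot D \<zeta> \<mu>) (\<lambda>a. wproj \<zeta> \<mu> (f a)) S"
      by (intro Q.finsum_insert) auto
    then show ?case using insert by (simp add: wq_add FG_sum)
  qed
qed

text \<open>Uniqueness behind the \<open>THE\<close> in \<open>wt_mult\<close> rests on p' q' - p q
  = (p' - p) q' + p (q' - q).\<close>

lemma wt_mult_eq:
  assumes p: "p \<in> UH (\<zeta> - \<mu>)" and q: "q \<in> UH (\<mu> - \<nu>)"
  shows "wt_mult D \<zeta> \<mu> \<nu> (wproj \<zeta> \<mu> p) (wproj \<mu> \<nu> q) = wproj \<zeta> \<nu> (p * q)"
  unfolding wt_mult_def
proof (rule the_equality)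
  show "\<exists>t\<in>U_wt D (\<zeta> - \<mu>). \<exists>s\<in>U_wt D (\<mu> - \<nu>). wproj \<zeta> \<mu> p = wt_proj D \<zeta> \<mu> t \<and>
      wproj \<mu> \<nu> q = wt_proj D \<mu> \<nu> s \<and> wproj \<zeta> \<nu> (p * q) = wt_proj D \<zeta> \<nu> (t \<otimes>\<^bsub>U_alg D\<^esub> s)"
    unfolding U_wt_eq using p q UH_UG[OF p] UH_UG[OF q]
    by (intro bexI[of _ "U_class D p"] bexI[of _ "U_class D q"]) (auto simp: wproj_def U.PA_mult)
next
  fix c assume "\<exists>t\<in>U_wt D (\<zeta> - \<mu>). \<exists>s\<in>U_wt D (\<mu> - \<nu>). wproj \<zeta> \<mu> p = wt_proj D \<zeta> \<mu> t \<and>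
      wproj \<mu> \<nu> q = wt_proj D \<mu> \<nu> s \<and> c = wt_proj D \<zeta> \<nu> (t \<otimes>\<^bsub>U_alg D\<^esub> s)"
  then obtain p' q' where pq: "p' \<in> UH (\<zeta> - \<mu>)" "q' \<in> UH (\<mu> - \<nu>)" "wproj \<zeta> \<mu> p = wproj \<zeta> \<mu> p'"
    "wproj \<mu> \<nu> q = wproj \<mu> \<nu> q'" "c = wt_proj D \<zeta> \<nu> (U_class D p' \<otimes>\<^bsub>U_alg D\<^esub> U_class D q')"
    unfolding U_wt_eq wproj_def by blast
  have ug: "p \<in> UG" "q \<in> UG" "p' \<in> UG" "q' \<in> UG" using p q pq UH_UG by auto
  have "p' - p \<in> Wsub \<zeta> \<mu>" "q' - q \<in> Wsub \<mu> \<nu>" using pq ug wq_eq by metis+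
  then have "(p' - p) * q' \<in> Wsub \<zeta> \<nu>" "p * (q' - q) \<in> Wsub \<zeta> \<nu>"
    using Wsub_mult_r Wsub_mult_l pq p by blast+
  then have "(p' - p) * q' + p * (q' - q) \<in> Wsub \<zeta> \<nu>" by (rule Wsub_add)
  then have "p' * q' - p * q \<in> Wsub \<zeta> \<nu>" by (simp add: algebra_simps)
  then show "c = wproj \<zeta> \<nu> (p * q)"
    unfolding pq(5) using ug by (simp add: U.PA_mult wproj_def[symmetric] wq_eq)
qed

subsection \<open>The maps to \<open>S(\<pi>)\<close>\<close>

definition sand :: "'x set \<Rightarrow> 'x \<Rightarrow> 'x \<Rightarrow> ('i, 'y) gen fpoly \<Rightarrow> ('i, 'x) gen fpoly" where
  "sand \<pi> \<zeta> \<mu> p = idem D \<pi> \<zeta> * fsub (pg \<pi>) p * idem D \<pi> \<mu>"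

lemma lin_sand: "lin (sand \<pi> \<zeta> \<mu>)"
  unfolding sand_def by (rule lin_comp[OF lin_mult_right lin_comp[OF lin_mult_left lin_fsub]])

lemma fsub_pg_FG[simp]: "p \<in> UG \<Longrightarrow> fsub (pg \<pi>) p \<in> SG \<pi>"
  by (rule fsub_FG[OF _ pg_FG])

lemma sand_FG[simp]: "p \<in> UG \<Longrightarrow> sand \<pi> \<zeta> \<mu> p \<in> SG \<pi>"
  unfolding sand_def by (intro FG_mult FG_idem fsub_pg_FG)

lemma fsub_pg_UI: assumes "finite (Wo \<pi>)" "x \<in> UI" shows "fsub (pg \<pi>) x \<in> SI \<pi>"
proof -
  have "UI \<subseteq> {p \<in> UG. fsub (pg \<pi>) p \<in> SI \<pi>}"
    by (rule U.PI_minimal[OF idealp_pullback[OF S.PI_idealp pg_FG]]) (use pg_rel[OF assms(1)] U.R_FG in auto)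
  then show ?thesis using assms by blast
qed

lemma sand_Wsub: assumes fin: "finite (Wo \<pi>)" and x: "x \<in> Wsub \<zeta> \<mu>" shows "sand \<pi> \<zeta> \<mu> x \<in> SI \<pi>"
proof -
  have "x \<in> {x. sand \<pi> \<zeta> \<mu> x \<in> SI \<pi>}"
  proof (rule Wsub_elim[OF _ _ _ _ x])
    show "pm.subspace {x. sand \<pi> \<zeta> \<mu> x \<in> SI \<pi>}"
      using SI_subspace[of \<pi>] lin_add[OF lin_sand] lin_sc[OF lin_sand] lin_0[OF lin_sand] by (simp add: pm.subspace_def)
    show "UI \<subseteq> {x. sand \<pi> \<zeta> \<mu> x \<in> SI \<pi>}"
      unfolding sand_def using S.PI_l S.PI_r fsub_pg_UI[OF fin] FG_idem by blast
    fix h p assume p: "p \<in> UG"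
    have e: "fsub (pg \<pi>) (Kd h \<kappa>) = Kp \<pi> h - sc (v powi pr h \<kappa>) 1" for \<kappa>
      by (simp add: Kd_def fsub_diff fsub_sc)
    have "(idem D \<pi> \<zeta> * Kp \<pi> h - sc (v powi pr h \<zeta>) (idem D \<pi> \<zeta>)) * (fsub (pg \<pi>) p * idem D \<pi> \<mu>) \<in> SI \<pi>"
      using p by (intro S.PI_r Kp_idem_l[OF fin] FG_mult FG_idem fsub_pg_FG)
    then show "Kd h \<zeta> * p \<in> {x. sand \<pi> \<zeta> \<mu> x \<in> SI \<pi>}"
      by (simp add: sand_def fsub_mult e left_diff_distrib right_diff_distrib mult.assoc sc_mult_left sc_mult_right)
    have "idem D \<pi> \<zeta> * fsub (pg \<pi>) p * (Kp \<pi> h * idem D \<pi> \<mu> - sc (v powi pr h \<mu>) (idem D \<pi> \<mu>)) \<in> SI \<pi>"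
      using p by (intro S.PI_l Kp_idem_r[OF fin] FG_mult FG_idem fsub_pg_FG)
    then show "p * Kd h \<mu> \<in> {x. sand \<pi> \<zeta> \<mu> x \<in> SI \<pi>}"
      by (simp add: sand_def fsub_mult e left_diff_distrib right_diff_distrib mult.assoc sc_mult_left sc_mult_right)
  qed
  then show ?thesis by simp
qed

text \<open>Again a value on a coset, now of classes in U: \<open>sand_Wsub\<close> makes the image
  a single point.\<close>

lemma pdot_comp_eq:
  assumes fin: "finite (Wo \<pi>)" and p: "p \<in> UG"
  shows "pdot_comp D \<pi> \<zeta> \<mu> (wproj \<zeta> \<mu> p) = S_class D \<pi> (sand \<pi> \<zeta> \<mu> p)"
proof -
  let ?f = "\<lambda>u. S_class D \<pi> (idem D \<pi> \<zeta>) \<otimes>\<^bsub>S_alg D \<pi>\<^esub> p_map D \<pi> u \<otimes>\<^bsub>S_alg D \<pi>\<^esub> S_class D \<pi> (idem D \<pi> \<mu>)"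
  have f: "?f (U_class D q) = S_class D \<pi> (sand \<pi> \<zeta> \<mu> q)" if "q \<in> UG" for q
    using that by (simp add: p_map_class[OF fin] S.PA_mult sand_def)
  have "?f u = S_class D \<pi> (sand \<pi> \<zeta> \<mu> p)" if u: "u \<in> wproj \<zeta> \<mu> p" for u
  proof -
    obtain n where n: "n \<in> wt_sub D \<zeta> \<mu>" "u = n \<oplus>\<^bsub>U_alg D\<^esub> U_class D p"
      using u unfolding wproj_def wt_proj_def Um.mem_coset[OF wt_sub_sbsp] by blast
    have "n \<in> carrier (U_alg D)" using wt_sub_sbsp[of \<zeta> \<mu>] n(1) unfolding Um.sbsp_def by blast
    then obtain x where x: "x \<in> UG" "n = U_class D x" using U.PA_E by blast
    then have xw: "x \<in> Wsub \<zeta> \<mu>" using n by (simp add: Wsub_def)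
    have "u = U_class D (x + p)" using n x p by (simp add: U.PA_add)
    then have "?f u = S_class D \<pi> (sand \<pi> \<zeta> \<mu> (x + p))" using f[of "x + p"] x p by simp
    also have "\<dots> = S_class D \<pi> (sand \<pi> \<zeta> \<mu> p)"
      using sand_Wsub[OF fin xw] x p by (subst S.cl_iff) (auto simp: lin_add[OF lin_sand])
    finally show ?thesis .
  qed
  moreover have "U_class D p \<in> wproj \<zeta> \<mu> p"
    unfolding wproj_def wt_proj_def Um.mem_coset[OF wt_sub_sbsp]
    using wt_sub_sbsp[of \<zeta> \<mu>] p by (intro bexI[of _ "\<zero>\<^bsub>U_alg D\<^esub>"]) (auto simp: Um.sbsp_def)
  ultimately have "?f ` wproj \<zeta> \<mu> p = {S_class D \<pi> (sand \<pi> \<zeta> \<mu> p)}" by blast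
  then show ?thesis by (simp add: pdot_comp_def)
qed

definition sp :: "('i, 'x, 'y) udot \<Rightarrow> ('x \<times> 'x) set" where
  "sp x = {(\<zeta>, \<mu>). x \<zeta> \<mu> \<noteq> \<zero>\<^bsub>wt_quot D \<zeta> \<mu>\<^esub>}"

lemma Udot_carrier: "x \<in> carrier (Udot D) \<longleftrightarrow> (\<forall>\<zeta> \<mu>. x \<zeta> \<mu> \<in> carrier (wt_quot D \<zeta> \<mu>)) \<and> finite (sp x)"
  by (simp add: Udot_def sp_def)

lemma Udot_simps:
  "\<zero>\<^bsub>Udot D\<^esub> = (\<lambda>\<zeta> \<mu>. \<zero>\<^bsub>wt_quot D \<zeta> \<mu>\<^esub>)"
  "x \<oplus>\<^bsub>Udot D\<^esub> y = (\<lambda>\<zeta> \<mu>. x \<zeta> \<mu> \<oplus>\<^bsub>wt_quot D \<zeta> \<mu>\<^esub> y \<zeta> \<mu>)"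
  "c \<odot>\<^bsub>Udot D\<^esub> x = (\<lambda>\<zeta> \<mu>. c \<odot>\<^bsub>wt_quot D \<zeta> \<mu>\<^esub> x \<zeta> \<mu>)"
  by (simp_all add: Udot_def)

lemma Udot_module: "Module.module Qv_ring (Udot D)"
proof -
  interpret Q: qvspace "wt_quot D \<zeta> \<mu>" for \<zeta> \<mu> by (rule qvspace.intro[OF wq_module])
  have sm: "c \<odot>\<^bsub>Udot D\<^esub> x \<in> carrier (Udot D)" if "x \<in> carrier (Udot D)" for c x
  proof -
    have "sp (c \<odot>\<^bsub>Udot D\<^esub> x) \<subseteq> sp x"
    proof (rule subrelI, rule ccontr)
      fix \<zeta> \<mu> assume m: "(\<zeta>, \<mu>) \<in> sp (c \<odot>\<^bsub>Udot D\<^esub> x)" and "(\<zeta>, \<mu>) \<notin> sp x"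
      then have "x \<zeta> \<mu> = \<zero>\<^bsub>wt_quot D \<zeta> \<mu>\<^esub>" by (simp only: sp_def mem_Collect_eq prod.case not_not)
      then have "(c \<odot>\<^bsub>Udot D\<^esub> x) \<zeta> \<mu> = \<zero>\<^bsub>wt_quot D \<zeta> \<mu>\<^esub>" by (simp only: Udot_simps Q.sm_zero_r)
      then show False using m by (simp only: sp_def mem_Collect_eq prod.case)
    qed
    moreover have "finite (sp x)" using that by (simp add: Udot_carrier)
    ultimately have "finite (sp (c \<odot>\<^bsub>Udot D\<^esub> x))" by (rule finite_subset)
    then show ?thesis using that by (simp add: Udot_carrier Udot_simps)
  qed
  have "abelian_group (Udot D)"
  proof (rule abelian_groupI)
    fix x y assume xy: "x \<in> carrier (Udot D)" "y \<in> carrier (Udot D)"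
    have "sp (x \<oplus>\<^bsub>Udot D\<^esub> y) \<subseteq> sp x \<union> sp y"
    proof (rule subrelI, rule ccontr)
      fix \<zeta> \<mu> assume m: "(\<zeta>, \<mu>) \<in> sp (x \<oplus>\<^bsub>Udot D\<^esub> y)" and "(\<zeta>, \<mu>) \<notin> sp x \<union> sp y"
      then have "x \<zeta> \<mu> = \<zero>\<^bsub>wt_quot D \<zeta> \<mu>\<^esub>" "y \<zeta> \<mu> = \<zero>\<^bsub>wt_quot D \<zeta> \<mu>\<^esub>"
        by (simp_all only: Un_iff sp_def mem_Collect_eq prod.case not_not de_Morgan_disj)
      then have "(x \<oplus>\<^bsub>Udot D\<^esub> y) \<zeta> \<mu> = \<zero>\<^bsub>wt_quot D \<zeta> \<mu>\<^esub>" by (simp only: Udot_simps Q.l_zero Q.zero_closed)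
      then show False using m by (simp only: sp_def mem_Collect_eq prod.case)
    qed
    moreover have "finite (sp x \<union> sp y)" using xy by (simp add: Udot_carrier)
    ultimately have "finite (sp (x \<oplus>\<^bsub>Udot D\<^esub> y))" by (rule finite_subset)
    then show "x \<oplus>\<^bsub>Udot D\<^esub> y \<in> carrier (Udot D)"
      using xy by (simp add: Udot_carrier Udot_simps)
    show "x \<oplus>\<^bsub>Udot D\<^esub> y = y \<oplus>\<^bsub>Udot D\<^esub> x"
      using xy by (simp add: Udot_carrier Udot_simps Q.a_comm)
  next
    show "\<zero>\<^bsub>Udot D\<^esub> \<in> carrier (Udot D)" by (simp add: Udot_carrier Udot_simps sp_def)
  next
    fix x y z assume "x \<in> carrier (Udot D)" "y \<in> carrier (Udot D)" "z \<in> carrier (Udot D)"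
    then show "x \<oplus>\<^bsub>Udot D\<^esub> y \<oplus>\<^bsub>Udot D\<^esub> z = x \<oplus>\<^bsub>Udot D\<^esub> (y \<oplus>\<^bsub>Udot D\<^esub> z)"
      by (simp add: Udot_carrier Udot_simps Q.a_assoc)
  next
    fix x assume x: "x \<in> carrier (Udot D)"
    then show "\<zero>\<^bsub>Udot D\<^esub> \<oplus>\<^bsub>Udot D\<^esub> x = x" by (simp add: Udot_carrier Udot_simps)
    show "\<exists>y\<in>carrier (Udot D). y \<oplus>\<^bsub>Udot D\<^esub> x = \<zero>\<^bsub>Udot D\<^esub>"
    proof (intro bexI)
      show "((- 1) \<odot>\<^bsub>Udot D\<^esub> x) \<oplus>\<^bsub>Udot D\<^esub> x = \<zero>\<^bsub>Udot D\<^esub>"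
        using x by (simp add: Udot_carrier Udot_simps Q.sm_minus Q.l_neg)
      show "(- 1) \<odot>\<^bsub>Udot D\<^esub> x \<in> carrier (Udot D)" by (rule sm[OF x])
    qed
  qed
  then show ?thesis
  proof (rule moduleI[OF cring_Qv_ring])
    fix a x assume "x \<in> carrier (Udot D)"
    then show "a \<odot>\<^bsub>Udot D\<^esub> x \<in> carrier (Udot D)" by (rule sm)
  qed (simp_all add: Udot_carrier Udot_simps Q.sm_add_l Q.sm_add_r Q.sm_assoc)
qed

end

context rdatum
begin

lemma Udot_reps:
  assumes "x \<in> carrier (Udot D)"
  obtains X where "\<And>\<zeta> \<mu>. X \<zeta> \<mu> \<in> UH (\<zeta> - \<mu>)" "\<And>\<zeta> \<mu>. x \<zeta> \<mu> = wproj \<zeta> \<mu> (X \<zeta> \<mu>)"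
    "\<And>\<zeta> \<mu>. (\<zeta>, \<mu>) \<notin> sp x \<Longrightarrow> X \<zeta> \<mu> = 0"
proof -
  have "\<exists>p. p \<in> UH (\<zeta> - \<mu>) \<and> x \<zeta> \<mu> = wproj \<zeta> \<mu> p \<and> ((\<zeta>, \<mu>) \<notin> sp x \<longrightarrow> p = 0)" for \<zeta> \<mu>
  proof (cases "(\<zeta>, \<mu>) \<in> sp x")
    case True
    have "x \<zeta> \<mu> \<in> carrier (wt_quot D \<zeta> \<mu>)" using assms by (simp add: Udot_carrier)
    from wq_E[OF this] True show ?thesis by metis
  next
    case False
    then have "x \<zeta> \<mu> = wproj \<zeta> \<mu> 0" by (simp add: sp_def wq_zero)
    then show ?thesis by (intro exI[of _ 0]) simp
  qed
  then obtain X where "\<forall>\<zeta> \<mu>. X \<zeta> \<mu> \<in> UH (\<zeta> - \<mu>) \<and> x \<zeta> \<mu> = wproj \<zeta> \<mu> (X \<zeta> \<mu>) \<and> ((\<zeta>, \<mu>) \<notin> sp x \<longrightarrow> X \<zeta> \<mu> = 0)" by metis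
  then show thesis using that by blast
qed

lemma Udot_sp_sub:
  assumes "\<And>\<zeta> \<mu>. x \<zeta> \<mu> = wproj \<zeta> \<mu> (X \<zeta> \<mu>)" "\<And>\<zeta> \<mu>. (\<zeta>, \<mu>) \<notin> Fs \<Longrightarrow> X \<zeta> \<mu> = 0"
  shows "sp x \<subseteq> Fs"
proof (rule subrelI, rule ccontr)
  fix \<zeta> \<mu> assume m: "(\<zeta>, \<mu>) \<in> sp x" and "(\<zeta>, \<mu>) \<notin> Fs"
  then have "x \<zeta> \<mu> = \<zero>\<^bsub>wt_quot D \<zeta> \<mu>\<^esub>" using assms by (simp add: wq_zero)
  then show False using m by (simp add: sp_def)
qed

lemma Udot_memI:
  assumes "\<And>\<zeta> \<mu>. X \<zeta> \<mu> \<in> UG" "\<And>\<zeta> \<mu>. x \<zeta> \<mu> = wproj \<zeta> \<mu> (X \<zeta> \<mu>)"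
    "finite Fs" "\<And>\<zeta> \<mu>. (\<zeta>, \<mu>) \<notin> Fs \<Longrightarrow> X \<zeta> \<mu> = 0"
  shows "x \<in> carrier (Udot D)"
proof -
  have "sp x \<subseteq> Fs" by (rule Udot_sp_sub[OF assms(2,4)])
  then have "finite (sp x)" using assms(3) by (rule finite_subset)
  then show ?thesis unfolding Udot_carrier using assms(1,2) by simp
qed

text \<open>The index set may exceed the support, so that several elements can be expanded over a
  common one. A surplus term represents zero and lies in the ideal by
  \<open>sand_Wsub\<close>.\<close>

lemma pdot_eq:
  assumes fin: "finite (Wo \<pi>)"
    and X: "\<And>\<zeta> \<mu>. X \<zeta> \<mu> \<in> UG" "\<And>\<zeta> \<mu>. x \<zeta> \<mu> = wproj \<zeta> \<mu> (X \<zeta> \<mu>)"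
    and F: "finite Fs" "\<And>\<zeta> \<mu>. (\<zeta>, \<mu>) \<notin> Fs \<Longrightarrow> X \<zeta> \<mu> = 0"
  shows "pdot D \<pi> x = S_class D \<pi> (\<Sum>(\<zeta>, \<mu>)\<in>Fs. sand \<pi> \<zeta> \<mu> (X \<zeta> \<mu>))"
proof -
  interpret R: Ring.ring "S_alg D \<pi>" by (rule S.PA_ring)
  let ?f = "\<lambda>z. sand \<pi> (fst z) (snd z) (X (fst z) (snd z))"
  have sub: "sp x \<subseteq> Fs" by (rule Udot_sp_sub[OF X(2) F(2)])
  have fin': "finite (sp x)" using sub F(1) by (rule finite_subset)
  have fFG: "?f z \<in> SG \<pi>" for z using X(1) by simp
  have "pdot D \<pi> x = finsum (S_alg D \<pi>) (\<lambda>z. S_class D \<pi> (?f z)) (sp x)"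
    unfolding pdot_def sp_def[symmetric]
  proof (rule R.finsum_cong'[OF refl])
    show "(\<lambda>z. S_class D \<pi> (?f z)) \<in> sp x \<rightarrow> carrier (S_alg D \<pi>)" using fFG by simp
    fix z
    show "(case z of (\<zeta>, \<mu>) \<Rightarrow> pdot_comp D \<pi> \<zeta> \<mu> (x \<zeta> \<mu>)) = S_class D \<pi> (?f z)"
      by (cases z) (simp add: X(2) pdot_comp_eq[OF fin X(1)])
  qed
  also have "\<dots> = S_class D \<pi> (\<Sum>z\<in>sp x. ?f z)" by (rule S.PA_finsum[OF fin' fFG])
  also have "\<dots> = S_class D \<pi> (\<Sum>z\<in>Fs. ?f z)"
  proof (subst S.cl_iff)
    have "(\<Sum>z\<in>Fs. ?f z) = (\<Sum>z\<in>sp x. ?f z) + (\<Sum>z\<in>Fs - sp x. ?f z)"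
      using sum.subset_diff[OF sub F(1), of ?f] by (simp add: add.commute)
    moreover have "(\<Sum>z\<in>Fs - sp x. ?f z) \<in> SI \<pi>"
    proof (rule S.PI_sum)
      fix z assume "z \<in> Fs - sp x"
      then have "x (fst z) (snd z) = \<zero>\<^bsub>wt_quot D (fst z) (snd z)\<^esub>" by (cases z) (simp add: sp_def)
      then have "wproj (fst z) (snd z) (X (fst z) (snd z)) = wproj (fst z) (snd z) 0" by (simp add: X(2) wq_zero)
      then have "X (fst z) (snd z) \<in> Wsub (fst z) (snd z)" using X(1) wq_eq[of "X (fst z) (snd z)" 0] by simp
      then show "?f z \<in> SI \<pi>" by (rule sand_Wsub[OF fin])
    qed
    ultimately show "(\<Sum>z\<in>sp x. ?f z) - (\<Sum>z\<in>Fs. ?f z) \<in> SI \<pi>" using S.PI_minus by simp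
  qed (use fFG in auto)
  finally show ?thesis by (simp add: case_prod_beta)
qed

lemma pdot_closed: assumes "finite (Wo \<pi>)" "x \<in> carrier (Udot D)" shows "pdot D \<pi> x \<in> carrier (S_alg D \<pi>)"
proof -
  obtain X where X: "\<And>\<zeta> \<mu>. X \<zeta> \<mu> \<in> UH (\<zeta> - \<mu>)" "\<And>\<zeta> \<mu>. x \<zeta> \<mu> = wproj \<zeta> \<mu> (X \<zeta> \<mu>)"
    "\<And>\<zeta> \<mu>. (\<zeta>, \<mu>) \<notin> sp x \<Longrightarrow> X \<zeta> \<mu> = 0" using Udot_reps[OF assms(2)] by blast
  have "finite (sp x)" using assms by (simp add: Udot_carrier)
  from pdot_eq[OF assms(1) UH_UG[OF X(1)] X(2) this X(3)] show ?thesis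
    using UH_UG[OF X(1)] by (auto intro!: S.cl_closed FG_sum)
qed

lemma pdot_add:
  assumes fin: "finite (Wo \<pi>)" and x: "x \<in> carrier (Udot D)" and y: "y \<in> carrier (Udot D)"
  shows "pdot D \<pi> (x \<oplus>\<^bsub>Udot D\<^esub> y) = pdot D \<pi> x \<oplus>\<^bsub>S_alg D \<pi>\<^esub> pdot D \<pi> y"
proof -
  obtain X where X: "\<And>\<zeta> \<mu>. X \<zeta> \<mu> \<in> UH (\<zeta> - \<mu>)" "\<And>\<zeta> \<mu>. x \<zeta> \<mu> = wproj \<zeta> \<mu> (X \<zeta> \<mu>)"
    "\<And>\<zeta> \<mu>. (\<zeta>, \<mu>) \<notin> sp x \<Longrightarrow> X \<zeta> \<mu> = 0" using Udot_reps[OF x] by blast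
  obtain Y where Y: "\<And>\<zeta> \<mu>. Y \<zeta> \<mu> \<in> UH (\<zeta> - \<mu>)" "\<And>\<zeta> \<mu>. y \<zeta> \<mu> = wproj \<zeta> \<mu> (Y \<zeta> \<mu>)"
    "\<And>\<zeta> \<mu>. (\<zeta>, \<mu>) \<notin> sp y \<Longrightarrow> Y \<zeta> \<mu> = 0" using Udot_reps[OF y] by blast
  note XU = UH_UG[OF X(1)] and YU = UH_UG[OF Y(1)]
  let ?F = "sp x \<union> sp y"
  have F: "finite ?F" using x y by (simp add: Udot_carrier)
  have px: "pdot D \<pi> x = S_class D \<pi> (\<Sum>(\<zeta>, \<mu>)\<in>?F. sand \<pi> \<zeta> \<mu> (X \<zeta> \<mu>))"
    by (rule pdot_eq[OF fin XU X(2) F]) (use X(3) in auto)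
  have py: "pdot D \<pi> y = S_class D \<pi> (\<Sum>(\<zeta>, \<mu>)\<in>?F. sand \<pi> \<zeta> \<mu> (Y \<zeta> \<mu>))"
    by (rule pdot_eq[OF fin YU Y(2) F]) (use Y(3) in auto)
  have "pdot D \<pi> (x \<oplus>\<^bsub>Udot D\<^esub> y) = S_class D \<pi> (\<Sum>(\<zeta>, \<mu>)\<in>?F. sand \<pi> \<zeta> \<mu> (X \<zeta> \<mu> + Y \<zeta> \<mu>))"
    by (rule pdot_eq[OF fin _ _ F]) (use XU YU X Y in \<open>auto simp: Udot_simps wq_add\<close>)
  also have "\<dots> = S_class D \<pi> ((\<Sum>(\<zeta>, \<mu>)\<in>?F. sand \<pi> \<zeta> \<mu> (X \<zeta> \<mu>)) + (\<Sum>(\<zeta>, \<mu>)\<in>?F. sand \<pi> \<zeta> \<mu> (Y \<zeta> \<mu>)))"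
    by (simp add: lin_add[OF lin_sand] sum.distrib case_prod_beta)
  also have "\<dots> = pdot D \<pi> x \<oplus>\<^bsub>S_alg D \<pi>\<^esub> pdot D \<pi> y"
    unfolding px py by (rule S.PA_add[symmetric]) (use XU YU in \<open>auto intro!: FG_sum\<close>)
  finally show ?thesis .
qed

lemma pdot_smult:
  assumes fin: "finite (Wo \<pi>)" and x: "x \<in> carrier (Udot D)"
  shows "pdot D \<pi> (c \<odot>\<^bsub>Udot D\<^esub> x) = c \<odot>\<^bsub>S_alg D \<pi>\<^esub> pdot D \<pi> x"
proof -
  obtain X where X: "\<And>\<zeta> \<mu>. X \<zeta> \<mu> \<in> UH (\<zeta> - \<mu>)" "\<And>\<zeta> \<mu>. x \<zeta> \<mu> = wproj \<zeta> \<mu> (X \<zeta> \<mu>)"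
    "\<And>\<zeta> \<mu>. (\<zeta>, \<mu>) \<notin> sp x \<Longrightarrow> X \<zeta> \<mu> = 0" using Udot_reps[OF x] by blast
  note XU = UH_UG[OF X(1)]
  have F: "finite (sp x)" using x by (simp add: Udot_carrier)
  have px: "pdot D \<pi> x = S_class D \<pi> (\<Sum>(\<zeta>, \<mu>)\<in>sp x. sand \<pi> \<zeta> \<mu> (X \<zeta> \<mu>))"
    by (rule pdot_eq[OF fin XU X(2) F X(3)])
  have "pdot D \<pi> (c \<odot>\<^bsub>Udot D\<^esub> x) = S_class D \<pi> (\<Sum>(\<zeta>, \<mu>)\<in>sp x. sand \<pi> \<zeta> \<mu> (sc c (X \<zeta> \<mu>)))"
    by (rule pdot_eq[OF fin _ _ F]) (use XU X in \<open>auto simp: Udot_simps wq_smult\<close>)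
  also have "\<dots> = S_class D \<pi> (sc c (\<Sum>(\<zeta>, \<mu>)\<in>sp x. sand \<pi> \<zeta> \<mu> (X \<zeta> \<mu>)))"
    by (simp add: lin_sc[OF lin_sand] pm.scale_sum_right case_prod_beta)
  also have "\<dots> = c \<odot>\<^bsub>S_alg D \<pi>\<^esub> pdot D \<pi> x"
    unfolding px by (rule S.PA_smult[symmetric]) (use XU in \<open>auto intro!: FG_sum\<close>)
  finally show ?thesis .
qed

lemma idem_move_word:
  assumes fin: "finite (Wo \<pi>)" and w: "set (letters w) \<subseteq> U_gens D"
  shows "idem D \<pi> \<zeta> * fsub (pg \<pi>) (bs w) - fsub (pg \<pi>) (bs w) * idem D \<pi> (\<zeta> - gw w) \<in> SI \<pi>"
proof -
  have "\<forall>\<zeta>. idem D \<pi> \<zeta> * fsub (pg \<pi>) (bs w) - fsub (pg \<pi>) (bs w) * idem D \<pi> (\<zeta> - gw w) \<in> SI \<pi>"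
  proof (rule U_word_induct[where P = "\<lambda>x \<nu>. \<forall>\<zeta>. idem D \<pi> \<zeta> * fsub (pg \<pi>) x - fsub (pg \<pi>) x * idem D \<pi> (\<zeta> - \<nu>) \<in> SI \<pi>", OF w])
    show "\<forall>\<zeta>. idem D \<pi> \<zeta> * fsub (pg \<pi>) 1 - fsub (pg \<pi>) 1 * idem D \<pi> (\<zeta> - 0) \<in> SI \<pi>" using S.PI_0 by simp
  next
    fix s i x \<nu> assume i: "i \<in> II" and x: "x \<in> UG"
      and IH: "\<forall>\<zeta>. idem D \<pi> \<zeta> * fsub (pg \<pi>) x - fsub (pg \<pi>) x * idem D \<pi> (\<zeta> - \<nu>) \<in> SI \<pi>"
    show "\<forall>\<zeta>. idem D \<pi> \<zeta> * fsub (pg \<pi>) (fgen (E s i) * x) - fsub (pg \<pi>) (fgen (E s i) * x) * idem D \<pi> (\<zeta> - (sal s i + \<nu>)) \<in> SI \<pi>"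
    proof
      fix \<zeta>
      have a: "(fgen (E s i) * idem D \<pi> (\<zeta> - sal s i) - idem D \<pi> \<zeta> * fgen (E s i)) * fsub (pg \<pi>) x \<in> SI \<pi>"
        using S.PI_r[OF S_E[OF i, of s \<pi> "\<zeta> - sal s i"] fsub_pg_FG[OF x]] by simp
      have b: "fgen (E s i) * (idem D \<pi> (\<zeta> - sal s i) * fsub (pg \<pi>) x - fsub (pg \<pi>) x * idem D \<pi> (\<zeta> - sal s i - \<nu>)) \<in> SI \<pi>"
        using IH i by (intro S.PI_l) auto
      show "idem D \<pi> \<zeta> * fsub (pg \<pi>) (fgen (E s i) * x) - fsub (pg \<pi>) (fgen (E s i) * x) * idem D \<pi> (\<zeta> - (sal s i + \<nu>)) \<in> SI \<pi>"
        using S.PI_diff[OF b a] by (simp add: fsub_mult algebra_simps)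
    qed
  next
    fix h x \<nu> assume x: "x \<in> UG"
      and IH: "\<forall>\<zeta>. idem D \<pi> \<zeta> * fsub (pg \<pi>) x - fsub (pg \<pi>) x * idem D \<pi> (\<zeta> - \<nu>) \<in> SI \<pi>"
    show "\<forall>\<zeta>. idem D \<pi> \<zeta> * fsub (pg \<pi>) (fgen (T h) * x) - fsub (pg \<pi>) (fgen (T h) * x) * idem D \<pi> (\<zeta> - \<nu>) \<in> SI \<pi>"
    proof
      fix \<zeta>
      have a: "(idem D \<pi> \<zeta> * Kp \<pi> h - Kp \<pi> h * idem D \<pi> \<zeta>) * fsub (pg \<pi>) x \<in> SI \<pi>"
        using S.PI_r[OF S.PI_diff[OF Kp_idem_l[OF fin, where h = h and \<mu> = \<zeta>] Kp_idem_r[OF fin, where h = h and \<mu> = \<zeta>]]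
            fsub_pg_FG[OF x]] by simp
      have b: "Kp \<pi> h * (idem D \<pi> \<zeta> * fsub (pg \<pi>) x - fsub (pg \<pi>) x * idem D \<pi> (\<zeta> - \<nu>)) \<in> SI \<pi>"
        using IH by (intro S.PI_l) auto
      show "idem D \<pi> \<zeta> * fsub (pg \<pi>) (fgen (T h) * x) - fsub (pg \<pi>) (fgen (T h) * x) * idem D \<pi> (\<zeta> - \<nu>) \<in> SI \<pi>"
        using S.PI_add[OF a b] by (simp add: fsub_mult algebra_simps)
    qed
  qed
  then show ?thesis by blast
qed

lemma idem_move:
  assumes fin: "finite (Wo \<pi>)" and p: "p \<in> UH \<nu>"
  shows "idem D \<pi> \<zeta> * fsub (pg \<pi>) p - fsub (pg \<pi>) p * idem D \<pi> (\<zeta> - \<nu>) \<in> SI \<pi>"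
proof (rule subspace_lin[where f = "\<lambda>p. idem D \<pi> \<zeta> * fsub (pg \<pi>) p - fsub (pg \<pi>) p * idem D \<pi> (\<zeta> - \<nu>)", OF _ SI_subspace])
  show "lin (\<lambda>p. idem D \<pi> \<zeta> * fsub (pg \<pi>) p - fsub (pg \<pi>) p * idem D \<pi> (\<zeta> - \<nu>))"
    by (rule lin_minus2[OF lin_comp[OF lin_mult_left lin_fsub] lin_comp[OF lin_mult_right lin_fsub]])
  fix w assume "w \<in> Poly_Mapping.keys p"
  then show "idem D \<pi> \<zeta> * fsub (pg \<pi>) (bs w) - fsub (pg \<pi>) (bs w) * idem D \<pi> (\<zeta> - \<nu>) \<in> SI \<pi>"
    using idem_move_word[OF fin, of w \<zeta>] UH_keys[OF p, of w] by simp
qed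

text \<open>The conditional prepares the double sum over two middle weights in
  \<open>Udot_mult\<close>. Different ones are annihilated by orthogonality; for equal ones the
  middle idempotent is moved across X and absorbed by the left one.\<close>

lemma sand_mult:
  assumes fin: "finite (Wo \<pi>)" and X: "X \<in> UH (\<zeta> - \<mu>)" and Y: "Y \<in> UG"
  shows "(if \<mu>' = \<mu> then sand \<pi> \<zeta> \<nu> (X * Y) else 0) - sand \<pi> \<zeta> \<mu> X * sand \<pi> \<mu>' \<nu> Y \<in> SI \<pi>"
proof -
  let ?i = "idem D \<pi>" and ?X = "fsub (pg \<pi>) X" and ?Y = "fsub (pg \<pi>) Y"
  have XF: "?X \<in> SG \<pi>" "?Y \<in> SG \<pi>" using UH_UG[OF X] Y by auto
  show ?thesis
  proof (cases "\<mu>' = \<mu>")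
    case False
    have "- (?i \<zeta> * ?X * (?i \<mu> * ?i \<mu>' - (if \<mu> = \<mu>' then ?i \<mu> else 0)) * (?Y * ?i \<nu>)) \<in> SI \<pi>"
      using XF by (intro S.PI_minus S.PI_r S.PI_l S_idem) auto
    then show ?thesis using False by (simp add: sand_def mult.assoc)
  next
    case True
    have r1: "?i \<zeta> * (?i \<zeta> * ?X - ?X * ?i \<mu>) \<in> SI \<pi>"
      using idem_move[OF fin X, of \<zeta>] by (intro S.PI_l) auto
    have r2: "?i \<zeta> * ?X * (?i \<mu> * ?i \<mu> - ?i \<mu>) \<in> SI \<pi>"
      using S_idem[of \<pi> \<mu> \<mu>] XF by (intro S.PI_l) auto
    have r3: "(?i \<zeta> * ?i \<zeta> - ?i \<zeta>) * ?X \<in> SI \<pi>"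
      using S_idem[of \<pi> \<zeta> \<zeta>] XF by (intro S.PI_r) auto
    have "(?i \<zeta> * (?i \<zeta> * ?X - ?X * ?i \<mu>) - ?i \<zeta> * ?X * (?i \<mu> * ?i \<mu> - ?i \<mu>) - (?i \<zeta> * ?i \<zeta> - ?i \<zeta>) * ?X) * (?Y * ?i \<nu>) \<in> SI \<pi>"
      using XF by (intro S.PI_r S.PI_diff r1 r2 r3) auto
    then show ?thesis using True by (simp add: sand_def fsub_mult algebra_simps)
  qed
qed

lemma Udot_mult_eq:
  assumes x: "x \<in> carrier (Udot D)" and y: "y \<in> carrier (Udot D)"
    and X: "\<And>\<zeta> \<mu>. X \<zeta> \<mu> \<in> UH (\<zeta> - \<mu>)" "\<And>\<zeta> \<mu>. x \<zeta> \<mu> = wproj \<zeta> \<mu> (X \<zeta> \<mu>)" "\<And>\<zeta> \<mu>. (\<zeta>, \<mu>) \<notin> sp x \<Longrightarrow> X \<zeta> \<mu> = 0"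
    and Y: "\<And>\<zeta> \<mu>. Y \<zeta> \<mu> \<in> UH (\<zeta> - \<mu>)" "\<And>\<zeta> \<mu>. y \<zeta> \<mu> = wproj \<zeta> \<mu> (Y \<zeta> \<mu>)" "\<And>\<zeta> \<mu>. (\<zeta>, \<mu>) \<notin> sp y \<Longrightarrow> Y \<zeta> \<mu> = 0"
    and P: "finite P" "snd ` sp x \<subseteq> P"
  shows "(x \<otimes>\<^bsub>Udot D\<^esub> y) \<zeta> \<nu> = wproj \<zeta> \<nu> (\<Sum>\<mu>\<in>P. X \<zeta> \<mu> * Y \<mu> \<nu>)"
proof -
  interpret Q: qvspace "wt_quot D \<zeta> \<nu>" by (rule qvspace.intro[OF wq_module])
  define M where "M = {\<mu>. x \<zeta> \<mu> \<noteq> \<zero>\<^bsub>wt_quot D \<zeta> \<mu>\<^esub> \<and> y \<mu> \<nu> \<noteq> \<zero>\<^bsub>wt_quot D \<mu> \<nu>\<^esub>}"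
  have Ms: "\<mu> \<in> M \<longleftrightarrow> (\<zeta>, \<mu>) \<in> sp x \<and> (\<mu>, \<nu>) \<in> sp y" for \<mu> by (simp add: M_def sp_def)
  have MP: "M \<subseteq> P" using P(2) Ms by force
  have fM: "finite M" using MP P(1) by (rule finite_subset)
  have XY: "X \<zeta> \<mu> * Y \<mu> \<nu> \<in> UG" for \<mu> using X(1) Y(1) UH_UG by blast
  have "(x \<otimes>\<^bsub>Udot D\<^esub> y) \<zeta> \<nu> = finsum (wt_quot D \<zeta> \<nu>) (\<lambda>\<mu>. wt_mult D \<zeta> \<mu> \<nu> (x \<zeta> \<mu>) (y \<mu> \<nu>)) M"
    by (simp add: Udot_def M_def)
  also have "\<dots> = finsum (wt_quot D \<zeta> \<nu>) (\<lambda>\<mu>. wproj \<zeta> \<nu> (X \<zeta> \<mu> * Y \<mu> \<nu>)) M"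
    by (rule Q.finsum_cong') (use XY in \<open>auto simp: X(2) Y(2) wt_mult_eq[OF X(1) Y(1)]\<close>)
  also have "\<dots> = wproj \<zeta> \<nu> (\<Sum>\<mu>\<in>M. X \<zeta> \<mu> * Y \<mu> \<nu>)" by (rule wq_finsum[OF fM XY])
  also have "(\<Sum>\<mu>\<in>M. X \<zeta> \<mu> * Y \<mu> \<nu>) = (\<Sum>\<mu>\<in>P. X \<zeta> \<mu> * Y \<mu> \<nu>)"
    by (rule sum.mono_neutral_left[OF P(1) MP]) (use X(3) Y(3) Ms in force)
  finally show ?thesis .
qed

lemma Udot_mult:
  assumes x: "x \<in> carrier (Udot D)" and y: "y \<in> carrier (Udot D)"
  shows "x \<otimes>\<^bsub>Udot D\<^esub> y \<in> carrier (Udot D)"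
    and "finite (Wo \<pi>) \<Longrightarrow> pdot D \<pi> (x \<otimes>\<^bsub>Udot D\<^esub> y) = pdot D \<pi> x \<otimes>\<^bsub>S_alg D \<pi>\<^esub> pdot D \<pi> y"
proof -
  obtain X where X: "\<And>\<zeta> \<mu>. X \<zeta> \<mu> \<in> UH (\<zeta> - \<mu>)" "\<And>\<zeta> \<mu>. x \<zeta> \<mu> = wproj \<zeta> \<mu> (X \<zeta> \<mu>)"
    "\<And>\<zeta> \<mu>. (\<zeta>, \<mu>) \<notin> sp x \<Longrightarrow> X \<zeta> \<mu> = 0" using Udot_reps[OF x] by blast
  obtain Y where Y: "\<And>\<zeta> \<mu>. Y \<zeta> \<mu> \<in> UH (\<zeta> - \<mu>)" "\<And>\<zeta> \<mu>. y \<zeta> \<mu> = wproj \<zeta> \<mu> (Y \<zeta> \<mu>)"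
    "\<And>\<zeta> \<mu>. (\<zeta>, \<mu>) \<notin> sp y \<Longrightarrow> Y \<zeta> \<mu> = 0" using Udot_reps[OF y] by blast
  note XU = UH_UG[OF X(1)] and YU = UH_UG[OF Y(1)]
  \<comment> \<open>P holds the middle weights of both factors, so the same set serves in the
    expansions of x, of y and of the product.\<close>
  define A P C where "A = fst ` sp x" "P = snd ` sp x \<union> fst ` sp y" "C = snd ` sp y"
  note APC = A_P_C_def
  have fin: "finite A" "finite P" "finite C" using x y by (auto simp: APC Udot_carrier)
  define Z where "Z \<zeta> \<nu> = (\<Sum>\<mu>\<in>P. X \<zeta> \<mu> * Y \<mu> \<nu>)" for \<zeta> \<nu>
  have ZU: "Z \<zeta> \<nu> \<in> UG" for \<zeta> \<nu> unfolding Z_def using XU YU by (intro FG_sum FG_mult)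
  have xy: "(x \<otimes>\<^bsub>Udot D\<^esub> y) \<zeta> \<nu> = wproj \<zeta> \<nu> (Z \<zeta> \<nu>)" for \<zeta> \<nu>
    unfolding Z_def by (rule Udot_mult_eq[OF x y X Y fin(2)]) (auto simp: APC)
  have X0: "X \<zeta> \<mu> = 0" if "(\<zeta>, \<mu>) \<notin> A \<times> P" for \<zeta> \<mu>
    using that by (intro X(3)) (force simp: APC)
  have Y0: "Y \<zeta> \<mu> = 0" if "(\<zeta>, \<mu>) \<notin> P \<times> C" for \<zeta> \<mu>
    using that by (intro Y(3)) (force simp: APC)
  have Z0: "Z \<zeta> \<nu> = 0" if "(\<zeta>, \<nu>) \<notin> A \<times> C" for \<zeta> \<nu>
  proof -
    have "X \<zeta> \<mu> * Y \<mu> \<nu> = 0" for \<mu> using that X0[of \<zeta> \<mu>] Y0[of \<mu> \<nu>] by (cases "\<zeta> \<in> A") auto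
    then show ?thesis by (simp add: Z_def)
  qed
  show "x \<otimes>\<^bsub>Udot D\<^esub> y \<in> carrier (Udot D)"
    by (rule Udot_memI[where Fs = "A \<times> C", OF ZU xy _ Z0]) (use fin in auto)
  assume f: "finite (Wo \<pi>)"
  have px: "pdot D \<pi> x = S_class D \<pi> (\<Sum>\<zeta>\<in>A. \<Sum>\<mu>\<in>P. sand \<pi> \<zeta> \<mu> (X \<zeta> \<mu>))"
    unfolding sum.cartesian_product by (rule pdot_eq[where Fs = "A \<times> P", OF f XU X(2) _ X0]) (use fin in auto)
  have py: "pdot D \<pi> y = S_class D \<pi> (\<Sum>\<nu>\<in>C. \<Sum>\<mu>\<in>P. sand \<pi> \<mu> \<nu> (Y \<mu> \<nu>))"
    by (subst sum.swap, unfold sum.cartesian_product) (rule pdot_eq[where Fs = "P \<times> C", OF f YU Y(2) _ Y0], use fin in auto)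
  have pxy: "pdot D \<pi> (x \<otimes>\<^bsub>Udot D\<^esub> y) = S_class D \<pi> (\<Sum>\<zeta>\<in>A. \<Sum>\<nu>\<in>C. sand \<pi> \<zeta> \<nu> (Z \<zeta> \<nu>))"
    unfolding sum.cartesian_product by (rule pdot_eq[where Fs = "A \<times> C", OF f ZU xy _ Z0]) (use fin in auto)
  have "(\<Sum>\<zeta>\<in>A. \<Sum>\<nu>\<in>C. \<Sum>\<mu>\<in>P. \<Sum>\<mu>'\<in>P. (if \<mu>' = \<mu> then sand \<pi> \<zeta> \<nu> (X \<zeta> \<mu> * Y \<mu>' \<nu>) else 0) - sand \<pi> \<zeta> \<mu> (X \<zeta> \<mu>) * sand \<pi> \<mu>' \<nu> (Y \<mu>' \<nu>)) \<in> SI \<pi>"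
    by (intro S.PI_sum sand_mult[OF f X(1) YU])
  also have "(\<Sum>\<zeta>\<in>A. \<Sum>\<nu>\<in>C. \<Sum>\<mu>\<in>P. \<Sum>\<mu>'\<in>P. (if \<mu>' = \<mu> then sand \<pi> \<zeta> \<nu> (X \<zeta> \<mu> * Y \<mu>' \<nu>) else 0) - sand \<pi> \<zeta> \<mu> (X \<zeta> \<mu>) * sand \<pi> \<mu>' \<nu> (Y \<mu>' \<nu>))
    = (\<Sum>\<zeta>\<in>A. \<Sum>\<nu>\<in>C. sand \<pi> \<zeta> \<nu> (Z \<zeta> \<nu>)) -
      (\<Sum>\<zeta>\<in>A. \<Sum>\<mu>\<in>P. sand \<pi> \<zeta> \<mu> (X \<zeta> \<mu>)) * (\<Sum>\<nu>\<in>C. \<Sum>\<mu>\<in>P. sand \<pi> \<mu> \<nu> (Y \<mu> \<nu>))"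
  proof -
    have "(\<Sum>\<mu>'\<in>P. if \<mu>' = \<mu> then sand \<pi> \<zeta> \<nu> (X \<zeta> \<mu> * Y \<mu>' \<nu>) else 0) = sand \<pi> \<zeta> \<nu> (X \<zeta> \<mu> * Y \<mu> \<nu>)"
      if "\<mu> \<in> P" for \<zeta> \<nu> \<mu> using that fin(2) by simp
    then show ?thesis
      by (simp add: sum_subtractf sum_product Z_def lin_sum[OF lin_sand])
  qed
  finally show "pdot D \<pi> (x \<otimes>\<^bsub>Udot D\<^esub> y) = pdot D \<pi> x \<otimes>\<^bsub>S_alg D \<pi>\<^esub> pdot D \<pi> y"
    unfolding px py pxy using XU YU ZU
    by (subst S.PA_mult) (auto simp: S.cl_iff FG_sum FG_mult intro!: FG_sum FG_mult)
qed

lemma Udot_idem_mem: "Udot_idem D \<kappa> \<in> carrier (Udot D)"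
  and pdot_idem: "finite (Wo \<pi>) \<Longrightarrow> pdot D \<pi> (Udot_idem D \<kappa>) = S_class D \<pi> (idem D \<pi> \<kappa>)"
proof -
  define X where "X \<zeta> \<mu> = (if \<zeta> = \<kappa> \<and> \<mu> = \<kappa> then 1 else 0 :: ('i, 'y) gen fpoly)" for \<zeta> \<mu>
  have XU: "X \<zeta> \<mu> \<in> UG" for \<zeta> \<mu> by (simp add: X_def)
  have x: "Udot_idem D \<kappa> \<zeta> \<mu> = wproj \<zeta> \<mu> (X \<zeta> \<mu>)" for \<zeta> \<mu>
    by (auto simp: Udot_idem_def X_def wq_zero wproj_def U.PA_one)
  have X0: "X \<zeta> \<mu> = 0" if "(\<zeta>, \<mu>) \<notin> {(\<kappa>, \<kappa>)}" for \<zeta> \<mu> using that by (simp add: X_def)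
  show "Udot_idem D \<kappa> \<in> carrier (Udot D)" by (rule Udot_memI[where Fs = "{(\<kappa>, \<kappa>)}", OF XU x _ X0]) simp_all
  assume f: "finite (Wo \<pi>)"
  have "pdot D \<pi> (Udot_idem D \<kappa>) = S_class D \<pi> (\<Sum>(\<zeta>, \<mu>)\<in>{(\<kappa>, \<kappa>)}. sand \<pi> \<zeta> \<mu> (X \<zeta> \<mu>))"
    by (rule pdot_eq[where Fs = "{(\<kappa>, \<kappa>)}", OF f XU x _ X0]) simp_all
  also have "\<dots> = S_class D \<pi> (idem D \<pi> \<kappa>)"
    using S_idem[of \<pi> \<kappa> \<kappa>] by (simp add: S.cl_iff sand_def X_def)
  finally show "pdot D \<pi> (Udot_idem D \<kappa>) = S_class D \<pi> (idem D \<pi> \<kappa>)" .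
qed

lemma pdot_trans:
  assumes f: "finite (Wo \<pi>')" and sub: "Wo \<pi> \<subseteq> Wo \<pi>'" and x: "x \<in> carrier (Udot D)"
  shows "S_trans D \<pi> \<pi>' (pdot D \<pi>' x) = pdot D \<pi> x"
proof -
  obtain X where X: "\<And>\<zeta> \<mu>. X \<zeta> \<mu> \<in> UH (\<zeta> - \<mu>)" "\<And>\<zeta> \<mu>. x \<zeta> \<mu> = wproj \<zeta> \<mu> (X \<zeta> \<mu>)"
    "\<And>\<zeta> \<mu>. (\<zeta>, \<mu>) \<notin> sp x \<Longrightarrow> X \<zeta> \<mu> = 0" using Udot_reps[OF x] by blast
  note XU = UH_UG[OF X(1)]
  have F: "finite (sp x)" using x by (simp add: Udot_carrier)
  have f': "finite (Wo \<pi>)" using sub f by (rule finite_subset)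
  have "fsub (tg \<pi>) (\<Sum>(\<zeta>, \<mu>)\<in>sp x. sand \<pi>' \<zeta> \<mu> (X \<zeta> \<mu>)) = (\<Sum>(\<zeta>, \<mu>)\<in>sp x. sand \<pi> \<zeta> \<mu> (X \<zeta> \<mu>))"
    by (simp add: fsub_sum case_prod_beta sand_def fsub_mult fsub_idem[OF sub] fsub_tg_pg[OF f sub])
  moreover have "pdot D \<pi>' x = S_class D \<pi>' (\<Sum>(\<zeta>, \<mu>)\<in>sp x. sand \<pi>' \<zeta> \<mu> (X \<zeta> \<mu>))"
    by (rule pdot_eq[OF f XU X(2) F X(3)])
  moreover have "pdot D \<pi> x = S_class D \<pi> (\<Sum>(\<zeta>, \<mu>)\<in>sp x. sand \<pi> \<zeta> \<mu> (X \<zeta> \<mu>))"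
    by (rule pdot_eq[OF f' XU X(2) F X(3)])
  moreover have "(\<Sum>(\<zeta>, \<mu>)\<in>sp x. sand \<pi>' \<zeta> \<mu> (X \<zeta> \<mu>)) \<in> SG \<pi>'"
    using XU by (auto intro!: FG_sum)
  ultimately show ?thesis by (simp only: S_trans_class[OF f sub])
qed

lemma S_trans_hom:
  assumes f: "finite (Wo \<pi>')" and sub: "Wo \<pi> \<subseteq> Wo \<pi>'" and a: "a \<in> carrier (S_alg D \<pi>')" and b: "b \<in> carrier (S_alg D \<pi>')"
  shows "S_trans D \<pi> \<pi>' a \<in> carrier (S_alg D \<pi>)"
    "S_trans D \<pi> \<pi>' (a \<oplus>\<^bsub>S_alg D \<pi>'\<^esub> b) = S_trans D \<pi> \<pi>' a \<oplus>\<^bsub>S_alg D \<pi>\<^esub> S_trans D \<pi> \<pi>' b"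
    "S_trans D \<pi> \<pi>' (a \<otimes>\<^bsub>S_alg D \<pi>'\<^esub> b) = S_trans D \<pi> \<pi>' a \<otimes>\<^bsub>S_alg D \<pi>\<^esub> S_trans D \<pi> \<pi>' b"
    "S_trans D \<pi> \<pi>' (c \<odot>\<^bsub>S_alg D \<pi>'\<^esub> a) = c \<odot>\<^bsub>S_alg D \<pi>\<^esub> S_trans D \<pi> \<pi>' a"
    "S_trans D \<pi> \<pi>' \<one>\<^bsub>S_alg D \<pi>'\<^esub> = \<one>\<^bsub>S_alg D \<pi>\<^esub>"
    "S_trans D \<pi> \<pi>' \<zero>\<^bsub>S_alg D \<pi>'\<^esub> = \<zero>\<^bsub>S_alg D \<pi>\<^esub>"
proof -
  obtain p q where pq: "p \<in> SG \<pi>'" "a = S_class D \<pi>' p" "q \<in> SG \<pi>'" "b = S_class D \<pi>' q"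
    using S.PA_E[OF a] S.PA_E[OF b] by metis
  note t = S_trans_class[OF f sub]
  have F: "fsub (tg \<pi>) r \<in> SG \<pi>" if "r \<in> SG \<pi>'" for r using that tg_FG by (rule fsub_FG)
  show "S_trans D \<pi> \<pi>' a \<in> carrier (S_alg D \<pi>)" using pq F by (simp add: t)
  show "S_trans D \<pi> \<pi>' (a \<oplus>\<^bsub>S_alg D \<pi>'\<^esub> b) = S_trans D \<pi> \<pi>' a \<oplus>\<^bsub>S_alg D \<pi>\<^esub> S_trans D \<pi> \<pi>' b"
    using pq F by (simp add: t S.PA_add fsub_add)
  show "S_trans D \<pi> \<pi>' (a \<otimes>\<^bsub>S_alg D \<pi>'\<^esub> b) = S_trans D \<pi> \<pi>' a \<otimes>\<^bsub>S_alg D \<pi>\<^esub> S_trans D \<pi> \<pi>' b"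
    using pq F by (simp add: t S.PA_mult fsub_mult)
  show "S_trans D \<pi> \<pi>' (c \<odot>\<^bsub>S_alg D \<pi>'\<^esub> a) = c \<odot>\<^bsub>S_alg D \<pi>\<^esub> S_trans D \<pi> \<pi>' a"
    using pq F by (simp add: t S.PA_smult fsub_sc)
  show "S_trans D \<pi> \<pi>' \<one>\<^bsub>S_alg D \<pi>'\<^esub> = \<one>\<^bsub>S_alg D \<pi>\<^esub>" by (simp add: t S.PA_one)
  show "S_trans D \<pi> \<pi>' \<zero>\<^bsub>S_alg D \<pi>'\<^esub> = \<zero>\<^bsub>S_alg D \<pi>\<^esub>" by (simp add: t S.PA_zero fsub_0)
qed

subsection \<open>Finite dimensionality of \<open>S(\<pi>)\<close>\<close>

definition Ew :: "sign \<Rightarrow> 'i list \<Rightarrow> ('i, 'z) gen fpoly" where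
  "Ew s x = prod_list (map (\<lambda>i. fgen (E s i)) x)"

definition swt :: "sign \<Rightarrow> 'i list \<Rightarrow> 'x" where "swt s x = sum_list (map (sal s) x)"

lemma Ew_Cons: "Ew s (i # x) = fgen (E s i) * Ew s x" and Ew_Nil[simp]: "Ew s [] = 1"
  by (simp_all add: Ew_def)

lemma Ew_FG: "(\<And>i. i \<in> II \<Longrightarrow> E s i \<in> G) \<Longrightarrow> set x \<subseteq> II \<Longrightarrow> Ew s x \<in> FG G"
  unfolding Ew_def by (intro FG_prod_list) auto

lemma swt_wsum: "set x \<subseteq> II \<Longrightarrow> swt s x = zsmul (sgn_int s) (wsum (\<lambda>j. int (count (mset x) j)))"
proof (induction x)
  case Nil
  have "zsmul m (0::'x) = 0" for m by (simp add: zsmul_def)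
  then show ?case by (simp add: swt_def wsum_def)
next
  case (Cons i x)
  have e: "(\<lambda>j. int (count (mset (i # x)) j)) = (\<lambda>j. int (count (mset x) j))(i := int (count (mset x) i) + 1)" by auto
  have d: "zsmul m (a + b) = zsmul m a + zsmul m (b::'x)" for m a b
    by (simp add: zsmul_def sum.distrib)
  have i: "i \<in> II" and x: "set x \<subseteq> II" using Cons.prems by auto
  have "swt s (i # x) = sal s i + swt s x" by (simp add: swt_def)
  also have "\<dots> = zsmul (sgn_int s) (wsum (\<lambda>j. int (count (mset x) j)) + zsmul 1 (al i))"
    unfolding Cons.IH[OF x] d by (simp add: sal_def)
  finally show ?case
    unfolding e using wsum_upd[OF i, of "\<lambda>j. int (count (mset x) j)" 1] by simp
qed

lemma S_word_move:
  assumes "set x \<subseteq> II"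
  shows "idem D \<pi> \<zeta> * Ew s x - Ew s x * idem D \<pi> (\<zeta> - swt s x) \<in> SI \<pi>"
  using assms
proof (induction x arbitrary: \<zeta>)
  case Nil
  then show ?case using S.PI_0 by (simp add: swt_def)
next
  case (Cons i x)
  then have i: "i \<in> II" and x: "set x \<subseteq> II" by auto
  have a: "(fgen (E s i) * idem D \<pi> (\<zeta> - sal s i) - idem D \<pi> \<zeta> * fgen (E s i)) * Ew s x \<in> SI \<pi>"
    using S.PI_r[OF S_E[OF i, of s \<pi> "\<zeta> - sal s i"] Ew_FG[OF _ x]] by simp
  have b: "fgen (E s i) * (idem D \<pi> (\<zeta> - sal s i) * Ew s x - Ew s x * idem D \<pi> (\<zeta> - sal s i - swt s x)) \<in> SI \<pi>"
    using Cons.IH[OF x] i by (intro S.PI_l) auto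
  show ?case using S.PI_diff[OF b a] by (simp add: Ew_Cons swt_def algebra_simps)
qed

text \<open>The weight of a word determines its letters by \<open>wsum_inj\<close>, and hence its
  length.\<close>

lemma finite_words: assumes "finite Q" shows "finite {x. set x \<subseteq> II \<and> wsum (\<lambda>j. int (count (mset x) j)) \<in> Q}"
proof -
  have "finite {x. set x \<subseteq> II \<and> wsum (\<lambda>j. int (count (mset x) j)) = \<rho>}" for \<rho>
  proof (cases "\<exists>x0. set x0 \<subseteq> II \<and> wsum (\<lambda>j. int (count (mset x0) j)) = \<rho>")
    case True
    then obtain x0 where x0: "set x0 \<subseteq> II" "wsum (\<lambda>j. int (count (mset x0) j)) = \<rho>" by blast
    have "mset x = mset x0" if "set x \<subseteq> II" "wsum (\<lambda>j. int (count (mset x) j)) = \<rho>" for x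
    proof (rule multiset_eqI)
      fix j
      show "count (mset x) j = count (mset x0) j"
      proof (cases "j \<in> II")
        case True
        have "wsum (\<lambda>j. int (count (mset x) j)) = wsum (\<lambda>j. int (count (mset x0) j))" using that x0 by simp
        from wsum_inj[OF this True] show ?thesis by simp
      next
        case False
        then have "j \<notin> set x" "j \<notin> set x0" using that x0 by auto
        then show ?thesis by (metis count_mset_0_iff)
      qed
    qed
    then have "{x. set x \<subseteq> II \<and> wsum (\<lambda>j. int (count (mset x) j)) = \<rho>} \<subseteq> {x. set x \<subseteq> II \<and> length x = length x0}"
      by (auto dest: mset_eq_length)
    then show ?thesis by (rule finite_subset) (rule finite_lists_length_eq[OF finite_I])
  next
    case False
    then have "{x. set x \<subseteq> II \<and> wsum (\<lambda>j. int (count (mset x) j)) = \<rho>} = {}" by blast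
    then show ?thesis by (simp only: finite.emptyI)
  qed
  then have "finite (\<Union>\<rho>\<in>Q. {x. set x \<subseteq> II \<and> wsum (\<lambda>j. int (count (mset x) j)) = \<rho>})" using assms by blast
  then show ?thesis by (rule rev_finite_subset) auto
qed

theorem S_finite_span:
  assumes fin: "finite (Wo \<pi>)"
  shows "\<exists>Bs. finite Bs \<and> Bs \<subseteq> carrier (S_alg D \<pi>) \<and> lin_span (S_alg D \<pi>) Bs = carrier (S_alg D \<pi>)"
proof -
  interpret R: qvspace "S_alg D \<pi>" by (rule qvspace.intro[OF S.PA_module])
  define gg where "gg y \<kappa> x = (Ew Neg y * idem D \<pi> \<kappa> * Ew Pos x :: ('i, 'x) gen fpoly)" for y \<kappa> x
  define GG where "GG = {gg y \<kappa> x | y \<kappa> x. set y \<subseteq> II \<and> set x \<subseteq> II}"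
  have EF: "Ew s x \<in> SG \<pi>" if "set x \<subseteq> II" for s x using that by (intro Ew_FG) auto
  have GF: "gg y \<kappa> x \<in> SG \<pi>" if "set y \<subseteq> II" "set x \<subseteq> II" for y \<kappa> x
    unfolding gg_def using that EF by (intro FG_mult FG_idem)
  \<comment> \<open>The elements that lie in the span of the triangular products modulo the ideal. Z
    turns out to contain 1 and to be stable under left multiplication by every generator.\<close>
  define Z where "Z = {p \<in> SG \<pi>. \<exists>z\<in>pm.span GG. p - z \<in> SI \<pi>}"
  have spF: "z \<in> SG \<pi>" if "z \<in> pm.span GG" for z
  proof -
    have "pm.span GG \<subseteq> SG \<pi>" by (rule pm.span_minimal) (auto simp: GG_def GF pm.subspace_def)
    then show ?thesis using that by blast
  qed
  have Zsub: "pm.subspace Z" unfolding pm.subspace_def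
  proof (intro conjI ballI allI)
    show "0 \<in> Z" unfolding Z_def using pm.span_zero S.PI_0 by force
    show "x + y \<in> Z" if xy: "x \<in> Z" "y \<in> Z" for x y
    proof -
      obtain a b where ab: "a \<in> pm.span GG" "b \<in> pm.span GG" "x - a \<in> SI \<pi>" "y - b \<in> SI \<pi>" "x \<in> SG \<pi>" "y \<in> SG \<pi>"
        using xy by (auto simp: Z_def)
      have "(x + y) - (a + b) \<in> SI \<pi>" using S.PI_add[OF ab(3,4)] by (simp add: algebra_simps)
      then show ?thesis unfolding Z_def using pm.span_add[OF ab(1,2)] ab by auto
    qed
    show "sc c x \<in> Z" if x: "x \<in> Z" for c x
    proof -
      obtain a where ab: "a \<in> pm.span GG" "x - a \<in> SI \<pi>" "x \<in> SG \<pi>" using x by (auto simp: Z_def)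
      have "sc c x - sc c a \<in> SI \<pi>" using S.PI_sc[OF ab(2), of c] by (simp add: pm.scale_right_diff_distrib)
      then show ?thesis unfolding Z_def using pm.span_scale[OF ab(1)] ab by auto
    qed
  qed
  note Z_add = pm.subspace_add[OF Zsub] and Z_sum = pm.subspace_sum[OF Zsub] and Z_sc = pm.subspace_scale[OF Zsub]
  have ZSI: "x \<in> Z" if "x \<in> SI \<pi>" for x
    unfolding Z_def using that S.PI_FG pm.span_zero by force
  have ZG: "gg y \<kappa> x \<in> Z" if "set y \<subseteq> II" "set x \<subseteq> II" for y \<kappa> x
  proof -
    have "gg y \<kappa> x \<in> pm.span GG" using that by (intro pm.span_base) (auto simp: GG_def)
    then show ?thesis unfolding Z_def using GF[OF that] S.PI_0 by force
  qed
  have ZF: "z \<in> SG \<pi>" if "z \<in> Z" for z using that by (simp add: Z_def)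
  have Zeq: "x \<in> Z" if "x - y \<in> SI \<pi>" "y \<in> Z" for x y
    using Z_add[OF ZSI[OF that(1)] that(2)] by simp
  have Zmult: "c * p \<in> Z" if c: "c \<in> SG \<pi>" "\<And>y \<kappa> x. set y \<subseteq> II \<Longrightarrow> set x \<subseteq> II \<Longrightarrow> c * gg y \<kappa> x \<in> Z" and p: "p \<in> Z" for c p
  proof -
    obtain z where z: "z \<in> pm.span GG" "p - z \<in> SI \<pi>" using p by (auto simp: Z_def)
    have "pm.span GG \<subseteq> {z. c * z \<in> Z}"
    proof (rule pm.span_minimal)
      show "GG \<subseteq> {z. c * z \<in> Z}" using c(2) by (auto simp: GG_def)
      show "pm.subspace {z. c * z \<in> Z}"
        using Zsub by (simp add: pm.subspace_def distrib_left sc_mult_right)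
    qed
    then have "c * z \<in> Z" using z by blast
    moreover have "c * p - c * z \<in> SI \<pi>" using S.PI_l[OF z(2) c(1)] by (simp add: right_diff_distrib)
    ultimately show ?thesis using Zeq by blast
  qed
  have Fgg: "fgen (E Neg j) * gg y \<kappa> x \<in> Z" if "j \<in> II" "set y \<subseteq> II" "set x \<subseteq> II" for j y \<kappa> x
    using ZG[of "j # y" x \<kappa>] that by (simp add: gg_def Ew_Cons mult.assoc)
  have FZ: "fgen (E Neg j) * p \<in> Z" if "j \<in> II" "p \<in> Z" for j p
    by (rule Zmult[OF _ Fgg[OF that(1)] that(2)]) (use that in auto)
  have Igg: "idem D \<pi> \<zeta> * gg y \<kappa> x \<in> Z" if "set y \<subseteq> II" "set x \<subseteq> II" for \<zeta> y \<kappa> x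
  proof -
    let ?m = "\<zeta> - swt Neg y"
    have a: "(idem D \<pi> \<zeta> * Ew Neg y - Ew Neg y * idem D \<pi> ?m) * (idem D \<pi> \<kappa> * Ew Pos x) \<in> SI \<pi>"
      using that EF by (intro S.PI_r S_word_move) auto
    have b: "Ew Neg y * (idem D \<pi> ?m * idem D \<pi> \<kappa> - (if ?m = \<kappa> then idem D \<pi> ?m else 0)) * Ew Pos x \<in> SI \<pi>"
      using that EF by (intro S.PI_r S.PI_l S_idem) auto
    have "idem D \<pi> \<zeta> * gg y \<kappa> x - (if ?m = \<kappa> then gg y ?m x else 0) \<in> SI \<pi>"
      using S.PI_add[OF a b] by (auto simp: gg_def algebra_simps)
    moreover have "(if ?m = \<kappa> then gg y ?m x else 0) \<in> Z" using ZG[OF that] ZSI[OF S.PI_0] by simp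
    ultimately show ?thesis by (rule Zeq)
  qed
  have IZ: "idem D \<pi> \<zeta> * p \<in> Z" if "p \<in> Z" for \<zeta> p
    by (rule Zmult[OF _ Igg that]) auto
  \<comment> \<open>E_i is moved to the right through the letters of y. Each commutator is a
    combination of idempotents, which \<open>Igg\<close> has dealt with.\<close>
  have Egg: "fgen (E Pos i) * gg y \<kappa> x \<in> Z" if i: "i \<in> II" and y: "set y \<subseteq> II" and x: "set x \<subseteq> II" for i y \<kappa> x
    using y
  proof (induction y)
    case Nil
    have "(fgen (E Pos i) * idem D \<pi> \<kappa> - idem D \<pi> (\<kappa> + sal Pos i) * fgen (E Pos i)) * Ew Pos x \<in> SI \<pi>"
      using x EF by (intro S.PI_r S_E i)
    then have "fgen (E Pos i) * gg [] \<kappa> x - gg [] (\<kappa> + sal Pos i) (i # x) \<in> SI \<pi>"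
      by (simp add: gg_def Ew_Cons algebra_simps)
    then show ?case by (rule Zeq) (use i x in \<open>intro ZG; simp\<close>)
  next
    case (Cons j y)
    then have j: "j \<in> II" and y: "set y \<subseteq> II" by auto
    let ?S = "if i = j then (\<Sum>\<zeta>\<in>Wo \<pi>. sc (qint (qi i) (pr (ch i) \<zeta>)) (idem D \<pi> \<zeta>)) else 0"
    have "(fgen (E Pos i) * fgen (E Neg j) - fgen (E Neg j) * fgen (E Pos i) - ?S) * gg y \<kappa> x \<in> SI \<pi>"
      using GF[OF y x] by (intro S.PI_r S_comm i j)
    then have "fgen (E Pos i) * gg (j # y) \<kappa> x - (fgen (E Neg j) * (fgen (E Pos i) * gg y \<kappa> x) + ?S * gg y \<kappa> x) \<in> SI \<pi>"
      by (simp add: gg_def Ew_Cons algebra_simps)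
    moreover have "?S * gg y \<kappa> x \<in> Z"
      using Igg[OF y x] ZSI[OF S.PI_0] by (auto simp: sum_distrib_right sc_mult_left intro!: Z_sum Z_sc)
    ultimately show ?case using FZ[OF j Cons.IH[OF y]] Zeq Z_add by blast
  qed
  have EZ: "fgen (E Pos i) * p \<in> Z" if "i \<in> II" "p \<in> Z" for i p
    by (rule Zmult[OF _ Egg[OF that(1)] that(2)]) (use that in auto)
  have one: "1 \<in> Z"
  proof (rule Zeq)
    show "1 - (\<Sum>\<zeta>\<in>Wo \<pi>. idem D \<pi> \<zeta>) \<in> SI \<pi>" using S.PI_minus[OF S_one[of \<pi>]] by simp
    show "(\<Sum>\<zeta>\<in>Wo \<pi>. idem D \<pi> \<zeta>) \<in> Z" using ZG[of "[]" "[]"] by (intro Z_sum) (simp add: gg_def)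
  qed
  have all: "p \<in> Z" if p: "p \<in> SG \<pi>" for p
  proof (rule subspace_lin[where f = "\<lambda>p. p", OF lin_id Zsub])
    fix w assume "w \<in> Poly_Mapping.keys p"
    then have w: "set (letters w) \<subseteq> S_gens D \<pi>" using p by (auto simp: FG_def)
    have "prod_list (map fgen gs) \<in> Z" if "set gs \<subseteq> S_gens D \<pi>" for gs
      using that
    proof (induction gs)
      case (Cons g gs)
      then have IH: "prod_list (map fgen gs) \<in> Z" and g: "g \<in> S_gens D \<pi>" by auto
      show ?case
      proof (cases g)
        case (E s i)
        then show ?thesis using g IH EZ FZ by (cases s) auto
      next
        case (T \<zeta>)
        then have "fgen g = idem D \<pi> \<zeta>" using g by (auto simp: S_gens_def idem_def)
        then show ?thesis using IZ[OF IH] by simp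
      qed
    qed (simp add: one)
    then show "bs w \<in> Z" using w by (simp add: bs_prod_list)
  qed
  \<comment> \<open>For a product that is nonzero in S(\<pi>), the weight in the middle and the
    weights at both ends lie in W\<pi>. This leaves finitely many words on either side.\<close>
  define GN where "GN = {g \<in> GG. g \<notin> SI \<pi>}"
  have "finite GN"
  proof -
    define XX where "XX = {x. set x \<subseteq> II \<and> wsum (\<lambda>j. int (count (mset x) j)) \<in> (\<lambda>(a, b). a - b) ` (Wo \<pi> \<times> Wo \<pi>)}"
    have fX: "finite XX" unfolding XX_def by (rule finite_words) (use fin in auto)
    have "GN \<subseteq> (\<lambda>(y, \<kappa>, x). gg y \<kappa> x) ` (XX \<times> Wo \<pi> \<times> XX)"
    proof
      fix g assume "g \<in> GN"
      then obtain y \<kappa> x where g: "g = gg y \<kappa> x" "set y \<subseteq> II" "set x \<subseteq> II" "gg y \<kappa> x \<notin> SI \<pi>"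
        by (auto simp: GN_def GG_def)
      have k: "\<kappa> \<in> Wo \<pi>"
      proof (rule ccontr)
        assume "\<kappa> \<notin> Wo \<pi>"
        then show False using g(4) S.PI_0 by (simp add: gg_def idem_def)
      qed
      have x: "\<kappa> - swt Pos x \<in> Wo \<pi>"
      proof (rule ccontr)
        assume "\<kappa> - swt Pos x \<notin> Wo \<pi>"
        then have "Ew Neg y * (idem D \<pi> \<kappa> * Ew Pos x) \<in> SI \<pi>"
          using S.PI_l[OF S_word_move[OF g(3), of \<pi> \<kappa> Pos] EF[OF g(2)], of Neg] by (simp add: idem_def)
        then show False using g(4) by (simp add: gg_def mult.assoc)
      qed
      have y: "\<kappa> + swt Neg y \<in> Wo \<pi>"
      proof (rule ccontr)
        assume "\<kappa> + swt Neg y \<notin> Wo \<pi>"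
        then have "- (Ew Neg y * idem D \<pi> \<kappa>) * Ew Pos x \<in> SI \<pi>"
          using S.PI_r[OF S_word_move[OF g(2), of \<pi> "\<kappa> + swt Neg y" Neg] EF[OF g(3)], of Pos] by (simp add: idem_def)
        then show False using g(4) S.PI_minus by (fastforce simp: gg_def)
      qed
      have "x \<in> XX" unfolding XX_def using g(3) k x swt_wsum[OF g(3), of Pos] by force
      moreover have "y \<in> XX" unfolding XX_def using g(2) k y swt_wsum[OF g(2), of Neg]
        by (auto simp: zsmul_minus intro!: image_eqI[of _ _ "(\<kappa>, \<kappa> + swt Neg y)"])
      ultimately show "g \<in> (\<lambda>(y, \<kappa>, x). gg y \<kappa> x) ` (XX \<times> Wo \<pi> \<times> XX)" using g(1) k by force
    qed
    then show ?thesis by (rule finite_subset) (use fX fin in auto)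
  qed
  moreover have GNF: "S_class D \<pi> ` GN \<subseteq> carrier (S_alg D \<pi>)"
    using GF by (auto simp: GN_def GG_def)
  moreover have "lin_span (S_alg D \<pi>) (S_class D \<pi> ` GN) = carrier (S_alg D \<pi>)"
  proof
    let ?V = "lin_span (S_alg D \<pi>) (S_class D \<pi> ` GN)"
    have V: "R.sbsp ?V" by (rule R.span_sbsp[OF GNF])
    then show "?V \<subseteq> carrier (S_alg D \<pi>)" by (simp add: R.sbsp_def)
    have V0: "S_class D \<pi> x \<in> ?V" if "x \<in> SI \<pi>" for x
    proof -
      have "S_class D \<pi> x = \<zero>\<^bsub>S_alg D \<pi>\<^esub>" using that S.PI_FG S.cl_zero_iff by blast
      then show ?thesis using V by (simp add: R.sbsp_def)
    qed
    have "pm.span GG \<subseteq> {p \<in> SG \<pi>. S_class D \<pi> p \<in> ?V}"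
    proof (rule pm.span_minimal)
      show "GG \<subseteq> {p \<in> SG \<pi>. S_class D \<pi> p \<in> ?V}"
      proof
        fix g assume g: "g \<in> GG"
        then have "g \<in> SG \<pi>" using GF by (auto simp: GG_def)
        moreover have "S_class D \<pi> g \<in> ?V"
        proof (cases "g \<in> SI \<pi>")
          case False
          then show ?thesis using g GNF by (intro R.span_base) (auto simp: GN_def)
        qed (rule V0)
        ultimately show "g \<in> {p \<in> SG \<pi>. S_class D \<pi> p \<in> ?V}" by simp
      qed
      show "pm.subspace {p \<in> SG \<pi>. S_class D \<pi> p \<in> ?V}"
        using V V0[OF S.PI_0] unfolding pm.subspace_def R.sbsp_def
        by (auto simp: S.PA_add[symmetric] S.PA_smult[symmetric])
    qed
    then have span: "S_class D \<pi> z \<in> ?V" if "z \<in> pm.span GG" for z using that by blast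
    show "carrier (S_alg D \<pi>) \<subseteq> ?V"
    proof
      fix a assume "a \<in> carrier (S_alg D \<pi>)"
      then obtain p where p: "p \<in> SG \<pi>" "a = S_class D \<pi> p" using S.PA_E by blast
      obtain z where z: "z \<in> pm.span GG" "p - z \<in> SI \<pi>" using all[OF p(1)] by (auto simp: Z_def)
      then have "a = S_class D \<pi> z" using p spF S.cl_iff by simp
      then show "a \<in> ?V" using span z by simp
    qed
  qed
  ultimately show ?thesis by (intro exI[of _ "S_class D \<pi> ` GN"]) auto
qed

end

section \<open>The kernels of the maps to \<open>S(\<pi>)\<close> intersect in zero\<close>

context rdatum
begin

lemma serre_expand:
  assumes "i \<in> II" "j \<in> II"
  shows "serre D s i j = (\<Sum>k\<le>nat (1 - ca i j). sc (serre_coeff (qi i) (nat (1 - ca i j)) k)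
    (fgen (E s i) ^ k * (fgen (E s j) * fgen (E s i) ^ (nat (1 - ca i j) - k))) :: ('i, 'z) gen fpoly)"
proof -
  have neg: "(- 1) ^ n * p = sc ((- 1) ^ n) p" for n and p :: "('i, 'z) gen fpoly"
    by (induction n) (simp_all add: mult.assoc)
  show ?thesis unfolding serre_def Let_def pr_ca[OF assms]
    by (intro sum.cong refl)
      (simp add: divpow_def fscale_sc vi_qi neg sc_mult_left sc_mult_right serre_coeff_def mult.assoc mult.left_commute)
qed

text \<open>Words with a letter outside I go to 0, in accordance with \<open>G0\<close>.\<close>

definition kb :: "sign \<Rightarrow> 'i list \<Rightarrow> ('i, 'z) gen fpoly" where
  "kb s x = (if set x \<subseteq> II then Ew s x else 0)"

definition ks :: "sign \<Rightarrow> ('i list \<Rightarrow>\<^sub>0 qv) \<Rightarrow> ('i, 'z) gen fpoly" where "ks s = lx (kb s)"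

definition kappa :: "('i list \<times> 'i list \<Rightarrow>\<^sub>0 qv) \<Rightarrow> ('i, 'z) gen fpoly" where
  "kappa = lx (\<lambda>(x, y). kb Neg y * kb Pos x)"

lemma kappa_tens: "kappa (tens p r) = ks Neg r * ks Pos p"
  by (rule tens_eqI[where f = "\<lambda>p r. kappa (tens p r)" and g = "\<lambda>p r. ks Neg r * ks Pos p"])
    (rule lin_comp[OF _ lin_tens1] lin_comp[OF _ lin_tens2] lin_comp[OF lin_mult_left] lin_comp[OF lin_mult_right]
      | simp add: kappa_def ks_def)+

lemma ks_FG: "ks s r \<in> FG G" if "\<And>i. i \<in> II \<Longrightarrow> E s i \<in> G"
  unfolding ks_def lx_def using Ew_FG[OF that] by (intro FG_sum FG_sc) (auto simp: kb_def)

lemma Ew_append: "Ew s (x @ y) = Ew s x * Ew s y" by (simp add: Ew_def)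
lemma Ew_replicate: "Ew s (replicate n i) = fgen (E s i) ^ n" by (induction n) (simp_all add: Ew_Cons)

text \<open>Serre vectors go to multiples of the Serre relations and words in \<open>G0\<close> to
  0. This is the way back from vanishing in a Verma module to a relation in U.\<close>

lemma ks_NN: "r \<in> NN G0 \<Longrightarrow> ks s r \<in> UI"
proof (induction rule: NN.induct)
  case NN_0 then show ?case by (simp add: ks_def lx_0 U.PI_0)
next
  case (NN_add x y) then show ?case by (simp add: ks_def lx_add U.PI_add)
next
  case (NN_sc x c) then show ?case by (simp add: ks_def lx_sc U.PI_sc)
next
  case (NN_f x i)
  have "ks s (FW i x) = fgen (E s i) * (ks s x :: ('i, 'y) gen fpoly)"
    unfolding ks_def
    by (rule lin_eqI[where f = "\<lambda>x. lx (kb s) (FW i x)" and g = "\<lambda>x. fgen (E s i) * (lx (kb s) x :: ('i, 'y) gen fpoly)",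
          OF lin_comp[OF lin_lx lin_lx] lin_comp[OF lin_mult_left lin_lx]])
      (use NN_f(2) in \<open>simp add: fw_def kb_def Ew_Cons\<close>)
  then show ?case using NN_f U.PI_l by simp
next
  case (NN_G w) then show ?case by (simp add: ks_def kb_def G0_def U.PI_0)
next
  case (NN_S i j w)
  have "ks s (serreW i j (bs w)) = serre D s i j * (kb s w :: ('i, 'y) gen fpoly)"
  proof (cases "set w \<subseteq> II")
    case True
    then have "kb s (replicate k i @ j # replicate n i @ w) =
        (fgen (E s i) ^ k * (fgen (E s j) * (fgen (E s i) ^ n * Ew s w)) :: ('i, 'y) gen fpoly)" for k n
      using NN_S by (auto simp: kb_def Ew_append Ew_Cons Ew_replicate)
    moreover have "kb s w = (Ew s w :: ('i, 'y) gen fpoly)" using True by (simp add: kb_def)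
    ultimately show ?thesis using NN_S
      by (simp add: serreW_bs ks_def lx_sum lx_sc serre_expand sum_distrib_right sc_mult_left mult.assoc)
  next
    case False
    then have "kb s (replicate k i @ j # replicate n i @ w) = (0 :: ('i, 'y) gen fpoly)" for k n by (simp add: kb_def)
    then show ?thesis using False by (simp add: serreW_bs ks_def lx_sum lx_sc kb_def)
  qed
  moreover have "(kb s w :: ('i, 'y) gen fpoly) \<in> UG" using Ew_FG[of s "U_gens D" w] by (auto simp: kb_def)
  ultimately show ?case using U_serre[OF NN_S] U.PI_r by metis
qed

lemma kappa_NV: assumes "t \<in> NV G0 G0" shows "kappa t \<in> UI"
proof (rule NV_lin[OF _ UI_subspace _ assms])
  show "lin (kappa :: _ \<Rightarrow> ('i, 'y) gen fpoly)" by (simp add: kappa_def)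
  fix p r assume "p \<in> NN G0 \<or> r \<in> NN G0"
  moreover have "(ks s z :: ('i, 'y) gen fpoly) \<in> UG" for s z by (rule ks_FG) auto
  ultimately show "kappa (tens p r) \<in> UI"
    unfolding kappa_tens using ks_NN U.PI_l U.PI_r by blast
qed

subsection \<open>Triangular spanning set\<close>

text \<open>
  Dividing out \<open>UL \<mu>\<close> lets each \<open>K\<^sub>h\<close> act on the right by its value at \<open>\<mu>\<close>; modulo it the products
  \<open>F\<^sub>y E\<^sub>x\<close> span.
\<close>

definition UL :: "'x \<Rightarrow> ('i, 'y) gen fpoly set" where
  "UL \<mu> = pm.span (UI \<union> {q * Kd h \<mu> | q h. q \<in> UG})"

lemma UL_Wsub: "x \<in> UL \<mu> \<Longrightarrow> x \<in> Wsub \<zeta> \<mu>"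
proof -
  have "UL \<mu> \<subseteq> Wsub \<zeta> \<mu>" unfolding UL_def
    by (rule pm.span_minimal[OF _ Wsub_subspace]) (use Wsub_UI Wsub_r in auto)
  then show "x \<in> UL \<mu> \<Longrightarrow> x \<in> Wsub \<zeta> \<mu>" by blast
qed

lemma UL_subspace: "pm.subspace (UL \<mu>)" unfolding UL_def by (rule pm.subspace_span)
lemma UL_UI: "x \<in> UI \<Longrightarrow> x \<in> UL \<mu>" unfolding UL_def by (intro pm.span_base) simp
lemma UL_K: "q \<in> UG \<Longrightarrow> q * Kd h \<mu> \<in> UL \<mu>" unfolding UL_def by (intro pm.span_base) auto

lemma UL_l: assumes "x \<in> UL \<mu>" "p \<in> UG" shows "p * x \<in> UL \<mu>"
proof -
  have "UL \<mu> \<subseteq> {x. p * x \<in> UL \<mu>}" unfolding UL_def[of \<mu>]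
  proof (rule pm.span_minimal)
    show "UI \<union> {q * Kd h \<mu> |q h. q \<in> UG} \<subseteq> {x. p * x \<in> pm.span (UI \<union> {q * Kd h \<mu> |q h. q \<in> UG})}"
    proof
      fix x assume "x \<in> UI \<union> {q * Kd h \<mu> |q h. q \<in> UG}"
      then consider "x \<in> UI" | q h where "x = q * Kd h \<mu>" "q \<in> UG" by blast
      then have "p * x \<in> UL \<mu>"
      proof cases
        case 1 then show ?thesis using U.PI_l assms(2) UL_UI by blast
      next
        case 2 then show ?thesis using UL_K[of "p * q" h \<mu>] assms(2) by (simp add: mult.assoc)
      qed
      then show "x \<in> {x. p * x \<in> pm.span (UI \<union> {q * Kd h \<mu> |q h. q \<in> UG})}" by (simp add: UL_def)
    qed
    show "pm.subspace {x. p * x \<in> pm.span (UI \<union> {q * Kd h \<mu> |q h. q \<in> UG})}"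
      using UL_subspace[of \<mu>] unfolding UL_def[symmetric]
      by (simp add: pm.subspace_def distrib_left sc_mult_right)
  qed
  then show ?thesis using assms by blast
qed

lemma sal_Neg: "sal Neg i = - sal Pos i" by (simp add: sal_def zsmul_minus)

lemma UH_word: "set x \<subseteq> II \<Longrightarrow> Ew s x \<in> UH (swt s x)"
proof (induction x)
  case (Cons i x)
  have "fgen (E s i) * q \<in> UH (sal s i + \<nu>)" if q: "q \<in> UH \<nu>" for q \<nu>
  proof -
    have "gw w = sal s i + \<nu>" if w: "w \<in> Poly_Mapping.keys (fgen (E s i) * q)" for w
    proof -
      obtain w1 w2 where "w = w1 + w2" "w1 \<in> Poly_Mapping.keys (fgen (E s i) :: ('i, 'y) gen fpoly)" "w2 \<in> Poly_Mapping.keys q"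
        using keys_mult[of "fgen (E s i)" q] w by blast
      then show ?thesis using UH_keys[OF q, of w2] by (auto simp: fgen_def gw_def fmon_plus sal_def)
    qed
    moreover have "fgen (E s i) * q \<in> UG" using Cons.prems UH_UG[OF q] by auto
    ultimately show ?thesis by (simp add: UH_def)
  qed
  then show ?case using Cons by (simp add: Ew_Cons swt_def)
qed (simp add: swt_def)

lemma UH_mult: assumes p: "p \<in> UH \<nu>" and q: "q \<in> UH \<rho>" shows "p * q \<in> UH (\<nu> + \<rho>)"
proof -
  have "gw w = \<nu> + \<rho>" if w: "w \<in> Poly_Mapping.keys (p * q)" for w
  proof -
    obtain w1 w2 where "w = w1 + w2" "w1 \<in> Poly_Mapping.keys p" "w2 \<in> Poly_Mapping.keys q"
      using keys_mult[of p q] w by blast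
    then show ?thesis using UH_keys[OF q, of w2] UH_keys[OF p, of w1] by (auto simp: gw_def fmon_plus)
  qed
  then show ?thesis using UH_UG[OF p] UH_UG[OF q] by (simp add: UH_def)
qed

lemma UH_Wsub: assumes q: "q \<in> UH \<nu>" and ne: "\<nu> \<noteq> \<zeta> - \<mu>" shows "q \<in> Wsub \<zeta> \<mu>"
  by (rule subspace_lin[where f = "\<lambda>p. p", OF lin_id Wsub_subspace])
    (use UH_keys[OF q] ne in \<open>auto intro!: word_Wsub\<close>)

definition II_words :: "('i list \<times> 'i list \<Rightarrow>\<^sub>0 qv) set" where
  "II_words = {t. \<forall>(x, y)\<in>Poly_Mapping.keys t. set x \<subseteq> II \<and> set y \<subseteq> II}"

text \<open>The combinations of the F_y E_x modulo \<open>UL \<mu>\<close> are stable under left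
  multiplication by generators: E_i is commuted through y, and the toral elements that appear are
  moved to the far right and evaluated there. \<open>UL \<mu>\<close> is a left ideal, so nothing is
  lost on the way.\<close>

theorem U_triangular:
  assumes p: "p \<in> UG"
  shows "\<exists>t\<in>II_words. p - kappa t \<in> UL \<mu>"
proof -
  define gu where "gu y x = (Ew Neg y * Ew Pos x :: ('i, 'y) gen fpoly)" for y x
  define Z where "Z = {p. \<exists>t\<in>II_words. p - kappa t \<in> UL \<mu>}"
  have lk: "lin (kappa :: _ \<Rightarrow> ('i, 'y) gen fpoly)" by (simp add: kappa_def)
  have Z0: "x \<in> Z" if "x \<in> UL \<mu>" for x
  proof -
    have "(0 :: 'i list \<times> 'i list \<Rightarrow>\<^sub>0 qv) \<in> II_words" by (simp add: II_words_def)
    then show ?thesis using that unfolding Z_def by (auto simp: lin_0[OF lk] intro: bexI[rotated])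
  qed
  have Zsub: "pm.subspace Z" unfolding pm.subspace_def
  proof (intro conjI ballI allI)
    show "0 \<in> Z" using UL_UI[OF U.PI_0] by (rule Z0)
    show "x + y \<in> Z" if "x \<in> Z" "y \<in> Z" for x y
    proof -
      obtain t where tu1: "t \<in> II_words" "x - kappa t \<in> UL \<mu>" using \<open>x \<in> Z\<close> unfolding Z_def by blast
      obtain u where tu2: "u \<in> II_words" "y - kappa u \<in> UL \<mu>" using \<open>y \<in> Z\<close> unfolding Z_def by blast
      note tu = tu1(1) tu2(1) tu1(2) tu2(2)
      have "t + u \<in> II_words" using tu(1,2) unfolding II_words_def by (auto dest!: keys_plusE)
      moreover have "x + y - kappa (t + u) \<in> UL \<mu>"
        using pm.subspace_add[OF UL_subspace tu(3,4)] by (simp add: lin_add[OF lk] algebra_simps)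
      ultimately show ?thesis by (auto simp: Z_def)
    qed
    show "sc c x \<in> Z" if "x \<in> Z" for c x
    proof -
      obtain t where t: "t \<in> II_words" "x - kappa t \<in> UL \<mu>" using \<open>x \<in> Z\<close> unfolding Z_def by blast
      have "sc c t \<in> II_words" using t(1) unfolding II_words_def by (auto dest!: keys_scE)
      moreover have "sc c x - kappa (sc c t) \<in> UL \<mu>"
        using pm.subspace_scale[OF UL_subspace t(2), of c] by (simp add: lin_sc[OF lk] pm.scale_right_diff_distrib)
      ultimately show ?thesis by (auto simp: Z_def)
    qed
  qed
  note Z_add = pm.subspace_add[OF Zsub] and Z_sc = pm.subspace_scale[OF Zsub] and Z_diff = pm.subspace_diff[OF Zsub]
  have Zeq: "x \<in> Z" if "x - y \<in> UL \<mu>" "y \<in> Z" for x y using Z_add[OF Z0[OF that(1)] that(2)] by simp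
  have Zg: "gu y x \<in> Z" if "set y \<subseteq> II" "set x \<subseteq> II" for y x
  proof -
    have "bs (x, y) \<in> II_words" using that by (simp add: II_words_def)
    moreover have "gu y x - kappa (bs (x, y)) \<in> UL \<mu>" using that UL_UI[OF U.PI_0] by (simp add: kappa_def kb_def gu_def)
    ultimately show ?thesis unfolding Z_def by blast
  qed
  have guH: "gu y x \<in> UH (swt Neg y + swt Pos x)" if "set y \<subseteq> II" "set x \<subseteq> II" for y x
    unfolding gu_def using that by (intro UH_mult UH_word)
  have Zmult: "c * p \<in> Z" if c: "c \<in> UG" "\<And>y x. set y \<subseteq> II \<Longrightarrow> set x \<subseteq> II \<Longrightarrow> c * gu y x \<in> Z" and p: "p \<in> Z" for c p
  proof -
    obtain t where t: "t \<in> II_words" "p - kappa t \<in> UL \<mu>" using p by (auto simp: Z_def)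
    have "c * kappa t \<in> Z"
    proof (rule subspace_lin[where f = "\<lambda>t. c * kappa t", OF lin_comp[OF lin_mult_left lk] Zsub])
      fix w assume "w \<in> Poly_Mapping.keys t"
      then show "c * kappa (bs w) \<in> Z"
        using t(1) c(2)[of "snd w" "fst w"] by (cases w) (auto simp: II_words_def kappa_def kb_def gu_def)
    qed
    moreover have "c * p - c * kappa t \<in> UL \<mu>" using UL_l[OF t(2) c(1)] by (simp add: right_diff_distrib)
    ultimately show ?thesis using Zeq by blast
  qed
  have Fgu: "fgen (E Neg j) * gu y x \<in> Z" if "j \<in> II" "set y \<subseteq> II" "set x \<subseteq> II" for j y x
    using Zg[of "j # y" x] that by (simp add: gu_def Ew_Cons mult.assoc)
  have FZ: "fgen (E Neg j) * p \<in> Z" if "j \<in> II" "p \<in> Z" for j p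
    by (rule Zmult[OF _ Fgu[OF that(1)] that(2)]) (use that in auto)
  have Kgu: "fgen (T h) * gu y x \<in> Z" if "set y \<subseteq> II" "set x \<subseteq> II" for h y x
  proof -
    let ?c = "v powi pr h (swt Neg y + swt Pos x)"
    have ug: "gu y x \<in> UG" using guH[OF that] by (rule UH_UG)
    have "fgen (T h) * gu y x - sc ?c (gu y x * fgen (T h)) \<in> UL \<mu>"
      by (rule UL_UI[OF K_UH[OF guH[OF that]]])
    moreover have "sc ?c (gu y x * fgen (T h)) - sc (?c * v powi pr h \<mu>) (gu y x) \<in> UL \<mu>"
      using pm.subspace_scale[OF UL_subspace UL_K[OF ug, of h \<mu>], of ?c]
      by (simp add: Kd_def right_diff_distrib sc_mult_right pm.scale_right_diff_distrib)
    ultimately show ?thesis using Zeq Z_sc[OF Zg[OF that]] by blast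
  qed
  have KZ: "fgen (T h) * p \<in> Z" if "p \<in> Z" for h p
    by (rule Zmult[OF _ Kgu that]) auto
  have Egu: "fgen (E Pos i) * gu y x \<in> Z" if i: "i \<in> II" and y: "set y \<subseteq> II" and x: "set x \<subseteq> II" for i y x
    using y
  proof (induction y)
    case Nil
    then show ?case using Zg[of "[]" "i # x"] i x by (simp add: gu_def Ew_Cons)
  next
    case (Cons j y)
    then have j: "j \<in> II" and y: "set y \<subseteq> II" by auto
    let ?S = "if i = j then sc (inverse (qi i - inverse (qi i)))
       (fgen (T (zsmul (dnum D i) (ch i))) - fgen (T (zsmul (- dnum D i) (ch i)))) else 0"
    have "(fgen (E Pos i) * fgen (E Neg j) - fgen (E Neg j) * fgen (E Pos i) - ?S) * gu y x \<in> UI"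
      using UH_UG[OF guH[OF y x]] by (intro U.PI_r U_comm i j)
    then have "fgen (E Pos i) * gu (j # y) x - (fgen (E Neg j) * (fgen (E Pos i) * gu y x) + ?S * gu y x) \<in> UL \<mu>"
      using UL_UI by (simp add: gu_def Ew_Cons algebra_simps)
    moreover have "?S * gu y x \<in> Z"
      using Kgu[OF y x] Z0[OF UL_UI[OF U.PI_0]]
      by (auto simp: sc_mult_left left_diff_distrib intro!: Z_sc Z_diff)
    ultimately show ?case using FZ[OF j Cons.IH[OF y]] Zeq Z_add by blast
  qed
  have EZ: "fgen (E Pos i) * p \<in> Z" if "i \<in> II" "p \<in> Z" for i p
    by (rule Zmult[OF _ Egu[OF that(1)] that(2)]) (use that in auto)
  have "p \<in> Z"
  proof (rule subspace_lin[where f = "\<lambda>p. p", OF lin_id Zsub])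
    fix w assume "w \<in> Poly_Mapping.keys p"
    then have w: "set (letters w) \<subseteq> U_gens D" using p by (auto simp: FG_def)
    show "bs w \<in> Z"
    proof (rule U_word_induct[where P = "\<lambda>x \<nu>. x \<in> Z", OF w])
      show "1 \<in> Z" using Zg[of "[]" "[]"] by (simp add: gu_def)
      show "fgen (E s i) * x \<in> Z" if "i \<in> II" "x \<in> Z" for s i x
        using that EZ FZ by (cases s) auto
    qed (rule KZ)
  qed
  then show ?thesis by (auto simp: Z_def)
qed

end

section \<open>The action of S(\<pi>) on the tensor product\<close>

locale rdatum_tensor = rdatum D + tensor_rep "idx D" "form D" a b G G'
  for D :: "('i, 'x::ab_group_add, 'y::ab_group_add) root_datum" and a b :: "'i \<Rightarrow> int" and G G' +
  fixes \<mu> :: 'x and \<pi> :: "'x set"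
  assumes ab: "\<And>i. i \<in> idx D \<Longrightarrow> b i - a i = pairing D (coroot D i) \<mu>"
    and fin: "finite (weyl_orbit D \<pi>)"
    and outside: "\<And>x y. bs (x, y) \<notin> NV G G' \<Longrightarrow> \<mu> + swt Pos x + swt Neg y \<in> weyl_orbit D \<pi>"
begin

text \<open>
  The weights of the tensor product lie in \<open>X\<close> and not only in the weight lattice of the \<open>h\<^sub>i\<close>: the
  generating vector is given the weight \<open>\<mu>\<close>.
\<close>

definition xw :: "'i list \<times> 'i list \<Rightarrow> 'x" where "xw = (\<lambda>(x, y). \<mu> + swt Pos x + swt Neg y)"

lemma xw_out: "xw w \<notin> Wo \<pi> \<Longrightarrow> bs w \<in> N" using outside by (cases w) (auto simp: xw_def)

definition prj :: "'x \<Rightarrow> ('i list \<times> 'i list \<Rightarrow>\<^sub>0 qv) \<Rightarrow> ('i list \<times> 'i list \<Rightarrow>\<^sub>0 qv)" where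
  "prj \<kappa> = lx (\<lambda>w. if xw w = \<kappa> then bs w else 0)"

lemma lin_prj: "lin (prj \<kappa>)" by (simp add: prj_def)

lemma swt_mset: "swt s x = (\<Sum>j\<in>#mset x. sal s j)"
  by (induction x) (auto simp: swt_def)

lemma prj_hom:
  assumes "\<And>w. w \<in> Poly_Mapping.keys z \<Longrightarrow> xw w = \<rho>"
  shows "prj \<kappa> z = (if \<rho> = \<kappa> then z else 0)"
proof (rule lin_eqI[where f = "prj \<kappa>" and g = "\<lambda>z. if \<rho> = \<kappa> then z else 0" and p = z, OF lin_prj])
  show "lin (\<lambda>z. if \<rho> = \<kappa> then z else (0 :: 'i list \<times> 'i list \<Rightarrow>\<^sub>0 qv))"
    by (cases "\<rho> = \<kappa>") (simp_all add: lin_id lin_zero)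
qed (simp add: prj_def assms)

text \<open>N is spanned by tensors with a submodule element in one factor; once the other factor is
  a basis word, \<open>prj\<close> acts on that element through \<open>diag\<close>, which preserves
  the submodule.\<close>

lemma N_prj: assumes "z \<in> N" shows "prj \<kappa> z \<in> N"
proof (rule NV_lin[OF lin_prj NV_subspace _ assms])
  fix p r assume "p \<in> NN G \<or> r \<in> NN G'"
  then show "prj \<kappa> (tens p r) \<in> N"
  proof
    assume p: "p \<in> NN G"
    show ?thesis
    proof (rule subspace_lin[where f = "\<lambda>r. prj \<kappa> (tens p r)", OF lin_comp[OF lin_prj lin_tens2] NV_subspace])
      fix y
      have "prj \<kappa> (tens p (bs y)) = tens (diag (\<lambda>M. if \<mu> + (\<Sum>j\<in>#M. sal Pos j) + swt Neg y = \<kappa> then 1 else 0) p) (bs y)"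
        by (rule lin_eqI[where f = "\<lambda>p. prj \<kappa> (tens p (bs y))" and
              g = "\<lambda>p. tens (diag (\<lambda>M. if \<mu> + (\<Sum>j\<in>#M. sal Pos j) + swt Neg y = \<kappa> then 1 else 0) p) (bs y)",
              OF lin_comp[OF lin_prj lin_tens1] lin_comp[OF lin_tens1 lin_diag]])
          (simp add: prj_def xw_def diag_bs swt_mset tens_01)
      then show "prj \<kappa> (tens p (bs y)) \<in> N" using NV_tens NN_diag[OF p] by metis
    qed
  next
    assume r: "r \<in> NN G'"
    show ?thesis
    proof (rule subspace_lin[where f = "\<lambda>p. prj \<kappa> (tens p r)", OF lin_comp[OF lin_prj lin_tens1] NV_subspace])
      fix x
      have "prj \<kappa> (tens (bs x) r) = tens (bs x) (diag (\<lambda>M. if \<mu> + swt Pos x + (\<Sum>j\<in>#M. sal Neg j) = \<kappa> then 1 else 0) r)"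
        by (rule lin_eqI[where f = "\<lambda>r. prj \<kappa> (tens (bs x) r)" and
              g = "\<lambda>r. tens (bs x) (diag (\<lambda>M. if \<mu> + swt Pos x + (\<Sum>j\<in>#M. sal Neg j) = \<kappa> then 1 else 0) r)",
              OF lin_comp[OF lin_prj lin_tens2] lin_comp[OF lin_tens2 lin_diag]])
          (simp add: prj_def xw_def diag_bs swt_mset tens_02)
      then show "prj \<kappa> (tens (bs x) r) \<in> N" using NV_tens NN_diag[OF r] by metis
    qed
  qed
qed

primrec es :: "sign \<Rightarrow> 'i \<Rightarrow> 'i list \<times> 'i list \<Rightarrow> ('i list \<times> 'i list \<Rightarrow>\<^sub>0 qv)" where
  "es Pos i = eV a b i"
| "es Neg i = fV a b i"

lemma es_xw: assumes "i \<in> II" "w' \<in> Poly_Mapping.keys (es s i w)" shows "xw w' = xw w + sal s i"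
proof -
  obtain x y where w: "w = (x, y)" by (cases w)
  have sw: "swt s' z = sal s' i + swt s' u" if "u \<in> Poly_Mapping.keys (rem c i z)" for s' u c z
    unfolding swt_mset rem_mset[OF that, symmetric] by simp
  show ?thesis
  proof (cases s)
    case Pos
    then have "w' = (i # x, y) \<or> (\<exists>u\<in>Poly_Mapping.keys (rem b i y). w' = (x, u))"
      using keys_eV assms(2) w by simp
    then show ?thesis using Pos sw[of _ b y Neg] by (auto simp: xw_def w swt_def sal_Neg algebra_simps)
  next
    case Neg
    then have "w' = (x, i # y) \<or> (\<exists>u\<in>Poly_Mapping.keys (rem a i x). w' = (u, y))"
      using keys_fV assms(2) w by simp
    then show ?thesis using Neg sw[of _ a x Pos] by (auto simp: xw_def w swt_def sal_Neg algebra_simps)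
  qed
qed

lemma N_es: "z \<in> N \<Longrightarrow> i \<in> II \<Longrightarrow> lx (es s i) z \<in> N" by (cases s) (simp_all add: N_EV N_FV)

primrec ga :: "('i, 'x) gen \<Rightarrow> ('i list \<times> 'i list \<Rightarrow>\<^sub>0 qv) \<Rightarrow> ('i list \<times> 'i list \<Rightarrow>\<^sub>0 qv)" where
  "ga (E s i) = lx (es s i)"
| "ga (T \<kappa>) = prj \<kappa>"

lemma lin_ga: "lin (ga g)" by (cases g) (simp_all add: lin_prj)

text \<open>The free algebra acts on the free space. The relations of S(\<pi>) hold modulo N, which
  is \<open>act_rel\<close>.\<close>

definition act :: "('i, 'x) gen fpoly \<Rightarrow> ('i list \<times> 'i list \<Rightarrow>\<^sub>0 qv) \<Rightarrow> ('i list \<times> 'i list \<Rightarrow>\<^sub>0 qv)" where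
  "act p z = lx (\<lambda>w. foldr ga (letters w) z) p"

lemma lin_foldr_ga: "lin (foldr ga gs)"
proof (induction gs)
  case Nil then show ?case by (simp add: id_def lin_id)
next
  case (Cons g gs) then show ?case using lin_comp[OF lin_ga] by (simp add: comp_def)
qed

lemma lin_act1: "lin (\<lambda>p. act p z)" by (simp add: act_def)
lemma lin_act2: "lin (act p)" unfolding act_def lx_def by (intro lin_sums lin_scale lin_foldr_ga)

lemmas act_add = lin_add[OF lin_act1] and act_sc = lin_sc[OF lin_act1] and act_0 = lin_0[OF lin_act1]
  and act_diff = lin_diff[OF lin_act1] and act_sum = lin_sum[OF lin_act1]

lemma act_mult: "act (p * q) z = act p (act q z)"
  by (rule tens_eqI[where f = "\<lambda>p q. act (p * q) z" and g = "\<lambda>p q. act p (act q z)"])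
    (rule lin_comp[OF lin_act1 lin_mult_right] lin_comp[OF lin_act1 lin_mult_left] lin_act1 lin_comp[OF lin_act2 lin_act1]
      | simp add: act_def mult_single fmon_plus)+

lemma act_fgen[simp]: "act (fgen g) z = ga g z" by (simp add: act_def fgen_def)
lemma act_1[simp]: "act 1 z = z"
proof -
  have "act (bs 0) z = z" unfolding act_def by (simp add: fmon_zero del: single_one)
  then show ?thesis by simp
qed

lemma act_pow: "act (p ^ n) z = (act p ^^ n) z" by (induction n) (simp_all add: act_mult)

lemma act_idem: "act (idem D \<pi> \<kappa>) z = (if \<kappa> \<in> Wo \<pi> then prj \<kappa> z else 0)"
  by (simp add: idem_def act_0)

lemma act_N: assumes "p \<in> SG \<pi>" "z \<in> N" shows "act p z \<in> N"
proof (rule subspace_lin[where f = "\<lambda>p. act p z", OF lin_act1 NV_subspace])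
  fix w assume "w \<in> Poly_Mapping.keys p"
  then have "set (letters w) \<subseteq> S_gens D \<pi>" using assms(1) by (auto simp: FG_def)
  then have "foldr ga (letters w) z \<in> N"
  proof (induction "letters w" arbitrary: w)
    case Nil then show ?case using assms(2) by (metis foldr_Nil id_apply)
  next
    case (Cons g gs)
    have "foldr ga gs z \<in> N" using Cons(1)[of "FMon gs"] Cons(2,3) by (metis fmon.sel insert_subset list.simps(15))
    moreover have "g \<in> S_gens D \<pi>" using Cons(2,3) by (metis insert_subset list.simps(15))
    ultimately have "ga g (foldr ga gs z) \<in> N" by (cases g) (auto intro: N_es N_prj)
    then show ?case using Cons(2)[symmetric] by simp
  qed
  then show "act (bs w) z \<in> N" by (simp add: act_def)
qed

lemma act_serre:
  assumes "i \<in> II" "j \<in> II"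
  shows "act (serre D s i j) z = (case s of Pos \<Rightarrow> SE i j z | Neg \<Rightarrow> SF i j z)"
proof -
  have "act (serre D s i j) z = (\<Sum>k\<le>nat (1 - ca i j). sc (serre_coeff (qi i) (nat (1 - ca i j)) k)
     ((lx (es s i) ^^ k) (lx (es s j) ((lx (es s i) ^^ (nat (1 - ca i j) - k)) z))))"
    unfolding serre_expand[OF assms] act_sum act_sc act_mult act_pow
  proof -
    have "act (fgen (E s i)) = lx (es s i)" "act (fgen (E s j)) = lx (es s j)" by (intro ext; simp)+
    then show "(\<Sum>k\<le>nat (1 - ca i j). sc (serre_coeff (qi i) (nat (1 - ca i j)) k)
       ((act (fgen (E s i)) ^^ k) (act (fgen (E s j)) ((act (fgen (E s i)) ^^ (nat (1 - ca i j) - k)) z)))) =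
      (\<Sum>k\<le>nat (1 - ca i j). sc (serre_coeff (qi i) (nat (1 - ca i j)) k)
     ((lx (es s i) ^^ k) (lx (es s j) ((lx (es s i) ^^ (nat (1 - ca i j) - k)) z))))" by simp
  qed
  then show ?thesis by (cases s) (simp_all add: SE_def' T.serreF_def)
qed

lemma wtV_xw: assumes "i \<in> II" "set x \<subseteq> II" "set y \<subseteq> II" shows "wtV a b (x, y) i = pr (ch i) (xw (x, y))"
proof -
  have s: "pr (ch i) (swt s z) = sgn_int s * (\<Sum>j\<in>#mset z. ca i j)" if "set z \<subseteq> II" for s z
    using that by (induction z) (auto simp: swt_def sal_def pr_add2 pr_zsmul2 pr_ca assms(1) distrib_left)
  show ?thesis using ab[OF assms(1)] s[OF assms(2), of Pos] s[OF assms(3), of Neg]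
    by (simp add: wtV_def wtw_def xw_def pr_add2)
qed

text \<open>It suffices to treat basis vectors outside N. Their weights lie in W\<pi> by
  \<open>outside\<close>, so the idempotents of S(\<pi>) see all of them.\<close>

lemma act_rel: assumes r: "r \<in> S_rels D \<pi>" shows "act r z \<in> N"
proof (rule subspace_lin[OF lin_act2 NV_subspace])
  fix w
  have rF: "r \<in> SG \<pi>" using r S.R_FG by blast
  show "act r (bs w) \<in> N"
  proof (cases "bs w \<in> N")
    case True
    then show ?thesis using rF by (rule act_N[rotated])
  next
    case wN: False
    then have wW: "xw w \<in> Wo \<pi>" using xw_out by blast
    have pw: "prj \<kappa> (bs w) = (if xw w = \<kappa> then bs w else 0)" for \<kappa> by (rule prj_hom) simp
    have iw: "act (idem D \<pi> \<kappa>) (bs w) = (if xw w = \<kappa> then bs w else 0)" for \<kappa>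
      using wW by (auto simp: act_idem pw)
    have i0: "act p 0 = 0" for p by (rule lin_0[OF lin_act2])
    consider \<zeta> \<zeta>' where "r = idem D \<pi> \<zeta> * idem D \<pi> \<zeta>' - (if \<zeta> = \<zeta>' then idem D \<pi> \<zeta> else 0)"
      | "r = (\<Sum>\<zeta>\<in>Wo \<pi>. idem D \<pi> \<zeta>) - 1"
      | s i \<zeta> where "i \<in> II" "r = fgen (E s i) * idem D \<pi> \<zeta> - idem D \<pi> (\<zeta> + zsmul (sgn_int s) (al i)) * fgen (E s i)"
      | i j where "i \<in> II" "j \<in> II" "r = fgen (E Pos i) * fgen (E Neg j) - fgen (E Neg j) * fgen (E Pos i)
          - (if i = j then (\<Sum>\<zeta>\<in>Wo \<pi>. fscale (qint (vi D i) (pr (ch i) \<zeta>)) (idem D \<pi> \<zeta>)) else 0)"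
      | s i j where "i \<in> II" "j \<in> II" "i \<noteq> j" "r = serre D s i j"
      using r unfolding S_rels_def serre_rels_def by blast
    then show ?thesis
    proof cases
      case 1
      have "act r (bs w) = 0" by (auto simp: 1 act_diff act_mult iw i0 act_0)
      then show ?thesis by (simp add: NV_0)
    next
      case 2
      have "act r (bs w) = 0" using wW fin by (simp add: 2 act_diff act_sum iw)
      then show ?thesis by (simp add: NV_0)
    next
      case 3
      let ?e = "es s i w"
      have pe: "prj \<kappa> ?e = (if xw w + sal s i = \<kappa> then ?e else 0)" for \<kappa>
        by (rule prj_hom) (rule es_xw[OF 3(1)])
      \<comment> \<open>If the idempotent at the new weight is 0 by convention, the relation demands
        that E_i w itself vanish modulo N.\<close>
      have eN: "?e \<in> N" if "xw w + sal s i \<notin> Wo \<pi>"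
        by (rule NV_keys) (use that es_xw[OF 3(1)] xw_out in metis)
      have "act r (bs w) = (if xw w = \<zeta> then ?e else 0) -
          (if \<zeta> + sal s i \<in> Wo \<pi> then if xw w = \<zeta> then ?e else 0 else 0)"
        using wW by (auto simp: 3(2) act_diff act_mult pw act_idem pe sal_def[symmetric] lx_0 i0)
      also have "\<dots> \<in> N" using eN by (auto simp: NV_0)
      finally show ?thesis .
    next
      case 4
      obtain x y where xy: "w = (x, y)" by (cases w)
      have II: "set x \<subseteq> II" "set y \<subseteq> II" using wN N_junk[of x y] xy by auto
      have "act r (bs w) = EV i (FV j (bs w)) - FV j (EV i (bs w)) - (if i = j then sc (qint (qi i) (pr (ch i) (xw w))) (bs w) else 0)"
      proof -
        have "(\<Sum>\<zeta>\<in>Wo \<pi>. act (sc (qint (qi i) (pr (ch i) \<zeta>)) (idem D \<pi> \<zeta>)) (bs w)) =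
            (\<Sum>\<zeta>\<in>Wo \<pi>. if xw w = \<zeta> then sc (qint (qi i) (pr (ch i) (xw w))) (bs w) else 0)"
          by (intro sum.cong refl) (auto simp: act_sc iw)
        also have "\<dots> = sc (qint (qi i) (pr (ch i) (xw w))) (bs w)" using wW fin by simp
        finally have S: "(\<Sum>\<zeta>\<in>Wo \<pi>. act (sc (qint (qi i) (pr (ch i) \<zeta>)) (idem D \<pi> \<zeta>)) (bs w)) = sc (qint (qi i) (pr (ch i) (xw w))) (bs w)" .
        show ?thesis
        proof (cases "i = j")
          case True
          then show ?thesis using S by (simp add: 4(3) act_diff act_mult act_sum fscale_sc vi_qi)
        next
          case False
          then show ?thesis by (simp add: 4(3) act_diff act_mult act_0)
        qed
      qed
      also have "\<dots> = 0"
        using T.comm[OF 4(1,2), of w] wtV_xw[OF 4(1) II] by (auto simp: xy)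
      finally show ?thesis by (simp add: NV_0)
    next
      case 5
      then show ?thesis using act_serre[OF 5(1,2)] SE_in_N[OF 5(1-3)] SF_in_N[OF 5(1-3)] by (cases s) auto
    qed
  qed
qed

text \<open>The polynomials that send everything into N form a two-sided ideal: right multiples
  since z is arbitrary, left multiples since N is stable.\<close>

lemma act_SI: assumes "p \<in> SI \<pi>" shows "act p z \<in> N"
proof -
  have "SI \<pi> \<subseteq> {p \<in> SG \<pi>. \<forall>z. act p z \<in> N}"
  proof (rule S.PI_minimal)
    show "idealp (S_gens D \<pi>) {p \<in> SG \<pi>. \<forall>z. act p z \<in> N}"
      unfolding idealp_def
    proof (intro conjI ballI)
      show "{p \<in> SG \<pi>. \<forall>z. act p z \<in> N} \<subseteq> SG \<pi>" by blast
      show "0 \<in> {p \<in> SG \<pi>. \<forall>z. act p z \<in> N}" by (simp add: act_0 NV_0)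
      fix x assume x: "x \<in> {p \<in> SG \<pi>. \<forall>z. act p z \<in> N}"
      show "x + y \<in> {p \<in> SG \<pi>. \<forall>z. act p z \<in> N}" if "y \<in> {p \<in> SG \<pi>. \<forall>z. act p z \<in> N}" for y
        using x that by (simp add: act_add NV_add)
      show "p * x \<in> {p \<in> SG \<pi>. \<forall>z. act p z \<in> N}" if "p \<in> SG \<pi>" for p
        using x act_N[OF that] that by (simp add: act_mult)
      show "x * p \<in> {p \<in> SG \<pi>. \<forall>z. act p z \<in> N}" if "p \<in> SG \<pi>" for p
        using x that by (simp add: act_mult)
    qed
    show "S_rels D \<pi> \<subseteq> {p \<in> SG \<pi>. \<forall>z. act p z \<in> N}" using act_rel S.R_FG by blast
  qed
  then show ?thesis using assms by blast
qed

lemma act_word: "act (Ew s x) z = foldr (\<lambda>i. lx (es s i)) x z"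
  by (induction x) (simp_all add: Ew_Cons act_mult)

lemma act_kappa:
  assumes "t \<in> II_words"
  shows "act (kappa t) (bs ([], [])) = tau a b t"
  unfolding tau_def
proof (rule lin_eqI[where f = "\<lambda>t. act (kappa t) (bs ([], []))", OF _ lin_lx])
  show "lin (\<lambda>t. act (kappa t) (bs ([], [])))" unfolding kappa_def by (rule lin_comp[OF lin_act1 lin_lx])
  fix w assume w: "w \<in> Poly_Mapping.keys t"
  obtain x y where xy: "w = (x, y)" by (cases w)
  have "set x \<subseteq> II" "set y \<subseteq> II" using assms w by (auto simp: II_words_def xy)
  moreover have "foldr (\<lambda>i. lx (eV a b i)) x (bs ([], [])) = bs (x, [])"
    by (induction x) (simp_all add: eV_def tens_02)
  ultimately show "act (kappa (bs w)) (bs ([], [])) =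
     lx (\<lambda>(x, y). foldr (\<lambda>i. lx (fV a b i)) y (bs (x, []))) (bs w)"
    by (simp add: xy kappa_def kb_def act_mult act_word)
qed

lemma tau_xw:
  assumes t: "t \<in> II_words" and wt: "\<And>w. w \<in> Poly_Mapping.keys t \<Longrightarrow> xw w = \<rho>"
    and w: "w \<in> Poly_Mapping.keys (tau a b t)"
  shows "xw w = \<rho>"
proof -
  obtain x y where xy: "(x, y) \<in> Poly_Mapping.keys t" "w \<in> Poly_Mapping.keys (foldr (\<lambda>i. lx (fV a b i)) y (bs (x, [])))"
    using keys_lx[OF w[unfolded tau_def]] by auto
  have "set y \<subseteq> II" using t xy by (auto simp: II_words_def)
  then have "u \<in> Poly_Mapping.keys (foldr (\<lambda>i. lx (fV a b i)) y (bs (x, []))) \<Longrightarrow> xw u = xw (x, y)" for u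
  proof (induction y arbitrary: u)
    case (Cons i y)
    then obtain u' where "u' \<in> Poly_Mapping.keys (foldr (\<lambda>i. lx (fV a b i)) y (bs (x, [])))" "u \<in> Poly_Mapping.keys (fV a b i u')"
      using keys_lx by fastforce
    then show ?case using Cons es_xw[of i u Neg u'] by (simp add: xw_def swt_def)
  qed simp
  then show ?thesis using xy wt by metis
qed

end

section \<open>Choice of the tensor product and of \<pi> for a given element\<close>

context rdatum
begin

theorem Wsub_of_sand:
  assumes p: "p \<in> UH (\<zeta> - \<mu>)" and s: "\<And>\<pi>. \<pi> \<in> fin_sat D \<Longrightarrow> sand \<pi> \<zeta> \<mu> p \<in> SI \<pi>"
  shows "p \<in> Wsub \<zeta> \<mu>"
proof -
  obtain t where t: "t \<in> II_words" "p - kappa t \<in> UL \<mu>" using U_triangular[OF UH_UG[OF p]] by blast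
  define good where "good = (\<lambda>(x, y). swt Pos x + swt Neg y = \<zeta> - \<mu>)"
  \<comment> \<open>Products F_y E_x of weight other than \<zeta> - \<mu> vanish in the component
    (\<zeta>, \<mu>). Without them the generating vector is sent into the single weight
    \<zeta>.\<close>
  define t' where "t' = lx (\<lambda>w. if good w then bs w else 0) t"
  have lk: "lin kappa" by (simp add: kappa_def)
  have keys': "w \<in> Poly_Mapping.keys t \<and> good w" if w: "w \<in> Poly_Mapping.keys t'" for w
    using keys_lx[OF w[unfolded t'_def]] by (auto split: if_splits)
  have t'II: "t' \<in> II_words" using t(1) keys' by (fastforce simp: II_words_def)
  have "kappa t - kappa t' \<in> Wsub \<zeta> \<mu>"
    unfolding t'_def
  proof (rule subspace_lin[where f = "\<lambda>t. kappa t - kappa (lx (\<lambda>w. if good w then bs w else 0) t)",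
        OF lin_minus2[OF lk lin_comp[OF lk lin_lx]] Wsub_subspace])
    fix w assume w: "w \<in> Poly_Mapping.keys t"
    obtain x y where xy: "w = (x, y)" by (cases w)
    have II: "set x \<subseteq> II" "set y \<subseteq> II" using t(1) w by (auto simp: II_words_def xy)
    show "kappa (bs w) - kappa (lx (\<lambda>w. if good w then bs w else 0) (bs w)) \<in> Wsub \<zeta> \<mu>"
    proof (cases "good w")
      case True
      then show ?thesis using Wsub_UI[OF U.PI_0] by simp
    next
      case False
      have "Ew Neg y * Ew Pos x \<in> UH (swt Neg y + swt Pos x)" using II by (intro UH_mult UH_word)
      then have "Ew Neg y * Ew Pos x \<in> Wsub \<zeta> \<mu>" using False by (intro UH_Wsub) (auto simp: good_def xy add.commute)
      then show ?thesis using False II by (simp add: lin_0[OF lk]) (simp add: kappa_def kb_def xy)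
    qed
  qed
  then have pk: "p - kappa t' \<in> Wsub \<zeta> \<mu>" using Wsub_add[OF UL_Wsub[OF t(2)]] by fastforce
  define L where "L = (\<lambda>w. max (length (fst w)) (length (snd w))) ` Poly_Mapping.keys t'"
  have "finite L" by (simp add: L_def)
  then obtain d where d: "\<forall>n\<in>L. n \<le> d" using finite_nat_set_iff_bounded_le by blast
  \<comment> \<open>Both highest weights must be at least d in every coordinate, and they differ by
    the coordinates of \<mu>, which may be negative; hence the absolute value.\<close>
  define m where "m i = pr (ch i) \<mu>" for i
  define c where "c i = d + nat \<bar>m i\<bar>" for i
  define c' where "c' i = nat (int (c i) + m i)" for i
  have c'c: "int (c' i) - int (c i) = m i" "c' i \<ge> d" for i by (auto simp: c'_def c_def)
  define a b where "a = (\<lambda>i. int (c i))" "b = (\<lambda>i. int (c' i))"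
  interpret TR: tensor_rep II "form D" a b "Gb c" "Gb c'" by (rule tensor_rep_Gb) (simp_all add: a_b_def)
  obtain dN where dN: "\<forall>x y. length x > dN \<or> length y > dN \<longrightarrow> bs (x, y) \<in> TR.N" using NV_cofinite by blast
  define WW where "WW = {x. set x \<subseteq> II \<and> length x \<le> dN}"
  have fW: "finite WW" unfolding WW_def by (rule finite_lists_length_le[OF finite_I])
  \<comment> \<open>The candidates for weights of the finite dimensional quotient, together with
    \<mu> and \<zeta>, whose idempotents are to act as the identity on the generating vector and on
    its image.\<close>
  define P where "P = insert \<mu> (insert \<zeta> ((\<lambda>(x, y). \<mu> + swt Pos x + swt Neg y) ` (WW \<times> WW)))"
  have "finite P" unfolding P_def using fW by simp
  then obtain \<pi> where \<pi>: "\<pi> \<in> fin_sat D" "P \<subseteq> Wo \<pi>" using fin_sat_covers by blast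
  interpret R: rdatum_tensor D a b "Gb c" "Gb c'" \<mu> \<pi>
  proof
    show "b i - a i = pr (ch i) \<mu>" if "i \<in> II" for i using c'c by (simp add: a_b_def m_def)
    show "finite (Wo \<pi>)" by (rule fin_sat_finite[OF \<pi>(1)])
    fix x y assume n: "bs (x, y) \<notin> TR.N"
    then have "\<not> (length x > dN \<or> length y > dN)" "set x \<subseteq> II" "set y \<subseteq> II"
      using dN TR.N_junk[of x y] by blast+
    then have "x \<in> WW" "y \<in> WW" by (simp_all add: WW_def not_less)
    then have "\<mu> + swt Pos x + swt Neg y \<in> P" unfolding P_def by (intro insertI2 image_eqI[where x = "(x, y)"]) auto
    then show "\<mu> + swt Pos x + swt Neg y \<in> Wo \<pi>" using \<pi>(2) by blast
  qed
  have "sand \<pi> \<zeta> \<mu> (p - kappa t') \<in> SI \<pi>" by (rule sand_Wsub[OF R.fin pk])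
  then have "sand \<pi> \<zeta> \<mu> p - sand \<pi> \<zeta> \<mu> (p - kappa t') \<in> SI \<pi>" using s[OF \<pi>(1)] by (intro S.PI_diff)
  then have "sand \<pi> \<zeta> \<mu> (kappa t') \<in> SI \<pi>" by (simp add: lin_diff[OF lin_sand])
  moreover have "fsub (pg \<pi>) (kappa t') = kappa t'"
  proof -
    have w: "fsub (pg \<pi>) (Ew s x) = Ew s x" for s x by (induction x) (simp_all add: Ew_Cons fsub_mult)
    show ?thesis
      by (rule lin_eqI[where f = "\<lambda>t. fsub (pg \<pi>) (kappa t)" and g = kappa])
        (auto simp: kappa_def kb_def fsub_mult w fsub_0 intro: lin_comp[OF lin_fsub lin_lx])
  qed
  ultimately have "idem D \<pi> \<zeta> * kappa t' * idem D \<pi> \<mu> \<in> SI \<pi>" by (simp add: sand_def)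
  then have "R.act (idem D \<pi> \<zeta> * kappa t' * idem D \<pi> \<mu>) (bs ([], [])) \<in> TR.N" by (rule R.act_SI)
  moreover have "R.act (idem D \<pi> \<mu>) (bs ([], [])) = bs ([], [])"
  proof -
    have "\<mu> \<in> Wo \<pi>" using \<pi>(2) by (auto simp: P_def)
    moreover have "R.prj \<mu> (bs ([], [])) = (if \<mu> = \<mu> then bs ([], []) else 0)"
      by (rule R.prj_hom) (simp add: R.xw_def swt_def)
    ultimately show ?thesis by (simp add: R.act_idem)
  qed
  ultimately have "R.act (idem D \<pi> \<zeta>) (tau a b t') \<in> TR.N" by (simp add: R.act_mult R.act_kappa[OF t'II])
  moreover have "R.act (idem D \<pi> \<zeta>) (tau a b t') = tau a b t'"
  proof -
    have "\<zeta> \<in> Wo \<pi>" using \<pi>(2) by (auto simp: P_def)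
    moreover have "R.prj \<zeta> (tau a b t') = (if \<zeta> = \<zeta> then tau a b t' else 0)"
    proof (rule R.prj_hom)
      fix w assume "w \<in> Poly_Mapping.keys (tau a b t')"
      then show "R.xw w = \<zeta>"
        by (rule R.tau_xw[OF t'II, rotated]) (use keys' in \<open>auto simp: R.xw_def good_def add.assoc\<close>)
    qed
    ultimately show ?thesis by (simp add: R.act_idem)
  qed
  ultimately have tn: "tau a b t' \<in> NV (Gb c) (Gb c')" by simp
  have "t' \<in> NV G0 G0"
  proof (rule tau_separates[OF _ _ _ tn])
    fix x y assume "(x, y) \<in> Poly_Mapping.keys t'"
    then have "max (length x) (length y) \<in> L" by (force simp: L_def)
    then show "length x \<le> d \<and> length y \<le> d" using d by auto
  qed (use c'c in \<open>auto simp: c_def\<close>)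
  then have "kappa t' \<in> Wsub \<zeta> \<mu>" by (intro Wsub_UI kappa_NV)
  then show ?thesis using Wsub_add[OF pk] by fastforce
qed

theorem pdot_faithful:
  assumes x: "x \<in> carrier (Udot D)" and z: "\<And>\<pi>. \<pi> \<in> fin_sat D \<Longrightarrow> pdot D \<pi> x = \<zero>\<^bsub>S_alg D \<pi>\<^esub>"
  shows "x = \<zero>\<^bsub>Udot D\<^esub>"
proof -
  obtain X where X: "\<And>\<zeta> \<mu>. X \<zeta> \<mu> \<in> UH (\<zeta> - \<mu>)" "\<And>\<zeta> \<mu>. x \<zeta> \<mu> = wproj \<zeta> \<mu> (X \<zeta> \<mu>)"
    "\<And>\<zeta> \<mu>. (\<zeta>, \<mu>) \<notin> sp x \<Longrightarrow> X \<zeta> \<mu> = 0" using Udot_reps[OF x] by blast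
  note XU = UH_UG[OF X(1)]
  have F: "finite (sp x)" using x by (simp add: Udot_carrier)
  have "X \<zeta> \<mu> \<in> Wsub \<zeta> \<mu>" for \<zeta> \<mu>
  proof (rule Wsub_of_sand[OF X(1)])
    fix \<pi> assume \<pi>: "\<pi> \<in> fin_sat D"
    note f = fin_sat_finite[OF \<pi>]
    let ?i = "idem D \<pi>"
    have "pdot D \<pi> x = S_class D \<pi> (\<Sum>(\<zeta>, \<mu>)\<in>sp x. sand \<pi> \<zeta> \<mu> (X \<zeta> \<mu>))"
      by (rule pdot_eq[OF f XU X(2) F X(3)])
    moreover have "(\<Sum>(\<zeta>, \<mu>)\<in>sp x. sand \<pi> \<zeta> \<mu> (X \<zeta> \<mu>)) \<in> SG \<pi>" using XU by (auto intro!: FG_sum)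
    ultimately have S: "(\<Sum>(\<zeta>, \<mu>)\<in>sp x. sand \<pi> \<zeta> \<mu> (X \<zeta> \<mu>)) \<in> SI \<pi>" using z[OF \<pi>]
      by (intro S.cl_zero_iff[THEN iffD1]) simp_all
    \<comment> \<open>Multiplication by the idempotents at \<zeta> and \<mu> isolates one component
      of the sum over the support.\<close>
    have one: "?i \<zeta> * sand \<pi> \<zeta>' \<mu>' (X \<zeta>' \<mu>') * ?i \<mu> - (if (\<zeta>', \<mu>') = (\<zeta>, \<mu>) then sand \<pi> \<zeta> \<mu> (X \<zeta> \<mu>) else 0) \<in> SI \<pi>" for \<zeta>' \<mu>'
    proof -
      let ?Y = "fsub (pg \<pi>) (X \<zeta>' \<mu>')"
      have YF: "?Y \<in> SG \<pi>" using XU by simp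
      have a: "(?i \<zeta> * ?i \<zeta>' - (if \<zeta> = \<zeta>' then ?i \<zeta> else 0)) * (?Y * (?i \<mu>' * ?i \<mu>)) \<in> SI \<pi>"
        using YF by (intro S.PI_r S_idem) auto
      have b: "(if \<zeta> = \<zeta>' then ?i \<zeta> else 0) * ?Y * (?i \<mu>' * ?i \<mu> - (if \<mu>' = \<mu> then ?i \<mu>' else 0)) \<in> SI \<pi>"
        using YF by (intro S.PI_l S_idem) auto
      show ?thesis using S.PI_add[OF a b] by (auto simp: sand_def algebra_simps)
    qed
    have "(\<Sum>z\<in>sp x. ?i \<zeta> * sand \<pi> (fst z) (snd z) (X (fst z) (snd z)) * ?i \<mu> - (if (fst z, snd z) = (\<zeta>, \<mu>) then sand \<pi> \<zeta> \<mu> (X \<zeta> \<mu>) else 0)) \<in> SI \<pi>"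
      by (intro S.PI_sum one)
    moreover have "(\<Sum>z\<in>sp x. ?i \<zeta> * sand \<pi> (fst z) (snd z) (X (fst z) (snd z)) * ?i \<mu>) \<in> SI \<pi>"
    proof -
      have "?i \<zeta> * (\<Sum>(\<zeta>, \<mu>)\<in>sp x. sand \<pi> \<zeta> \<mu> (X \<zeta> \<mu>)) * ?i \<mu> \<in> SI \<pi>" by (intro S.PI_l S.PI_r S) auto
      then show ?thesis by (simp add: sum_distrib_left sum_distrib_right case_prod_beta)
    qed
    ultimately have "(\<Sum>z\<in>sp x. if (fst z, snd z) = (\<zeta>, \<mu>) then sand \<pi> \<zeta> \<mu> (X \<zeta> \<mu>) else 0) \<in> SI \<pi>"
      using S.PI_diff by (fastforce simp: sum_subtractf)
    moreover have "(\<Sum>z\<in>sp x. if (fst z, snd z) = (\<zeta>, \<mu>) then sand \<pi> \<zeta> \<mu> (X \<zeta> \<mu>) else 0) = sand \<pi> \<zeta> \<mu> (X \<zeta> \<mu>)"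
    proof (cases "(\<zeta>, \<mu>) \<in> sp x")
      case True
      then show ?thesis using F by simp
    next
      case False
      then have "(\<Sum>z\<in>sp x. if (fst z, snd z) = (\<zeta>, \<mu>) then sand \<pi> \<zeta> \<mu> (X \<zeta> \<mu>) else 0) = 0"
        by (intro sum.neutral) auto
      then show ?thesis using X(3)[OF False] by (simp add: lin_0[OF lin_sand])
    qed
    ultimately show "sand \<pi> \<zeta> \<mu> (X \<zeta> \<mu>) \<in> SI \<pi>" by simp
  qed
  then have "x \<zeta> \<mu> = \<zero>\<^bsub>wt_quot D \<zeta> \<mu>\<^esub>" for \<zeta> \<mu>
    unfolding X(2) wq_zero using XU wq_eq[of "X \<zeta> \<mu>" 0] by simp
  then show ?thesis by (intro ext) (simp add: Udot_simps)
qed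

end

section \<open>Coherent bases of separated inverse systems\<close>

context qvspace
begin

lemma indep_unique:
  assumes "lin_indep M S" "S \<subseteq> carrier M" "finite U" "U \<subseteq> S" "lincomb M c U = lincomb M d U" "b \<in> U"
  shows "c b = d b"
  using lincomb_diff_eq[of U c d] assms unfolding lin_indep_def by fastforce

lemma coords_eqI:
  assumes S: "lin_indep M S" "S \<subseteq> carrier M" and U: "finite U" "U \<subseteq> S"
    and c: "\<And>b. b \<notin> U \<Longrightarrow> c b = 0" and x: "lincomb M c U = x"
  shows "coords M S x = c"
  unfolding coords_def
proof (rule the_equality)
  have sub: "{b. c b \<noteq> 0} \<subseteq> U" using c by auto
  have "lincomb M c {b. c b \<noteq> 0} = lincomb M c U"
    using U S sub by (intro lincomb_mono_neutral) auto
  then show "{b. c b \<noteq> 0} \<subseteq> S \<and> finite {b. c b \<noteq> 0} \<and> lincomb M c {b. c b \<noteq> 0} = x"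
    using sub U x finite_subset[OF sub] by auto
  fix d assume d: "{b. d b \<noteq> 0} \<subseteq> S \<and> finite {b. d b \<noteq> 0} \<and> lincomb M d {b. d b \<noteq> 0} = x"
  let ?V = "U \<union> {b. d b \<noteq> 0}"
  have V: "finite ?V" "?V \<subseteq> S" using U d by auto
  have "lincomb M d {b. d b \<noteq> 0} = lincomb M d ?V" using V S by (intro lincomb_mono_neutral) auto
  moreover have "lincomb M c U = lincomb M c ?V" using V S c by (intro lincomb_mono_neutral) auto
  ultimately have eq: "lincomb M d ?V = lincomb M c ?V" using d x by simp
  show "d = c"
  proof
    fix b show "d b = c b"
    proof (cases "b \<in> ?V")
      case True
      then show ?thesis using indep_unique[OF S V eq] by blast
    next
      case False
      then show ?thesis using c by auto
    qed
  qed
qed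

lemma coords_props:
  assumes S: "is_basis M S" and x: "x \<in> carrier M"
  shows "{b. coords M S x b \<noteq> 0} \<subseteq> S" "finite {b. coords M S x b \<noteq> 0}"
    "lincomb M (coords M S x) {b. coords M S x b \<noteq> 0} = x"
proof -
  have S': "lin_indep M S" "S \<subseteq> carrier M" "lin_span M S = carrier M" using S by (auto simp: is_basis_def)
  obtain c U where U: "finite U" "U \<subseteq> S" "x = lincomb M c U" using x S'(3) unfolding lin_span_def by blast
  define c' where "c' b = (if b \<in> U then c b else 0)" for b
  have "lincomb M c' U = x" unfolding U(3) using U S' by (intro lincomb_cong) (auto simp: c'_def)
  then have c: "coords M S x = c'" by (intro coords_eqI[OF S'(1,2) U(1,2)]) (auto simp: c'_def)
  have sub: "{b. c' b \<noteq> 0} \<subseteq> U" by (auto simp: c'_def)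
  have "lincomb M c' {b. c' b \<noteq> 0} = lincomb M c' U" using U S' sub by (intro lincomb_mono_neutral) auto
  then show "{b. coords M S x b \<noteq> 0} \<subseteq> S" "finite {b. coords M S x b \<noteq> 0}"
    "lincomb M (coords M S x) {b. coords M S x b \<noteq> 0} = x"
    unfolding c using sub U \<open>lincomb M c' U = x\<close> finite_subset[OF sub] by auto
qed

text \<open>The basis elements occurring in the expansions of the finite generating set already
  generate; any further basis element would have two expansions.\<close>

lemma basis_finite:
  assumes S: "is_basis M S" and Z: "finite Z" "Z \<subseteq> carrier M" "lin_span M Z = carrier M"
  shows "finite S"
proof -
  have S': "lin_indep M S" "S \<subseteq> carrier M" using S by (auto simp: is_basis_def)
  define U where "U = (\<Union>x\<in>Z. {b. coords M S x b \<noteq> 0})"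
  have U: "finite U" "U \<subseteq> S" unfolding U_def using coords_props[OF S] Z by blast+
  have "Z \<subseteq> lin_span M U"
  proof
    fix x assume x: "x \<in> Z"
    then have "x = lincomb M (coords M S x) {b. coords M S x b \<noteq> 0}" "{b. coords M S x b \<noteq> 0} \<subseteq> U"
      using coords_props[OF S] Z by (auto simp: U_def)
    then show "x \<in> lin_span M U" unfolding lin_span_def using coords_props(2)[OF S, of x] x Z by blast
  qed
  then have all: "carrier M \<subseteq> lin_span M U"
    using span_minimal[OF span_sbsp[of U]] Z(3) U S' by blast
  have "b \<in> U" if b: "b \<in> S" for b
  proof (rule ccontr)
    assume nb: "b \<notin> U"
    have bM: "b \<in> carrier M" using b S' by blast
    then obtain c V where V: "finite V" "V \<subseteq> U" "b = lincomb M c V" using all unfolding lin_span_def by blast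
    define c' where "c' x = (if x \<in> V then c x else 0)" for x
    have "lincomb M c' V = b" unfolding V(3) using V U S' by (intro lincomb_cong) (auto simp: c'_def)
    then have "coords M S b = c'" using V U by (intro coords_eqI[OF S', of V]) (auto simp: c'_def)
    moreover have "lincomb M (\<lambda>x. if x = b then 1 else 0) {b} = b"
      unfolding lincomb_def using bM by (subst finsum_insert) auto
    then have "coords M S b = (\<lambda>x. if x = b then 1 else 0)" using b by (intro coords_eqI[OF S', of "{b}"]) auto
    ultimately have "c' b = 1" by metis
    then show False using nb V by (auto simp: c'_def split: if_splits)
  qed
  then show ?thesis using U(1) by (meson finite_subset subsetI)
qed

lemma basis_nonzero: assumes S: "is_basis M S" and b: "b \<in> S" shows "b \<noteq> \<zero>"
proof
  assume "b = \<zero>"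
  then have "lincomb M (\<lambda>_. 1) {b} = \<zero>" unfolding lincomb_def by (subst finsum_insert) auto
  then show False using S b unfolding is_basis_def lin_indep_def
    by (metis empty_subsetI finite.emptyI finite_insert insert_subset one_neq_zero singletonI)
qed

end

text \<open>What the formal part rests on: a separated system, directed by unions, of finite
  dimensional algebras under M. As M stands for an algebra that may lack a unit, the family e
  replaces it: in each algebra almost all e \<zeta> vanish and their images sum to 1.\<close>

locale coherent_system =
  fixes M :: "(qv, 'u) module" and P :: "'p set set" and R :: "'p set \<Rightarrow> (qv, 's) module"
    and pd :: "'p set \<Rightarrow> 'u \<Rightarrow> 's" and tr :: "'p set \<Rightarrow> 'p set \<Rightarrow> 's \<Rightarrow> 's" and e :: "'z \<Rightarrow> 'u" and B :: "'u set"
  assumes M: "Module.module Qv_ring M" and R: "\<And>\<pi>. \<pi> \<in> P \<Longrightarrow> assoc_algebra (R \<pi>)"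
    and P_union: "\<And>\<pi> \<pi>'. \<pi> \<in> P \<Longrightarrow> \<pi>' \<in> P \<Longrightarrow> \<pi> \<union> \<pi>' \<in> P"
    and M_mult: "\<And>x y. x \<in> carrier M \<Longrightarrow> y \<in> carrier M \<Longrightarrow> x \<otimes>\<^bsub>M\<^esub> y \<in> carrier M"
    and pd_closed: "\<And>\<pi> x. \<pi> \<in> P \<Longrightarrow> x \<in> carrier M \<Longrightarrow> pd \<pi> x \<in> carrier (R \<pi>)"
    and pd_add: "\<And>\<pi> x y. \<pi> \<in> P \<Longrightarrow> x \<in> carrier M \<Longrightarrow> y \<in> carrier M \<Longrightarrow> pd \<pi> (x \<oplus>\<^bsub>M\<^esub> y) = pd \<pi> x \<oplus>\<^bsub>R \<pi>\<^esub> pd \<pi> y"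
    and pd_smult: "\<And>\<pi> c x. \<pi> \<in> P \<Longrightarrow> x \<in> carrier M \<Longrightarrow> pd \<pi> (c \<odot>\<^bsub>M\<^esub> x) = c \<odot>\<^bsub>R \<pi>\<^esub> pd \<pi> x"
    and pd_mult: "\<And>\<pi> x y. \<pi> \<in> P \<Longrightarrow> x \<in> carrier M \<Longrightarrow> y \<in> carrier M \<Longrightarrow> pd \<pi> (x \<otimes>\<^bsub>M\<^esub> y) = pd \<pi> x \<otimes>\<^bsub>R \<pi>\<^esub> pd \<pi> y"
    and separated: "\<And>x. x \<in> carrier M \<Longrightarrow> (\<And>\<pi>. \<pi> \<in> P \<Longrightarrow> pd \<pi> x = \<zero>\<^bsub>R \<pi>\<^esub>) \<Longrightarrow> x = \<zero>\<^bsub>M\<^esub>"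
    and tr_pd: "\<And>\<pi> \<pi>' x. \<pi> \<in> P \<Longrightarrow> \<pi>' \<in> P \<Longrightarrow> \<pi> \<subseteq> \<pi>' \<Longrightarrow> x \<in> carrier M \<Longrightarrow> tr \<pi> \<pi>' (pd \<pi>' x) = pd \<pi> x"
    and tr_add: "\<And>\<pi> \<pi>' a b. \<pi> \<in> P \<Longrightarrow> \<pi>' \<in> P \<Longrightarrow> \<pi> \<subseteq> \<pi>' \<Longrightarrow> a \<in> carrier (R \<pi>') \<Longrightarrow> b \<in> carrier (R \<pi>') \<Longrightarrow>
      tr \<pi> \<pi>' (a \<oplus>\<^bsub>R \<pi>'\<^esub> b) = tr \<pi> \<pi>' a \<oplus>\<^bsub>R \<pi>\<^esub> tr \<pi> \<pi>' b"
    and tr_smult: "\<And>\<pi> \<pi>' c a. \<pi> \<in> P \<Longrightarrow> \<pi>' \<in> P \<Longrightarrow> \<pi> \<subseteq> \<pi>' \<Longrightarrow> a \<in> carrier (R \<pi>') \<Longrightarrow>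
      tr \<pi> \<pi>' (c \<odot>\<^bsub>R \<pi>'\<^esub> a) = c \<odot>\<^bsub>R \<pi>\<^esub> tr \<pi> \<pi>' a"
    and tr_zero: "\<And>\<pi> \<pi>'. \<pi> \<in> P \<Longrightarrow> \<pi>' \<in> P \<Longrightarrow> \<pi> \<subseteq> \<pi>' \<Longrightarrow> tr \<pi> \<pi>' \<zero>\<^bsub>R \<pi>'\<^esub> = \<zero>\<^bsub>R \<pi>\<^esub>"
    and fin_span: "\<And>\<pi>. \<pi> \<in> P \<Longrightarrow> \<exists>Z. finite Z \<and> Z \<subseteq> carrier (R \<pi>) \<and> lin_span (R \<pi>) Z = carrier (R \<pi>)"
    and e_mem: "\<And>\<zeta>. e \<zeta> \<in> carrier M"
    and unit: "\<And>\<pi>. \<pi> \<in> P \<Longrightarrow> \<exists>F. finite F \<and> (\<forall>\<zeta>. \<zeta> \<notin> F \<longrightarrow> pd \<pi> (e \<zeta>) = \<zero>\<^bsub>R \<pi>\<^esub>) \<and> (\<Oplus>\<^bsub>R \<pi>\<^esub>\<zeta>\<in>F. pd \<pi> (e \<zeta>)) = \<one>\<^bsub>R \<pi>\<^esub>"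
    and B: "is_basis M B"
    and pd_inj: "\<And>\<pi>. \<pi> \<in> P \<Longrightarrow> inj_on (pd \<pi>) {b \<in> B. pd \<pi> b \<noteq> \<zero>\<^bsub>R \<pi>\<^esub>}"
    and pd_basis: "\<And>\<pi>. \<pi> \<in> P \<Longrightarrow> is_basis (R \<pi>) (pd \<pi> ` B - {\<zero>\<^bsub>R \<pi>\<^esub>})"
begin

sublocale M: qvspace M by (rule qvspace.intro[OF M])

lemma R_space: "\<pi> \<in> P \<Longrightarrow> qvspace (R \<pi>)" using R by (auto simp: assoc_algebra_def intro: qvspace.intro)
lemma R_ring: "\<pi> \<in> P \<Longrightarrow> Ring.ring (R \<pi>)" using R by (auto simp: assoc_algebra_def)
lemma R_sm: "\<pi> \<in> P \<Longrightarrow> x \<in> carrier (R \<pi>) \<Longrightarrow> y \<in> carrier (R \<pi>) \<Longrightarrow>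
    (c \<odot>\<^bsub>R \<pi>\<^esub> x) \<otimes>\<^bsub>R \<pi>\<^esub> y = c \<odot>\<^bsub>R \<pi>\<^esub> (x \<otimes>\<^bsub>R \<pi>\<^esub> y) \<and> x \<otimes>\<^bsub>R \<pi>\<^esub> (c \<odot>\<^bsub>R \<pi>\<^esub> y) = c \<odot>\<^bsub>R \<pi>\<^esub> (x \<otimes>\<^bsub>R \<pi>\<^esub> y)"
  using R by (auto simp: assoc_algebra_def)

lemma R_distr:
  assumes "\<pi> \<in> P" "x \<in> carrier (R \<pi>)" "y \<in> carrier (R \<pi>)" "z \<in> carrier (R \<pi>)"
  shows "(x \<oplus>\<^bsub>R \<pi>\<^esub> y) \<otimes>\<^bsub>R \<pi>\<^esub> z = x \<otimes>\<^bsub>R \<pi>\<^esub> z \<oplus>\<^bsub>R \<pi>\<^esub> y \<otimes>\<^bsub>R \<pi>\<^esub> z"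
    "z \<otimes>\<^bsub>R \<pi>\<^esub> (x \<oplus>\<^bsub>R \<pi>\<^esub> y) = z \<otimes>\<^bsub>R \<pi>\<^esub> x \<oplus>\<^bsub>R \<pi>\<^esub> z \<otimes>\<^bsub>R \<pi>\<^esub> y"
    "x \<otimes>\<^bsub>R \<pi>\<^esub> y \<otimes>\<^bsub>R \<pi>\<^esub> z = x \<otimes>\<^bsub>R \<pi>\<^esub> (y \<otimes>\<^bsub>R \<pi>\<^esub> z)"
proof -
  interpret Ring.ring "R \<pi>" by (rule R_ring[OF assms(1)])
  show "(x \<oplus>\<^bsub>R \<pi>\<^esub> y) \<otimes>\<^bsub>R \<pi>\<^esub> z = x \<otimes>\<^bsub>R \<pi>\<^esub> z \<oplus>\<^bsub>R \<pi>\<^esub> y \<otimes>\<^bsub>R \<pi>\<^esub> z"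
    "z \<otimes>\<^bsub>R \<pi>\<^esub> (x \<oplus>\<^bsub>R \<pi>\<^esub> y) = z \<otimes>\<^bsub>R \<pi>\<^esub> x \<oplus>\<^bsub>R \<pi>\<^esub> z \<otimes>\<^bsub>R \<pi>\<^esub> y"
    "x \<otimes>\<^bsub>R \<pi>\<^esub> y \<otimes>\<^bsub>R \<pi>\<^esub> z = x \<otimes>\<^bsub>R \<pi>\<^esub> (y \<otimes>\<^bsub>R \<pi>\<^esub> z)"
    using assms by (simp_all add: l_distr r_distr m_assoc)
qed

lemma R_one: "\<pi> \<in> P \<Longrightarrow> x \<in> carrier (R \<pi>) \<Longrightarrow> \<one>\<^bsub>R \<pi>\<^esub> \<otimes>\<^bsub>R \<pi>\<^esub> x = x \<and> x \<otimes>\<^bsub>R \<pi>\<^esub> \<one>\<^bsub>R \<pi>\<^esub> = x"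
  using R_ring[of \<pi>] by (simp add: Ring.ring_def monoid.l_one monoid.r_one)

lemma B_M: "b \<in> B \<Longrightarrow> b \<in> carrier M" using B by (auto simp: is_basis_def)

definition Bs :: "'p set \<Rightarrow> 'u set" where "Bs \<pi> = {b \<in> B. pd \<pi> b \<noteq> \<zero>\<^bsub>R \<pi>\<^esub>}"

lemma Bs_image: "pd \<pi> ` Bs \<pi> = pd \<pi> ` B - {\<zero>\<^bsub>R \<pi>\<^esub>}" by (auto simp: Bs_def)
lemma Bs_inj: "\<pi> \<in> P \<Longrightarrow> inj_on (pd \<pi>) (Bs \<pi>)" using pd_inj by (simp add: Bs_def)
lemma Bs_M: "b \<in> Bs \<pi> \<Longrightarrow> b \<in> carrier M" by (simp add: Bs_def B_M)

lemma finite_Bs: assumes \<pi>: "\<pi> \<in> P" shows "finite (Bs \<pi>)"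
proof -
  interpret qvspace "R \<pi>" by (rule R_space[OF \<pi>])
  obtain Z where "finite Z" "Z \<subseteq> carrier (R \<pi>)" "lin_span (R \<pi>) Z = carrier (R \<pi>)" using fin_span[OF \<pi>] by blast
  then have "finite (pd \<pi> ` Bs \<pi>)" unfolding Bs_image by (rule basis_finite[OF pd_basis[OF \<pi>]])
  then show ?thesis by (rule finite_imageD[OF _ Bs_inj[OF \<pi>]])
qed

lemma B_Bs: assumes b: "b \<in> B" shows "\<exists>\<pi>\<in>P. b \<in> Bs \<pi>"
  using separated[OF B_M[OF b]] M.basis_nonzero[OF B b] b unfolding Bs_def by blast

lemma pd_zero: "\<pi> \<in> P \<Longrightarrow> pd \<pi> \<zero>\<^bsub>M\<^esub> = \<zero>\<^bsub>R \<pi>\<^esub>"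
proof -
  assume \<pi>: "\<pi> \<in> P"
  interpret Q: qvspace "R \<pi>" by (rule R_space[OF \<pi>])
  have z: "\<zero>\<^bsub>M\<^esub> \<in> carrier M" by simp
  show ?thesis using pd_smult[OF \<pi> z, of 0] pd_closed[OF \<pi> z] by simp
qed

lemma Bs_mono: assumes "\<pi> \<in> P" "\<pi>' \<in> P" "\<pi> \<subseteq> \<pi>'" shows "Bs \<pi> \<subseteq> Bs \<pi>'"
proof
  fix b assume "b \<in> Bs \<pi>"
  then have b: "b \<in> B" "pd \<pi> b \<noteq> \<zero>\<^bsub>R \<pi>\<^esub>" by (simp_all add: Bs_def)
  then have "pd \<pi>' b \<noteq> \<zero>\<^bsub>R \<pi>'\<^esub>" using tr_pd[OF assms B_M[OF b(1)]] tr_zero[OF assms] by force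
  then show "b \<in> Bs \<pi>'" using b by (simp add: Bs_def)
qed

text \<open>The component at \<pi> of a formal sum; by \<open>ev_inj\<close> and
  \<open>ev_surj\<close> it amounts to the coefficients on \<open>Bs \<pi>\<close>.\<close>

definition ev :: "'p set \<Rightarrow> ('u \<Rightarrow> qv) \<Rightarrow> 's" where
  "ev \<pi> a = (\<Oplus>\<^bsub>R \<pi>\<^esub>b\<in>Bs \<pi>. a b \<odot>\<^bsub>R \<pi>\<^esub> pd \<pi> b)"

context
  fixes \<pi> assumes \<pi>: "\<pi> \<in> P"
begin

interpretation R: qvspace "R \<pi>" by (rule R_space[OF \<pi>])
interpretation R: Ring.ring "R \<pi>" by (rule R_ring[OF \<pi>])

lemma pd_Bs[simp]: "b \<in> Bs \<pi> \<Longrightarrow> pd \<pi> b \<in> carrier (R \<pi>)" using pd_closed[OF \<pi> Bs_M] .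

lemma ev_closed: "ev \<pi> a \<in> carrier (R \<pi>)" unfolding ev_def by (rule R.finsum_closed) auto

lemma ev_cong: "(\<And>b. b \<in> Bs \<pi> \<Longrightarrow> a b = a' b) \<Longrightarrow> ev \<pi> a = ev \<pi> a'"
  unfolding ev_def by (rule R.finsum_cong') auto

lemma ev_zero: "ev \<pi> (\<lambda>_. 0) = \<zero>\<^bsub>R \<pi>\<^esub>"
  unfolding ev_def by (subst R.finsum_cong'[where g = "\<lambda>_. \<zero>\<^bsub>R \<pi>\<^esub>"]) (auto simp: R.finsum_zero)

lemma ev_add: "ev \<pi> (\<lambda>b. a b + a' b) = ev \<pi> a \<oplus>\<^bsub>R \<pi>\<^esub> ev \<pi> a'"
proof -
  have "ev \<pi> (\<lambda>b. a b + a' b) = (\<Oplus>\<^bsub>R \<pi>\<^esub>b\<in>Bs \<pi>. a b \<odot>\<^bsub>R \<pi>\<^esub> pd \<pi> b \<oplus>\<^bsub>R \<pi>\<^esub> a' b \<odot>\<^bsub>R \<pi>\<^esub> pd \<pi> b)"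
    unfolding ev_def by (rule R.finsum_cong') (auto simp: R.sm_add_l)
  then show ?thesis by (simp add: ev_def R.finsum_addf Pi_iff)
qed

lemma ev_smult: "ev \<pi> (\<lambda>b. c * a b) = c \<odot>\<^bsub>R \<pi>\<^esub> ev \<pi> a"
  unfolding ev_def by (subst R.sm_finsum[OF finite_Bs[OF \<pi>]]) (auto intro!: R.finsum_cong' simp: R.sm_assoc)

lemma ev_sum: "finite K \<Longrightarrow> ev \<pi> (\<lambda>d. \<Sum>k\<in>K. c k * g k d) = (\<Oplus>\<^bsub>R \<pi>\<^esub>k\<in>K. c k \<odot>\<^bsub>R \<pi>\<^esub> ev \<pi> (g k))"
proof (induction K rule: finite_induct)
  case empty then show ?case by (simp add: ev_zero)
next
  case (insert k K)
  then show ?case by (simp add: ev_add ev_smult ev_closed R.finsum_insert Pi_iff)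
qed

lemma ev_lincomb: "ev \<pi> a = lincomb (R \<pi>) (\<lambda>s. a (inv_into (Bs \<pi>) (pd \<pi>) s)) (pd \<pi> ` Bs \<pi>)"
  unfolding ev_def lincomb_def using Bs_inj[OF \<pi>]
  by (subst R.add.finprod_reindex) (auto intro!: R.finsum_cong' simp: inv_into_f_f)

lemma ev_inj: assumes eq: "ev \<pi> a = ev \<pi> a'" and b: "b \<in> Bs \<pi>" shows "a b = a' b"
proof -
  have I: "lin_indep (R \<pi>) (pd \<pi> ` Bs \<pi>)" "pd \<pi> ` Bs \<pi> \<subseteq> carrier (R \<pi>)"
    using pd_basis[OF \<pi>] unfolding Bs_image by (auto simp: is_basis_def)
  have "a (inv_into (Bs \<pi>) (pd \<pi>) (pd \<pi> b)) = a' (inv_into (Bs \<pi>) (pd \<pi>) (pd \<pi> b))"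
    by (rule R.indep_unique[OF I, of "pd \<pi> ` Bs \<pi>"]) (use eq b finite_Bs[OF \<pi>] in \<open>auto simp: ev_lincomb\<close>)
  then show ?thesis using b Bs_inj[OF \<pi>] by (simp add: inv_into_f_f)
qed

lemma ev_surj: assumes s: "s \<in> carrier (R \<pi>)" shows "\<exists>a. ev \<pi> a = s"
proof -
  have "lin_span (R \<pi>) (pd \<pi> ` Bs \<pi>) = carrier (R \<pi>)"
    using pd_basis[OF \<pi>] unfolding Bs_image by (auto simp: is_basis_def)
  then obtain c U where U: "finite U" "U \<subseteq> pd \<pi> ` Bs \<pi>" "s = lincomb (R \<pi>) c U" using s unfolding lin_span_def by blast
  define c' where "c' x = (if x \<in> U then c x else 0)" for x
  have "s = lincomb (R \<pi>) c' U" unfolding U(3) using U by (intro R.lincomb_cong) (auto simp: c'_def)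
  also have "\<dots> = lincomb (R \<pi>) c' (pd \<pi> ` Bs \<pi>)"
    using U finite_Bs[OF \<pi>] by (intro R.lincomb_mono_neutral) (auto simp: c'_def)
  also have "\<dots> = ev \<pi> (\<lambda>b. c' (pd \<pi> b))"
    unfolding ev_lincomb by (intro R.lincomb_cong) (auto simp: inv_into_f_f Bs_inj[OF \<pi>])
  finally show ?thesis by metis
qed

lemma ev_coords: assumes x: "x \<in> carrier M" shows "ev \<pi> (coords M B x) = pd \<pi> x"
proof -
  define c where "c = coords M B x"
  define U where "U = {b. c b \<noteq> 0}"
  have U: "finite U" "U \<subseteq> B" "lincomb M c U = x" using M.coords_props[OF B x] by (simp_all add: U_def c_def)
  have "pd \<pi> (finsum M (\<lambda>b. c b \<odot>\<^bsub>M\<^esub> b) V) = (\<Oplus>\<^bsub>R \<pi>\<^esub>b\<in>V. c b \<odot>\<^bsub>R \<pi>\<^esub> pd \<pi> b)" if "finite V" "V \<subseteq> B" for V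
    using that
  proof (induction V rule: finite_induct)
    case empty then show ?case by (simp add: pd_zero[OF \<pi>])
  next
    case (insert b V)
    have "finsum M (\<lambda>b. c b \<odot>\<^bsub>M\<^esub> b) V \<in> carrier M"
      by (rule M.finsum_closed) (use insert.prems B_M in auto)
    then show ?case using insert
      by (subst M.finsum_insert; (subst R.finsum_insert)?) (auto simp: B_M pd_add[OF \<pi>] pd_smult[OF \<pi>] pd_closed[OF \<pi>])
  qed
  from this[OF U(1,2)] have "pd \<pi> x = (\<Oplus>\<^bsub>R \<pi>\<^esub>b\<in>U. c b \<odot>\<^bsub>R \<pi>\<^esub> pd \<pi> b)" using U(3) by (simp add: lincomb_def)
  also have "\<dots> = (\<Oplus>\<^bsub>R \<pi>\<^esub>b\<in>U \<union> Bs \<pi>. c b \<odot>\<^bsub>R \<pi>\<^esub> pd \<pi> b)"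
    using U(1,2) finite_Bs[OF \<pi>] pd_closed[OF \<pi>] B_M
    by (intro R.add.finprod_mono_neutral_cong_left) (auto simp: U_def Bs_def)
  also have "\<dots> = ev \<pi> c" unfolding ev_def
    using U(1,2) finite_Bs[OF \<pi>] pd_closed[OF \<pi>] B_M
    by (intro R.add.finprod_mono_neutral_cong_right) (auto simp: Bs_def)
  finally show ?thesis by (simp add: c_def)
qed

lemma tr_ev: assumes \<pi>': "\<pi>' \<in> P" and sub: "\<pi> \<subseteq> \<pi>'" shows "tr \<pi> \<pi>' (ev \<pi>' a) = ev \<pi> a"
proof -
  interpret R': qvspace "R \<pi>'" by (rule R_space[OF \<pi>'])
  note pc = pd_closed[OF \<pi>' B_M]
  have "tr \<pi> \<pi>' (\<Oplus>\<^bsub>R \<pi>'\<^esub>b\<in>V. a b \<odot>\<^bsub>R \<pi>'\<^esub> pd \<pi>' b) = (\<Oplus>\<^bsub>R \<pi>\<^esub>b\<in>V. a b \<odot>\<^bsub>R \<pi>\<^esub> pd \<pi> b)" if "finite V" "V \<subseteq> B" for V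
    using that
  proof (induction V rule: finite_induct)
    case empty then show ?case by (simp add: tr_zero[OF \<pi> \<pi>' sub])
  next
    case (insert b V)
    have "(\<Oplus>\<^bsub>R \<pi>'\<^esub>b\<in>V. a b \<odot>\<^bsub>R \<pi>'\<^esub> pd \<pi>' b) \<in> carrier (R \<pi>')" using insert.prems pc by (auto intro!: R'.finsum_closed)
    then show ?case using insert pc pd_closed[OF \<pi> B_M]
      by (subst R'.finsum_insert; (subst R.finsum_insert)?)
        (auto simp: tr_add[OF \<pi> \<pi>' sub] tr_smult[OF \<pi> \<pi>' sub] tr_pd[OF \<pi> \<pi>' sub] B_M)
  qed
  from this[OF finite_Bs[OF \<pi>']] have "tr \<pi> \<pi>' (ev \<pi>' a) = (\<Oplus>\<^bsub>R \<pi>\<^esub>b\<in>Bs \<pi>'. a b \<odot>\<^bsub>R \<pi>\<^esub> pd \<pi> b)"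
    by (auto simp: ev_def Bs_def)
  also have "\<dots> = ev \<pi> a" unfolding ev_def
    using finite_Bs[OF \<pi>'] pd_closed[OF \<pi>] B_M Bs_mono[OF \<pi> \<pi>' sub]
    by (intro R.add.finprod_mono_neutral_cong_right) (auto simp: Bs_def)
  finally show ?thesis .
qed

text \<open>If b or c dies in \<open>R \<pi>\<close>, so does their product, and then all its
  coefficients on \<open>Bs \<pi>\<close> are zero.\<close>

lemma struct_supp:
  assumes d: "d \<in> Bs \<pi>" and b: "b \<in> B" and c: "c \<in> B" and n: "coords M B (b \<otimes>\<^bsub>M\<^esub> c) d \<noteq> 0"
  shows "b \<in> Bs \<pi> \<and> c \<in> Bs \<pi>"
proof (rule ccontr)
  assume "\<not> ?thesis"
  then have "pd \<pi> b = \<zero>\<^bsub>R \<pi>\<^esub> \<or> pd \<pi> c = \<zero>\<^bsub>R \<pi>\<^esub>" using b c by (auto simp: Bs_def)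
  then have "ev \<pi> (coords M B (b \<otimes>\<^bsub>M\<^esub> c)) = ev \<pi> (\<lambda>_. 0)"
    using b c pd_closed[OF \<pi>] by (auto simp: ev_coords ev_zero M_mult B_M pd_mult[OF \<pi>])
  from ev_inj[OF this d] show False using n by simp
qed

lemma idem_supp: assumes d: "d \<in> Bs \<pi>" and n: "coords M B (e \<zeta>) d \<noteq> 0" shows "pd \<pi> (e \<zeta>) \<noteq> \<zero>\<^bsub>R \<pi>\<^esub>"
proof
  assume "pd \<pi> (e \<zeta>) = \<zero>\<^bsub>R \<pi>\<^esub>"
  then have "ev \<pi> (coords M B (e \<zeta>)) = ev \<pi> (\<lambda>_. 0)" by (simp add: ev_coords ev_zero e_mem)
  from ev_inj[OF this d] show False using n by simp
qed

end

lemma finite_struct: assumes d: "d \<in> B" shows "finite {(b, c) \<in> B \<times> B. coords M B (b \<otimes>\<^bsub>M\<^esub> c) d \<noteq> 0}"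
proof -
  obtain \<pi> where \<pi>: "\<pi> \<in> P" "d \<in> Bs \<pi>" using B_Bs[OF d] by blast
  show ?thesis
  proof (rule finite_subset)
    show "{(b, c) \<in> B \<times> B. coords M B (b \<otimes>\<^bsub>M\<^esub> c) d \<noteq> 0} \<subseteq> Bs \<pi> \<times> Bs \<pi>"
    proof (rule subrelI)
      fix b c assume "(b, c) \<in> {(b, c) \<in> B \<times> B. coords M B (b \<otimes>\<^bsub>M\<^esub> c) d \<noteq> 0}"
      then have "b \<in> B" "c \<in> B" "coords M B (b \<otimes>\<^bsub>M\<^esub> c) d \<noteq> 0" by simp_all
      from struct_supp[OF \<pi> this] show "(b, c) \<in> Bs \<pi> \<times> Bs \<pi>" by simp
    qed
    show "finite (Bs \<pi> \<times> Bs \<pi>)" using finite_Bs[OF \<pi>(1)] by simp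
  qed
qed

lemma finite_idem: assumes d: "d \<in> B" shows "finite {\<zeta>. coords M B (e \<zeta>) d \<noteq> 0}"
proof -
  obtain \<pi> where \<pi>: "\<pi> \<in> P" "d \<in> Bs \<pi>" using B_Bs[OF d] by blast
  obtain F where F: "finite F" "\<forall>\<zeta>. \<zeta> \<notin> F \<longrightarrow> pd \<pi> (e \<zeta>) = \<zero>\<^bsub>R \<pi>\<^esub>" using unit[OF \<pi>(1)] by auto
  have "\<zeta> \<in> F" if "coords M B (e \<zeta>) d \<noteq> 0" for \<zeta> using idem_supp[OF \<pi> that] F(2) by metis
  then have "{\<zeta>. coords M B (e \<zeta>) d \<noteq> 0} \<subseteq> F" by (simp add: subset_iff)
  then show ?thesis using F(1) by (rule finite_subset)
qed

section \<open>The algebra of formal sums\<close>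

definition formal :: "(qv, 'u \<Rightarrow> qv) module" where
  "formal = \<lparr>
     carrier = {a. \<forall>b. b \<notin> B \<longrightarrow> a b = 0},
     mult = (\<lambda>a a' d. if d \<in> B
               then \<Sum>(b, c) \<in> {(b, c) \<in> B \<times> B. coords M B (b \<otimes>\<^bsub>M\<^esub> c) d \<noteq> 0}. a b * a' c * coords M B (b \<otimes>\<^bsub>M\<^esub> c) d
               else 0),
     one = (\<lambda>d. if d \<in> B then \<Sum>\<zeta> \<in> {\<zeta>. coords M B (e \<zeta>) d \<noteq> 0}. coords M B (e \<zeta>) d else 0),
     zero = (\<lambda>_. 0), add = (\<lambda>a a' b. a b + a' b), smult = (\<lambda>k a b. k * a b)\<rparr>"

lemma formal_simps[simp]:
  "a \<in> carrier formal \<longleftrightarrow> (\<forall>b. b \<notin> B \<longrightarrow> a b = 0)" "\<zero>\<^bsub>formal\<^esub> = (\<lambda>_. 0)"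
  "a \<oplus>\<^bsub>formal\<^esub> a' = (\<lambda>b. a b + a' b)" "k \<odot>\<^bsub>formal\<^esub> a = (\<lambda>b. k * a b)"
  by (simp_all add: formal_def)

lemma formal_mult_outside: "d \<notin> B \<Longrightarrow> (a \<otimes>\<^bsub>formal\<^esub> a') d = 0"
  and formal_one_outside: "d \<notin> B \<Longrightarrow> \<one>\<^bsub>formal\<^esub> d = 0"
  by (simp_all add: formal_def)

text \<open>The evaluations are jointly injective, so the algebra axioms for formal sums are
  inherited from the \<open>R \<pi>\<close>.\<close>

lemma formal_eqI:
  assumes "a \<in> carrier formal" "a' \<in> carrier formal" "\<And>\<pi>. \<pi> \<in> P \<Longrightarrow> ev \<pi> a = ev \<pi> a'"
  shows "a = a'"
proof
  fix b show "a b = a' b"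
  proof (cases "b \<in> B")
    case True
    then obtain \<pi> where "\<pi> \<in> P" "b \<in> Bs \<pi>" using B_Bs by blast
    then show ?thesis using ev_inj assms(3) by blast
  qed (use assms in auto)
qed

text \<open>For d in \<open>Bs \<pi>\<close> the sum over pairs stays within \<open>Bs \<pi>\<close>
  by \<open>struct_supp\<close>, and what remains is the bilinear expansion of a product in
  \<open>R \<pi>\<close>.\<close>

lemma ev_mult: assumes \<pi>: "\<pi> \<in> P" shows "ev \<pi> (a \<otimes>\<^bsub>formal\<^esub> a') = ev \<pi> a \<otimes>\<^bsub>R \<pi>\<^esub> ev \<pi> a'"
proof -
  interpret R: qvspace "R \<pi>" by (rule R_space[OF \<pi>])
  interpret R: Ring.ring "R \<pi>" by (rule R_ring[OF \<pi>])
  note f = finite_Bs[OF \<pi>] and [simp] = ev_closed[OF \<pi>] pd_Bs[OF \<pi>]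
  let ?m = "\<lambda>b c. coords M B (b \<otimes>\<^bsub>M\<^esub> c)"
  have "(a \<otimes>\<^bsub>formal\<^esub> a') d = (\<Sum>b\<in>Bs \<pi>. a b * (\<Sum>c\<in>Bs \<pi>. a' c * ?m b c d))" if d: "d \<in> Bs \<pi>" for d
  proof -
    have "d \<in> B" using d by (simp add: Bs_def)
    then have "(a \<otimes>\<^bsub>formal\<^esub> a') d = (\<Sum>(b, c) \<in> {(b, c) \<in> B \<times> B. ?m b c d \<noteq> 0}. a b * a' c * ?m b c d)"
      by (simp add: formal_def)
    also have "\<dots> = (\<Sum>(b, c) \<in> Bs \<pi> \<times> Bs \<pi>. a b * a' c * ?m b c d)"
    proof (rule sum.mono_neutral_left)
      show "{(b, c) \<in> B \<times> B. ?m b c d \<noteq> 0} \<subseteq> Bs \<pi> \<times> Bs \<pi>"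
      proof (rule subrelI)
        fix b c assume "(b, c) \<in> {(b, c) \<in> B \<times> B. ?m b c d \<noteq> 0}"
        then have "b \<in> B" "c \<in> B" "?m b c d \<noteq> 0" by simp_all
        from struct_supp[OF \<pi> d this] show "(b, c) \<in> Bs \<pi> \<times> Bs \<pi>" by simp
      qed
    qed (use f in \<open>auto simp: Bs_def\<close>)
    also have "\<dots> = (\<Sum>b\<in>Bs \<pi>. a b * (\<Sum>c\<in>Bs \<pi>. a' c * ?m b c d))"
      by (simp add: sum.cartesian_product[symmetric] sum_distrib_left mult.assoc)
    finally show ?thesis .
  qed
  then have "ev \<pi> (a \<otimes>\<^bsub>formal\<^esub> a') = ev \<pi> (\<lambda>d. \<Sum>b\<in>Bs \<pi>. a b * (\<Sum>c\<in>Bs \<pi>. a' c * ?m b c d))"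
    by (rule ev_cong[OF \<pi>])
  also have "\<dots> = (\<Oplus>\<^bsub>R \<pi>\<^esub>b\<in>Bs \<pi>. a b \<odot>\<^bsub>R \<pi>\<^esub> (\<Oplus>\<^bsub>R \<pi>\<^esub>c\<in>Bs \<pi>. a' c \<odot>\<^bsub>R \<pi>\<^esub> ev \<pi> (?m b c)))"
    by (simp only: ev_sum[OF \<pi> f])
  also have "\<dots> = (\<Oplus>\<^bsub>R \<pi>\<^esub>b\<in>Bs \<pi>. (a b \<odot>\<^bsub>R \<pi>\<^esub> pd \<pi> b) \<otimes>\<^bsub>R \<pi>\<^esub> ev \<pi> a')"
  proof (rule R.finsum_cong')
    fix b assume b: "b \<in> Bs \<pi>"
    have "(\<Oplus>\<^bsub>R \<pi>\<^esub>c\<in>Bs \<pi>. a' c \<odot>\<^bsub>R \<pi>\<^esub> ev \<pi> (?m b c)) = (\<Oplus>\<^bsub>R \<pi>\<^esub>c\<in>Bs \<pi>. pd \<pi> b \<otimes>\<^bsub>R \<pi>\<^esub> (a' c \<odot>\<^bsub>R \<pi>\<^esub> pd \<pi> c))"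
      by (rule R.finsum_cong') (use b in \<open>auto simp: ev_coords[OF \<pi>] M_mult Bs_M pd_mult[OF \<pi>] R_sm[OF \<pi>]\<close>)
    also have "\<dots> = pd \<pi> b \<otimes>\<^bsub>R \<pi>\<^esub> ev \<pi> a'" unfolding ev_def using b f by (subst R.finsum_rdistr) auto
    finally show "a b \<odot>\<^bsub>R \<pi>\<^esub> (\<Oplus>\<^bsub>R \<pi>\<^esub>c\<in>Bs \<pi>. a' c \<odot>\<^bsub>R \<pi>\<^esub> ev \<pi> (?m b c)) = (a b \<odot>\<^bsub>R \<pi>\<^esub> pd \<pi> b) \<otimes>\<^bsub>R \<pi>\<^esub> ev \<pi> a'"
      using b by (simp add: R_sm[OF \<pi>])
  qed auto
  also have "\<dots> = ev \<pi> a \<otimes>\<^bsub>R \<pi>\<^esub> ev \<pi> a'"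
    unfolding ev_def[of \<pi> a] using f by (subst R.finsum_ldistr) auto
  finally show ?thesis .
qed

lemma ev_one: assumes \<pi>: "\<pi> \<in> P" shows "ev \<pi> \<one>\<^bsub>formal\<^esub> = \<one>\<^bsub>R \<pi>\<^esub>"
proof -
  interpret R: qvspace "R \<pi>" by (rule R_space[OF \<pi>])
  obtain F where F: "finite F" "\<And>\<zeta>. \<zeta> \<notin> F \<Longrightarrow> pd \<pi> (e \<zeta>) = \<zero>\<^bsub>R \<pi>\<^esub>" "(\<Oplus>\<^bsub>R \<pi>\<^esub>\<zeta>\<in>F. pd \<pi> (e \<zeta>)) = \<one>\<^bsub>R \<pi>\<^esub>"
    using unit[OF \<pi>] by blast
  have "\<one>\<^bsub>formal\<^esub> d = (\<Sum>\<zeta>\<in>F. 1 * coords M B (e \<zeta>) d)" if d: "d \<in> Bs \<pi>" for d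
  proof -
    have "d \<in> B" using d by (simp add: Bs_def)
    then have "\<one>\<^bsub>formal\<^esub> d = (\<Sum>\<zeta> \<in> {\<zeta>. coords M B (e \<zeta>) d \<noteq> 0}. coords M B (e \<zeta>) d)" by (simp add: formal_def)
    also have "\<dots> = (\<Sum>\<zeta>\<in>F. coords M B (e \<zeta>) d)"
    proof (rule sum.mono_neutral_left[OF F(1)])
      show "{\<zeta>. coords M B (e \<zeta>) d \<noteq> 0} \<subseteq> F" using F(2) idem_supp[OF \<pi> d] by blast
    qed auto
    finally show ?thesis by simp
  qed
  then have "ev \<pi> \<one>\<^bsub>formal\<^esub> = ev \<pi> (\<lambda>d. \<Sum>\<zeta>\<in>F. 1 * coords M B (e \<zeta>) d)" by (rule ev_cong[OF \<pi>])
  also have "\<dots> = (\<Oplus>\<^bsub>R \<pi>\<^esub>\<zeta>\<in>F. pd \<pi> (e \<zeta>))"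
    unfolding ev_sum[OF \<pi> F(1)]
    by (rule R.finsum_cong') (auto simp: ev_coords[OF \<pi>] e_mem pd_closed[OF \<pi>])
  finally show ?thesis using F(3) by simp
qed

theorem formal_algebra: "assoc_algebra formal"
proof -
  have m: "a \<otimes>\<^bsub>formal\<^esub> a' \<in> carrier formal" and o: "\<one>\<^bsub>formal\<^esub> \<in> carrier formal" for a a'
    by (simp_all add: formal_mult_outside formal_one_outside)
  have add: "abelian_group formal"
  proof (rule abelian_groupI)
    fix a assume "a \<in> carrier formal"
    then show "\<exists>a'\<in>carrier formal. a' \<oplus>\<^bsub>formal\<^esub> a = \<zero>\<^bsub>formal\<^esub>"
      by (intro bexI[of _ "\<lambda>b. - a b"]) auto
  qed (auto simp: add.assoc add.commute)
  have mod: "Module.module Qv_ring formal"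
    by (rule moduleI[OF cring_Qv_ring add]) (auto simp: algebra_simps)
  note ev = ev_mult ev_one ev_add ev_smult ev_closed
  have "Ring.ring formal"
  proof (rule ringI[OF add])
    show "Group.monoid formal"
    proof (rule monoidI)
      fix x y z assume "x \<in> carrier formal" "y \<in> carrier formal" "z \<in> carrier formal"
      show "x \<otimes>\<^bsub>formal\<^esub> y \<otimes>\<^bsub>formal\<^esub> z = x \<otimes>\<^bsub>formal\<^esub> (y \<otimes>\<^bsub>formal\<^esub> z)"
        by (rule formal_eqI[OF m m]) (simp add: ev R_distr R_one)
    next
      fix x assume x: "x \<in> carrier formal"
      show "\<one>\<^bsub>formal\<^esub> \<otimes>\<^bsub>formal\<^esub> x = x"
        by (rule formal_eqI[OF m x]) (simp add: ev R_distr R_one)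
      show "x \<otimes>\<^bsub>formal\<^esub> \<one>\<^bsub>formal\<^esub> = x"
        by (rule formal_eqI[OF m x]) (simp add: ev R_distr R_one)
    qed (use m o in auto)
  next
    fix x y z assume "x \<in> carrier formal" "y \<in> carrier formal" "z \<in> carrier formal"
    have s: "a \<otimes>\<^bsub>formal\<^esub> b \<oplus>\<^bsub>formal\<^esub> (c \<otimes>\<^bsub>formal\<^esub> d) \<in> carrier formal" for a b c d by (simp add: formal_mult_outside)
    show "(x \<oplus>\<^bsub>formal\<^esub> y) \<otimes>\<^bsub>formal\<^esub> z = x \<otimes>\<^bsub>formal\<^esub> z \<oplus>\<^bsub>formal\<^esub> y \<otimes>\<^bsub>formal\<^esub> z"
      by (rule formal_eqI[OF m s]) (simp add: ev R_distr R_one)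
    show "z \<otimes>\<^bsub>formal\<^esub> (x \<oplus>\<^bsub>formal\<^esub> y) = z \<otimes>\<^bsub>formal\<^esub> x \<oplus>\<^bsub>formal\<^esub> z \<otimes>\<^bsub>formal\<^esub> y"
      by (rule formal_eqI[OF m s]) (simp add: ev R_distr R_one)
  qed
  moreover have "(c \<odot>\<^bsub>formal\<^esub> x) \<otimes>\<^bsub>formal\<^esub> y = c \<odot>\<^bsub>formal\<^esub> (x \<otimes>\<^bsub>formal\<^esub> y) \<and>
        x \<otimes>\<^bsub>formal\<^esub> (c \<odot>\<^bsub>formal\<^esub> y) = c \<odot>\<^bsub>formal\<^esub> (x \<otimes>\<^bsub>formal\<^esub> y)" for c x y
  proof -
    have s: "c \<odot>\<^bsub>formal\<^esub> (x \<otimes>\<^bsub>formal\<^esub> y) \<in> carrier formal" by (simp add: formal_mult_outside)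
    show ?thesis
      by (intro conjI; rule formal_eqI[OF m s]) (simp_all add: ev R_sm)
  qed
  ultimately show ?thesis using mod unfolding assoc_algebra_def by blast
qed

section \<open>Identification with the inverse limit\<close>

definition limit :: "(qv, 'p set \<Rightarrow> 's) module" where
  "limit = \<lparr>
     carrier = {a \<in> (\<Pi>\<^sub>E \<pi>\<in>P. carrier (R \<pi>)). \<forall>\<pi>\<in>P. \<forall>\<pi>'\<in>P. \<pi> \<subseteq> \<pi>' \<longrightarrow> a \<pi> = tr \<pi> \<pi>' (a \<pi>')},
     mult = (\<lambda>a b. \<lambda>\<pi>\<in>P. a \<pi> \<otimes>\<^bsub>R \<pi>\<^esub> b \<pi>), one = (\<lambda>\<pi>\<in>P. \<one>\<^bsub>R \<pi>\<^esub>),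
     zero = (\<lambda>\<pi>\<in>P. \<zero>\<^bsub>R \<pi>\<^esub>), add = (\<lambda>a b. \<lambda>\<pi>\<in>P. a \<pi> \<oplus>\<^bsub>R \<pi>\<^esub> b \<pi>),
     smult = (\<lambda>c a. \<lambda>\<pi>\<in>P. c \<odot>\<^bsub>R \<pi>\<^esub> a \<pi>)\<rparr>"

definition ident :: "('u \<Rightarrow> qv) \<Rightarrow> 'p set \<Rightarrow> 's" where "ident a = (\<lambda>\<pi>\<in>P. ev \<pi> a)"

lemma limit_carrier: "u \<in> carrier limit \<longleftrightarrow> u \<in> (\<Pi>\<^sub>E \<pi>\<in>P. carrier (R \<pi>)) \<and>
    (\<forall>\<pi>\<in>P. \<forall>\<pi>'\<in>P. \<pi> \<subseteq> \<pi>' \<longrightarrow> u \<pi> = tr \<pi> \<pi>' (u \<pi>'))"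
  by (simp add: limit_def)

lemma ident_limit: "ident a \<in> carrier limit"
proof -
  have "ident a \<in> (\<Pi>\<^sub>E \<pi>\<in>P. carrier (R \<pi>))" by (simp add: ident_def ev_closed)
  moreover have "ident a \<pi> = tr \<pi> \<pi>' (ident a \<pi>')" if "\<pi> \<in> P" "\<pi>' \<in> P" "\<pi> \<subseteq> \<pi>'" for \<pi> \<pi>'
    using that tr_ev[OF that] by (simp add: ident_def)
  ultimately show ?thesis unfolding limit_carrier by blast
qed

lemma ident_surj: assumes u: "u \<in> carrier limit" shows "\<exists>a\<in>carrier formal. ident a = u"
proof -
  have uR: "u \<pi> \<in> carrier (R \<pi>)" if "\<pi> \<in> P" for \<pi> using u that unfolding limit_carrier by blast
  have ut: "u \<pi> = tr \<pi> \<pi>' (u \<pi>')" if "\<pi> \<in> P" "\<pi>' \<in> P" "\<pi> \<subseteq> \<pi>'" for \<pi> \<pi>' using u that unfolding limit_carrier by blast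
  obtain A where A: "\<And>\<pi>. \<pi> \<in> P \<Longrightarrow> ev \<pi> (A \<pi>) = u \<pi>" using ev_surj[OF _ uR] by metis
  have up: "A \<pi>' b = A \<pi> b" if "\<pi> \<in> P" "\<pi>' \<in> P" "\<pi> \<subseteq> \<pi>'" "b \<in> Bs \<pi>" for \<pi> \<pi>' b
  proof (rule ev_inj[OF that(1) _ that(4)])
    show "ev \<pi> (A \<pi>') = ev \<pi> (A \<pi>)" using tr_ev[OF that(1-3)] ut[OF that(1-3)] A that by metis
  qed
  \<comment> \<open>Two indices that both see b are compared at their union.\<close>
  have agree: "A \<pi>' b = A \<pi> b" if "\<pi> \<in> P" "\<pi>' \<in> P" "b \<in> Bs \<pi>" "b \<in> Bs \<pi>'" for \<pi> \<pi>' b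
    using up[of \<pi> "\<pi> \<union> \<pi>'" b] up[of \<pi>' "\<pi> \<union> \<pi>'" b] P_union that by simp
  obtain pi where pi: "\<And>b. b \<in> B \<Longrightarrow> pi b \<in> P" "\<And>b. b \<in> B \<Longrightarrow> b \<in> Bs (pi b)" using B_Bs by metis
  define a where "a b = (if b \<in> B then A (pi b) b else 0)" for b
  have "ev \<pi> a = u \<pi>" if \<pi>: "\<pi> \<in> P" for \<pi>
  proof -
    have "ev \<pi> a = ev \<pi> (A \<pi>)"
    proof (rule ev_cong[OF \<pi>])
      fix b assume b: "b \<in> Bs \<pi>"
      then have "b \<in> B" by (simp add: Bs_def)
      then show "a b = A \<pi> b" using agree[OF \<pi> pi(1) b pi(2)] by (simp add: a_def)
    qed
    then show ?thesis using A[OF \<pi>] by simp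
  qed
  \<comment> \<open>Equality of functions also concerns arguments outside P, where extensionality
    fixes the value on both sides.\<close>
  moreover have "u \<pi> = undefined" if "\<pi> \<notin> P" for \<pi>
    using u that unfolding limit_carrier by (blast intro: PiE_arb)
  ultimately have "ident a = u" by (intro ext) (simp add: ident_def restrict_def)
  moreover have "a \<in> carrier formal" by (simp add: a_def)
  ultimately show ?thesis by blast
qed

theorem ident_iso: "ident \<in> algebra_iso formal limit"
proof -
  have "inj_on ident (carrier formal)"
  proof (rule inj_onI)
    fix a a' assume a: "a \<in> carrier formal" "a' \<in> carrier formal" and eq: "ident a = ident a'"
    show "a = a'"
    proof (rule formal_eqI[OF a])
      fix \<pi> assume "\<pi> \<in> P"
      then show "ev \<pi> a = ev \<pi> a'" using fun_cong[OF eq, of \<pi>] by (simp add: ident_def)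
    qed
  qed
  moreover have "ident ` carrier formal = carrier limit" using ident_limit ident_surj by blast
  moreover have "ident \<in> ring_hom formal limit"
  proof (rule ring_hom_memI)
    show "ident (a \<otimes>\<^bsub>formal\<^esub> a') = ident a \<otimes>\<^bsub>limit\<^esub> ident a'" for a a'
      by (rule ext) (simp add: ident_def limit_def ev_mult)
    show "ident (a \<oplus>\<^bsub>formal\<^esub> a') = ident a \<oplus>\<^bsub>limit\<^esub> ident a'" for a a'
      by (rule ext) (simp add: ident_def limit_def ev_add)
    show "ident \<one>\<^bsub>formal\<^esub> = \<one>\<^bsub>limit\<^esub>"
      by (rule ext) (simp add: ident_def limit_def ev_one)
  qed (rule ident_limit)
  moreover have "ident (c \<odot>\<^bsub>formal\<^esub> a) = c \<odot>\<^bsub>limit\<^esub> ident a" for c a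
    by (rule ext) (simp add: ident_def limit_def ev_smult)
  ultimately show ?thesis unfolding algebra_iso_def ring_iso_def bij_betw_def by blast
qed

lemma ident_coords: "x \<in> carrier M \<Longrightarrow> ident (coords M B x) = (\<lambda>\<pi>\<in>P. pd \<pi> x)"
  by (rule ext) (simp add: ident_def ev_coords)

end

text \<open>The three finiteness claims give content to the rest: sums over infinite sets would
  silently be zero in the identification, the product and the unit. The last conjunct says that the
  isomorphism takes the expansion in B of an element of the modified form to its family of images,
  so it is the identification compatible with completion.\<close>

theorem proposition3p7:
  fixes D :: "('i, 'x::ab_group_add, 'y::ab_group_add) root_datum"
    and B :: "('i, 'x, 'y) udot set"
  assumes "is_root_datum D"
    and "finite_type D"
    and "coherent_basis D B"
  shows "(\<forall>\<pi>\<in>fin_sat D. finite (basis_supp D B \<pi>)) \<and>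
    (\<forall>d\<in>B. finite {(b, c) \<in> B \<times> B. struct_const D B b c d \<noteq> 0}) \<and>
    (\<forall>d\<in>B. finite {\<zeta>. coords (Udot D) B (Udot_idem D \<zeta>) d \<noteq> 0}) \<and>
    assoc_algebra (formal_alg D B) \<and>
    formal_ident D B \<in> algebra_iso (formal_alg D B) (Uhat D) \<and>
    (\<forall>x\<in>carrier (Udot D). formal_ident D B (coords (Udot D) B x) = (\<lambda>\<pi>\<in>fin_sat D. pdot D \<pi> x))"
proof -
  interpret rdatum D by (rule rdatum.intro[OF assms(1,2)])
  note f = fin_sat_finite and mono = weyl_orbit_mono
  have S0: "\<zero>\<^bsub>S_alg D \<pi>\<^esub> \<in> carrier (S_alg D \<pi>)" for \<pi> by (simp add: S.PA_zero)
  interpret C: coherent_system "Udot D" "fin_sat D" "S_alg D" "pdot D" "S_trans D" "Udot_idem D" B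
  proof (rule coherent_system.intro)
    fix \<pi> assume \<pi>: "\<pi> \<in> fin_sat D"
    have "(\<Oplus>\<^bsub>S_alg D \<pi>\<^esub>\<zeta>\<in>Wo \<pi>. S_class D \<pi> (idem D \<pi> \<zeta>)) = \<one>\<^bsub>S_alg D \<pi>\<^esub>"
    proof -
      have "(\<Oplus>\<^bsub>S_alg D \<pi>\<^esub>\<zeta>\<in>Wo \<pi>. S_class D \<pi> (idem D \<pi> \<zeta>)) = S_class D \<pi> (\<Sum>\<zeta>\<in>Wo \<pi>. idem D \<pi> \<zeta>)"
        by (rule S.PA_finsum[OF f[OF \<pi>]]) auto
      also have "\<dots> = S_class D \<pi> 1"
        by (rule S.cl_iff[THEN iffD2]) (use S.PI_R in \<open>auto simp: S_rels_def\<close>)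
      finally show ?thesis by (simp add: S.PA_one)
    qed
    then show "\<exists>F. finite F \<and> (\<forall>\<zeta>. \<zeta> \<notin> F \<longrightarrow> pdot D \<pi> (Udot_idem D \<zeta>) = \<zero>\<^bsub>S_alg D \<pi>\<^esub>) \<and>
        (\<Oplus>\<^bsub>S_alg D \<pi>\<^esub>\<zeta>\<in>F. pdot D \<pi> (Udot_idem D \<zeta>)) = \<one>\<^bsub>S_alg D \<pi>\<^esub>"
      using f[OF \<pi>] by (intro exI[of _ "Wo \<pi>"]) (simp add: pdot_idem idem_def S.PA_zero)
    show "inj_on (pdot D \<pi>) {b \<in> B. pdot D \<pi> b \<noteq> \<zero>\<^bsub>S_alg D \<pi>\<^esub>}"
      and "is_basis (S_alg D \<pi>) (pdot D \<pi> ` B - {\<zero>\<^bsub>S_alg D \<pi>\<^esub>})"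
      using assms(3) \<pi> by (simp_all add: coherent_basis_def basis_supp_def)
  next
    show "is_basis (Udot D) B" using assms(3) by (simp add: coherent_basis_def)
  next
    fix x assume "x \<in> carrier (Udot D)" "\<And>\<pi>. \<pi> \<in> fin_sat D \<Longrightarrow> pdot D \<pi> x = \<zero>\<^bsub>S_alg D \<pi>\<^esub>"
    then show "x = \<zero>\<^bsub>Udot D\<^esub>" by (rule pdot_faithful)
  qed ((rule Udot_module S.PA_algebra fin_sat_union Udot_mult(1) pdot_closed pdot_add pdot_smult
      Udot_mult(2) pdot_trans S_trans_hom(2,4) S_trans_hom(6)[OF _ _ S0 S0] S_finite_span Udot_idem_mem;
      ((assumption | rule f | rule mono)+)?)+)
  have Bs: "C.Bs = basis_supp D B" by (intro ext) (simp add: C.Bs_def basis_supp_def)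
  have "C.formal = formal_alg D B" unfolding C.formal_def formal_alg_def struct_const_def by (rule refl)
  moreover have "C.limit = Uhat D" by (simp add: C.limit_def Uhat_def)
  moreover have "C.ident = formal_ident D B" by (intro ext) (simp add: C.ident_def C.ev_def formal_ident_def Bs)
  ultimately show ?thesis
    using C.finite_Bs C.finite_struct C.finite_idem C.formal_algebra C.ident_iso C.ident_coords
    unfolding struct_const_def Bs by simp
qed

end
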